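(* Let $(X,\sigma_X)$ be an irreducible (one-step) shift of finite type, $(Y,\sigma_Y)$ a subshift, $\pi:X\to Y$ a one-block factor map and $f\in C(X)$. Suppose there exists $\mu$ such that $\mu$ is an invariant weak Gibbs measure for $f$. Let $g_n$ be the functions on $Y$ associated to $f$ and $\pi$ as in the context, and $\mathcal G=\{\log g_n\}_{n=1}^\infty$. Then there exists $h\in C(Y)$ satisfying the following equivalent statements (i) $P(\sigma_X,\pi,f-h\circ\pi)(y)=0$ for every periodic point $y\in Y$ (equivalently, $\lim_{n\to\infty}\frac1n\log(g_n(y)/e^{(S_nh)(y)})=0$ for every periodic point $y\in Y$); (ii) $f-h\circ\pi$ is a compensation function for $\pi$; (iii) $\lim_{n\to\infty}\frac1n\log(g_n(y)/e^{(S_nh)(y)})=0$ for every $y\in Y$; (iv) $\mathcal G$ is asymptotically additive on $Y$ and $\lim_{n\to\infty}\frac1n\lVert\log(g_n/e^{S_nh})\rVert_\infty=0$; (v) $\int P(\sigma_X,\pi,f)\,dm=\int h\,dm$ for all $m\in M(Y,\sigma_Y)$; if and only if there exists a continuous function on $Y$ for which $\pi\mu$ is an invariant weak Gibbs measure on $Y$.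
   Context: $\mathbb N=\{1,2,\dots\}$. A (one-sided) subshift $(X,\sigma_X)$ is a closed set $X\subseteq\{1,\dots,k\}^{\mathbb N}$ (some $k\ge1$) with $\sigma_X(X)\subseteq X$, where $(\sigma_Xx)_i=x_{i+1}$. The metric is $d(x,x')=2^{-k}$ if $x_i=x_i'$ for $1\le i\le k$ and $x_{k+1}\ne x'_{k+1}$, $d(x,x')=1$ if $x_1\neq x_1'$, and $d(x,x)=0$. $B_n(X)$ is the set of words of length $n$ appearing in points of $X$, $B_0(X)=\{\epsilon\}$ (empty word), $B(X)=\bigcup_{n\ge0}B_n(X)$. The cylinder $[x_1\dots x_n]$ is the set of $z\in X$ with $z_i=x_i$ for $1\le i\le n$. $X$ is irreducible if for all $u,v\in B(X)$ there is $w\in B(X)$ with $uwv\in B(X)$. Shifts of finite type are one-step: $X$ is the set of all sequences in $\{1,\dots,k\}^{\mathbb N}$ in which no word of a given set of forbidden blocks of length $\le2$ appears. $x$ is periodic if $\sigma_X^lx=x$ for some $l\in\mathbb N$. $M(X,\sigma_X)$ is the set of $\sigma_X$-invariant Borel probability measures; $h_\mu(\sigma_X)$ is measure-theoretic entropy; $(S_nf)(x)=\sum_{i=0}^{n-1}f(\sigma_X^ix)$. A factor map $\pi:X\to Y$ is a continuous surjection with $\pi\circ\sigma_X=\sigma_Y\circ\pi$; it is one-block if $\pi(x)_i$ depends only on $x_i$, so $\pi$ acts on words. $\pi\mu$ is the push-forward measure $\mu\circ\pi^{-1}$. Relative pressure: for $f\in C(X)$, $n\in\mathbb N$, $\delta>0$,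 $y\in Y$, let $P_n(\sigma_X,\pi,f,\delta)(y)=\sup\{\sum_{x\in E}e^{(S_nf)(x)}: E\text{ is an }(n,\delta)\text{-separated subset of }\pi^{-1}(\{y\})\}$, $P(\sigma_X,\pi,f,\delta)(y)=\limsup_{n\to\infty}\frac1n\log P_n(\sigma_X,\pi,f,\delta)(y)$, and $P(\sigma_X,\pi,f)(y)=\lim_{\delta\to0}P(\sigma_X,\pi,f,\delta)(y)$. The functions $g_n$: for $y\in Y$ let $E_n(y)$ denote a set consisting of exactly one point from each cylinder $[x_1\dots x_n]$ in $X$ such that $\pi(x_1\dots x_n)=y_1\dots y_n$; set $g_n(y)=\sup_{E_n(y)}\sum_{x\in E_n(y)}e^{(S_nf)(x)}$, the supremum over all such choices $E_n(y)$. $F\in C(X)$ is a compensation function for $\pi$ if $\sup_{\mu\in M(X,\sigma_X)}\{h_\mu(\sigma_X)+\int F\,d\mu+\int\phi\circ\pi\,d\mu\}=\sup_{\nu\in M(Y,\sigma_Y)}\{h_\nu(\sigma_Y)+\int\phi\,d\nu\}$ for every $\phi\in C(Y)$. A sequence $\{\log f_n\}_{n=1}^\infty$ with $f_n:Y\to(0,\infty)$ continuous is asymptotically additive on $Y$ if for every $\epsilon>0$ there is a continuous function $\rho_\epsilon$ on $Y$ with $\limsup_{n\to\infty}\frac1n\lVert\log f_n-S_n\rho_\epsilon\rVert_\infty<\epsilon$ (supremum norm). For a continuous function $f$ on a subshift $X$, its topological pressure is $P(f)=\limsup_{n\to\infty}\frac1n\log\sum_{u\in B_n(X)}\sup\{e^{(S_nf)(x)}:x\in[u]\}$.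 A measure $\mu\in M(X,\sigma_X)$ is an (invariant) weak Gibbs measure for $f$ if there are $C_n>0$ with $\lim_{n\to\infty}\frac1n\log C_n=0$ and $\frac1{C_n}<\frac{\mu[x_1\dots x_n]}{e^{-nP(f)+(S_nf)(x)}}<C_n$ for every $x\in X$, $n\in\mathbb N$. *)

theory Defs
  imports "HOL-Probability.Probability"
begin

text \<open>
  Points of a one-sided shift space are functions \<open>nat \<Rightarrow> nat\<close>; coordinates are numbered from
  \<open>0\<close>, so \<open>x i\<close> is the coordinate written \<open>x_{i+1}\<close> when sequences are indexed by
  \<open>{1, 2, ...}\<close>. The topology and the Borel sets are those of the library's product topology
  (\<open>nat\<close> being discrete), which is the topology induced by \<open>shift_dist\<close>. The words
  \<open>x_1 ... x_n\<close> are lists. Functions on a space \<open>X\<close> are total functions used on \<open>X\<close> only.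
\<close>

section \<open>Shift spaces\<close>

definition shift_map :: "(nat \<Rightarrow> nat) \<Rightarrow> (nat \<Rightarrow> nat)" where
  "shift_map x = (\<lambda>i. x (Suc i))"

definition full_shift :: "nat \<Rightarrow> (nat \<Rightarrow> nat) set" where
  "full_shift k = {x. \<forall>i. x i \<in> {1..k}}"

definition subshift :: "(nat \<Rightarrow> nat) set \<Rightarrow> bool" where
  "subshift X \<longleftrightarrow> closed X \<and> (\<exists>k\<ge>1. X \<subseteq> full_shift k) \<and> shift_map ` X \<subseteq> X"

definition shift_dist :: "(nat \<Rightarrow> nat) \<Rightarrow> (nat \<Rightarrow> nat) \<Rightarrow> real" where
  "shift_dist x x' = (if x = x' then 0 else (1 / 2) ^ (LEAST i. x i \<noteq> x' i))"

definition occurs_in :: "nat list \<Rightarrow> (nat \<Rightarrow> nat) \<Rightarrow> bool" where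
  "occurs_in w x \<longleftrightarrow> (\<exists>i. \<forall>j<length w. x (i + j) = w ! j)"

definition words :: "(nat \<Rightarrow> nat) set \<Rightarrow> nat \<Rightarrow> nat list set" where
  "words X n = (if n = 0 then {[]} else {w. length w = n \<and> (\<exists>x\<in>X. occurs_in w x)})"

definition language :: "(nat \<Rightarrow> nat) set \<Rightarrow> nat list set" where
  "language X = (\<Union>n. words X n)"

definition initial_word :: "nat \<Rightarrow> (nat \<Rightarrow> nat) \<Rightarrow> nat list" where
  "initial_word n x = map x [0..<n]"

definition cyl :: "(nat \<Rightarrow> nat) set \<Rightarrow> nat list \<Rightarrow> (nat \<Rightarrow> nat) set" where
  "cyl X u = {z \<in> X. initial_word (length u) z = u}"

definition irreducible_shift :: "(nat \<Rightarrow> nat) set \<Rightarrow> bool" where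
  "irreducible_shift X \<longleftrightarrow>
     (\<forall>u\<in>language X. \<forall>v\<in>language X. \<exists>w\<in>language X. u @ w @ v \<in> language X)"

definition one_step_sft :: "(nat \<Rightarrow> nat) set \<Rightarrow> bool" where
  "one_step_sft X \<longleftrightarrow>
     (\<exists>k\<ge>1. \<exists>F. (\<forall>w\<in>F. length w \<le> 2) \<and>
        X = {x \<in> full_shift k. \<forall>w\<in>F. \<not> occurs_in w x})"

definition periodic_point :: "(nat \<Rightarrow> nat) \<Rightarrow> bool" where
  "periodic_point x \<longleftrightarrow> (\<exists>l\<ge>1. (shift_map ^^ l) x = x)"

definition birkhoff_sum ::
    "((nat \<Rightarrow> nat) \<Rightarrow> real) \<Rightarrow> nat \<Rightarrow> (nat \<Rightarrow> nat) \<Rightarrow> real" where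
  "birkhoff_sum f n x = (\<Sum>i<n. f ((shift_map ^^ i) x))"

definition factor_map ::
    "(nat \<Rightarrow> nat) set \<Rightarrow> (nat \<Rightarrow> nat) set \<Rightarrow> ((nat \<Rightarrow> nat) \<Rightarrow> (nat \<Rightarrow> nat)) \<Rightarrow> bool" where
  "factor_map X Y \<pi> \<longleftrightarrow>
     continuous_on X \<pi> \<and> \<pi> ` X = Y \<and> (\<forall>x\<in>X. \<pi> (shift_map x) = shift_map (\<pi> x))"

text \<open>
  \<open>\<theta>\<close> is the map on symbols inducing a one-block map \<open>\<pi>\<close>; \<open>\<pi>\<close> acts on words by \<open>map \<theta>\<close>.
  For a factor map this is the same as requiring that \<open>(\<pi> x)_i\<close> depends only on \<open>x_i\<close>,
  as commutation with the shifts makes the dependence uniform in \<open>i\<close>.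
\<close>
definition one_block ::
    "(nat \<Rightarrow> nat) set \<Rightarrow> (nat \<Rightarrow> nat) \<Rightarrow> ((nat \<Rightarrow> nat) \<Rightarrow> (nat \<Rightarrow> nat)) \<Rightarrow> bool" where
  "one_block X \<theta> \<pi> \<longleftrightarrow> (\<forall>x\<in>X. \<forall>i. \<pi> x i = \<theta> (x i))"

section \<open>Invariant measures and entropy\<close>

definition borel_of_shift :: "(nat \<Rightarrow> nat) set \<Rightarrow> (nat \<Rightarrow> nat) measure" where
  "borel_of_shift X = restrict_space borel X"

definition inv_measures :: "(nat \<Rightarrow> nat) set \<Rightarrow> (nat \<Rightarrow> nat) measure set" where
  "inv_measures X =
     {\<mu>. prob_space \<mu> \<and> sets \<mu> = sets (borel_of_shift X) \<and> distr \<mu> \<mu> shift_map = \<mu>}"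

definition finite_partition :: "'a measure \<Rightarrow> 'a set set \<Rightarrow> bool" where
  "finite_partition M \<xi> \<longleftrightarrow> finite \<xi> \<and> \<xi> \<subseteq> sets M \<and> partition_on (space M) \<xi>"

text \<open>The join of the preimages of \<open>\<xi>\<close> under \<open>T ^^ i\<close>, \<open>i < n\<close>.\<close>
definition join_partition ::
    "'a measure \<Rightarrow> ('a \<Rightarrow> 'a) \<Rightarrow> 'a set set \<Rightarrow> nat \<Rightarrow> 'a set set" where
  "join_partition M T \<xi> n =
     {{x \<in> space M. \<forall>i<n. (T ^^ i) x \<in> A i} | A. \<forall>i<n. A i \<in> \<xi>} - {{}}"

text \<open>Natural logarithm; \<open>0 * ln 0 = 0\<close>.\<close>
definition partition_entropy :: "'a measure \<Rightarrow> 'a set set \<Rightarrow> real" where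
  "partition_entropy M \<xi> = - (\<Sum>A\<in>\<xi>. measure M A * ln (measure M A))"

definition measure_entropy :: "'a measure \<Rightarrow> ('a \<Rightarrow> 'a) \<Rightarrow> ereal" where
  "measure_entropy M T =
     (SUP \<xi>\<in>{\<xi>. finite_partition M \<xi>}.
        ereal (lim (\<lambda>n. partition_entropy M (join_partition M T \<xi> n) / real n)))"

section \<open>Pressure, weak Gibbs measures and compensation functions\<close>

definition pressure :: "(nat \<Rightarrow> nat) set \<Rightarrow> ((nat \<Rightarrow> nat) \<Rightarrow> real) \<Rightarrow> ereal" where
  "pressure X f =
     limsup (\<lambda>n. ereal (ln (\<Sum>u\<in>words X n. SUP x\<in>cyl X u. exp (birkhoff_sum f n x)) / real n))"

text \<open>The pressure of a continuous function on a nonempty subshift is finite.\<close>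
definition weak_gibbs ::
    "(nat \<Rightarrow> nat) set \<Rightarrow> ((nat \<Rightarrow> nat) \<Rightarrow> real) \<Rightarrow> (nat \<Rightarrow> nat) measure \<Rightarrow> bool" where
  "weak_gibbs X f \<mu> \<longleftrightarrow> \<mu> \<in> inv_measures X \<and>
     (\<exists>C :: nat \<Rightarrow> real. (\<forall>n\<ge>1. C n > 0) \<and> (\<lambda>n. ln (C n) / real n) \<longlonglongrightarrow> 0 \<and>
        (\<forall>x\<in>X. \<forall>n\<ge>1.
           let r = measure \<mu> (cyl X (initial_word n x)) /
                   exp (- real n * real_of_ereal (pressure X f) + birkhoff_sum f n x)
           in 1 / C n < r \<and> r < C n))"

text \<open>
  Points of a separated set are more than \<open>\<delta>\<close> apart in the \<open>n\<close>-th Bowen metric. By compactness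
  all such sets are finite; finiteness is stated because infinite sums are \<open>0\<close> by convention.
\<close>
definition separated ::
    "nat \<Rightarrow> real \<Rightarrow> (nat \<Rightarrow> nat) set \<Rightarrow> bool" where
  "separated n \<delta> E \<longleftrightarrow> finite E \<and>
     (\<forall>x\<in>E. \<forall>x'\<in>E. x \<noteq> x' \<longrightarrow>
        (\<exists>i<n. shift_dist ((shift_map ^^ i) x) ((shift_map ^^ i) x') > \<delta>))"

definition rel_pressure_n ::
    "(nat \<Rightarrow> nat) set \<Rightarrow> ((nat \<Rightarrow> nat) \<Rightarrow> (nat \<Rightarrow> nat)) \<Rightarrow> ((nat \<Rightarrow> nat) \<Rightarrow> real) \<Rightarrow>
     nat \<Rightarrow> real \<Rightarrow> (nat \<Rightarrow> nat) \<Rightarrow> real" where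
  "rel_pressure_n X \<pi> f n \<delta> y =
     (SUP E\<in>{E. E \<subseteq> {x \<in> X. \<pi> x = y} \<and> separated n \<delta> E}. \<Sum>x\<in>E. exp (birkhoff_sum f n x))"

definition rel_pressure_delta ::
    "(nat \<Rightarrow> nat) set \<Rightarrow> ((nat \<Rightarrow> nat) \<Rightarrow> (nat \<Rightarrow> nat)) \<Rightarrow> ((nat \<Rightarrow> nat) \<Rightarrow> real) \<Rightarrow>
     real \<Rightarrow> (nat \<Rightarrow> nat) \<Rightarrow> ereal" where
  "rel_pressure_delta X \<pi> f \<delta> y = limsup (\<lambda>n. ereal (ln (rel_pressure_n X \<pi> f n \<delta> y) / real n))"

text \<open>The limit exists since \<open>rel_pressure_delta\<close> is antitone in \<open>\<delta>\<close>.\<close>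
definition rel_pressure ::
    "(nat \<Rightarrow> nat) set \<Rightarrow> ((nat \<Rightarrow> nat) \<Rightarrow> (nat \<Rightarrow> nat)) \<Rightarrow> ((nat \<Rightarrow> nat) \<Rightarrow> real) \<Rightarrow>
     (nat \<Rightarrow> nat) \<Rightarrow> ereal" where
  "rel_pressure X \<pi> f y = Lim (at_right 0) (\<lambda>\<delta>. rel_pressure_delta X \<pi> f \<delta> y)"

definition words_over ::
    "(nat \<Rightarrow> nat) set \<Rightarrow> (nat \<Rightarrow> nat) \<Rightarrow> nat \<Rightarrow> (nat \<Rightarrow> nat) \<Rightarrow> nat list set" where
  "words_over X \<theta> n y = {u \<in> words X n. map \<theta> u = initial_word n y}"

text \<open>The admissible choices of the set \<open>E_n(y)\<close>.\<close>
definition cylinder_choices ::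
    "(nat \<Rightarrow> nat) set \<Rightarrow> (nat \<Rightarrow> nat) \<Rightarrow> nat \<Rightarrow> (nat \<Rightarrow> nat) \<Rightarrow> (nat \<Rightarrow> nat) set set" where
  "cylinder_choices X \<theta> n y =
     {E. E \<subseteq> (\<Union>u\<in>words_over X \<theta> n y. cyl X u) \<and>
         (\<forall>u\<in>words_over X \<theta> n y. \<exists>!x. x \<in> E \<inter> cyl X u)}"

definition g_fun ::
    "(nat \<Rightarrow> nat) set \<Rightarrow> (nat \<Rightarrow> nat) \<Rightarrow> ((nat \<Rightarrow> nat) \<Rightarrow> real) \<Rightarrow>
     nat \<Rightarrow> (nat \<Rightarrow> nat) \<Rightarrow> real" where
  "g_fun X \<theta> f n y = (SUP E\<in>cylinder_choices X \<theta> n y. \<Sum>x\<in>E. exp (birkhoff_sum f n x))"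

definition compensation_function ::
    "(nat \<Rightarrow> nat) set \<Rightarrow> (nat \<Rightarrow> nat) set \<Rightarrow> ((nat \<Rightarrow> nat) \<Rightarrow> (nat \<Rightarrow> nat)) \<Rightarrow>
     ((nat \<Rightarrow> nat) \<Rightarrow> real) \<Rightarrow> bool" where
  "compensation_function X Y \<pi> F \<longleftrightarrow> continuous_on X F \<and>
     (\<forall>\<phi> :: (nat \<Rightarrow> nat) \<Rightarrow> real. continuous_on Y \<phi> \<longrightarrow>
        (SUP \<mu>\<in>inv_measures X. measure_entropy \<mu> shift_map +
           ereal (integral\<^sup>L \<mu> F) + ereal (integral\<^sup>L \<mu> (\<phi> \<circ> \<pi>))) =
        (SUP \<nu>\<in>inv_measures Y. measure_entropy \<nu> shift_map + ereal (integral\<^sup>L \<nu> \<phi>)))"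

definition sup_norm :: "(nat \<Rightarrow> nat) set \<Rightarrow> ((nat \<Rightarrow> nat) \<Rightarrow> real) \<Rightarrow> ereal" where
  "sup_norm Y \<phi> = (SUP y\<in>Y. ereal \<bar>\<phi> y\<bar>)"

text \<open>Asymptotic additivity of the sequence of the functions \<open>ln (g n)\<close>, \<open>n \<ge> 1\<close>.\<close>
definition log_asymptotically_additive ::
    "(nat \<Rightarrow> nat) set \<Rightarrow> (nat \<Rightarrow> (nat \<Rightarrow> nat) \<Rightarrow> real) \<Rightarrow> bool" where
  "log_asymptotically_additive Y g \<longleftrightarrow>
     (\<forall>n\<ge>1. continuous_on Y (g n) \<and> (\<forall>y\<in>Y. g n y > 0)) \<and>
     (\<forall>\<epsilon>>0. \<exists>\<rho> :: (nat \<Rightarrow> nat) \<Rightarrow> real. continuous_on Y \<rho> \<and>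
        limsup (\<lambda>n. sup_norm Y (\<lambda>y. ln (g n y) - birkhoff_sum \<rho> n y) / ereal (real n)) < ereal \<epsilon>)"

end

theory Submission
  imports Defs "HOL-Real_Asymp.Real_Asymp"
begin

text \<open>
  For a word \<open>v\<close> of \<open>Y\<close> let the fibre sum of \<open>f\<close> over \<open>v\<close> be the sum, over the words \<open>u\<close> of \<open>X\<close>
  lying over \<open>v\<close>, of the maximum of \<open>exp (S\<^sub>n f)\<close> on the cylinder of \<open>u\<close>. The fibre sum over the
  first \<open>n\<close> letters of \<open>y\<close> is \<open>g\<^sub>n y\<close>. All conditions on \<open>h\<close> are shown to be equivalent to one uniform
  statement (\<open>fibre_potential\<close>): \<open>ln g\<^sub>n - S\<^sub>n h\<close> is \<open>o(n)\<close>, uniformly on \<open>Y\<close>. As Birkhoff sums of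
  continuous functions depend on the coordinates beyond the \<open>n\<close>-th only up to \<open>o(n)\<close>, replacing \<open>f\<close>
  by \<open>F = f - h \<circ> \<pi>\<close> reduces this to the case \<open>h = 0\<close> (\<open>fibre_sum_minus_pi\<close>): the fibre sums of \<open>F\<close>
  neither grow nor decay exponentially.

  Periodic points suffice (\<open>unif_sublinear_if_periodic\<close>). In an irreducible one-step shift the
  lifts of a word \<open>v\<close> can be extended, after discarding all but a fixed proportion of their weight, by
  one word of bounded length so that they can be concatenated freely (\<open>return_extension\<close>). All
  concatenations lie over the same periodic point, which begins with \<open>v\<close>; if the fibre sums along
  that point grow subexponentially, then the fibre sum over \<open>v\<close> cannot have been large. It cannot
  have been small either, because fibre sums are submultiplicative.

  The relative pressure at \<open>y\<close> is the growth rate of a smaller sum, over the words that extend to a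
  point of the fibre over \<open>y\<close> itself (\<open>rel_pressure_eq\<close>). By compactness, whether a letter begins a
  point of the fibre over \<open>y\<close> is decided by finitely many coordinates of \<open>y\<close>. Their number is bounded
  along a periodic orbit, so that there both sums grow alike (\<open>rel_pressure_periodic\<close>). For an
  invariant measure it is bounded outside a set of small measure, which together with Fatou's
  lemma and a maximal inequality gives the equality of integrals (\<open>integral_rel_pressure\<close>).
  Conversely that equality, for the measures carried by periodic orbits, determines the growth
  of the fibre sums along periodic points.

  For compensation functions the suprema over measures are turned into pressures by the variational
  principle on \<open>X\<close> and on \<open>Y\<close>. Both directions are proved from Gibbs' inequality: the upper bound by
  coding itineraries through an arbitrary finite partition by words and rare corrections
  (\<open>itinerary_entropy_le\<close>), the lower bound by stationary concatenations of independent blocks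
  (\<open>free_concatenation_measure\<close>). The condition then compares the sums, over the words \<open>v\<close> of \<open>Y\<close>,
  of the weights of \<open>\<phi>\<close> with and without the fibre sum of \<open>F\<close> over \<open>v\<close> as a factor. They
  grow alike if the fibre sums are subexponential. For the converse, \<open>\<phi>\<close> is taken to be
  very negative away from a periodic orbit, which isolates the fibre sums along this orbit
  (\<open>growth_if_compensation\<close>).

  Finally, if \<open>\<mu>\<close> is a weak Gibbs measure for \<open>f\<close>, then the measure of a cylinder of \<open>Y\<close> of length
  \<open>n\<close> under \<open>\<pi> \<mu>\<close> is \<open>exp (- n P(f))\<close> times the fibre sum, up to a subexponential factor
  (\<open>pushforward_fibre_sum\<close>). So \<open>\<pi> \<mu>\<close> is weak Gibbs for some continuous function if and only if the
  fibre sums are, in this sense, Birkhoff sums of a continuous function.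
\<close>

section \<open>Exponential growth rates\<close>

definition growth :: "(nat \<Rightarrow> real) \<Rightarrow> ereal" where
  "growth a = limsup (\<lambda>n. ereal (a n / real n))"

text \<open>The constant \<open>C\<close> absorbs small \<open>n\<close>. In this form estimates of growth rates are
  combined by adding inequalities that hold for every \<open>n\<close>.\<close>
lemma growth_le_iff:
  "growth a \<le> ereal L \<longleftrightarrow> (\<forall>\<epsilon>>0. \<exists>C. \<forall>n. a n \<le> (L + \<epsilon>) * real n + C)" (is "?l \<longleftrightarrow> ?r")
proof
  assume l: ?l
  show ?r
  proof (intro allI impI)
    fix \<epsilon> :: real assume "\<epsilon> > 0"
    then have "ereal (L + \<epsilon>) > growth a" using l by (metis ereal_less_le less_add_same_cancel1 less_ereal.simps(1) order_le_less_trans)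
    then have "eventually (\<lambda>n. ereal (a n / real n) < ereal (L + \<epsilon>)) sequentially"
      unfolding growth_def using Limsup_lessD by blast
    then obtain N where N: "\<And>n. n \<ge> N \<Longrightarrow> a n / real n < L + \<epsilon>"
      unfolding eventually_sequentially by auto
    define C where "C = (\<Sum>n\<le>N. \<bar>a n - (L + \<epsilon>) * real n\<bar>)"
    have "a n \<le> (L + \<epsilon>) * real n + C" for n
    proof (cases "n \<le> N")
      case True
      have "\<bar>a n - (L + \<epsilon>) * real n\<bar> \<le> C"
        unfolding C_def using True by (intro member_le_sum) auto
      then show ?thesis by linarith
    next
      case False
      have "a n < (L + \<epsilon>) * real n" using N[of n] False by (simp add: field_simps)
      moreover have "C \<ge> 0" unfolding C_def by (intro sum_nonneg) auto
      ultimately show ?thesis by linarith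
    qed
    then show "\<exists>C. \<forall>n. a n \<le> (L + \<epsilon>) * real n + C" by blast
  qed
next
  assume r: ?r
  show ?l unfolding growth_def
  proof (subst Limsup_le_iff, intro allI impI)
    fix y assume y: "y > ereal L"
    obtain \<epsilon> where e: "\<epsilon> > 0" "ereal (L + 2 * \<epsilon>) \<le> y"
    proof (cases y)
      case (real r)
      then show ?thesis using y by (intro that[of "(r - L) / 2"]) (auto simp: field_simps)
    qed (use y that[of 1] in auto)
    obtain C where C: "\<And>n. a n \<le> (L + \<epsilon>) * real n + C" using r e(1) by blast
    have "eventually (\<lambda>n. n > max 0 (nat \<lceil>C / \<epsilon>\<rceil>)) sequentially" by (rule eventually_gt_at_top)
    then show "eventually (\<lambda>n. ereal (a n / real n) < y) sequentially"
    proof eventually_elim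
      case (elim n)
      then have "C / \<epsilon> < real n" "n > 0" by linarith+
      then have "C < \<epsilon> * real n" using e(1) by (simp add: field_simps)
      then have "a n < (L + 2 * \<epsilon>) * real n" using C[of n] by (simp add: algebra_simps)
      then have "a n / real n < L + 2 * \<epsilon>" using \<open>n > 0\<close> by (simp add: field_simps)
      then show ?case using e(2) by (metis less_ereal.simps(1) order_less_le_trans)
    qed
  qed
qed

lemma growth_leD:
  assumes "growth a \<le> ereal L" "\<epsilon> > 0"
  obtains C where "\<And>n. a n \<le> (L + \<epsilon>) * real n + C"
  using assms growth_le_iff by blast

lemma growth_leI:
  assumes "\<And>\<epsilon>. \<epsilon> > 0 \<Longrightarrow> \<exists>C. \<forall>n. a n \<le> (L + \<epsilon>) * real n + C"
  shows "growth a \<le> ereal L"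
  using assms growth_le_iff by blast

lemma growth_mono:
  assumes "\<And>\<epsilon>. \<epsilon> > 0 \<Longrightarrow> \<exists>C. \<forall>n. a n \<le> b n + \<epsilon> * real n + C"
  shows "growth a \<le> growth b"
proof (rule dense_ge)
  fix y assume "growth b < y"
  then obtain L where L: "growth b < ereal L" "ereal L < y" by (metis ereal_dense2)
  have "growth a \<le> ereal L"
  proof (rule growth_leI)
    fix \<epsilon> :: real assume e: "\<epsilon> > 0"
    obtain C where C: "\<And>n. b n \<le> (L + \<epsilon>/2) * real n + C"
      using growth_leD[of b L "\<epsilon>/2"] L(1) e by (metis half_gt_zero less_imp_le)
    obtain C' where C': "\<And>n. a n \<le> b n + (\<epsilon>/2) * real n + C'" using assms[of "\<epsilon>/2"] e by auto
    have "a n \<le> (L + \<epsilon>) * real n + (C + C')" for n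
      using C[of n] C'[of n] by (simp add: algebra_simps)
    then show "\<exists>C. \<forall>n. a n \<le> (L + \<epsilon>) * real n + C" by blast
  qed
  then show "growth a \<le> y" using L by simp
qed

lemma growth_lessD:
  assumes "growth a < ereal M"
  obtains L C where "L < M" "\<And>n. a n \<le> L * real n + C"
proof -
  obtain L where L: "growth a < ereal L" "ereal L < ereal M" using assms by (metis ereal_dense2)
  obtain C where "\<And>n. a n \<le> (L + (M - L) / 2) * real n + C"
    using growth_leD[of a L "(M - L) / 2"] L by (metis diff_gt_0_iff_gt half_gt_zero less_ereal.simps(1) less_imp_le)
  moreover have "L + (M - L) / 2 < M" using L by (auto simp: field_simps)
  ultimately show ?thesis using that by blast
qed

text \<open>An upper limit can be bounded from below along a subsequence; along periodic points
  and for concatenations of blocks only the multiples of the period are accessible.\<close>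
lemma growth_ge_multiples:
  assumes "\<And>k. k \<ge> 1 \<Longrightarrow> real k * A - C \<le> a (k * p)" "p \<ge> 1"
  shows "ereal (A / real p) \<le> growth a"
proof (rule ccontr)
  assume "\<not> ?thesis"
  then have "growth a < ereal (A / real p)" by simp
  then obtain L C' where L: "L < A / real p" and C': "\<And>n. a n \<le> L * real n + C'"
    using growth_lessD by metis
  define d where "d = A - L * real p"
  have d: "d > 0" using L assms(2) unfolding d_def by (simp add: field_simps)
  obtain k :: nat where k: "real k > (C + C') / d" using reals_Archimedean2 by blast
  define k' where "k' = Suc k"
  have "real k' > (C + C') / d" using k unfolding k'_def by simp
  then have "real k' * d > C + C'" using d by (simp add: field_simps)
  moreover have "real k' * A - C \<le> L * real (k' * p) + C'"
    using assms(1)[of k'] C'[of "k' * p"] unfolding k'_def by linarith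
  ultimately show False unfolding d_def by (simp add: algebra_simps)
qed

lemma growth_ge:
  assumes "\<And>n. n \<ge> 1 \<Longrightarrow> L * real n - C \<le> a n"
  shows "ereal L \<le> growth a"
  using growth_ge_multiples[of L C a 1] assms by (simp add: mult.commute)

lemma growth_mono_const:
  assumes "\<And>n. a n \<le> b n + C" shows "growth a \<le> growth b"
proof (rule growth_mono)
  fix \<epsilon> :: real assume "\<epsilon> > 0"
  then have "a n \<le> b n + \<epsilon> * real n + C" for n
    using assms[of n] mult_nonneg_nonneg[of \<epsilon> "real n"] by linarith
  then show "\<exists>C. \<forall>n. a n \<le> b n + \<epsilon> * real n + C" by blast
qed

lemma growth_le_linear:
  assumes "\<And>n. a n \<le> L * real n + C" shows "growth a \<le> ereal L"
proof (rule growth_leI)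
  fix \<epsilon> :: real assume "\<epsilon> > 0"
  then have "a n \<le> (L + \<epsilon>) * real n + C" for n
    using assms[of n] mult_nonneg_nonneg[of \<epsilon> "real n"] unfolding distrib_right by linarith
  then show "\<exists>C. \<forall>n. a n \<le> (L + \<epsilon>) * real n + C" by blast
qed

lemma growth_mono_ge1:
  assumes "\<And>\<epsilon>. \<epsilon> > 0 \<Longrightarrow> \<exists>C. \<forall>n\<ge>1. a n \<le> b n + \<epsilon> * real n + C"
  shows "growth a \<le> growth b"
proof (rule growth_mono)
  fix \<epsilon> :: real assume "\<epsilon> > 0"
  then obtain C where C: "\<And>n. n \<ge> 1 \<Longrightarrow> a n \<le> b n + \<epsilon> * real n + C" using assms by blast
  have "a n \<le> b n + \<epsilon> * real n + max C (a 0 - b 0)" for n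
    using C[of n] by (cases "n = 0") auto
  then show "\<exists>C. \<forall>n. a n \<le> b n + \<epsilon> * real n + C" by blast
qed

lemma growth_le_shift: "growth a \<le> growth (\<lambda>n. a (n + r))"
proof (rule dense_ge)
  fix y assume "growth (\<lambda>n. a (n + r)) < y"
  then obtain L where L: "growth (\<lambda>n. a (n + r)) < ereal L" "ereal L < y" by (metis ereal_dense2)
  have "growth a \<le> ereal L"
  proof (rule growth_leI)
    fix \<epsilon> :: real assume e: "\<epsilon> > 0"
    obtain C where C: "\<And>n. a (n + r) \<le> (L + \<epsilon>) * real n + C"
      using growth_leD[OF less_imp_le[OF L(1)] e] by metis
    have "a m \<le> (L + \<epsilon>) * real m + (\<bar>C\<bar> + \<bar>L + \<epsilon>\<bar> * real r + (\<Sum>i<r. \<bar>a i\<bar> + \<bar>L + \<epsilon>\<bar> * real r))" for m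
    proof (cases "m < r")
      case True
      have "\<bar>a m\<bar> + \<bar>L + \<epsilon>\<bar> * real r \<le> (\<Sum>i<r. \<bar>a i\<bar> + \<bar>L + \<epsilon>\<bar> * real r)"
        using True by (intro member_le_sum) auto
      moreover have "\<bar>(L + \<epsilon>) * real m\<bar> \<le> \<bar>L + \<epsilon>\<bar> * real r"
        unfolding abs_mult using True by (intro mult_mono) auto
      ultimately show ?thesis by linarith
    next
      case False
      then obtain n where n: "m = n + r" by (metis add.commute le_Suc_ex not_less)
      have "(L + \<epsilon>) * real n = (L + \<epsilon>) * real m - (L + \<epsilon>) * real r" by (simp add: n algebra_simps)
      moreover have "\<bar>(L + \<epsilon>) * real r\<bar> \<le> \<bar>L + \<epsilon>\<bar> * real r" by (simp add: abs_mult)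
      moreover have "0 \<le> (\<Sum>i<r. \<bar>a i\<bar> + \<bar>L + \<epsilon>\<bar> * real r)" by (intro sum_nonneg) auto
      ultimately show ?thesis using C[of n] unfolding n by linarith
    qed
    then show "\<exists>C. \<forall>n. a n \<le> (L + \<epsilon>) * real n + C" by blast
  qed
  then show "growth a \<le> y" using L by simp
qed

lemma growth_abs_le:
  assumes "\<And>n. \<bar>a n\<bar> \<le> K * real n"
  shows "growth a \<le> ereal K" "ereal (- K) \<le> growth a" "\<bar>growth a\<bar> \<noteq> \<infinity>"
proof -
  have b: "a n \<le> K * real n + 0" "- K * real n - 0 \<le> a n" for n using assms[of n] by (simp_all add: abs_le_iff minus_le_iff)
  show 1: "growth a \<le> ereal K" by (rule growth_le_linear[OF b(1)])
  show 2: "ereal (- K) \<le> growth a" by (rule growth_ge[OF b(2)])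
  show "\<bar>growth a\<bar> \<noteq> \<infinity>" using 1 2 by auto
qed

text \<open>A uniform bound \<open>o(n)\<close>, with the small \<open>n\<close> absorbed in the constant.\<close>
definition unif_sublinear :: "'a set \<Rightarrow> (nat \<Rightarrow> 'a \<Rightarrow> real) \<Rightarrow> bool" where
  "unif_sublinear Y a \<longleftrightarrow> (\<forall>\<epsilon>>0. \<exists>C. \<forall>n. \<forall>y\<in>Y. \<bar>a n y\<bar> \<le> \<epsilon> * real n + C)"

lemma growth_cong:
  assumes "unif_sublinear Y (\<lambda>n y. a n y - b n y)" "y \<in> Y"
  shows "growth (\<lambda>n. a n y) = growth (\<lambda>n. b n y)"
proof (rule antisym; rule growth_mono)
  fix \<epsilon> :: real assume "\<epsilon> > 0"
  then obtain C where C: "\<And>n. \<bar>a n y - b n y\<bar> \<le> \<epsilon> * real n + C"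
    using assms unfolding unif_sublinear_def by blast
  have "a n y \<le> b n y + \<epsilon> * real n + C" "b n y \<le> a n y + \<epsilon> * real n + C" for n
    using C[of n] by linarith+
  then show "\<exists>C. \<forall>n. a n y \<le> b n y + \<epsilon> * real n + C"
    "\<exists>C. \<forall>n. b n y \<le> a n y + \<epsilon> * real n + C" by blast+
qed

section \<open>Sums over words\<close>

lemma sum_le_cover:
  fixes t :: "'a \<Rightarrow> real"
  assumes "finite J" and b: "\<And>x. x \<in> J \<Longrightarrow> 0 \<le> b x" and c: "\<And>v. v \<in> A \<Longrightarrow> \<exists>x\<in>J. g x = v \<and> t v \<le> b x"
  shows "sum t A \<le> sum b J"
proof -
  obtain s where s: "\<And>v. v \<in> A \<Longrightarrow> s v \<in> J \<and> g (s v) = v \<and> t v \<le> b (s v)" using c by metis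
  have inj: "inj_on s A" by (rule inj_onI) (metis s)
  have "sum t A \<le> (\<Sum>v\<in>A. b (s v))" using s by (intro sum_mono) auto
  also have "\<dots> = sum b (s ` A)" by (simp add: sum.reindex[OF inj])
  also have "\<dots> \<le> sum b J" using s b assms(1) by (intro sum_mono2) auto
  finally show ?thesis .
qed

text \<open>A word is determined by its two parts, but not every pair of parts need occur.\<close>
lemma sum_split_words_le:
  fixes c :: "'a list \<Rightarrow> real"
  assumes fin: "finite A" "finite B" and pos: "\<And>u. u \<in> A \<Longrightarrow> 0 \<le> a u" "\<And>u. u \<in> B \<Longrightarrow> 0 \<le> b u"
    and split: "\<And>u. u \<in> S \<Longrightarrow> take n u \<in> A \<and> drop n u \<in> B \<and> c u \<le> a (take n u) * b (drop n u)"
  shows "sum c S \<le> sum a A * sum b B"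
proof -
  have "sum c S \<le> (\<Sum>x\<in>A \<times> B. a (fst x) * b (snd x))"
  proof (rule sum_le_cover[where g = "\<lambda>x. fst x @ snd x"])
    show "finite (A \<times> B)" using fin by simp
    show "0 \<le> a (fst x) * b (snd x)" if "x \<in> A \<times> B" for x using that pos by (auto intro: mult_nonneg_nonneg)
    fix u assume "u \<in> S"
    then show "\<exists>x\<in>A \<times> B. fst x @ snd x = u \<and> c u \<le> a (fst x) * b (snd x)"
      using split by (intro bexI[of _ "(take n u, drop n u)"]) auto
  qed
  also have "\<dots> = sum a A * sum b B" unfolding sum_product sum.cartesian_product by (simp add: case_prod_unfold)
  finally show ?thesis .
qed

section \<open>Words and cylinders\<close>

lemma initial_word_eq_iff: "initial_word n x = initial_word n y \<longleftrightarrow> (\<forall>i<n. x i = y i)"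
  by (auto simp: initial_word_def)

lemma length_initial_word [simp]: "length (initial_word n x) = n"
  by (simp add: initial_word_def)

lemma nth_initial_word [simp]: "i < n \<Longrightarrow> initial_word n x ! i = x i"
  by (simp add: initial_word_def)

lemma initial_word_0 [simp]: "initial_word 0 x = []"
  by (simp add: initial_word_def)

lemma shift_map_power: "(shift_map ^^ i) x = (\<lambda>j. x (i + j))"
proof (induction i)
  case (Suc i)
  then show ?case by (simp add: shift_map_def)
qed simp

lemma initial_word_add:
  "initial_word (n + m) x = initial_word n x @ initial_word m ((shift_map ^^ n) x)"
  by (rule nth_equalityI) (auto simp: initial_word_def nth_append shift_map_power)

lemma initial_word_eq_mono:
  "initial_word n x = initial_word n y \<Longrightarrow> m \<le> n \<Longrightarrow> initial_word m x = initial_word m y"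
  by (auto simp: initial_word_eq_iff)

lemma birkhoff_sum_0 [simp]: "birkhoff_sum f 0 x = 0"
  by (simp add: birkhoff_sum_def)

lemma birkhoff_sum_Suc: "birkhoff_sum f (Suc n) x = birkhoff_sum f n x + f ((shift_map ^^ n) x)"
  by (simp add: birkhoff_sum_def)

lemma birkhoff_sum_add:
  "birkhoff_sum f (n + m) x = birkhoff_sum f n x + birkhoff_sum f m ((shift_map ^^ n) x)"
proof (induction m)
  case (Suc m)
  have "(shift_map ^^ (n + m)) x = (shift_map ^^ m) ((shift_map ^^ n) x)"
    by (simp add: shift_map_power add_ac)
  then show ?case using Suc by (simp add: birkhoff_sum_Suc)
qed simp

lemma birkhoff_sum_diff:
  "birkhoff_sum (\<lambda>x. f x - g x) n x = birkhoff_sum f n x - birkhoff_sum g n x"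
  by (simp add: birkhoff_sum_def sum_subtractf)

lemma birkhoff_sum_plus:
  "birkhoff_sum (\<lambda>x. f x + g x) n x = birkhoff_sum f n x + birkhoff_sum g n x"
  by (simp add: birkhoff_sum_def sum.distrib)

lemma coordinate_continuous [simp]: "continuous_on S (\<lambda>x::nat \<Rightarrow> nat. x i)"
  by (rule continuous_on_subset[OF continuous_on_product_coordinates]) auto

lemma open_same_prefix: "open {z::nat \<Rightarrow> nat. \<forall>i<n. z i = x i}"
proof -
  have "open {z::nat \<Rightarrow> nat. \<forall>i\<in>{..<n}. z (id i) \<in> {x i}}"
    by (rule product_topology_basis') (auto intro: Topological_Spaces.open_discrete)
  then show ?thesis by (simp add: Ball_def)
qed

lemma open_word_set: "open {z. P (initial_word n z)}"
proof (rule Topological_Spaces.openI)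
  fix z assume z: "z \<in> {z. P (initial_word n z)}"
  have "{z'. \<forall>i<n. z' i = z i} \<subseteq> {z. P (initial_word n z)}"
    using z by (auto simp flip: initial_word_eq_iff)
  then show "\<exists>T. open T \<and> z \<in> T \<and> T \<subseteq> {z. P (initial_word n z)}"
    using open_same_prefix by blast
qed

lemma closed_word_set: "closed {z. P (initial_word n z)}"
proof -
  have "- {z. P (initial_word n z)} = {z. \<not> P (initial_word n z)}" by auto
  then show ?thesis using open_word_set[of "\<lambda>w. \<not> P w" n] by (simp add: closed_def)
qed

lemma continuous_on_word_fun: "continuous_on S (\<lambda>z. F (initial_word n z) :: 'b::topological_space)"
proof (rule continuous_on_subset[of UNIV])
  have "(\<lambda>z. F (initial_word n z)) -` B = {z. F (initial_word n z) \<in> B}" for B by auto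
  then show "continuous_on UNIV (\<lambda>z. F (initial_word n z))"
    unfolding continuous_on_open_vimage[OF open_UNIV] by (auto intro: open_word_set)
qed auto

text \<open>A basic open set of the product topology restricts finitely many coordinates.\<close>
lemma open_contains_cylinder:
  fixes U :: "(nat \<Rightarrow> nat) set"
  assumes "open U" "x \<in> U"
  obtains n where "{z. initial_word n z = initial_word n x} \<subseteq> U"
proof -
  have op: "openin (product_topology (\<lambda>i. euclidean) UNIV) U" using assms(1) by (simp add: open_fun_def)
  obtain V where V: "finite {i. V i \<noteq> (UNIV::nat set)}" "x \<in> Pi\<^sub>E UNIV V" "Pi\<^sub>E UNIV V \<subseteq> U"
    using bspec[OF iffD1[OF openin_product_topology_alt op] assms(2)] by auto
  obtain n where n: "\<And>i. V i \<noteq> UNIV \<Longrightarrow> i < n"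
    using finite_nat_bounded[OF V(1)] by (auto simp: subset_eq)
  have "{z. initial_word n z = initial_word n x} \<subseteq> Pi\<^sub>E UNIV V"
  proof (safe intro!: PiE_I)
    fix z i assume "initial_word n z = initial_word n x"
    then show "z i \<in> V i" using n[of i] V(2) by (cases "V i = UNIV") (auto simp: initial_word_eq_iff)
  qed auto
  from that[OF subset_trans[OF this V(3)]] show ?thesis .
qed

lemma compact_full_shift: "compact (full_shift k)"
proof -
  have "full_shift k = Pi\<^sub>E UNIV (\<lambda>_. {1..k})" by (auto simp: full_shift_def PiE_iff)
  moreover have "compactin (product_topology (\<lambda>i::nat. euclidean::nat topology) UNIV) (Pi\<^sub>E UNIV (\<lambda>_. {1..k}))"
    unfolding compactin_PiE by (auto simp: finite_imp_compact)
  ultimately show ?thesis by (simp add: euclidean_product_topology)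
qed

locale nonempty_subshift =
  fixes Z :: "(nat \<Rightarrow> nat) set"
  assumes Z_subshift: "subshift Z" and Z_nonempty: "Z \<noteq> {}"
begin

definition alphabet_bound :: nat where
  "alphabet_bound = (SOME k. k \<ge> 1 \<and> Z \<subseteq> full_shift k)"

lemma alphabet_bound: "alphabet_bound \<ge> 1" "Z \<subseteq> full_shift alphabet_bound"
  using someI_ex[of "\<lambda>k. k \<ge> 1 \<and> Z \<subseteq> full_shift k"] Z_subshift
  unfolding alphabet_bound_def subshift_def by auto

lemma Z_letter: "x \<in> Z \<Longrightarrow> x i \<in> {1..alphabet_bound}"
  using alphabet_bound(2) by (auto simp: full_shift_def)

lemma Z_closed: "closed Z" using Z_subshift by (simp add: subshift_def)

lemma Z_compact: "compact Z"
  using compact_full_shift Z_closed alphabet_bound(2)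
  by (metis closed_Int_compact inf.absorb_iff1 inf_commute)

lemma Z_shift: "x \<in> Z \<Longrightarrow> (shift_map ^^ i) x \<in> Z"
proof (induction i)
  case (Suc i)
  then show ?case using Z_subshift by (auto simp: subshift_def)
qed simp

lemma Z_shift1: "x \<in> Z \<Longrightarrow> shift_map x \<in> Z"
  using Z_shift[of x 1] by simp

lemma words_eq: "words Z n = initial_word n ` Z"
proof (cases "n = 0")
  case True
  then show ?thesis using Z_nonempty by (auto simp: words_def)
next
  case False
  show ?thesis
  proof (intro set_eqI iffI)
    fix w assume "w \<in> words Z n"
    then obtain x i where x: "x \<in> Z" "length w = n" "\<forall>j<length w. x (i + j) = w ! j"
      using False by (auto simp: words_def occurs_in_def)
    have "w = initial_word n ((shift_map ^^ i) x)"
      by (rule nth_equalityI) (use x in \<open>auto simp: shift_map_power\<close>)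
    then show "w \<in> initial_word n ` Z" using Z_shift x by blast
  next
    fix w assume "w \<in> initial_word n ` Z"
    then obtain x where "x \<in> Z" "w = initial_word n x" by blast
    then show "w \<in> words Z n" using False by (auto simp: words_def occurs_in_def intro!: exI[of _ 0])
  qed
qed

lemma finite_words [simp]: "finite (words Z n)"
proof (rule finite_subset)
  show "words Z n \<subseteq> {w. set w \<subseteq> {1..alphabet_bound} \<and> length w = n}"
    using Z_letter by (fastforce simp: words_eq initial_word_def)
qed (rule finite_lists_length_eq, simp)

lemma card_words: "card (words Z n) \<le> alphabet_bound ^ n"
proof -
  have "card (words Z n) \<le> card {w. set w \<subseteq> {1..alphabet_bound} \<and> length w = n}"
    using Z_letter by (intro card_mono finite_lists_length_eq) (fastforce simp: words_eq initial_word_def)+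
  also have "\<dots> = alphabet_bound ^ n" by (subst card_lists_length_eq) auto
  finally show ?thesis .
qed

lemma words_nonempty: "words Z n \<noteq> {}" using Z_nonempty by (simp add: words_eq)

lemma cyl_nonempty: "u \<in> words Z n \<Longrightarrow> cyl Z u \<noteq> {}"
  by (auto simp: words_eq cyl_def)

lemma cyl_compact: "compact (cyl Z u)"
proof -
  have "cyl Z u = Z \<inter> {z. initial_word (length u) z = u}" by (auto simp: cyl_def)
  then show ?thesis using compact_Int_closed[OF Z_compact closed_word_set[of "\<lambda>w. w = u"]] by simp
qed

lemma continuous_shift_power: "continuous_on S (\<lambda>x. (shift_map ^^ i) x)"
  by (simp add: shift_map_power) (intro continuous_on_coordinatewise_then_product coordinate_continuous)

lemma continuous_birkhoff_sum:
  assumes "continuous_on Z f" shows "continuous_on Z (birkhoff_sum f n)"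
proof -
  have "continuous_on Z (\<lambda>x. \<Sum>i<n. f ((shift_map ^^ i) x))"
    using Z_shift
    by (intro continuous_on_sum continuous_on_compose2[OF assms continuous_shift_power]) auto
  then show ?thesis by (simp add: birkhoff_sum_def[abs_def])
qed

lemma continuous_bounded:
  assumes "continuous_on Z f"
  obtains K where "K \<ge> 0" "\<And>x. x \<in> Z \<Longrightarrow> \<bar>f x\<bar> \<le> (K::real)"
proof -
  have "bounded (f ` Z)" using assms Z_compact by (simp add: compact_continuous_image compact_imp_bounded)
  then obtain K where "\<And>x. x \<in> Z \<Longrightarrow> \<bar>f x\<bar> \<le> K" unfolding bounded_iff by auto
  then show ?thesis using that[of "max 0 K"] by fastforce
qed

lemma birkhoff_sum_bound:
  assumes "\<And>x. x \<in> Z \<Longrightarrow> \<bar>f x\<bar> \<le> K" "x \<in> Z"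
  shows "\<bar>birkhoff_sum f n x\<bar> \<le> K * real n"
proof -
  have "\<bar>birkhoff_sum f n x\<bar> \<le> (\<Sum>i<n. \<bar>f ((shift_map ^^ i) x)\<bar>)"
    unfolding birkhoff_sum_def by (rule sum_abs)
  also have "\<dots> \<le> (\<Sum>i<n. K)" using assms Z_shift by (intro sum_mono) auto
  finally show ?thesis by (simp add: mult.commute)
qed

text \<open>Uniform continuity, from compactness, in terms of common initial words.\<close>
lemma continuous_uniform_prefix:
  assumes f: "continuous_on Z f" and "\<epsilon> > (0::real)"
  obtains k where "\<And>x y. x \<in> Z \<Longrightarrow> y \<in> Z \<Longrightarrow> initial_word k x = initial_word k y \<Longrightarrow> \<bar>f x - f y\<bar> < \<epsilon>"
proof -
  have "\<exists>n. \<forall>z\<in>Z. initial_word n z = initial_word n x \<longrightarrow> \<bar>f z - f x\<bar> < \<epsilon>/2" if x: "x \<in> Z" for x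
  proof -
    have "\<exists>A. open A \<and> A \<inter> Z = f -` {t. \<bar>t - f x\<bar> < \<epsilon>/2} \<inter> Z"
      by (rule f[unfolded continuous_on_open_invariant, rule_format]) (intro open_Collect_less continuous_intros)
    then obtain A where A: "open A" "A \<inter> Z = f -` {t. \<bar>t - f x\<bar> < \<epsilon>/2} \<inter> Z" by blast
    have "x \<in> A \<inter> Z" unfolding A(2) using x assms(2) by simp
    then have "x \<in> A" by simp
    then obtain n where "{z. initial_word n z = initial_word n x} \<subseteq> A"
      using open_contains_cylinder A(1) by blast
    then have "z \<in> A \<inter> Z" if "z \<in> Z" "initial_word n z = initial_word n x" for z using that by blast
    then show ?thesis unfolding A(2) by (intro exI[of _ n]) simp
  qed
  then obtain N where N: "\<And>x z. x \<in> Z \<Longrightarrow> z \<in> Z \<Longrightarrow> initial_word (N x) z = initial_word (N x) x \<Longrightarrow> \<bar>f z - f x\<bar> < \<epsilon>/2"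
    by metis
  define U where "U x = {z. initial_word (N x) z = initial_word (N x) x}" for x
  have oU: "open (U x)" for x unfolding U_def by (rule open_word_set)
  have "Z \<subseteq> \<Union> (U ` Z)" by (auto simp: U_def)
  then obtain D where D: "D \<subseteq> Z" "finite D" "Z \<subseteq> \<Union> (U ` D)"
    using compactE_image[OF Z_compact, of Z U] oU by metis
  show ?thesis
  proof (rule that[of "Max (insert 0 (N ` D))"])
    fix x y assume xy: "x \<in> Z" "y \<in> Z" and e: "initial_word (Max (insert 0 (N ` D))) x = initial_word (Max (insert 0 (N ` D))) y"
    obtain c where c: "c \<in> D" "x \<in> U c" using D xy by blast
    have "N c \<le> Max (insert 0 (N ` D))" using c D by (intro Max_ge) auto
    then have "initial_word (N c) x = initial_word (N c) y" using e initial_word_eq_mono by blast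
    then have "\<bar>f x - f c\<bar> < \<epsilon>/2" "\<bar>f y - f c\<bar> < \<epsilon>/2" using N c D xy unfolding U_def by auto
    then show "\<bar>f x - f y\<bar> < \<epsilon>" by linarith
  qed
qed

text \<open>The coordinates of a point beyond the \<open>n\<close>-th have an effect on the \<open>n\<close>-th Birkhoff sum that
  is sublinear in \<open>n\<close>: all but a bounded number of the summands are almost determined.\<close>
lemma bounded_distortion:
  assumes f: "continuous_on Z f" and e: "\<epsilon> > (0::real)"
  obtains C where "C \<ge> 0" "\<And>n x y. x \<in> Z \<Longrightarrow> y \<in> Z \<Longrightarrow> initial_word n x = initial_word n y \<Longrightarrow>
     \<bar>birkhoff_sum f n x - birkhoff_sum f n y\<bar> \<le> \<epsilon> * real n + C"
proof -
  obtain k where k: "\<And>x y. x \<in> Z \<Longrightarrow> y \<in> Z \<Longrightarrow> initial_word k x = initial_word k y \<Longrightarrow> \<bar>f x - f y\<bar> < \<epsilon>"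
    using continuous_uniform_prefix[OF f e] by metis
  obtain K where K: "K \<ge> 0" "\<And>x. x \<in> Z \<Longrightarrow> \<bar>f x\<bar> \<le> K" using continuous_bounded[OF f] by metis
  show ?thesis
  proof (rule that[of "2 * K * real k"])
    show "2 * K * real k \<ge> 0" using K by simp
    fix n x y assume xy: "x \<in> Z" "y \<in> Z" "initial_word n x = initial_word n y"
    have b: "\<bar>f ((shift_map ^^ i) x) - f ((shift_map ^^ i) y)\<bar> \<le> \<epsilon> + (if i + k \<le> n then 0 else 2 * K)" for i
    proof (cases "i + k \<le> n")
      case True
      then have "initial_word k ((shift_map ^^ i) x) = initial_word k ((shift_map ^^ i) y)"
        using xy(3) by (auto simp: initial_word_eq_iff shift_map_power)
      then show ?thesis using k[of "(shift_map ^^ i) x" "(shift_map ^^ i) y"] Z_shift xy True by auto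
    next
      case False
      then show ?thesis using K(2)[of "(shift_map ^^ i) x"] K(2)[of "(shift_map ^^ i) y"] Z_shift xy e by auto
    qed
    have "\<bar>birkhoff_sum f n x - birkhoff_sum f n y\<bar> \<le> (\<Sum>i<n. \<bar>f ((shift_map ^^ i) x) - f ((shift_map ^^ i) y)\<bar>)"
      unfolding birkhoff_sum_def sum_subtractf[symmetric] by (rule sum_abs)
    also have "\<dots> \<le> (\<Sum>i<n. \<epsilon> + (if i + k \<le> n then 0 else 2 * K))" by (intro sum_mono b)
    also have "\<dots> = \<epsilon> * real n + (\<Sum>i<n. if i + k \<le> n then 0 else 2 * K)"
      by (simp add: sum.distrib mult.commute)
    also have "(\<Sum>i<n. if i + k \<le> n then 0 else 2 * K) = (\<Sum>i\<in>{i. i < n \<and> n < i + k}. 2 * K)"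
      by (rule sum.mono_neutral_cong_right) auto
    also have "\<dots> \<le> 2 * K * real k"
    proof -
      have "{i. i < n \<and> n < i + k} \<subseteq> {n - k..<n}" by auto
      then have "card {i. i < n \<and> n < i + k} \<le> k" using card_mono[of "{n-k..<n}" "{i. i < n \<and> n < i + k}"] by simp
      then show ?thesis using K(1) by (simp add: mult.commute mult_left_mono)
    qed
    finally show "\<bar>birkhoff_sum f n x - birkhoff_sum f n y\<bar> \<le> \<epsilon> * real n + 2 * K * real k" by simp
  qed
qed

definition weight :: "((nat \<Rightarrow> nat) \<Rightarrow> real) \<Rightarrow> nat list \<Rightarrow> real" where
  "weight F u = (SUP x\<in>cyl Z u. exp (birkhoff_sum F (length u) x))"

text \<open>The supremum is a maximum because the cylinder is compact.\<close>
lemma weight_attained: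
  assumes F: "continuous_on Z F" and u: "u \<in> words Z n"
  obtains x where "x \<in> Z" "initial_word n x = u" "weight F u = exp (birkhoff_sum F n x)"
    "\<And>x'. x' \<in> Z \<Longrightarrow> initial_word n x' = u \<Longrightarrow> birkhoff_sum F n x' \<le> birkhoff_sum F n x"
proof -
  have len: "length u = n" using u by (auto simp: words_eq)
  have "continuous_on (cyl Z u) (birkhoff_sum F n)"
    by (rule continuous_on_subset[OF continuous_birkhoff_sum[OF F]]) (auto simp: cyl_def)
  from continuous_attains_sup[OF cyl_compact cyl_nonempty[OF u] this]
  obtain x where x: "x \<in> cyl Z u" "\<And>x'. x' \<in> cyl Z u \<Longrightarrow> birkhoff_sum F n x' \<le> birkhoff_sum F n x" by blast
  have "weight F u = exp (birkhoff_sum F n x)"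
    unfolding weight_def len by (rule cSup_eq_maximum) (use x in auto)
  then show ?thesis using x len by (intro that[of x]) (auto simp: cyl_def)
qed

lemma weight_upper:
  assumes F: "continuous_on Z F" and x: "x \<in> Z"
  shows "exp (birkhoff_sum F n x) \<le> weight F (initial_word n x)"
proof -
  have "initial_word n x \<in> words Z n" using x by (auto simp: words_eq)
  from weight_attained[OF F this] show ?thesis using x by (metis exp_le_cancel_iff)
qed

lemma weight_pos:
  assumes "continuous_on Z F" "u \<in> words Z n" shows "weight F u > 0"
  using weight_attained[OF assms] by (metis exp_gt_zero)

lemma weight_nonneg:
  assumes "continuous_on Z F" "u \<in> words Z n" shows "0 \<le> weight F u"
  using weight_pos[OF assms] by simp

lemma weight_bounds:
  assumes F: "continuous_on Z F" and u: "u \<in> words Z n" and K: "\<And>x. x \<in> Z \<Longrightarrow> \<bar>F x\<bar> \<le> K"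
  shows "exp (- (K * real n)) \<le> weight F u" "weight F u \<le> exp (K * real n)"
proof -
  obtain x where "x \<in> Z" "weight F u = exp (birkhoff_sum F n x)" using weight_attained[OF F u] by metis
  then show "exp (- (K * real n)) \<le> weight F u" "weight F u \<le> exp (K * real n)"
    using birkhoff_sum_bound[of F K x n] K by auto
qed

lemma weight_append:
  assumes F: "continuous_on Z F" and uv: "u @ v \<in> words Z (n + m)" and "length u = n"
  shows "u \<in> words Z n" "v \<in> words Z m" "weight F (u @ v) \<le> weight F u * weight F v"
proof -
  obtain x where x: "x \<in> Z" "initial_word (n + m) x = u @ v" "weight F (u @ v) = exp (birkhoff_sum F (n + m) x)"
    using weight_attained[OF F uv] by metis
  have e: "initial_word n x = u" "initial_word m ((shift_map ^^ n) x) = v"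
    using x(2) assms(3) unfolding initial_word_add by auto
  show "u \<in> words Z n" "v \<in> words Z m" using e x(1) Z_shift by (auto simp: words_eq)
  have "weight F (u @ v) = exp (birkhoff_sum F n x) * exp (birkhoff_sum F m ((shift_map ^^ n) x))"
    unfolding x(3) birkhoff_sum_add exp_add ..
  also have "\<dots> \<le> weight F u * weight F v"
    using weight_upper[OF F x(1), of n] weight_upper[OF F Z_shift[OF x(1)], of m n] e
    using weight_pos[OF F \<open>u \<in> words Z n\<close>] by (intro mult_mono) auto
  finally show "weight F (u @ v) \<le> weight F u * weight F v" .
qed

end

section \<open>Irreducible one-step shifts of finite type\<close>

text \<open>Forbidden words of length at most \<open>2\<close> constrain only pairs of consecutive
  coordinates. This is the form in which finite type is used: it allows points to be glued
  together.\<close>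
lemma one_step_sft_iff:
  assumes "one_step_sft X"
  shows "x \<in> X \<longleftrightarrow> (\<forall>i. \<exists>x'\<in>X. x' 0 = x i \<and> x' 1 = x (Suc i))"
proof -
  obtain k F where F: "\<And>w. w \<in> F \<Longrightarrow> length w \<le> 2"
    and X: "X = {x \<in> full_shift k. \<forall>w\<in>F. \<not> occurs_in w x}"
    using assms unfolding one_step_sft_def by blast
  show ?thesis
  proof
    assume x: "x \<in> X"
    have "(shift_map ^^ i) x \<in> X" for i
      using x unfolding X occurs_in_def by (auto simp: full_shift_def shift_map_power add.assoc[symmetric])
    then show "\<forall>i. \<exists>x'\<in>X. x' 0 = x i \<and> x' 1 = x (Suc i)"
      by (intro allI bexI[of _ "(shift_map ^^ _) x"]) (auto simp: shift_map_power)
  next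
    assume r: "\<forall>i. \<exists>x'\<in>X. x' 0 = x i \<and> x' 1 = x (Suc i)"
    have "\<not> occurs_in w x" if w: "w \<in> F" for w
    proof
      assume "occurs_in w x"
      then obtain i where i: "\<forall>j<length w. x (i + j) = w ! j" unfolding occurs_in_def by blast
      obtain x' where x': "x' \<in> X" "x' 0 = x i" "x' 1 = x (Suc i)" using r by blast
      have "\<forall>j<length w. x' (0 + j) = w ! j"
      proof (intro allI impI)
        fix j assume "j < length w"
        moreover from this have "j = 0 \<or> j = 1" using F[OF w] by linarith
        ultimately show "x' (0 + j) = w ! j" using i x'(2,3) by (metis Suc_eq_plus1 add.right_neutral add_0)
      qed
      then have "occurs_in w x'" unfolding occurs_in_def by blast
      then show False using x'(1) w unfolding X by blast
    qed
    moreover have "x \<in> full_shift k"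
      unfolding full_shift_def
    proof safe
      fix i
      obtain x' where "x' \<in> X" "x' 0 = x i" using r by blast
      then show "x i \<in> {1..k}" unfolding X full_shift_def by (metis (no_types, lifting) mem_Collect_eq)
    qed
    ultimately show "x \<in> X" unfolding X by blast
  qed
qed

lemma one_step_sft_imp_subshift:
  assumes "one_step_sft X" shows "subshift X"
proof -
  obtain k F where k: "k \<ge> 1" and X: "X = {x \<in> full_shift k. \<forall>w\<in>F. \<not> occurs_in w x}"
    using assms unfolding one_step_sft_def by blast
  have "X = full_shift k \<inter> (\<Inter>w\<in>F. \<Inter>i. {x. \<not> (\<forall>j<length w. initial_word (i + length w) x ! (i + j) = w ! j)})"
    unfolding X occurs_in_def by auto
  moreover have "full_shift k = (\<Inter>n. {x. set (initial_word n x) \<subseteq> {1..k}})"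
    by (fastforce simp: full_shift_def initial_word_def)
  then have "closed (full_shift k)" using closed_word_set[of "\<lambda>w. set w \<subseteq> {1..k}"] by (auto intro: closed_INT)
  then have "closed (full_shift k \<inter> (\<Inter>w\<in>F. \<Inter>i. {x. \<not> (\<forall>j<length w. initial_word (i + length w) x ! (i + j) = w ! j)}))"
    by (intro closed_Int closed_INT ballI closed_word_set)
  ultimately have "closed X" by simp
  moreover have "shift_map x \<in> X" if "x \<in> X" for x
    using that one_step_sft_iff[OF assms, of x] one_step_sft_iff[OF assms, of "shift_map x"]
    by (simp add: shift_map_def)
  ultimately show ?thesis using k unfolding subshift_def X by blast
qed

definition graft :: "nat \<Rightarrow> (nat \<Rightarrow> nat) \<Rightarrow> (nat \<Rightarrow> nat) \<Rightarrow> nat \<Rightarrow> nat" where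
  "graft n x y = (\<lambda>i. if i < n then x i else y (i - n))"

lemma initial_word_graft: "initial_word (n + m) (graft n x y) = initial_word n x @ initial_word m y"
  by (rule nth_equalityI) (auto simp: nth_append graft_def)

lemma initial_word_graft1: "initial_word n (graft n x y) = initial_word n x"
  using initial_word_graft[of n 0] by simp

definition concat_point :: "nat \<Rightarrow> (nat \<Rightarrow> nat list) \<Rightarrow> nat \<Rightarrow> nat" where
  "concat_point p B = (\<lambda>i. B (i div p) ! (i mod p))"

lemma shift_concat_point:
  "p \<ge> 1 \<Longrightarrow> (shift_map ^^ p) (concat_point p B) = concat_point p (\<lambda>q. B (Suc q))"
  by (auto simp: shift_map_power concat_point_def fun_eq_iff)

lemma shift_concat_point_mult:
  "p \<ge> 1 \<Longrightarrow> (shift_map ^^ (k * p)) (concat_point p B) = concat_point p (\<lambda>q. B (k + q))"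
  by (auto simp: shift_map_power concat_point_def fun_eq_iff)

lemma initial_word_concat_point:
  "length (B 0) = p \<Longrightarrow> initial_word p (concat_point p B) = B 0"
  by (rule nth_equalityI) (auto simp: concat_point_def)

locale irreducible_sft =
  fixes X :: "(nat \<Rightarrow> nat) set"
  assumes sft: "one_step_sft X" and irreducible: "irreducible_shift X" and X_nonempty: "X \<noteq> {}"
begin

sublocale X: nonempty_subshift X
  by unfold_locales (use one_step_sft_imp_subshift[OF sft] X_nonempty in auto)

lemma graft_in:
  assumes "x \<in> X" "y \<in> X" "x n = y 0"
  shows "graft n x y \<in> X"
  unfolding one_step_sft_iff[OF sft]
proof
  fix i
  consider "Suc i < n" | "Suc i = n" | "i \<ge> n" by linarith
  then show "\<exists>x'\<in>X. x' 0 = graft n x y i \<and> x' 1 = graft n x y (Suc i)"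
  proof cases
    case 1
    then show ?thesis using assms X.Z_shift by (intro bexI[of _ "(shift_map ^^ i) x"]) (auto simp: graft_def shift_map_power)
  next
    case 2
    then show ?thesis using assms X.Z_shift by (intro bexI[of _ "(shift_map ^^ i) x"]) (auto simp: graft_def shift_map_power)
  next
    case 3
    then show ?thesis using X.Z_shift[OF assms(2), of "i - n"]
      by (intro bexI[of _ "(shift_map ^^ (i - n)) y"]) (auto simp: graft_def shift_map_power Suc_diff_le)
  qed
qed

lemma connect:
  assumes "x \<in> X" "y \<in> X"
  obtains z r where "z \<in> X" "r \<ge> 1" "z 0 = x 0" "z r = y 0"
proof -
  have l: "[x 0] \<in> language X" if "x \<in> X" for x
    using that unfolding language_def X.words_eq by (auto simp: initial_word_def intro!: exI[of _ 1])
  obtain w where w: "[x 0] @ w @ [y 0] \<in> language X"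
    using irreducible l[OF assms(1)] l[OF assms(2)] unfolding irreducible_shift_def by blast
  then obtain n z where z: "z \<in> X" "[x 0] @ w @ [y 0] = initial_word n z"
    unfolding language_def X.words_eq by blast
  have n: "n = length w + 2" using arg_cong[OF z(2), of length] by simp
  have "z 0 = x 0" "z (Suc (length w)) = y 0"
    using arg_cong[OF z(2), of "\<lambda>v. v ! 0"] arg_cong[OF z(2), of "\<lambda>v. v ! Suc (length w)"] n
    by (auto simp: nth_append)
  then show ?thesis using that[of z "Suc (length w)"] z by simp
qed

text \<open>There are finitely many pairs of letters, so one bound serves all of them.\<close>
lemma connect_bounded:
  obtains M where "M \<ge> 1" "\<And>x y. x \<in> X \<Longrightarrow> y \<in> X \<Longrightarrow> \<exists>z\<in>X. \<exists>r\<ge>1. r \<le> M \<and> z 0 = x 0 \<and> z r = y 0"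
proof -
  define Q where "Q a b r \<longleftrightarrow> r \<ge> 1 \<and> (\<exists>z\<in>X. z 0 = a \<and> z r = b)" for a b and r :: nat
  define R where "R = (\<lambda>(a, b). SOME r. Q a b r)"
  define S where "S = {1..X.alphabet_bound} \<times> {1..X.alphabet_bound}"
  have fin: "finite (R ` S)" by (simp add: S_def)
  show ?thesis
  proof (rule that[of "Max (insert 1 (R ` S))"])
    show "1 \<le> Max (insert 1 (R ` S))" using fin by simp
    fix x y assume xy: "x \<in> X" "y \<in> X"
    obtain z r where "z \<in> X" "r \<ge> 1" "z 0 = x 0" "z r = y 0" using connect[OF xy] by metis
    then have "Q (x 0) (y 0) r" unfolding Q_def by blast
    then have "Q (x 0) (y 0) (R (x 0, y 0))" unfolding R_def by (simp add: someI[of "Q (x 0) (y 0)"])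
    moreover have "(x 0, y 0) \<in> S" using xy X.Z_letter unfolding S_def by blast
    then have "R (x 0, y 0) \<le> Max (insert 1 (R ` S))" using fin by (intro Max_ge) auto
    ultimately show "\<exists>z\<in>X. \<exists>r\<ge>1. r \<le> Max (insert 1 (R ` S)) \<and> z 0 = x 0 \<and> z r = y 0"
      unfolding Q_def by blast
  qed
qed

definition max_gap :: nat where
  "max_gap = (SOME M. \<forall>x\<in>X. \<forall>y\<in>X. \<exists>z\<in>X. \<exists>r\<ge>1. r \<le> M \<and> z 0 = x 0 \<and> z r = y 0)"

lemma max_gap:
  assumes "x \<in> X" "y \<in> X" shows "\<exists>z\<in>X. \<exists>r\<ge>1. r \<le> max_gap \<and> z 0 = x 0 \<and> z r = y 0"
proof -
  have "\<exists>M. \<forall>x\<in>X. \<forall>y\<in>X. \<exists>z\<in>X. \<exists>r\<ge>1. r \<le> M \<and> z 0 = x 0 \<and> z r = y 0"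
    using connect_bounded by metis
  from someI_ex[OF this] show ?thesis using assms unfolding max_gap_def by blast
qed

text \<open>The letter \<open>a\<close> at which the point returns is not part of the word: it is the first
  letter of the next word in a concatenation.\<close>
definition returns :: "nat \<Rightarrow> nat \<Rightarrow> nat list set" where
  "returns a p = {initial_word p x | x. x \<in> X \<and> x 0 = a \<and> x p = a}"

lemma length_returns: "w \<in> returns a p \<Longrightarrow> length w = p"
  by (auto simp: returns_def)

lemma concat_point_in:
  assumes p: "p \<ge> 1" and B: "\<And>q. B q \<in> returns a p"
  shows "concat_point p B \<in> X"
  unfolding one_step_sft_iff[OF sft]
proof
  fix i
  define q s where "q = i div p" and "s = i mod p"
  have s: "s < p" using p by (simp add: s_def)
  obtain x where x: "x \<in> X" "x 0 = a" "x p = a" "B q = initial_word p x" using B unfolding returns_def by blast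
  have "concat_point p B i = x s" using s x(4) by (simp add: concat_point_def q_def[symmetric] s_def[symmetric])
  moreover have "concat_point p B (Suc i) = x (Suc s)"
  proof (cases "Suc s < p")
    case True
    then have "Suc i mod p = Suc s" "Suc i div p = q"
      using p unfolding s_def q_def by (auto simp: mod_Suc div_Suc)
    then show ?thesis using True x(4) by (simp add: concat_point_def)
  next
    case False
    then have sp: "Suc s = p" using s by simp
    then have "Suc i mod p = 0" "Suc i div p = Suc q"
      using p unfolding s_def q_def by (auto simp: mod_Suc div_Suc)
    moreover obtain x' where "x' \<in> X" "x' 0 = a" "B (Suc q) = initial_word p x'" using B unfolding returns_def by blast
    ultimately show ?thesis using sp x(3) p by (simp add: concat_point_def)
  qed
  ultimately show "\<exists>x'\<in>X. x' 0 = concat_point p B i \<and> x' 1 = concat_point p B (Suc i)"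
    using X.Z_shift[OF x(1), of s] by (intro bexI[of _ "(shift_map ^^ s) x"]) (auto simp: shift_map_power)
qed

text \<open>A family of words is turned, at the cost of a bounded factor, into a family of words that
  can be concatenated freely: the pigeonhole principle fixes the first and the last letter, and
  one connecting word \<open>t\<close> from the last letter back to the first serves all of them.\<close>
lemma return_extension:
  fixes \<omega> :: "nat list \<Rightarrow> real"
  assumes n: "n \<ge> 1" and U: "U \<subseteq> words X n" and pos: "\<And>u. u \<in> U \<Longrightarrow> \<omega> u \<ge> 0"
  obtains a t U' where "length t \<le> max_gap" "U' \<subseteq> U" "\<And>u. u \<in> U' \<Longrightarrow> u @ t \<in> returns a (n + length t)"
       "sum \<omega> U \<le> real (X.alphabet_bound ^ 2) * sum \<omega> U'"
proof -
  have finU: "finite U" using U X.finite_words finite_subset by blast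
  define ends where "ends u = (u ! 0, u ! (n - 1))" for u :: "nat list"
  define S where "S = {1..X.alphabet_bound} \<times> {1..X.alphabet_bound}"
  have finS: "finite S" and cS: "card S = X.alphabet_bound ^ 2" by (auto simp: S_def power2_eq_square)
  have S0: "S \<noteq> {}" using X.alphabet_bound(1) by (auto simp: S_def)
  have "ends ` U \<subseteq> S" using U n X.Z_letter by (fastforce simp: X.words_eq ends_def S_def)
  then have "sum \<omega> U = (\<Sum>s\<in>S. sum \<omega> {u\<in>U. ends u = s})"
    using sum.group[OF finU finS, of ends \<omega>] by simp
  have "\<exists>s\<in>S. sum \<omega> U \<le> real (card S) * sum \<omega> {u\<in>U. ends u = s}"
  proof (rule ccontr)
    assume "\<not> ?thesis"
    then have "(\<Sum>s\<in>S. real (card S) * sum \<omega> {u\<in>U. ends u = s}) < (\<Sum>s\<in>S. sum \<omega> U)"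
      using finS S0 by (intro sum_strict_mono) (auto simp: not_le)
    then show False using \<open>sum \<omega> U = _\<close> by (simp add: sum_distrib_left[symmetric])
  qed
  then obtain a b where ab: "sum \<omega> U \<le> real (X.alphabet_bound ^ 2) * sum \<omega> {u\<in>U. ends u = (a, b)}"
    using cS by (metis prod.exhaust)
  define U' where "U' = {u\<in>U. ends u = (a, b)}"
  show thesis
  proof (cases "U' = {}")
    case True
    then show thesis using ab that[of "[]" "{}"] unfolding U'_def[symmetric] by auto
  next
    case False
    then obtain x where x: "x \<in> X" "x 0 = a" "x (n - 1) = b"
      using U n unfolding U'_def ends_def X.words_eq by fastforce
    obtain z r where z: "z \<in> X" "r \<ge> 1" "r \<le> max_gap" "z 0 = b" "z r = a"
      using max_gap[of "(shift_map ^^ (n - 1)) x" x] x X.Z_shift by (auto simp: shift_map_power)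
    \<comment> \<open>The end letters of \<open>z\<close> are left out: \<open>b\<close> is the last letter of \<open>u\<close>, and \<open>a\<close>
      begins the next word.\<close>
    define t where "t = initial_word (r - 1) (shift_map z)"
    have lt: "length t = r - 1" by (simp add: t_def)
    have "u @ t \<in> returns a (n + length t)" if u: "u \<in> U'" for u
    proof -
      obtain x where x: "x \<in> X" "x 0 = a" "x (n - 1) = b" "u = initial_word n x"
        using u U n unfolding U'_def ends_def X.words_eq by fastforce
      define w where "w = graft (n - 1) x z"
      have "w \<in> X" unfolding w_def using x z by (intro graft_in) auto
      moreover have "w 0 = a" using x z n by (auto simp: w_def graft_def)
      moreover have "w (n + length t) = a" using z n lt by (auto simp: w_def graft_def)
      moreover have "initial_word (n + length t) w = u @ t"
        using n z(2) x z
        by (intro nth_equalityI) (auto simp: nth_append w_def graft_def lt t_def shift_map_def not_less less_Suc_eq_le Suc_diff_le intro!: arg_cong[of _ _ z] arg_cong[of _ _ x])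
      ultimately show ?thesis unfolding returns_def by (metis (mono_tags, lifting) mem_Collect_eq)
    qed
    then show thesis using ab z lt that[of t U' a] unfolding U'_def[symmetric] by (auto simp: U'_def)
  qed
qed

end

section \<open>Fibre sums of a one-block factor map\<close>

lemma birkhoff_sum_blocks:
  "birkhoff_sum F (k * p) x = (\<Sum>q<k. birkhoff_sum F p ((shift_map ^^ (q * p)) x))"
proof (induction k)
  case (Suc k)
  have "birkhoff_sum F (Suc k * p) x = birkhoff_sum F (k * p + p) x" by (simp add: add.commute)
  then show ?case using Suc by (simp only: birkhoff_sum_add sum.lessThan_Suc)
qed simp

lemma shift_periodic: "(shift_map ^^ p) z = z \<Longrightarrow> (shift_map ^^ (k * p)) z = z"
  by (induction k) (simp_all add: funpow_add)

locale factor_code = irreducible_sft X for X +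
  fixes Y :: "(nat \<Rightarrow> nat) set" and \<pi> :: "(nat \<Rightarrow> nat) \<Rightarrow> (nat \<Rightarrow> nat)" and \<theta> :: "nat \<Rightarrow> nat"
  assumes Y_subshift: "subshift Y" and factor: "factor_map X Y \<pi>" and block: "one_block X \<theta> \<pi>"
begin

sublocale Y: nonempty_subshift Y
  by unfold_locales (use factor X_nonempty Y_subshift in \<open>auto simp: factor_map_def\<close>)

lemma pi_in: "x \<in> X \<Longrightarrow> \<pi> x \<in> Y" using factor by (auto simp: factor_map_def)

lemma pi_surj: "y \<in> Y \<Longrightarrow> \<exists>x\<in>X. \<pi> x = y" using factor by (auto simp: factor_map_def)

lemma pi_nth: "x \<in> X \<Longrightarrow> \<pi> x i = \<theta> (x i)" using block by (auto simp: one_block_def)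

lemma pi_shift: "x \<in> X \<Longrightarrow> \<pi> ((shift_map ^^ n) x) = (shift_map ^^ n) (\<pi> x)"
  using X.Z_shift[of x n] pi_nth by (auto simp: fun_eq_iff shift_map_power)

lemma map_initial_word: "x \<in> X \<Longrightarrow> map \<theta> (initial_word n x) = initial_word n (\<pi> x)"
  by (auto simp: initial_word_def pi_nth)

lemma continuous_pi: "continuous_on X \<pi>" using factor by (auto simp: factor_map_def)

definition lifts :: "nat list \<Rightarrow> nat list set" where
  "lifts v = {u \<in> words X (length v). map \<theta> u = v}"

definition fibre_sum :: "((nat \<Rightarrow> nat) \<Rightarrow> real) \<Rightarrow> nat list \<Rightarrow> real" where
  "fibre_sum F v = (\<Sum>u\<in>lifts v. X.weight F u)"

lemma finite_lifts [simp]: "finite (lifts v)" by (simp add: lifts_def)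

lemma lifts_initial_word: "lifts (initial_word n y) = words_over X \<theta> n y"
  by (auto simp: lifts_def words_over_def)

lemma lifts_nonempty: assumes "v \<in> words Y n" obtains u where "u \<in> lifts v"
proof -
  obtain y where "y \<in> Y" "v = initial_word n y" using assms Y.words_eq by auto
  then obtain x where "x \<in> X" "\<pi> x = y" using pi_surj by blast
  then have "initial_word n x \<in> lifts v"
    using map_initial_word[of x n] \<open>v = _\<close> by (auto simp: lifts_def X.words_eq)
  then show ?thesis using that by blast
qed

lemma fibre_sum_nonneg: "continuous_on X F \<Longrightarrow> fibre_sum F v \<ge> 0"
  unfolding fibre_sum_def using X.weight_pos by (intro sum_nonneg) (auto simp: lifts_def less_imp_le)

lemma fibre_sum_bounds:
  assumes F: "continuous_on X F"
  obtains D where "D \<ge> 1" "\<And>v. fibre_sum F v \<le> D ^ length v"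
    "\<And>n v. v \<in> words Y n \<Longrightarrow> (1 / D) ^ n \<le> fibre_sum F v"
    "\<And>n y. y \<in> Y \<Longrightarrow> \<bar>ln (fibre_sum F (initial_word n y))\<bar> \<le> ln D * real n"
proof -
  obtain K where K: "K \<ge> 0" "\<And>x. x \<in> X \<Longrightarrow> \<bar>F x\<bar> \<le> K" using X.continuous_bounded[OF F] by metis
  define D where "D = real X.alphabet_bound * exp K"
  have D1: "D \<ge> 1" unfolding D_def using X.alphabet_bound(1) K(1)
    by (metis mult_mono mult_1 of_nat_1 of_nat_mono one_le_exp_iff zero_le_one of_nat_0_le_iff)
  have up: "fibre_sum F v \<le> D ^ length v" for v
  proof -
    have "fibre_sum F v \<le> (\<Sum>u\<in>lifts v. exp (K * real (length v)))"
      unfolding fibre_sum_def by (intro sum_mono X.weight_bounds(2)[OF F _ K(2)]) (auto simp: lifts_def)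
    also have "\<dots> \<le> real (X.alphabet_bound ^ length v) * exp (K * real (length v))"
      using order_trans[OF card_mono[OF X.finite_words] X.card_words, of "lifts v" "length v"]
      by (simp add: lifts_def flip: of_nat_power)
    also have "\<dots> = D ^ length v" unfolding D_def
      by (simp add: power_mult_distrib exp_of_nat_mult[symmetric] mult.commute)
    finally show ?thesis .
  qed
  have lo: "(1 / D) ^ n \<le> fibre_sum F v" if v: "v \<in> words Y n" for v n
  proof -
    obtain u where u: "u \<in> lifts v" using lifts_nonempty[OF v] by blast
    have len: "length v = n" using v by (auto simp: Y.words_eq)
    have "1 / D \<le> exp (- K)"
      unfolding D_def exp_minus using X.alphabet_bound(1) by (simp add: field_simps)
    then have "(1 / D) ^ n \<le> exp (- K) ^ n" using D1 by (intro power_mono) auto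
    also have "\<dots> = exp (- (K * real n))" by (simp add: exp_of_nat_mult[symmetric] mult.commute)
    also have "\<dots> \<le> X.weight F u"
      using X.weight_bounds(1)[OF F _ K(2)] u by (auto simp: lifts_def len)
    also have "\<dots> \<le> fibre_sum F v"
      unfolding fibre_sum_def using u X.weight_pos[OF F] by (intro member_le_sum) (auto simp: lifts_def less_imp_le)
    finally show ?thesis .
  qed
  have "\<bar>ln (fibre_sum F (initial_word n y))\<bar> \<le> ln D * real n" if "y \<in> Y" for n y
  proof -
    have l: "(1 / D) ^ n \<le> fibre_sum F (initial_word n y)" using lo[of "initial_word n y" n] that by (auto simp: Y.words_eq)
    moreover have p: "(1 / D) ^ n > 0" using D1 by simp
    ultimately have pos: "fibre_sum F (initial_word n y) > 0" by linarith
    have "ln ((1 / D) ^ n) \<le> ln (fibre_sum F (initial_word n y))" using l p pos by simp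
    moreover have "ln (fibre_sum F (initial_word n y)) \<le> ln (D ^ n)"
      using up[of "initial_word n y"] pos D1 by simp
    ultimately show ?thesis using D1 by (simp add: ln_realpow ln_div mult.commute)
  qed
  then show ?thesis using that[of D] D1 up lo by blast
qed

lemma fibre_sum_pos:
  assumes "continuous_on X F" "v \<in> words Y n" shows "fibre_sum F v > 0"
proof -
  obtain D where "D \<ge> 1" "(1 / D) ^ n \<le> fibre_sum F v" using fibre_sum_bounds[OF assms(1)] assms(2) by metis
  moreover have "(1 / D) ^ n > 0" using \<open>D \<ge> 1\<close> by simp
  ultimately show ?thesis by linarith
qed

lemma fibre_sum_pos': "continuous_on X F \<Longrightarrow> y \<in> Y \<Longrightarrow> fibre_sum F (initial_word n y) > 0"
  using fibre_sum_pos[of F _ n] by (auto simp: Y.words_eq)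

text \<open>Both parts of a lift are lifts of the parts, but lifts of the parts need not fit
  together.\<close>
lemma fibre_sum_append:
  assumes F: "continuous_on X F" shows "fibre_sum F (v @ w) \<le> fibre_sum F v * fibre_sum F w"
  unfolding fibre_sum_def
proof (rule sum_split_words_le)
  show "0 \<le> X.weight F u" if "u \<in> lifts v" for u using that X.weight_nonneg[OF F] by (auto simp: lifts_def)
  show "0 \<le> X.weight F u" if "u \<in> lifts w" for u using that X.weight_nonneg[OF F] by (auto simp: lifts_def)
  fix u assume u: "u \<in> lifts (v @ w)"
  let ?n = "length v" and ?m = "length w"
  have m: "map \<theta> u = v @ w" and "u \<in> words X (?n + ?m)" using u by (auto simp: lifts_def)
  then have "take ?n u @ drop ?n u \<in> words X (?n + ?m)" "length (take ?n u) = ?n"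
    by (auto simp: X.words_eq)
  note X.weight_append[OF F this]
  moreover have "map \<theta> (take ?n u) = v" "map \<theta> (drop ?n u) = w"
    using m by (auto simp: take_map[symmetric] drop_map[symmetric])
  ultimately show "take ?n u \<in> lifts v \<and> drop ?n u \<in> lifts w \<and> X.weight F u \<le> X.weight F (take ?n u) * X.weight F (drop ?n u)"
    by (auto simp: lifts_def)
qed simp_all

lemma fibre_sum_initial_word_add:
  assumes F: "continuous_on X F"
  shows "fibre_sum F (initial_word (n + m) y) \<le> fibre_sum F (initial_word n y) * fibre_sum F (initial_word m ((shift_map ^^ n) y))"
  unfolding initial_word_add by (rule fibre_sum_append[OF F])

lemma fibre_sum_periodic_power:
  assumes F: "continuous_on X F" and z: "(shift_map ^^ p) z = z"
  shows "fibre_sum F (initial_word (k * p) z) \<le> fibre_sum F (initial_word p z) ^ k"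
proof (induction k)
  case 0
  have "fibre_sum F [] \<le> 1" using fibre_sum_bounds[OF F] by (metis list.size(3) power_0)
  then show ?case by simp
next
  case (Suc k)
  have "fibre_sum F (initial_word (p + k * p) z) \<le> fibre_sum F (initial_word p z) * fibre_sum F (initial_word (k * p) z)"
    using fibre_sum_initial_word_add[OF F, of p "k * p" z] z by simp
  also have "\<dots> \<le> fibre_sum F (initial_word p z) * fibre_sum F (initial_word p z) ^ k"
    using Suc fibre_sum_nonneg[OF F] by (intro mult_left_mono)
  finally show ?case by simp
qed

text \<open>Submultiplicativity along the multiples of the period; the incomplete last period
  costs a bounded factor.\<close>
lemma growth_periodic_le:
  assumes F: "continuous_on X F" and z: "z \<in> Y" "(shift_map ^^ p) z = z" "p \<ge> 1"
  shows "growth (\<lambda>n. ln (fibre_sum F (initial_word n z))) \<le> ereal (ln (fibre_sum F (initial_word p z)) / real p)"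
proof (rule growth_leI)
  fix \<epsilon> :: real assume e: "\<epsilon> > 0"
  obtain D where D: "D \<ge> 1" "\<And>v. fibre_sum F v \<le> D ^ length v" using fibre_sum_bounds[OF F] by metis
  define A where "A = ln (fibre_sum F (initial_word p z))"
  have "ln (fibre_sum F (initial_word m z)) \<le> (A / real p + \<epsilon>) * real m + (\<bar>A\<bar> + ln D * real p)" for m
  proof -
    define k s where "k = m div p" and "s = m mod p"
    have m: "m = k * p + s" and s: "s < p" using z(3) by (auto simp: k_def s_def)
    have "fibre_sum F (initial_word m z) \<le> fibre_sum F (initial_word (k * p) z) * fibre_sum F (initial_word s z)"
      using fibre_sum_initial_word_add[OF F, of "k * p" s z] shift_periodic[OF z(2)] by (simp add: m)
    also have "\<dots> \<le> fibre_sum F (initial_word p z) ^ k * D ^ s"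
      using fibre_sum_periodic_power[OF F z(2)] D(2)[of "initial_word s z"] fibre_sum_nonneg[OF F]
      by (intro mult_mono) auto
    finally have "ln (fibre_sum F (initial_word m z)) \<le> ln (fibre_sum F (initial_word p z) ^ k * D ^ s)"
      using fibre_sum_pos'[OF F z(1)] D(1) by (subst ln_le_cancel_iff) auto
    also have "\<dots> = real k * A + real s * ln D"
      using fibre_sum_pos'[OF F z(1), of p] D(1) by (simp add: ln_mult ln_realpow A_def)
    finally have 1: "ln (fibre_sum F (initial_word m z)) \<le> real k * A + real s * ln D" .
    have 2: "real s * ln D \<le> real p * ln D" using s D(1) by (intro mult_right_mono) auto
    have 3: "real k * A = (A / real p) * real m - A * (real s / real p)"
      using z(3) by (simp add: m field_simps)
    have "\<bar>A * (real s / real p)\<bar> \<le> \<bar>A\<bar> * 1"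
      unfolding abs_mult using s by (intro mult_left_mono) auto
    with 1 2 3 have "ln (fibre_sum F (initial_word m z)) \<le> (A / real p) * real m + \<bar>A\<bar> + real p * ln D" by linarith
    moreover have "\<epsilon> * real m \<ge> 0" using e by simp
    ultimately show ?thesis by (simp add: algebra_simps)
  qed
  then show "\<exists>C. \<forall>n. ln (fibre_sum F (initial_word n z)) \<le> (ln (fibre_sum F (initial_word p z)) / real p + \<epsilon>) * real n + C"
    unfolding A_def by blast
qed

text \<open>Each word of \<open>Y\<close> is closed up to a periodic point, whose fibre sums bound those over
  the word. For a lower bound one lift of the word suffices, by submultiplicativity along the
  periodic point; for an upper bound a fixed proportion of the lifts, counted by weight, must be
  concatenated freely.\<close>
lemma fibre_sum_lower_if_periodic:
  assumes F: "continuous_on X F"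
    and per: "\<And>z. z \<in> Y \<Longrightarrow> periodic_point z \<Longrightarrow> growth (\<lambda>n. ln (fibre_sum F (initial_word n z))) = 0"
  obtains C where "\<And>n y. y \<in> Y \<Longrightarrow> - C \<le> ln (fibre_sum F (initial_word n y))"
proof -
  obtain D where D: "D \<ge> 1" "\<And>v. fibre_sum F v \<le> D ^ length v" using fibre_sum_bounds[OF F] by metis
  define M where "M = max_gap"
  have "- (ln D * real M) \<le> ln (fibre_sum F (initial_word n y))" if y: "y \<in> Y" for n y
  proof (cases "n = 0")
    case True
    have "fibre_sum F [] \<ge> 1" using fibre_sum_bounds[OF F] y
      by (metis (no_types, lifting) Y.words_eq image_eqI initial_word_0 power_0)
    then show ?thesis using True D(1) by (simp add: order_trans[of _ 0])
  next
    case False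
    then have n: "n \<ge> 1" by simp
    obtain x where x: "x \<in> X" "\<pi> x = y" using pi_surj y by blast
    have xU: "{initial_word n x} \<subseteq> words X n" using x(1) by (auto simp: X.words_eq)
    \<comment> \<open>With constant weights the lemma cannot discard the only word of the family.\<close>
    obtain a t U' where t: "length t \<le> max_gap" "U' \<subseteq> {initial_word n x}"
      "\<And>u. u \<in> U' \<Longrightarrow> u @ t \<in> returns a (n + length t)"
      "sum (\<lambda>_. 1) {initial_word n x} \<le> real (X.alphabet_bound ^ 2) * sum (\<lambda>_. 1) U'"
      by (rule return_extension[OF n xU, of "\<lambda>_. 1"]) (simp, blast)
    note t = t(1)[folded M_def] t(2-4)
    have "U' \<noteq> {}" using t(4) by auto
    then have r: "initial_word n x @ t \<in> returns a (n + length t)" using t by auto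
    define p where "p = n + length t"
    define x' where "x' = concat_point p (\<lambda>_. initial_word n x @ t)"
    have p: "p \<ge> 1" using n by (simp add: p_def)
    have x': "x' \<in> X" unfolding x'_def by (rule concat_point_in[OF p]) (use r in \<open>simp add: p_def\<close>)
    have ip: "initial_word p x' = initial_word n x @ t"
      unfolding x'_def by (rule initial_word_concat_point) (simp add: p_def)
    then have "initial_word n x' = initial_word n x" using p_def by (simp add: initial_word_add)
    then have zn: "initial_word n (\<pi> x') = initial_word n y"
      using map_initial_word[OF x', of n] map_initial_word[OF x(1), of n] x(2) by simp
    have sx: "(shift_map ^^ p) x' = x'" unfolding x'_def shift_concat_point[OF p] ..
    have sz: "(shift_map ^^ p) (\<pi> x') = \<pi> x'" using pi_shift[OF x', of p] sx by simp
    then have "periodic_point (\<pi> x')" using p unfolding periodic_point_def by blast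
    then have "0 \<le> ereal (ln (fibre_sum F (initial_word p (\<pi> x'))) / real p)"
      using growth_periodic_le[OF F pi_in[OF x'] sz p] per pi_in[OF x'] by simp
    then have "0 \<le> ln (fibre_sum F (initial_word p (\<pi> x')))" using p by (simp add: zero_le_divide_iff)
    also have "\<dots> \<le> ln (fibre_sum F (initial_word n y) * D ^ M)"
    proof (subst ln_le_cancel_iff)
      have "fibre_sum F (initial_word p (\<pi> x')) \<le> fibre_sum F (initial_word n y) * fibre_sum F (initial_word (length t) ((shift_map ^^ n) (\<pi> x')))"
        using fibre_sum_initial_word_add[OF F, of n "length t" "\<pi> x'"] by (simp add: p_def zn)
      also have "\<dots> \<le> fibre_sum F (initial_word n y) * D ^ M"
        using D(2)[of "initial_word (length t) ((shift_map ^^ n) (\<pi> x'))"] power_increasing[OF t(1) D(1)] fibre_sum_nonneg[OF F]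
        by (intro mult_left_mono) auto
      finally show "fibre_sum F (initial_word p (\<pi> x')) \<le> fibre_sum F (initial_word n y) * D ^ M" .
    qed (use fibre_sum_pos'[OF F] pi_in[OF x'] y D in auto)
    also have "\<dots> = ln (fibre_sum F (initial_word n y)) + real M * ln D"
      using fibre_sum_pos'[OF F y, of n] D(1) by (simp add: ln_mult ln_realpow)
    finally show ?thesis by (simp add: mult.commute)
  qed
  then show ?thesis using that by blast
qed

lemma fibre_sum_upper_if_periodic:
  assumes F: "continuous_on X F"
    and per: "\<And>z. z \<in> Y \<Longrightarrow> periodic_point z \<Longrightarrow> growth (\<lambda>n. ln (fibre_sum F (initial_word n z))) = 0"
    and e: "\<epsilon> > 0"
  obtains C where "\<And>n y. y \<in> Y \<Longrightarrow> ln (fibre_sum F (initial_word n y)) \<le> \<epsilon> * real n + C"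
proof -
  obtain D where D: "D \<ge> 1" "\<And>v. fibre_sum F v \<le> D ^ length v" using fibre_sum_bounds[OF F] by metis
  define M where "M = max_gap"
  obtain C where C: "C \<ge> 0" "\<And>n x y. x \<in> X \<Longrightarrow> y \<in> X \<Longrightarrow> initial_word n x = initial_word n y \<Longrightarrow>
     \<bar>birkhoff_sum F n x - birkhoff_sum F n y\<bar> \<le> \<epsilon> * real n + C"
    using X.bounded_distortion[OF F e] by metis
  obtain K where K: "K \<ge> 0" "\<And>x. x \<in> X \<Longrightarrow> \<bar>F x\<bar> \<le> K" using X.continuous_bounded[OF F] by metis
  define N where "N = real (X.alphabet_bound ^ 2)"
  have N: "N \<ge> 1" using X.alphabet_bound(1) by (simp add: N_def)
  have "ln (fibre_sum F (initial_word n y)) \<le> \<epsilon> * real n + (C + K * real M + ln N)" if y: "y \<in> Y" for n y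
  proof (cases "n = 0")
    case True
    have "ln (fibre_sum F []) \<le> 0" using D(2)[of "[]"] fibre_sum_pos'[OF F y, of 0] by simp
    then show ?thesis using True C(1) K(1) N by (simp add: order_trans[of _ 0])
  next
    case False
    then have n: "n \<ge> 1" by simp
    let ?v = "initial_word n y"
    have lU: "lifts ?v \<subseteq> words X n" by (auto simp: lifts_def)
    have lpos: "X.weight F u \<ge> 0" if "u \<in> lifts ?v" for u
      using X.weight_nonneg[OF F, of u n] that by (auto simp: lifts_def)
    obtain a t U' where t: "length t \<le> max_gap" "U' \<subseteq> lifts ?v"
      "\<And>u. u \<in> U' \<Longrightarrow> u @ t \<in> returns a (n + length t)"
      "sum (X.weight F) (lifts ?v) \<le> real (X.alphabet_bound ^ 2) * sum (X.weight F) U'"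
      by (rule return_extension[OF n lU lpos]) (assumption, blast)
    note t = t(1)[folded M_def] t(2,3) t(4)[folded N_def fibre_sum_def]
    have finU: "finite U'" using t(2) finite_subset finite_lifts by blast
    have "U' \<noteq> {}" using t(4) fibre_sum_pos'[OF F y, of n] by auto
    then obtain u0 where u0: "u0 \<in> U'" by blast
    define p where "p = n + length t"
    have p: "p \<ge> 1" using n by (simp add: p_def)
    \<comment> \<open>The first \<open>k\<close> blocks are chosen freely, all others are the same.\<close>
    define B where "B b k q = (if q < k then b q else u0) @ t" for b :: "nat \<Rightarrow> nat list" and k q :: nat
    \<comment> \<open>The cost of the added word \<open>t\<close> and of the choice of a point in the cylinder.\<close>
    define E where "E = \<epsilon> * real n + C + K * real (length t)"
    have lenU: "length u = n" "map \<theta> u = ?v" if "u \<in> U'" for u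
      using that t(2) by (auto simp: lifts_def X.words_eq)
    define z where "z = \<pi> (concat_point p (\<lambda>_. u0 @ t))"
    define x where "x b k = concat_point p (B b k)" for b k
    have Bin: "B b k q \<in> returns a p" if "b \<in> {..<k} \<rightarrow>\<^sub>E U'" for b k q
      unfolding B_def p_def using that u0 t(3) by (auto simp: PiE_iff)
    have xin: "x b k \<in> X" if "b \<in> {..<k} \<rightarrow>\<^sub>E U'" for b k
      unfolding x_def using concat_point_in[OF p Bin[OF that]] .
    have x0: "concat_point p (\<lambda>_. u0 @ t) \<in> X"
      using concat_point_in[OF p, of "\<lambda>_. u0 @ t"] t(3)[OF u0] by (simp add: p_def)
    have px: "\<pi> (x b k) = z" if b: "b \<in> {..<k} \<rightarrow>\<^sub>E U'" for b k
    proof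
      fix i
      have s: "i mod p < p" using p by simp
      have "\<theta> (B b k (i div p) ! (i mod p)) = map \<theta> (B b k (i div p)) ! (i mod p)"
        using length_returns[OF Bin[OF b]] s by simp
      also have "map \<theta> (B b k (i div p)) = map \<theta> (u0 @ t)"
        using lenU(2) u0 b by (auto simp: B_def PiE_iff)
      also have "\<dots> ! (i mod p) = \<theta> ((u0 @ t) ! (i mod p))"
        using lenU(1)[OF u0] s by (subst nth_map) (auto simp: p_def)
      finally have "\<theta> (x b k i) = \<theta> (concat_point p (\<lambda>_. u0 @ t) i)"
        by (simp add: x_def concat_point_def)
      then show "\<pi> (x b k) i = z i"
        unfolding z_def pi_nth[OF xin[OF b]] pi_nth[OF x0] .
    qed
    have sz: "(shift_map ^^ p) z = z"
      unfolding z_def pi_shift[OF x0, symmetric] shift_concat_point[OF p] ..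
    have zY: "z \<in> Y" unfolding z_def using pi_in[OF x0] .
    have "periodic_point z" using sz p unfolding periodic_point_def by blast
    then have g0: "growth (\<lambda>n. ln (fibre_sum F (initial_word n z))) = 0" using per zY by blast
    define S where "S = (\<Sum>u\<in>U'. exp (- E) * X.weight F u)"
    have Spos: "S > 0" unfolding S_def using finU \<open>U' \<noteq> {}\<close> X.weight_pos[OF F] t(2)
      by (intro sum_pos) (auto simp: lifts_def)
    have block: "exp (- E) * X.weight F u \<le> exp (birkhoff_sum F p x)"
      if x: "x \<in> X" "initial_word p x = u @ t" and u: "u \<in> U'" for x u
    proof -
      have uw: "u \<in> words X n" using u t(2) by (auto simp: lifts_def)
      have iu: "initial_word n x = u" using x(2) lenU(1)[OF u] by (simp add: p_def initial_word_add)
      obtain x1 where x1: "x1 \<in> X" "initial_word n x1 = u" "X.weight F u = exp (birkhoff_sum F n x1)"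
        using X.weight_attained[OF F uw] by metis
      have "birkhoff_sum F n x1 \<le> birkhoff_sum F n x + \<epsilon> * real n + C"
        using C(2)[OF x1(1) x(1), of n] iu x1(2) by auto
      moreover have "\<bar>birkhoff_sum F (length t) ((shift_map ^^ n) x)\<bar> \<le> K * real (length t)"
        using X.birkhoff_sum_bound[of F K] K X.Z_shift[OF x(1)] by blast
      ultimately have "- E + birkhoff_sum F n x1 \<le> birkhoff_sum F p x"
        unfolding p_def birkhoff_sum_add E_def by linarith
      then show ?thesis unfolding x1(3) by (simp add: exp_add[symmetric])
    qed
    \<comment> \<open>All concatenations of \<open>k\<close> blocks lie over the initial word of one periodic point,
      so that the growth rate \<open>0\<close> there forces \<open>S \<le> 1\<close>.\<close>
    have "S ^ k \<le> fibre_sum F (initial_word (k * p) z)" for k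
    proof -
      let ?P = "{..<k} \<rightarrow>\<^sub>E U'"
      let ?w = "\<lambda>b. initial_word (k * p) (x b k)"
      have blk: "initial_word p ((shift_map ^^ (q * p)) (x b k)) = b q @ t" if "b \<in> ?P" "q < k" for b q
        unfolding x_def shift_concat_point_mult[OF p]
        using that length_returns[OF Bin[OF that(1), of q]]
        by (subst initial_word_concat_point) (auto simp: B_def)
      have inj: "inj_on ?w ?P"
      proof (rule inj_onI)
        fix b b' assume b: "b \<in> ?P" "b' \<in> ?P" and eq: "?w b = ?w b'"
        show "b = b'"
        proof (rule PiE_ext[OF b])
          fix q assume "q \<in> {..<k}"
          then have q: "q < k" by simp
          then have "q * p + p \<le> k * p" by (metis Suc_leI add.commute mult_Suc mult_le_mono1)
          then have "initial_word p ((shift_map ^^ (q * p)) (x b k)) = initial_word p ((shift_map ^^ (q * p)) (x b' k))"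
            using eq by (auto simp: initial_word_eq_iff shift_map_power)
          then show "b q = b' q" using blk b q by simp
        qed
      qed
      have "S ^ k = (\<Prod>q<k. \<Sum>u\<in>U'. exp (- E) * X.weight F u)" by (simp add: S_def)
      also have "\<dots> = (\<Sum>b\<in>?P. \<Prod>q<k. exp (- E) * X.weight F (b q))"
        by (rule prod_sum_PiE) (use finU in auto)
      also have "\<dots> \<le> (\<Sum>b\<in>?P. X.weight F (?w b))"
      proof (rule sum_mono)
        fix b assume b: "b \<in> ?P"
        have w0: "0 \<le> exp (- E) * X.weight F u" if "u \<in> U'" for u
          using X.weight_pos[OF F] t(2) that by (fastforce simp: lifts_def intro: less_imp_le)
        have "(\<Prod>q<k. exp (- E) * X.weight F (b q)) \<le> (\<Prod>q<k. exp (birkhoff_sum F p ((shift_map ^^ (q * p)) (x b k))))"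
          using b blk[OF b] X.Z_shift[OF xin[OF b]]
          by (intro prod_mono conjI block w0) (auto simp: PiE_iff)
        also have "\<dots> = exp (birkhoff_sum F (k * p) (x b k))"
          unfolding birkhoff_sum_blocks by (simp add: exp_sum)
        also have "\<dots> \<le> X.weight F (?w b)" by (rule X.weight_upper[OF F xin[OF b]])
        finally show "(\<Prod>q<k. exp (- E) * X.weight F (b q)) \<le> X.weight F (?w b)" .
      qed
      also have "\<dots> = (\<Sum>u\<in>?w ` ?P. X.weight F u)" by (simp add: sum.reindex[OF inj])
      also have "\<dots> \<le> fibre_sum F (initial_word (k * p) z)"
        unfolding fibre_sum_def
      proof (rule sum_mono2)
        show "?w ` ?P \<subseteq> lifts (initial_word (k * p) z)"
          using xin px map_initial_word by (auto simp: lifts_def X.words_eq)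
      qed (use X.weight_pos[OF F] in \<open>auto simp: lifts_def less_imp_le\<close>)
      finally show ?thesis .
    qed
    then have "real k * ln S - 0 \<le> ln (fibre_sum F (initial_word (k * p) z))" for k
      using Spos fibre_sum_pos'[OF F zY, of "k * p"] by (simp flip: ln_realpow)
    from growth_ge_multiples[OF this p] have "ln S / real p \<le> 0" unfolding g0 by simp
    then have "ln S \<le> 0" using p by (simp add: divide_le_0_iff)
    then have "S \<le> 1" using Spos by simp
    then have "sum (X.weight F) U' \<le> exp E"
      unfolding S_def sum_distrib_left[symmetric] by (simp add: exp_minus field_simps)
    then have "fibre_sum F ?v \<le> N * exp E" using t(4) N by (meson mult_left_mono order_trans zero_le_one)
    then have "ln (fibre_sum F ?v) \<le> ln (N * exp E)" using fibre_sum_pos'[OF F y, of n] N by simp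
    also have "\<dots> = ln N + E" using N by (simp add: ln_mult)
    also have "E \<le> \<epsilon> * real n + C + K * real M" unfolding E_def using t(1) K(1) by (simp add: mult_left_mono)
    finally show ?thesis by linarith
  qed
  then show ?thesis using that by blast
qed

lemma unif_sublinear_if_periodic:
  assumes F: "continuous_on X F"
    and per: "\<And>z. z \<in> Y \<Longrightarrow> periodic_point z \<Longrightarrow> growth (\<lambda>n. ln (fibre_sum F (initial_word n z))) = 0"
  shows "unif_sublinear Y (\<lambda>n y. ln (fibre_sum F (initial_word n y)))"
  unfolding unif_sublinear_def
proof (intro allI impI)
  fix \<epsilon> :: real assume e: "\<epsilon> > 0"
  obtain C where C: "\<And>n y. y \<in> Y \<Longrightarrow> - C \<le> ln (fibre_sum F (initial_word n y))"
    using fibre_sum_lower_if_periodic[OF F per] by metis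
  obtain C' where C': "\<And>n y. y \<in> Y \<Longrightarrow> ln (fibre_sum F (initial_word n y)) \<le> \<epsilon> * real n + C'"
    using fibre_sum_upper_if_periodic[OF F per e] by metis
  have "\<bar>ln (fibre_sum F (initial_word n y))\<bar> \<le> \<epsilon> * real n + max C C'" if "y \<in> Y" for n y
    using C[OF that, of n] C'[OF that, of n] mult_nonneg_nonneg[of \<epsilon> "real n"] e by linarith
  then show "\<exists>C. \<forall>n. \<forall>y\<in>Y. \<bar>ln (fibre_sum F (initial_word n y))\<bar> \<le> \<epsilon> * real n + C" by blast
qed

end

section \<open>Relative pressure at a point\<close>

context factor_code
begin

text \<open>The best choice of points takes a maximum point in each cylinder.\<close>
lemma g_fun_eq_fibre_sum:
  assumes F: "continuous_on X F"
  shows "g_fun X \<theta> F n y = fibre_sum F (initial_word n y)"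
proof -
  define W where "W = words_over X \<theta> n y"
  have W: "W \<subseteq> words X n" "finite W" by (auto simp: W_def words_over_def)
  have lenW: "u \<in> W \<Longrightarrow> length u = n" for u using W by (auto simp: X.words_eq)
  have "\<exists>x. x \<in> X \<and> initial_word n x = u \<and> X.weight F u = exp (birkhoff_sum F n x)" if "u \<in> W" for u
    using X.weight_attained[OF F] W(1) that by (metis subsetD)
  then obtain m where m: "\<And>u. u \<in> W \<Longrightarrow> m u \<in> X \<and> initial_word n (m u) = u \<and> X.weight F u = exp (birkhoff_sum F n (m u))"
    by metis
  have injm: "inj_on m W" by (rule inj_onI) (metis m)
  have fs: "fibre_sum F (initial_word n y) = sum (X.weight F) W"
    unfolding fibre_sum_def lifts_initial_word W_def ..
  have ch: "cylinder_choices X \<theta> n y = {E. E \<subseteq> (\<Union>u\<in>W. cyl X u) \<and> (\<forall>u\<in>W. \<exists>!x. x \<in> E \<inter> cyl X u)}"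
    unfolding cylinder_choices_def W_def ..
  have inc: "m ` W \<in> cylinder_choices X \<theta> n y"
    unfolding ch
  proof (intro CollectI conjI ballI)
    show "m ` W \<subseteq> (\<Union>u\<in>W. cyl X u)" using m lenW by (auto simp: cyl_def)
    fix u assume u: "u \<in> W"
    show "\<exists>!x. x \<in> m ` W \<inter> cyl X u"
    proof (rule ex1I[of _ "m u"])
      show "m u \<in> m ` W \<inter> cyl X u" using u m lenW by (auto simp: cyl_def)
      fix x assume "x \<in> m ` W \<inter> cyl X u"
      then show "x = m u" using m lenW u by (auto simp: cyl_def)
    qed
  qed
  have val: "(\<Sum>x\<in>m ` W. exp (birkhoff_sum F n x)) = sum (X.weight F) W"
    using m by (subst sum.reindex[OF injm]) (auto intro!: sum.cong)
  have up: "(\<Sum>x\<in>E. exp (birkhoff_sum F n x)) \<le> sum (X.weight F) W" if E: "E \<in> cylinder_choices X \<theta> n y" for E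
  proof -
    have E1: "x \<in> X" "initial_word n x \<in> W" "x \<in> cyl X (initial_word n x)" if "x \<in> E" for x
      using E lenW that unfolding ch by (auto simp: cyl_def)
    have inj: "inj_on (initial_word n) E"
    proof (rule inj_onI)
      fix x x' assume a: "x \<in> E" "x' \<in> E" "initial_word n x = initial_word n x'"
      have "\<exists>!z. z \<in> E \<inter> cyl X (initial_word n x)" using E E1[OF a(1)] unfolding ch by blast
      then show "x = x'" using E1[OF a(1)] E1[OF a(2)] a by (metis IntI)
    qed
    have "(\<Sum>x\<in>E. exp (birkhoff_sum F n x)) \<le> (\<Sum>x\<in>E. X.weight F (initial_word n x))"
      using E1 by (intro sum_mono X.weight_upper[OF F])
    also have "\<dots> = sum (X.weight F) (initial_word n ` E)" by (simp add: sum.reindex[OF inj])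
    also have "\<dots> \<le> sum (X.weight F) W"
      using E1 W X.weight_pos[OF F] by (intro sum_mono2) (auto simp: less_imp_le subset_eq)
    finally show ?thesis .
  qed
  show ?thesis unfolding fs g_fun_def
    by (rule cSup_eq_maximum) (use inc val up in \<open>auto intro!: image_eqI[of _ _ "m ` W"]\<close>)
qed

definition fibre_words :: "nat \<Rightarrow> (nat \<Rightarrow> nat) \<Rightarrow> nat list set" where
  "fibre_words n y = initial_word n ` {x \<in> X. \<pi> x = y}"

text \<open>The sum over the words read off points of the fibre; \<^const>\<open>fibre_sum\<close> takes in every
  word that lies over an initial word of \<open>y\<close>, whether or not it extends to a point over \<open>y\<close>.\<close>
definition point_sum :: "((nat \<Rightarrow> nat) \<Rightarrow> real) \<Rightarrow> nat \<Rightarrow> (nat \<Rightarrow> nat) \<Rightarrow> real" where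
  "point_sum F n y = (\<Sum>u\<in>fibre_words n y. X.weight F u)"

lemma fibre_words_subset: "fibre_words n y \<subseteq> lifts (initial_word n y)"
  using map_initial_word by (auto simp: fibre_words_def lifts_def X.words_eq)

lemma fibre_words_words: "u \<in> fibre_words n y \<Longrightarrow> u \<in> words X n"
  by (auto simp: fibre_words_def X.words_eq)

lemma finite_fibre_words [simp]: "finite (fibre_words n y)"
  using finite_subset[OF fibre_words_subset] by simp

lemma point_sum_le_fibre_sum:
  assumes "continuous_on X F" shows "point_sum F n y \<le> fibre_sum F (initial_word n y)"
  unfolding point_sum_def fibre_sum_def
  using X.weight_pos[OF assms] by (intro sum_mono2 fibre_words_subset) (auto simp: lifts_def less_imp_le)

lemma point_sum_bounds:
  assumes F: "continuous_on X F"
  obtains D where "D \<ge> 1" "\<And>n y. y \<in> Y \<Longrightarrow> \<bar>ln (point_sum F n y)\<bar> \<le> ln D * real n"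
     "\<And>n y. y \<in> Y \<Longrightarrow> 0 < point_sum F n y"
proof -
  obtain D where D: "D \<ge> 1" "\<And>v. fibre_sum F v \<le> D ^ length v" using fibre_sum_bounds[OF F] by metis
  obtain K where K: "K \<ge> 0" "\<And>x. x \<in> X \<Longrightarrow> \<bar>F x\<bar> \<le> K" using X.continuous_bounded[OF F] by metis
  have lo: "exp (- (K * real n)) \<le> point_sum F n y" if y: "y \<in> Y" for n y
  proof -
    obtain x where x: "x \<in> X" "\<pi> x = y" using pi_surj y by blast
    have "exp (- (K * real n)) \<le> X.weight F (initial_word n x)"
      by (rule X.weight_bounds(1)[OF F _ K(2)]) (use x in \<open>auto simp: X.words_eq\<close>)
    also have "\<dots> \<le> point_sum F n y" unfolding point_sum_def
    proof (rule member_le_sum)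
      show "initial_word n x \<in> fibre_words n y" using x by (auto simp: fibre_words_def)
    qed (use X.weight_pos[OF F fibre_words_words] in \<open>auto simp: less_imp_le\<close>)
    finally show ?thesis .
  qed
  have pos: "0 < point_sum F n y" if y: "y \<in> Y" for n y
    using lo[OF y, of n] by (meson exp_gt_zero order_less_le_trans)
  show ?thesis
  proof (rule that[of "max D (exp K)"])
    fix n y assume y: "y \<in> Y"
    have "- (K * real n) \<le> ln (point_sum F n y)" using lo[OF y, of n] pos[OF y, of n] by (simp add: ln_ge_iff)
    moreover have "K * real n \<le> ln (max D (exp K)) * real n"
      using D(1) by (intro mult_right_mono) (auto simp: ln_ge_iff)
    moreover have "ln (point_sum F n y) \<le> ln (D ^ n)"
      using pos[OF y, of n] D(1) point_sum_le_fibre_sum[OF F, of n y] D(2)[of "initial_word n y"]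
      by (subst ln_le_cancel_iff) auto
    moreover have "ln (D ^ n) \<le> ln (max D (exp K)) * real n"
      using D(1) by (simp add: ln_realpow mult.commute mult_left_mono)
    ultimately show "\<bar>ln (point_sum F n y)\<bar> \<le> ln (max D (exp K)) * real n" by linarith
  qed (use D pos in auto)
qed

lemma shift_dist_gt_imp:
  assumes "shift_dist x x' > \<delta>" "(1 / 2) ^ k \<le> \<delta>"
  shows "\<exists>j<k. x j \<noteq> x' j"
proof -
  have "(1 / 2 :: real) ^ k > 0" by simp
  then have "\<delta> > 0" using assms(2) by linarith
  then have ne: "x \<noteq> x'" using assms(1) unfolding shift_dist_def by auto
  then have "\<exists>i. x i \<noteq> x' i" by (simp add: fun_eq_iff)
  then have l: "x (LEAST i. x i \<noteq> x' i) \<noteq> x' (LEAST i. x i \<noteq> x' i)" by (rule LeastI_ex)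
  have "(1 / 2 :: real) ^ (LEAST i. x i \<noteq> x' i) > (1 / 2) ^ k"
    using order_le_less_trans[OF assms(2,1)] ne unfolding shift_dist_def by (simp only: if_False)
  then have "(LEAST i. x i \<noteq> x' i) < k"
    using power_decreasing[of k "LEAST i. x i \<noteq> x' i" "1 / 2 :: real"] by (cases "k \<le> (LEAST i. x i \<noteq> x' i)") auto
  then show ?thesis using l by blast
qed

lemma shift_dist_eq_1: "x 0 \<noteq> x' 0 \<Longrightarrow> shift_dist x x' = 1"
  by (auto simp: shift_dist_def Least_eq_0)

text \<open>Points of the fibre with different initial words of length \<open>n\<close> are separated at
  every scale \<open>\<delta> < 1\<close>, while a separated set has boundedly many points in each cylinder of
  length \<open>n\<close>. So the scale has no influence on the growth rate.\<close>
lemma rel_pressure_delta_eq: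
  assumes F: "continuous_on X F" and y: "y \<in> Y" and d: "0 < \<delta>" "\<delta> < 1"
  shows "rel_pressure_delta X \<pi> F \<delta> y = growth (\<lambda>n. ln (point_sum F n y))"
proof -
  let ?A = "\<lambda>n. {E. E \<subseteq> {x \<in> X. \<pi> x = y} \<and> separated n \<delta> E}"
  let ?s = "\<lambda>n E. \<Sum>x\<in>E. exp (birkhoff_sum F n x)"
  obtain k where k: "(1 / 2) ^ k \<le> \<delta>" using real_arch_pow_inv[OF d(1), of "1/2"] by (auto intro: less_imp_le)
  define N where "N = real (X.alphabet_bound ^ k)"
  have N: "N \<ge> 1" using X.alphabet_bound(1) by (simp add: N_def)
  obtain D where pos: "\<And>n. 0 < point_sum F n y" using point_sum_bounds[OF F] y by metis
  have up: "?s n E \<le> N * point_sum F n y" if E: "E \<in> ?A n" for n E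
  proof -
    have fin: "finite E" using E by (auto simp: separated_def)
    have diff: "initial_word (n + k) x \<noteq> initial_word (n + k) x'" if "x \<in> E" "x' \<in> E" "x \<noteq> x'" for x x'
    proof -
      obtain i where i: "i < n" "shift_dist ((shift_map ^^ i) x) ((shift_map ^^ i) x') > \<delta>"
        using E \<open>x \<in> E\<close> \<open>x' \<in> E\<close> \<open>x \<noteq> x'\<close> unfolding separated_def by blast
      obtain j where "j < k" "x (i + j) \<noteq> x' (i + j)"
        using shift_dist_gt_imp[OF i(2) k] by (auto simp: shift_map_power)
      then show ?thesis using i(1) by (auto simp: initial_word_eq_iff intro!: exI[of _ "i + j"])
    qed
    have im: "initial_word n ` E \<subseteq> fibre_words n y" using E by (auto simp: fibre_words_def)
    have "?s n E = (\<Sum>u\<in>fibre_words n y. \<Sum>x\<in>{x\<in>E. initial_word n x = u}. exp (birkhoff_sum F n x))"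
      by (rule sum.group[symmetric, OF fin _ im]) simp
    also have "\<dots> \<le> (\<Sum>u\<in>fibre_words n y. N * X.weight F u)"
    proof (rule sum_mono)
      fix u assume u: "u \<in> fibre_words n y"
      let ?E = "{x\<in>E. initial_word n x = u}"
      have "inj_on (\<lambda>x. initial_word k ((shift_map ^^ n) x)) ?E"
        by (rule inj_onI) (metis (mono_tags, lifting) diff initial_word_add mem_Collect_eq)
      moreover have "(\<lambda>x. initial_word k ((shift_map ^^ n) x)) ` ?E \<subseteq> words X k"
        using E X.Z_shift by (auto simp: X.words_eq)
      ultimately have "card ?E \<le> X.alphabet_bound ^ k"
        using card_inj_on_le[OF _ _ X.finite_words] X.card_words by (meson order_trans)
      then have c: "real (card ?E) \<le> N" by (simp add: N_def flip: of_nat_power)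
      have "(\<Sum>x\<in>?E. exp (birkhoff_sum F n x)) \<le> (\<Sum>x\<in>?E. X.weight F u)"
        using E X.weight_upper[OF F] by (intro sum_mono) auto
      also have "\<dots> \<le> N * X.weight F u"
        using c X.weight_pos[OF F fibre_words_words[OF u]] by (simp add: mult_right_mono)
      finally show "(\<Sum>x\<in>?E. exp (birkhoff_sum F n x)) \<le> N * X.weight F u" .
    qed
    also have "\<dots> = N * point_sum F n y" by (simp add: point_sum_def sum_distrib_left)
    finally show ?thesis .
  qed
  have bdd: "bdd_above (?s n ` ?A n)" for n using up by (intro bdd_aboveI[of _ "N * point_sum F n y"]) blast
  have "{} \<in> ?A n" for n by (auto simp: separated_def)
  then have up': "rel_pressure_n X \<pi> F n \<delta> y \<le> N * point_sum F n y" for n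
    unfolding rel_pressure_n_def using up by (intro cSUP_least) blast+
  have lo: "exp (- r) * point_sum F n y \<le> rel_pressure_n X \<pi> F n \<delta> y"
    if n: "n \<ge> 1" and r: "\<And>x x'. x \<in> X \<Longrightarrow> x' \<in> X \<Longrightarrow> initial_word n x = initial_word n x' \<Longrightarrow>
       \<bar>birkhoff_sum F n x - birkhoff_sum F n x'\<bar> \<le> r" for n r
  proof -
    have "\<forall>u\<in>fibre_words n y. \<exists>x. x \<in> X \<and> \<pi> x = y \<and> initial_word n x = u" by (auto simp: fibre_words_def)
    then obtain m where m: "\<And>u. u \<in> fibre_words n y \<Longrightarrow> m u \<in> X \<and> \<pi> (m u) = y \<and> initial_word n (m u) = u" by metis
    have inj: "inj_on m (fibre_words n y)" by (rule inj_onI) (metis m)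
    have "separated n \<delta> (m ` fibre_words n y)"
      unfolding separated_def
    proof (intro conjI ballI impI)
      fix x x' assume x: "x \<in> m ` fibre_words n y" "x' \<in> m ` fibre_words n y" "x \<noteq> x'"
      then have "initial_word n x \<noteq> initial_word n x'" using m by auto
      then obtain i where i: "i < n" "x i \<noteq> x' i" by (auto simp: initial_word_eq_iff)
      then have "shift_dist ((shift_map ^^ i) x) ((shift_map ^^ i) x') = 1" by (intro shift_dist_eq_1) (simp add: shift_map_power)
      then show "\<exists>i<n. \<delta> < shift_dist ((shift_map ^^ i) x) ((shift_map ^^ i) x')" using i(1) d(2) by (intro exI[of _ i]) auto
    qed simp
    then have mem: "m ` fibre_words n y \<in> ?A n" using m by auto
    have "exp (- r) * point_sum F n y = (\<Sum>u\<in>fibre_words n y. exp (- r) * X.weight F u)"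
      by (simp add: point_sum_def sum_distrib_left)
    also have "\<dots> \<le> (\<Sum>u\<in>fibre_words n y. exp (birkhoff_sum F n (m u)))"
    proof (rule sum_mono)
      fix u assume u: "u \<in> fibre_words n y"
      obtain x where x: "x \<in> X" "initial_word n x = u" "X.weight F u = exp (birkhoff_sum F n x)"
        using X.weight_attained[OF F fibre_words_words[OF u]] by metis
      have "- r + birkhoff_sum F n x \<le> birkhoff_sum F n (m u)"
        using r[OF x(1), of "m u"] m[OF u] x(2) by auto
      then show "exp (- r) * X.weight F u \<le> exp (birkhoff_sum F n (m u))"
        unfolding x(3) by (simp add: exp_add[symmetric])
    qed
    also have "\<dots> = ?s n (m ` fibre_words n y)" by (simp add: sum.reindex[OF inj])
    also have "\<dots> \<le> rel_pressure_n X \<pi> F n \<delta> y"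
      unfolding rel_pressure_n_def by (rule cSUP_upper[OF mem bdd])
    finally show ?thesis .
  qed
  show ?thesis unfolding rel_pressure_delta_def growth_def[symmetric]
  proof (rule antisym; rule growth_mono_ge1)
    fix \<epsilon> :: real assume e: "\<epsilon> > 0"
    obtain C where C: "C \<ge> 0" "\<And>n x y. x \<in> X \<Longrightarrow> y \<in> X \<Longrightarrow> initial_word n x = initial_word n y \<Longrightarrow>
     \<bar>birkhoff_sum F n x - birkhoff_sum F n y\<bar> \<le> \<epsilon> * real n + C"
      using X.bounded_distortion[OF F e] by metis
    have lo': "exp (- (\<epsilon> * real n + C)) * point_sum F n y \<le> rel_pressure_n X \<pi> F n \<delta> y" if "n \<ge> 1" for n
      using lo[OF that C(2)] .
    have rpos: "0 < rel_pressure_n X \<pi> F n \<delta> y" if "n \<ge> 1" for n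
      using lo'[OF that] pos[of n] by (meson exp_gt_zero mult_pos_pos order_less_le_trans)
    have "ln (point_sum F n y) \<le> ln (rel_pressure_n X \<pi> F n \<delta> y) + \<epsilon> * real n + C" if n: "n \<ge> 1" for n
    proof -
      have "ln (exp (- (\<epsilon> * real n + C)) * point_sum F n y) \<le> ln (rel_pressure_n X \<pi> F n \<delta> y)"
        using lo'[OF n] rpos[OF n] pos[of n] by (subst ln_le_cancel_iff) auto
      then show ?thesis using pos[of n] by (simp add: ln_mult)
    qed
    then show "\<exists>C. \<forall>n\<ge>1. ln (point_sum F n y) \<le> ln (rel_pressure_n X \<pi> F n \<delta> y) + \<epsilon> * real n + C" by blast
    have "ln (rel_pressure_n X \<pi> F n \<delta> y) \<le> ln (point_sum F n y) + \<epsilon> * real n + ln N" if n: "n \<ge> 1" for n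
    proof -
      have "ln (rel_pressure_n X \<pi> F n \<delta> y) \<le> ln (N * point_sum F n y)"
        using up'[of n] rpos[OF n] pos[of n] N by (subst ln_le_cancel_iff) auto
      also have "\<dots> = ln (point_sum F n y) + ln N" using pos[of n] N by (simp add: ln_mult)
      also have "\<dots> \<le> ln (point_sum F n y) + \<epsilon> * real n + ln N" using e by simp
      finally show ?thesis .
    qed
    then show "\<exists>C. \<forall>n\<ge>1. ln (rel_pressure_n X \<pi> F n \<delta> y) \<le> ln (point_sum F n y) + \<epsilon> * real n + C" by blast
  qed
qed

lemma rel_pressure_eq:
  assumes F: "continuous_on X F" and y: "y \<in> Y"
  shows "rel_pressure X \<pi> F y = growth (\<lambda>n. ln (point_sum F n y))"
proof -
  have "eventually (\<lambda>\<delta>. 0 < \<delta> \<and> \<delta> < (1::real)) (at_right 0)"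
    by (auto simp: eventually_at_right_field intro: exI[of _ 1])
  then have "eventually (\<lambda>\<delta>. rel_pressure_delta X \<pi> F \<delta> y = growth (\<lambda>n. ln (point_sum F n y))) (at_right 0)"
    by eventually_elim (simp add: rel_pressure_delta_eq[OF F y])
  then have "((\<lambda>\<delta>. rel_pressure_delta X \<pi> F \<delta> y) \<longlongrightarrow> growth (\<lambda>n. ln (point_sum F n y))) (at_right 0)"
    by (rule tendsto_eventually)
  then show ?thesis unfolding rel_pressure_def by (intro tendsto_Lim) auto
qed

text \<open>The finite intersection property for the closed sets of the points of \<open>K\<close> whose
  image agrees with \<open>y\<close> in the first \<open>n\<close> coordinates.\<close>
lemma compact_image_of_approximations:
  assumes "compact K" "K \<subseteq> X" "\<And>n. \<exists>x\<in>K. initial_word n (\<pi> x) = initial_word n y"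
  shows "y \<in> \<pi> ` K"
proof -
  have "K \<inter> (\<Inter>n\<in>UNIV. {x. map \<theta> (initial_word n x) = initial_word n y}) \<noteq> {}"
  proof (rule compact_imp_fip_image[OF assms(1)])
    fix I :: "nat set" assume I: "finite I"
    obtain x where x: "x \<in> K" "initial_word (Max (insert 0 I)) (\<pi> x) = initial_word (Max (insert 0 I)) y"
      using assms(3) by blast
    have "initial_word i (\<pi> x) = initial_word i y" if "i \<in> I" for i
      using initial_word_eq_mono[OF x(2), of i] I that by simp
    then have "x \<in> K \<inter> (\<Inter>n\<in>I. {x. map \<theta> (initial_word n x) = initial_word n y})"
      using x(1) assms(2) map_initial_word by auto
    then show "K \<inter> (\<Inter>n\<in>I. {x. map \<theta> (initial_word n x) = initial_word n y}) \<noteq> {}" by blast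
  qed (rule closed_word_set)
  then obtain x where x: "x \<in> K" "\<And>n. map \<theta> (initial_word n x) = initial_word n y" by auto
  have "\<pi> x = y"
  proof
    fix i
    have "initial_word (Suc i) (\<pi> x) = initial_word (Suc i) y" using x map_initial_word assms(2) by (metis subsetD)
    then show "\<pi> x i = y i" unfolding initial_word_eq_iff by blast
  qed
  then show ?thesis using x by blast
qed

text \<open>In this form the image is seen to be closed.\<close>
lemma image_cyl_eq:
  "\<pi> ` cyl X u = (\<Inter>n. {y. \<exists>x\<in>cyl X u. initial_word n (\<pi> x) = initial_word n y})"
proof
  show "(\<Inter>n. {y. \<exists>x\<in>cyl X u. initial_word n (\<pi> x) = initial_word n y}) \<subseteq> \<pi> ` cyl X u"
    by (auto intro!: compact_image_of_approximations[OF X.cyl_compact]) (auto simp: cyl_def)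
qed auto

lemma image_cyl_borel [measurable]: "\<pi> ` cyl X u \<in> sets borel"
proof -
  have "closed (\<pi> ` cyl X u)"
    unfolding image_cyl_eq using closed_word_set[of "\<lambda>w. \<exists>x\<in>cyl X u. initial_word _ (\<pi> x) = w"]
    by (intro closed_INT) auto
  then show ?thesis by simp
qed

text \<open>At the points of \<open>settled T\<close> the first \<open>T + 1\<close> coordinates already decide which
  letters begin a point of the fibre. A lift of a word that leads up to such a point can be
  continued to a point of the fibre.\<close>
definition settled :: "nat \<Rightarrow> (nat \<Rightarrow> nat) set" where
  "settled T = {y\<in>Y. \<forall>x\<in>X. initial_word (Suc T) (\<pi> x) = initial_word (Suc T) y \<longrightarrow> (\<exists>x'\<in>X. \<pi> x' = y \<and> x' 0 = x 0)}"

lemma settled_mono: "T \<le> T' \<Longrightarrow> settled T \<subseteq> settled T'"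
  unfolding settled_def using initial_word_eq_mono[of "Suc T'" _ _ "Suc T"] by blast

lemma in_image_cyl1: "y \<in> \<pi> ` cyl X [a] \<longleftrightarrow> (\<exists>x'\<in>X. \<pi> x' = y \<and> x' 0 = a)"
  by (auto simp: cyl_def initial_word_def)

text \<open>By compactness, a letter that begins points over arbitrarily good approximations of
  \<open>y\<close> begins a point over \<open>y\<close>.\<close>
lemma ex_settled:
  assumes y: "y \<in> Y" shows "\<exists>T. y \<in> settled T"
proof -
  have "\<exists>T. (\<exists>x\<in>cyl X [a]. initial_word T (\<pi> x) = initial_word T y) \<longrightarrow> y \<in> \<pi> ` cyl X [a]" for a
    using compact_image_of_approximations[OF X.cyl_compact, of "[a]" y] by (auto simp: cyl_def)
  then obtain T where T: "\<And>a. (\<exists>x\<in>cyl X [a]. initial_word (T a) (\<pi> x) = initial_word (T a) y) \<Longrightarrow> y \<in> \<pi> ` cyl X [a]"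
    by metis
  define T' where "T' = Max (T ` {1..X.alphabet_bound})"
  have "y \<in> settled T'"
    unfolding settled_def
  proof (intro CollectI conjI y ballI impI)
    fix x assume x: "x \<in> X" "initial_word (Suc T') (\<pi> x) = initial_word (Suc T') y"
    have "T (x 0) \<le> T'" unfolding T'_def using X.Z_letter[OF x(1)] by (intro Max_ge) auto
    then have "initial_word (T (x 0)) (\<pi> x) = initial_word (T (x 0)) y"
      using initial_word_eq_mono[OF x(2)] by simp
    then have "y \<in> \<pi> ` cyl X [x 0]" using x(1) by (intro T bexI[of _ x]) (auto simp: cyl_def initial_word_def)
    then show "\<exists>x'\<in>X. \<pi> x' = y \<and> x' 0 = x 0" unfolding in_image_cyl1 .
  qed
  then show ?thesis by blast
qed

text \<open>Apart from the closed set \<open>Y\<close>, a finite intersection of unions of a clopen set with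
  a closed image of a cylinder.\<close>
lemma settled_borel [measurable]: "settled T \<in> sets borel"
proof -
  have "settled T = Y \<inter> (\<Inter>a\<in>{1..X.alphabet_bound}.
     {y. \<not> (\<exists>x\<in>cyl X [a]. initial_word (Suc T) (\<pi> x) = initial_word (Suc T) y)} \<union> \<pi> ` cyl X [a])"
    (is "_ = ?R")
  proof (rule set_eqI)
    fix y
    have c: "x \<in> cyl X [a] \<longleftrightarrow> x \<in> X \<and> x 0 = a" for x a by (auto simp: cyl_def initial_word_def)
    have "y \<in> settled T \<longleftrightarrow> y \<in> Y \<and> (\<forall>a\<in>{1..X.alphabet_bound}.
        (\<exists>x\<in>cyl X [a]. initial_word (Suc T) (\<pi> x) = initial_word (Suc T) y) \<longrightarrow> y \<in> \<pi> ` cyl X [a])"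
      (is "_ \<longleftrightarrow> _ \<and> ?B")
    proof (intro iffI conjI ballI impI)
      fix a assume y: "y \<in> settled T" and "\<exists>x\<in>cyl X [a]. initial_word (Suc T) (\<pi> x) = initial_word (Suc T) y"
      then obtain x where x: "x \<in> cyl X [a]" "initial_word (Suc T) (\<pi> x) = initial_word (Suc T) y" by (elim bexE)
      have "x \<in> X" "x 0 = a" using x(1) c by simp_all
      have "\<exists>x'\<in>X. \<pi> x' = y \<and> x' 0 = x 0"
        using y[unfolded settled_def, THEN CollectD, THEN conjunct2, rule_format, OF \<open>x \<in> X\<close> x(2)] .
      then show "y \<in> \<pi> ` cyl X [a]" unfolding in_image_cyl1 \<open>x 0 = a\<close> .
    next
      assume r: "y \<in> Y \<and> ?B"
      show "y \<in> settled T"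
        unfolding settled_def
      proof (intro CollectI conjI ballI impI)
        fix x assume x: "x \<in> X" "initial_word (Suc T) (\<pi> x) = initial_word (Suc T) y"
        then have "x \<in> cyl X [x 0]" using c by simp
        then have "\<exists>z\<in>cyl X [x 0]. initial_word (Suc T) (\<pi> z) = initial_word (Suc T) y" using x(2) by (intro bexI[where x = x])
        then have "y \<in> \<pi> ` cyl X [x 0]" using conjunct2[OF r, rule_format, OF X.Z_letter[OF x(1), of 0]] by simp
        then show "\<exists>x'\<in>X. \<pi> x' = y \<and> x' 0 = x 0" unfolding in_image_cyl1 .
      qed (use r in simp)
    qed (simp add: settled_def)
    also have "\<dots> \<longleftrightarrow> y \<in> ?R" by blast
    finally show "y \<in> settled T \<longleftrightarrow> y \<in> ?R" .
  qed
  moreover have "closed {y. \<not> (\<exists>x\<in>cyl X [a]. initial_word (Suc T) (\<pi> x) = initial_word (Suc T) y)}" for a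
    by (rule closed_word_set)
  then have "{y. \<not> (\<exists>x\<in>cyl X [a]. initial_word (Suc T) (\<pi> x) = initial_word (Suc T) y)} \<union> \<pi> ` cyl X [a] \<in> sets borel" for a
    by (intro sets.Un image_cyl_borel borel_closed)
  moreover have "{1..X.alphabet_bound} \<noteq> {}" using X.alphabet_bound(1) by simp
  ultimately show ?thesis using borel_closed[OF Y.Z_closed] by (simp only:) (intro sets.Int sets.finite_INT; assumption?; simp)
qed

text \<open>A lift of the longer word, cut off at \<open>n\<close>, is grafted onto a point of the fibre over
  the settled point. The \<open>T + 1\<close> letters that are cut off cost a bounded factor.\<close>
lemma fibre_sum_le_point_sum:
  assumes F: "continuous_on X F"
  obtains C where "\<And>n y. y \<in> Y \<Longrightarrow> (shift_map ^^ n) y \<in> settled T \<Longrightarrow>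
     ln (fibre_sum F (initial_word (n + Suc T) y)) \<le> ln (point_sum F n y) + C"
proof -
  obtain D where D: "D \<ge> 1" "\<And>v. fibre_sum F v \<le> D ^ length v" using fibre_sum_bounds[OF F] by metis
  obtain pos: "\<And>n y. y \<in> Y \<Longrightarrow> 0 < point_sum F n y" using point_sum_bounds[OF F] by metis
  have "fibre_sum F (initial_word (n + Suc T) y) \<le> point_sum F n y * D ^ Suc T"
    if y: "y \<in> Y" and s: "(shift_map ^^ n) y \<in> settled T" for n y
  proof -
    let ?v = "initial_word (n + Suc T) y" and ?w = "initial_word (Suc T) ((shift_map ^^ n) y)"
    have a: "take n u \<in> fibre_words n y" "drop n u \<in> lifts ?w" "X.weight F u \<le> X.weight F (take n u) * X.weight F (drop n u)"
      if u: "u \<in> lifts ?v" for u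
    proof -
      obtain x where x: "x \<in> X" "u = initial_word (n + Suc T) x"
        using u by (auto simp: lifts_def X.words_eq)
      have e: "initial_word (n + Suc T) (\<pi> x) = ?v" using u x map_initial_word[OF x(1)] by (simp add: lifts_def)
      have tu: "take n u = initial_word n x" "drop n u = initial_word (Suc T) ((shift_map ^^ n) x)"
        unfolding x(2) initial_word_add by simp_all
      have xs: "(shift_map ^^ n) x \<in> X" by (rule X.Z_shift[OF x(1)])
      have e2: "initial_word (Suc T) (\<pi> ((shift_map ^^ n) x)) = ?w"
        using e unfolding pi_shift[OF x(1)] initial_word_add by simp
      show "drop n u \<in> lifts ?w"
        unfolding tu lifts_def using xs map_initial_word[OF xs, of "Suc T"] e2 by (auto simp: X.words_eq)
      obtain x' where x': "x' \<in> X" "\<pi> x' = (shift_map ^^ n) y" "x' 0 = x n"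
        using s e2 xs unfolding settled_def by (fastforce simp: shift_map_power)
      have sp: "graft n x x' \<in> X" using x x' by (intro graft_in) auto
      have "\<pi> (graft n x x') = y"
      proof
        fix i
        show "\<pi> (graft n x x') i = y i"
        proof (cases "i < n")
          case True
          then have "\<pi> x i = y i" using e by (auto simp: initial_word_eq_iff)
          then show ?thesis using True pi_nth[OF sp] pi_nth[OF x(1)] by (simp add: graft_def)
        next
          case False
          then show ?thesis using pi_nth[OF sp, of i] pi_nth[OF x'(1), of "i - n"] x'(2)
            by (simp add: graft_def shift_map_power)
        qed
      qed
      then show "take n u \<in> fibre_words n y"
        unfolding fibre_words_def tu using sp initial_word_graft1[of n x x']
        by (intro image_eqI[of _ _ "graft n x x'"]) auto
      have "u = take n u @ drop n u" by simp
      then show "X.weight F u \<le> X.weight F (take n u) * X.weight F (drop n u)"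
        using X.weight_append(3)[OF F, of "take n u" "drop n u" n "Suc T"] x by (auto simp: X.words_eq)
    qed
    have "fibre_sum F ?v \<le> point_sum F n y * fibre_sum F ?w"
      unfolding fibre_sum_def point_sum_def
    proof (rule sum_split_words_le)
      show "0 \<le> X.weight F u" if "u \<in> fibre_words n y" for u using X.weight_nonneg[OF F fibre_words_words[OF that]] .
      show "0 \<le> X.weight F u" if "u \<in> lifts ?w" for u using X.weight_nonneg[OF F] that by (auto simp: lifts_def)
    qed (use a in auto)
    also have "\<dots> \<le> point_sum F n y * D ^ Suc T"
      using D(2)[of ?w] pos[OF y, of n] by (intro mult_left_mono) (auto simp: less_imp_le)
    finally show ?thesis .
  qed
  note le = this
  have "ln (fibre_sum F (initial_word (n + Suc T) y)) \<le> ln (point_sum F n y) + ln (D ^ Suc T)"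
    if y: "y \<in> Y" and s: "(shift_map ^^ n) y \<in> settled T" for n y
  proof -
    have "ln (fibre_sum F (initial_word (n + Suc T) y)) \<le> ln (point_sum F n y * D ^ Suc T)"
      using le[OF y s] fibre_sum_pos'[OF F y, of "n + Suc T"] by (simp del: power_Suc)
    also have "\<dots> = ln (point_sum F n y) + ln (D ^ Suc T)"
      using pos[OF y, of n] D(1) by (simp add: ln_mult del: power_Suc)
    finally show ?thesis .
  qed
  then show ?thesis using that by blast
qed

text \<open>The orbit is finite, so one \<open>T\<close> serves all of its points.\<close>
lemma rel_pressure_periodic:
  assumes F: "continuous_on X F" and y: "y \<in> Y" "periodic_point y"
  shows "rel_pressure X \<pi> F y = growth (\<lambda>n. ln (fibre_sum F (initial_word n y)))"
proof -
  obtain l where l: "l \<ge> 1" "(shift_map ^^ l) y = y" using y(2) by (auto simp: periodic_point_def)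
  have "\<exists>T. \<forall>i<l. (shift_map ^^ i) y \<in> settled T"
  proof -
    have "\<forall>i. \<exists>T. (shift_map ^^ i) y \<in> settled T" using ex_settled Y.Z_shift[OF y(1)] by blast
    then obtain T where T: "\<And>i. (shift_map ^^ i) y \<in> settled (T i)" by metis
    have "(shift_map ^^ i) y \<in> settled (Max (T ` {..<l}))" if "i < l" for i
      using T[of i] settled_mono[of "T i" "Max (T ` {..<l})"] that by auto
    then show ?thesis by blast
  qed
  then obtain T where T: "\<And>i. i < l \<Longrightarrow> (shift_map ^^ i) y \<in> settled T" by blast
  have sT: "(shift_map ^^ n) y \<in> settled T" for n
  proof -
    have "(shift_map ^^ n) y = (shift_map ^^ (n mod l + n div l * l)) y" by simp
    also have "\<dots> = (shift_map ^^ (n mod l)) y" unfolding funpow_add o_def using shift_periodic[OF l(2)] by simp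
    finally show ?thesis using T[of "n mod l"] l(1) by simp
  qed
  obtain C where C: "\<And>n y. y \<in> Y \<Longrightarrow> (shift_map ^^ n) y \<in> settled T \<Longrightarrow>
     ln (fibre_sum F (initial_word (n + Suc T) y)) \<le> ln (point_sum F n y) + C"
    using fibre_sum_le_point_sum[OF F] by metis
  have "growth (\<lambda>n. ln (fibre_sum F (initial_word n y))) \<le> growth (\<lambda>n. ln (fibre_sum F (initial_word (n + Suc T) y)))"
    by (rule growth_le_shift)
  also have "\<dots> \<le> growth (\<lambda>n. ln (point_sum F n y))"
    by (rule growth_mono_const) (rule C[OF y(1) sT])
  finally have "growth (\<lambda>n. ln (fibre_sum F (initial_word n y))) \<le> growth (\<lambda>n. ln (point_sum F n y))" .
  moreover obtain pos: "\<And>n. 0 < point_sum F n y" using point_sum_bounds[OF F] y by metis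
  have "growth (\<lambda>n. ln (point_sum F n y)) \<le> growth (\<lambda>n. ln (fibre_sum F (initial_word n y)))"
    by (rule growth_mono_const[where C = 0]) (use ln_mono[OF point_sum_le_fibre_sum[OF F] pos] in simp)
  ultimately show ?thesis unfolding rel_pressure_eq[OF F y(1)] by (rule antisym[rotated])
qed

end

section \<open>Averages of upper limits\<close>

locale measure_preserving = prob_space M for M :: "'a measure" +
  fixes T :: "'a \<Rightarrow> 'a"
  assumes T_measurable [measurable]: "T \<in> measurable M M" and T_invariant: "distr M M T = M"
begin

lemma integral_T: "f \<in> borel_measurable M \<Longrightarrow> (\<integral>x. f (T x) \<partial>M) = (\<integral>x. f x \<partial>M :: real)"
  using integral_distr[OF T_measurable, of f] T_invariant by simp

lemma T_power_measurable [measurable]: "(T ^^ i) \<in> measurable M M"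
  by (induction i) (auto intro: measurable_comp[where g = T] simp: o_def)

lemma T_space: "x \<in> space M \<Longrightarrow> T x \<in> space M"
  using measurable_space[OF T_measurable] .

lemma T_power_space: "x \<in> space M \<Longrightarrow> (T ^^ i) x \<in> space M"
  using measurable_space[OF T_power_measurable] .

lemma integral_T_power:
  assumes [measurable]: "f \<in> borel_measurable M"
  shows "(\<integral>x. f ((T ^^ i) x) \<partial>M) = (\<integral>x. f x \<partial>M :: real)"
proof (induction i)
  case (Suc i)
  have "(\<lambda>x. f ((T ^^ i) x)) \<in> borel_measurable M" by measurable
  from integral_T[OF this] have "(\<integral>x. f ((T ^^ i) (T x)) \<partial>M) = (\<integral>x. f x \<partial>M)" using Suc by simp
  then show ?case by (simp only: funpow_Suc_right o_apply)
qed simp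

lemma integrable_bounded:
  assumes "f \<in> borel_measurable M" "\<And>x. x \<in> space M \<Longrightarrow> \<bar>f x\<bar> \<le> (K::real)"
  shows "integrable M f"
  using assms by (intro integrable_const_bound[of _ K]) auto

text \<open>The maximal ergodic inequality in the only case that matters here: if every orbit has a
  positive partial sum, then the integral is nonnegative. The maxima of the first \<open>N\<close>
  partial sums satisfy the recursion of \<open>maxsum\<close>.\<close>
fun maxsum :: "('a \<Rightarrow> real) \<Rightarrow> nat \<Rightarrow> 'a \<Rightarrow> real" where
  "maxsum g 0 x = 0"
| "maxsum g (Suc N) x = max 0 (g x + maxsum g N (T x))"

lemma maxsum_measurable [measurable]:
  assumes [measurable]: "g \<in> borel_measurable M" shows "maxsum g N \<in> borel_measurable M"
proof (induction N)
  case 0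
  have "maxsum g 0 = (\<lambda>_. 0)" by auto
  then show ?case by simp
next
  case (Suc N)
  note [measurable] = Suc
  have "maxsum g (Suc N) = (\<lambda>x. max 0 (g x + maxsum g N (T x)))" by auto
  moreover have "(\<lambda>x. max 0 (g x + maxsum g N (T x))) \<in> borel_measurable M" by measurable
  ultimately show ?case by simp
qed

lemma maxsum_nonneg: "0 \<le> maxsum g N x" by (cases N) auto

lemma maxsum_mono: "maxsum g N x \<le> maxsum g (Suc N) x"
proof (induction N arbitrary: x)
  case (Suc N)
  from Suc[of "T x"] show ?case unfolding maxsum.simps(2)[of g N x] maxsum.simps(2)[of g "Suc N" x] by linarith
qed simp

lemma maxsum_ge: "n \<le> N \<Longrightarrow> (\<Sum>i<n. g ((T ^^ i) x)) \<le> maxsum g N x"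
proof (induction n arbitrary: N x)
  case 0
  then show ?case by (simp add: maxsum_nonneg)
next
  case (Suc n)
  then obtain N' where N: "N = Suc N'" "n \<le> N'" by (cases N) auto
  have "(\<Sum>i<Suc n. g ((T ^^ i) x)) = g x + (\<Sum>i<n. g ((T ^^ i) (T x)))"
    by (subst sum.lessThan_Suc_shift) (simp add: funpow_swap1)
  then show ?case using Suc.IH[OF N(2), of "T x"] N(1) by simp
qed

lemma maxsum_bound:
  assumes "\<And>x. x \<in> space M \<Longrightarrow> \<bar>g x\<bar> \<le> K" "K \<ge> 0" "x \<in> space M" shows "maxsum g N x \<le> K * real N"
  using assms(3)
proof (induction N arbitrary: x)
  case (Suc N)
  have "g x + maxsum g N (T x) \<le> K + K * real N"
    using assms(1)[OF Suc.prems] Suc.IH[OF T_space[OF Suc.prems]] by linarith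
  then show ?case using assms(2) by (simp add: algebra_simps)
qed simp

lemma integral_nonneg_if_positive_sums:
  fixes g :: "'a \<Rightarrow> real"
  assumes g [measurable]: "g \<in> borel_measurable M" and K: "\<And>x. x \<in> space M \<Longrightarrow> \<bar>g x\<bar> \<le> K"
    and pos: "\<And>x. x \<in> space M \<Longrightarrow> \<exists>n. (\<Sum>i<n. g ((T ^^ i) x)) > 0"
  shows "0 \<le> (\<integral>x. g x \<partial>M)"
proof -
  obtain x0 where x0: "x0 \<in> space M" using not_empty by blast
  have K0: "K \<ge> 0" by (rule order_trans[OF abs_ge_zero K[OF x0]])
  let ?s = "\<lambda>N x. if maxsum g N x > 0 then g x else 0"
  have int: "integrable M (maxsum g N)" for N
    using maxsum_bound[OF K K0] maxsum_nonneg by (intro integrable_bounded[of _ "K * real N"]) auto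
  have s_int: "integrable M (?s N)" for N
    using K K0 by (intro integrable_bounded[of _ K]) auto
  \<comment> \<open>Garsia's argument: \<open>maxsum g (Suc N) x = g x + maxsum g N (T x)\<close> where the
    left-hand side is positive, and the integral does not see the shift by \<open>T\<close>.\<close>
  have "0 \<le> (\<integral>x. ?s (Suc N) x \<partial>M)" for N
  proof -
    have T_int: "integrable M (\<lambda>x. maxsum g (Suc N) (T x))"
      using integrable_distr_eq[OF T_measurable, of "maxsum g (Suc N)"] int[of "Suc N"] T_invariant by (simp del: maxsum.simps)
    have "0 = (\<integral>x. maxsum g (Suc N) x - maxsum g (Suc N) (T x) \<partial>M)"
      unfolding Bochner_Integration.integral_diff[OF int[of "Suc N"] T_int]
      using integral_T[of "maxsum g (Suc N)"] g by (simp del: maxsum.simps)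
    also have "\<dots> \<le> (\<integral>x. ?s (Suc N) x \<partial>M)"
    proof (rule integral_mono)
      fix x assume x: "x \<in> space M"
      show "maxsum g (Suc N) x - maxsum g (Suc N) (T x) \<le> ?s (Suc N) x"
        using maxsum_mono[of g N "T x"] maxsum_nonneg[of g "Suc N" "T x"] by (auto simp: max_def)
    qed (intro Bochner_Integration.integrable_diff int T_int s_int)+
    finally show ?thesis .
  qed
  moreover have "(\<lambda>N. \<integral>x. ?s N x \<partial>M) \<longlonglongrightarrow> (\<integral>x. g x \<partial>M)"
  proof (rule integral_dominated_convergence[where w = "\<lambda>_. K"])
    show "AE x in M. (\<lambda>N. ?s N x) \<longlonglongrightarrow> g x"
    proof (rule AE_I2)
      fix x assume "x \<in> space M"
      then obtain n where n: "(\<Sum>i<n. g ((T ^^ i) x)) > 0" using pos by blast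
      have "eventually (\<lambda>N. n \<le> N) sequentially" by (rule eventually_ge_at_top)
      then have "eventually (\<lambda>N. ?s N x = g x) sequentially"
        by eventually_elim (use n maxsum_ge[of n _ g x] in \<open>auto intro: order_less_le_trans\<close>)
      then show "(\<lambda>N. ?s N x) \<longlonglongrightarrow> g x" by (rule tendsto_eventually)
    qed
    show "AE x in M. norm (?s N x) \<le> K" for N using K K0 by auto
  qed auto
  then have "(\<lambda>N. \<integral>x. ?s (Suc N) x \<partial>M) \<longlonglongrightarrow> (\<integral>x. g x \<partial>M)" by (rule LIMSEQ_Suc)
  ultimately show ?thesis by (intro LIMSEQ_le_const) auto
qed

text \<open>One half of the ergodic theorem: apply the preceding lemma to \<open>h - u + \<epsilon>\<close>, where \<open>u\<close> is the
  upper limit of the averages, an invariant function.\<close>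
lemma integral_upper_average_le:
  assumes h [measurable]: "h \<in> borel_measurable M" and K: "\<And>x. x \<in> space M \<Longrightarrow> \<bar>h x\<bar> \<le> K"
    and u [measurable]: "u \<in> borel_measurable M"
    and uh: "\<And>x. x \<in> space M \<Longrightarrow> growth (\<lambda>n. \<Sum>i<n. h ((T ^^ i) x)) = ereal (u x)"
  shows "integrable M u" "(\<integral>x. u x \<partial>M) \<le> (\<integral>x. h x \<partial>M)"
proof -
  let ?S = "\<lambda>n x. \<Sum>i<n. h ((T ^^ i) x)"
  obtain x0 where x0: "x0 \<in> space M" using not_empty by blast
  have K0: "K \<ge> 0" by (rule order_trans[OF abs_ge_zero K[OF x0]])
  have Sb: "\<bar>?S n x\<bar> \<le> K * real n" if "x \<in> space M" for n x
  proof -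
    have "\<bar>?S n x\<bar> \<le> (\<Sum>i<n. \<bar>h ((T ^^ i) x)\<bar>)" by (rule sum_abs)
    also have "\<dots> \<le> (\<Sum>i<n. K)" using K T_power_space[OF that] by (intro sum_mono) auto
    finally show ?thesis by (simp add: mult.commute)
  qed
  have ub: "\<bar>u x\<bar> \<le> K" if x: "x \<in> space M" for x
  proof -
    have "ereal (u x) \<le> ereal K" "ereal (- K) \<le> ereal (u x)"
      unfolding uh[OF x, symmetric] using growth_abs_le[OF Sb[OF x]] by blast+
    then show ?thesis by (simp add: abs_le_iff)
  qed
  show u_int: "integrable M u" using ub by (intro integrable_bounded[of _ K]) auto
  have h_int: "integrable M h" using K by (intro integrable_bounded[of _ K]) auto
  have uT: "u (T x) = u x" if x: "x \<in> space M" for x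
  proof -
    have d: "\<bar>?S n (T x) - ?S n x\<bar> \<le> 2 * K" for n
    proof -
      have "?S (Suc n) x = h x + ?S n (T x)"
        by (subst sum.lessThan_Suc_shift) (simp add: funpow_swap1)
      then have "?S n (T x) - ?S n x = h ((T ^^ n) x) - h x" by simp
      then show ?thesis using K[OF x] K[OF T_power_space[OF x, of n]] by linarith
    qed
    have "unif_sublinear {x} (\<lambda>n y. ?S n (T y) - ?S n y)"
      unfolding unif_sublinear_def
    proof (intro allI impI)
      fix \<epsilon> :: real assume e: "\<epsilon> > 0"
      have "\<bar>?S n (T x) - ?S n x\<bar> \<le> \<epsilon> * real n + 2 * K" for n
        using d[of n] mult_nonneg_nonneg[of \<epsilon> "real n"] e by linarith
      then show "\<exists>C. \<forall>n. \<forall>y\<in>{x}. \<bar>?S n (T y) - ?S n y\<bar> \<le> \<epsilon> * real n + C" by blast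
    qed
    from growth_cong[OF this, of x] have "ereal (u (T x)) = ereal (u x)"
      using uh[OF x] uh[OF T_space[OF x]] by simp
    then show ?thesis by simp
  qed
  have uTi: "u ((T ^^ i) x) = u x" if x: "x \<in> space M" for x i
    by (induction i) (use uT T_power_space[OF x] in auto)
  have "(\<integral>x. u x \<partial>M) \<le> (\<integral>x. h x \<partial>M) + \<epsilon>" if e: "\<epsilon> > 0" for \<epsilon>
  proof -
    have "0 \<le> (\<integral>x. h x - u x + \<epsilon> \<partial>M)"
    proof (rule integral_nonneg_if_positive_sums[of _ "2 * K + \<epsilon>"])
      fix x assume x: "x \<in> space M"
      show "\<bar>h x - u x + \<epsilon>\<bar> \<le> 2 * K + \<epsilon>" using K[OF x] ub[OF x] e by linarith
      show "\<exists>n. 0 < (\<Sum>i<n. h ((T ^^ i) x) - u ((T ^^ i) x) + \<epsilon>)"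
      proof (rule ccontr)
        assume "\<not> ?thesis"
        then have n: "(\<Sum>i<n. h ((T ^^ i) x) - u ((T ^^ i) x) + \<epsilon>) \<le> 0" for n by (simp add: not_less)
        have "?S n x \<le> (u x - \<epsilon>) * real n + 0" for n
          using n[of n] uTi[OF x] by (simp add: sum.distrib sum_subtractf algebra_simps)
        then have "growth (\<lambda>n. ?S n x) \<le> ereal (u x - \<epsilon>)" by (rule growth_le_linear)
        then show False using uh[OF x] e by simp
      qed
    qed measurable
    also have "(\<integral>x. h x - u x + \<epsilon> \<partial>M) = (\<integral>x. h x \<partial>M) - (\<integral>x. u x \<partial>M) + \<epsilon>"
      using h_int u_int by (simp add: prob_space)
    finally show ?thesis by simp
  qed
  then show "(\<integral>x. u x \<partial>M) \<le> (\<integral>x. h x \<partial>M)" by (rule field_le_epsilon)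
qed

end

text \<open>A version of Fatou's lemma: the suprema over the tails decrease to the upper limit,
  and dominated convergence applies to them.\<close>
lemma (in prob_space) integral_limsup_ge:
  fixes a :: "nat \<Rightarrow> 'a \<Rightarrow> real"
  assumes a [measurable]: "\<And>n. a n \<in> borel_measurable M" and K: "\<And>n x. x \<in> space M \<Longrightarrow> \<bar>a n x\<bar> \<le> K"
    and L: "\<And>x. x \<in> space M \<Longrightarrow> limsup (\<lambda>n. ereal (a n x)) = ereal (L x)"
    and c: "\<And>\<epsilon>. \<epsilon> > 0 \<Longrightarrow> eventually (\<lambda>n. c - \<epsilon> \<le> (\<integral>x. a n x \<partial>M)) sequentially"
    and [measurable]: "L \<in> borel_measurable M"
  shows "c \<le> (\<integral>x. L x \<partial>M)"
proof -
  define b where "b n x = (SUP k\<in>{n..}. ereal (a k x))" for n x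
  have bb: "ereal (- K) \<le> b n x" "b n x \<le> ereal K" if "x \<in> space M" for n x
  proof -
    have "ereal (- K) \<le> ereal (a n x)" using K[OF that, of n] by (simp add: abs_le_iff)
    also have "\<dots> \<le> b n x" unfolding b_def by (rule SUP_upper) simp
    finally show "ereal (- K) \<le> b n x" .
    show "b n x \<le> ereal K" unfolding b_def using K[OF that] by (intro SUP_least) (auto simp: abs_le_iff)
  qed
  have bf: "\<bar>b n x\<bar> \<noteq> \<infinity>" "\<bar>real_of_ereal (b n x)\<bar> \<le> K" if "x \<in> space M" for n x
    using bb[OF that, of n] by (cases "b n x"; auto simp: abs_le_iff)+
  have [measurable]: "(\<lambda>x. real_of_ereal (b n x)) \<in> borel_measurable M" for n
    unfolding b_def by measurable
  have "(\<lambda>n. \<integral>x. real_of_ereal (b n x) \<partial>M) \<longlonglongrightarrow> (\<integral>x. L x \<partial>M)"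
  proof (rule integral_dominated_convergence[where w = "\<lambda>_. K"])
    show "AE x in M. (\<lambda>n. real_of_ereal (b n x)) \<longlonglongrightarrow> L x"
    proof (rule AE_I2)
      fix x assume x: "x \<in> space M"
      have "decseq (\<lambda>n. b n x)" unfolding b_def decseq_def by (auto intro!: SUP_subset_mono)
      from LIMSEQ_INF[OF this] have "(\<lambda>n. b n x) \<longlonglongrightarrow> ereal (L x)"
        using L[OF x] unfolding limsup_INF_SUP b_def by simp
      then show "(\<lambda>n. real_of_ereal (b n x)) \<longlonglongrightarrow> L x" by (rule lim_real_of_ereal)
    qed
    show "AE x in M. norm (real_of_ereal (b n x)) \<le> K" for n using bf(2) by auto
  qed auto
  moreover have "eventually (\<lambda>n. c - \<epsilon> \<le> (\<integral>x. real_of_ereal (b n x) \<partial>M)) sequentially" if "\<epsilon> > 0" for \<epsilon>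
    using c[OF that]
  proof eventually_elim
    case (elim n)
    have "(\<integral>x. a n x \<partial>M) \<le> (\<integral>x. real_of_ereal (b n x) \<partial>M)"
    proof (rule integral_mono)
      show "integrable M (a n)" using K by (intro integrable_const_bound[of _ K]) auto
      show "integrable M (\<lambda>x. real_of_ereal (b n x))" using bf(2) by (intro integrable_const_bound[of _ K]) auto
      fix x assume x: "x \<in> space M"
      have "ereal (a n x) \<le> b n x" unfolding b_def by (rule SUP_upper) simp
      then show "a n x \<le> real_of_ereal (b n x)" using bf(1)[OF x, of n] by (cases "b n x") auto
    qed
    then show ?case using elim by linarith
  qed
  ultimately have "c - \<epsilon> \<le> (\<integral>x. L x \<partial>M)" if "\<epsilon> > 0" for \<epsilon>
    using that by (intro tendsto_lowerbound[OF \<open>_ \<longlonglongrightarrow> _\<close>]) auto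
  then have "c \<le> (\<integral>x. L x \<partial>M) + \<epsilon>" if "\<epsilon> > 0" for \<epsilon> using that by (simp add: algebra_simps)
  then show ?thesis by (rule field_le_epsilon)
qed

section \<open>Invariant measures of a subshift\<close>

lemma continuous_shift_map: "continuous_on S shift_map"
  unfolding shift_map_def[abs_def] by (intro continuous_on_coordinatewise_then_product coordinate_continuous)

context nonempty_subshift
begin

lemma inv_measures_sets: "m \<in> inv_measures Z \<Longrightarrow> sets m = sets (restrict_space borel Z)"
  by (auto simp: inv_measures_def borel_of_shift_def)

lemma inv_measures_space: "m \<in> inv_measures Z \<Longrightarrow> space m = Z"
  using sets_eq_imp_space_eq[OF inv_measures_sets] by (simp add: space_restrict_space)

lemma shift_map_measurable: "shift_map \<in> measurable (restrict_space borel Z) (restrict_space borel Z)"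
proof (rule measurable_restrict_space2)
  show "shift_map \<in> space (restrict_space borel Z) \<rightarrow> Z"
    using Z_shift1 by (auto simp: space_restrict_space)
  show "shift_map \<in> borel_measurable (restrict_space borel Z)"
    by (intro borel_measurable_continuous_on_restrict continuous_shift_map)
qed

lemma inv_measures_preserving:
  assumes "m \<in> inv_measures Z" shows "measure_preserving m shift_map"
proof -
  interpret prob_space m using assms by (simp add: inv_measures_def)
  have "shift_map \<in> measurable m m"
    using shift_map_measurable measurable_cong_sets[OF inv_measures_sets[OF assms] inv_measures_sets[OF assms]] by simp
  then show ?thesis using assms by unfold_locales (auto simp: inv_measures_def)
qed

lemma measurable_inv_measure:
  assumes "m \<in> inv_measures Z" "f \<in> borel_measurable borel" shows "f \<in> borel_measurable m"
  using measurable_restrict_space1[OF assms(2)] measurable_cong_sets[OF inv_measures_sets[OF assms(1)] refl] by blast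

lemma continuous_measurable:
  assumes "m \<in> inv_measures Z" "continuous_on Z f" shows "f \<in> borel_measurable m"
  using borel_measurable_continuous_on_restrict[OF assms(2)] measurable_cong_sets[OF inv_measures_sets[OF assms(1)] refl] by blast

lemma continuous_integrable:
  assumes m: "m \<in> inv_measures Z" and f: "continuous_on Z f" shows "integrable m (f :: _ \<Rightarrow> real)"
proof -
  interpret measure_preserving m shift_map by (rule inv_measures_preserving[OF m])
  obtain K where "\<And>x. x \<in> Z \<Longrightarrow> \<bar>f x\<bar> \<le> K" using continuous_bounded[OF f] by metis
  then show ?thesis using continuous_measurable[OF m f] inv_measures_space[OF m]
    by (intro integrable_bounded[of _ K]) auto
qed

lemma integral_birkhoff_sum:
  assumes m: "m \<in> inv_measures Z" and f: "continuous_on Z f"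
  shows "(\<integral>x. birkhoff_sum f n x \<partial>m) = real n * (\<integral>x. f x \<partial>m)"
proof -
  interpret measure_preserving m shift_map by (rule inv_measures_preserving[OF m])
  have i: "continuous_on Z (\<lambda>x. f ((shift_map ^^ i) x))" for i
    using Z_shift by (intro continuous_on_compose2[OF f continuous_shift_power]) auto
  have "(\<integral>x. birkhoff_sum f n x \<partial>m) = (\<Sum>i<n. \<integral>x. f ((shift_map ^^ i) x) \<partial>m)"
    unfolding birkhoff_sum_def by (intro Bochner_Integration.integral_sum continuous_integrable[OF m i])
  also have "\<dots> = (\<Sum>i<n. \<integral>x. f x \<partial>m)"
    by (intro sum.cong refl integral_T_power continuous_measurable[OF m f])
  finally show ?thesis by simp
qed

definition orbit_measure :: "nat \<Rightarrow> (nat \<Rightarrow> nat) \<Rightarrow> (nat \<Rightarrow> nat) measure" where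
  "orbit_measure l z = distr (uniform_count_measure {..<l}) (restrict_space borel Z) (\<lambda>i. (shift_map ^^ i) z)"

lemma integral_orbit_measure:
  assumes z: "z \<in> Z" and f: "f \<in> borel_measurable (restrict_space borel Z)"
  shows "(\<integral>x. f x \<partial>orbit_measure l z) = (\<Sum>i<l. f ((shift_map ^^ i) z)) / real l"
proof -
  have [measurable]: "(\<lambda>i. (shift_map ^^ i) z) \<in> measurable (uniform_count_measure {..<l}) (restrict_space borel Z)"
    using Z_shift[OF z] by (intro measurable_restrict_space2) (auto simp: measurable_def space_uniform_count_measure sets_uniform_count_measure)
  show ?thesis unfolding orbit_measure_def
    using f by (subst integral_distr) (auto simp: integral_uniform_count_measure)
qed

lemma orbit_measure_inv:
  assumes z: "z \<in> Z" "(shift_map ^^ l) z = z" "l \<ge> 1"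
  shows "orbit_measure l z \<in> inv_measures Z"
proof -
  let ?m = "orbit_measure l z"
  have ms: "(\<lambda>i. (shift_map ^^ i) z) \<in> measurable (uniform_count_measure {..<l}) (restrict_space borel Z)"
    using Z_shift[OF z(1)] by (intro measurable_restrict_space2) (auto simp: measurable_def space_uniform_count_measure sets_uniform_count_measure)
  have "prob_space (uniform_count_measure {..<l})"
    using z(3) by (intro prob_space_uniform_count_measure) (auto simp: lessThan_empty_iff)
  then interpret prob_space ?m unfolding orbit_measure_def by (rule prob_space.prob_space_distr[OF _ ms])
  have se: "sets ?m = sets (restrict_space borel Z)" by (simp add: orbit_measure_def)
  have T: "shift_map \<in> measurable ?m ?m" using shift_map_measurable measurable_cong_sets[OF se se] by simp
  have sp: "space ?m = Z" using sets_eq_imp_space_eq[OF se] by (simp add: space_restrict_space)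
  have meas: "measure ?m A = (\<Sum>i<l. indicator A ((shift_map ^^ i) z)) / real l" if A: "A \<in> sets ?m" for A
  proof -
    have "indicator A \<in> borel_measurable (restrict_space borel Z)" using A se by simp
    from integral_orbit_measure[OF z(1) this, of l] show ?thesis
      using A sets.sets_into_space[OF A] by (simp add: Int_absorb2)
  qed
  have "distr ?m ?m shift_map = ?m"
  proof (rule measure_eqI)
    fix A assume "A \<in> sets (distr ?m ?m shift_map)"
    then have A: "A \<in> sets ?m" by simp
    have pre: "shift_map -` A \<inter> space ?m \<in> sets ?m" using measurable_sets[OF T A] .
    have "(\<Sum>i<l. indicator (shift_map -` A \<inter> space ?m) ((shift_map ^^ i) z)) = (\<Sum>i<l. indicator A ((shift_map ^^ Suc i) z) :: real)"
      using Z_shift[OF z(1)] sp by (intro sum.cong) (auto simp: indicator_def)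
    also have "\<dots> = (\<Sum>i<Suc l. indicator A ((shift_map ^^ i) z)) - indicator A z"
      by (subst sum.lessThan_Suc_shift) simp
    also have "\<dots> = (\<Sum>i<l. indicator A ((shift_map ^^ i) z))" using z(2) by simp
    finally have "measure ?m (shift_map -` A \<inter> space ?m) = measure ?m A" unfolding meas[OF A] meas[OF pre] by simp
    then show "emeasure (distr ?m ?m shift_map) A = emeasure ?m A"
      using A by (simp add: emeasure_distr[OF T A] emeasure_eq_measure)
  qed simp
  then show ?thesis using se prob_space_axioms by (simp add: inv_measures_def borel_of_shift_def)
qed

end

section \<open>The integrated relative pressure\<close>

lemma growth_add_linear: "growth (\<lambda>n. a n + c * real n) = growth a + ereal c"
proof -
  have "growth (\<lambda>n. a n + c * real n) = limsup (\<lambda>n. ereal (a n / real n) + ereal c)"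
    unfolding growth_def
  proof (rule Limsup_eq)
    have "eventually (\<lambda>n. n > 0) sequentially" by (rule eventually_gt_at_top)
    then show "eventually (\<lambda>n. ereal ((a n + c * real n) / real n) = ereal (a n / real n) + ereal c) sequentially"
      by eventually_elim (simp add: add_divide_distrib)
  qed
  also have "\<dots> = growth a + ereal c"
    unfolding growth_def by (rule Limsup_add_ereal_right) auto
  finally show ?thesis .
qed

context nonempty_subshift
begin

lemma birkhoff_sum_periodic:
  assumes f: "continuous_on Z f" and z: "z \<in> Z" "(shift_map ^^ l) z = z" "l \<ge> 1"
  obtains C where "\<And>n. \<bar>birkhoff_sum f n z - birkhoff_sum f l z / real l * real n\<bar> \<le> C"
proof -
  obtain K where K: "K \<ge> 0" "\<And>x. x \<in> Z \<Longrightarrow> \<bar>f x\<bar> \<le> K" using continuous_bounded[OF f] by metis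
  define c where "c = birkhoff_sum f l z / real l"
  have cK: "\<bar>c\<bar> \<le> K" using birkhoff_sum_bound[of f K z l] K z unfolding c_def by (simp add: field_simps)
  show ?thesis
  proof (rule that[of "2 * K * real l"])
    fix n
    define k s where "k = n div l" and "s = n mod l"
    have n: "n = k * l + s" and s: "s < l" using z(3) by (auto simp: k_def s_def)
    have "birkhoff_sum f (k * l) z = real k * birkhoff_sum f l z"
      unfolding birkhoff_sum_blocks using shift_periodic[OF z(2)] by simp
    then have "birkhoff_sum f n z = real k * birkhoff_sum f l z + birkhoff_sum f s z"
      unfolding n birkhoff_sum_add shift_periodic[OF z(2)] by simp
    then have "birkhoff_sum f n z - c * real n = birkhoff_sum f s z - c * real s"
      using z(3) unfolding c_def n by (simp add: field_simps)
    moreover have "\<bar>birkhoff_sum f s z\<bar> \<le> K * real s" using birkhoff_sum_bound[of f K z s] K z by blast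
    moreover have "\<bar>c * real s\<bar> \<le> K * real s" unfolding abs_mult using cK by (intro mult_mono) auto
    moreover have "K * real s \<le> K * real l" using s K(1) by (intro mult_left_mono) auto
    ultimately show "\<bar>birkhoff_sum f n z - birkhoff_sum f l z / real l * real n\<bar> \<le> 2 * K * real l"
      unfolding c_def[symmetric] by linarith
  qed
qed

end

context factor_code
begin

lemma continuous_comp_pi: "continuous_on Y h \<Longrightarrow> continuous_on X (\<lambda>x. h (\<pi> x))"
  using pi_in by (intro continuous_on_compose2[OF _ continuous_pi]) auto

lemma continuous_minus_pi:
  "continuous_on X f \<Longrightarrow> continuous_on Y h \<Longrightarrow> continuous_on X (\<lambda>x. f x - h (\<pi> x) :: real)"
  by (intro continuous_on_diff continuous_comp_pi)

lemma birkhoff_sum_pi: "x \<in> X \<Longrightarrow> birkhoff_sum (\<lambda>x. h (\<pi> x)) n x = birkhoff_sum h n (\<pi> x)"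
  unfolding birkhoff_sum_def by (intro sum.cong refl) (simp add: pi_shift)

text \<open>Over a word of \<open>Y\<close> the Birkhoff sums of \<open>h \<circ> \<pi>\<close> are constant up to distortion, so
  they can be taken out of the fibre sum.\<close>
lemma fibre_sum_minus_pi:
  assumes f: "continuous_on X f" and h: "continuous_on Y h"
  shows "unif_sublinear Y (\<lambda>n y. ln (fibre_sum (\<lambda>x. f x - h (\<pi> x)) (initial_word n y)) -
    (ln (fibre_sum f (initial_word n y)) - birkhoff_sum h n y))"
  unfolding unif_sublinear_def
proof (intro allI impI)
  fix \<epsilon> :: real assume e: "\<epsilon> > 0"
  let ?F = "\<lambda>x. f x - h (\<pi> x)"
  note F = continuous_minus_pi[OF f h]
  obtain C where C: "C \<ge> 0" "\<And>n x y. x \<in> Y \<Longrightarrow> y \<in> Y \<Longrightarrow> initial_word n x = initial_word n y \<Longrightarrow>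
     \<bar>birkhoff_sum h n x - birkhoff_sum h n y\<bar> \<le> \<epsilon> * real n + C"
    using Y.bounded_distortion[OF h e] by metis
  have "\<bar>ln (fibre_sum ?F (initial_word n y)) - (ln (fibre_sum f (initial_word n y)) - birkhoff_sum h n y)\<bar> \<le> \<epsilon> * real n + C"
    if y: "y \<in> Y" for n y
  proof -
    let ?r = "\<epsilon> * real n + C" and ?v = "initial_word n y"
    have S: "\<bar>birkhoff_sum ?F n x - (birkhoff_sum f n x - birkhoff_sum h n y)\<bar> \<le> ?r"
      if x: "x \<in> X" "initial_word n x = u" "u \<in> lifts ?v" for x u
    proof -
      have "birkhoff_sum ?F n x = birkhoff_sum f n x - birkhoff_sum h n (\<pi> x)"
        using birkhoff_sum_diff[of f "\<lambda>x. h (\<pi> x)" n x] birkhoff_sum_pi[OF x(1)] by simp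
      moreover have "initial_word n (\<pi> x) = ?v" using x map_initial_word[OF x(1), of n] by (simp add: lifts_def)
      ultimately show ?thesis using C(2)[OF pi_in[OF x(1)] y, of n] by linarith
    qed
    have lw: "u \<in> words X n" if "u \<in> lifts ?v" for u using that by (simp add: lifts_def)
    have 1: "X.weight ?F u \<le> exp (?r - birkhoff_sum h n y) * X.weight f u" if u: "u \<in> lifts ?v" for u
    proof -
      obtain x where x: "x \<in> X" "initial_word n x = u" "X.weight ?F u = exp (birkhoff_sum ?F n x)"
        using X.weight_attained[OF F lw[OF u]] by metis
      have "exp (birkhoff_sum ?F n x) \<le> exp (?r - birkhoff_sum h n y) * exp (birkhoff_sum f n x)"
        using S[OF x(1,2) u] unfolding exp_add[symmetric] by simp
      also have "\<dots> \<le> exp (?r - birkhoff_sum h n y) * X.weight f u"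
        using X.weight_upper[OF f x(1), of n] x(2) by (intro mult_left_mono) auto
      finally show ?thesis using x(3) by simp
    qed
    have 2: "X.weight f u \<le> exp (?r + birkhoff_sum h n y) * X.weight ?F u" if u: "u \<in> lifts ?v" for u
    proof -
      obtain x where x: "x \<in> X" "initial_word n x = u" "X.weight f u = exp (birkhoff_sum f n x)"
        using X.weight_attained[OF f lw[OF u]] by metis
      have "exp (birkhoff_sum f n x) \<le> exp (?r + birkhoff_sum h n y) * exp (birkhoff_sum ?F n x)"
        using S[OF x(1,2) u] unfolding exp_add[symmetric] by simp
      also have "\<dots> \<le> exp (?r + birkhoff_sum h n y) * X.weight ?F u"
        using X.weight_upper[OF F x(1), of n] x(2) by (intro mult_left_mono) auto
      finally show ?thesis using x(3) by simp
    qed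
    have "fibre_sum ?F ?v \<le> exp (?r - birkhoff_sum h n y) * fibre_sum f ?v"
      unfolding fibre_sum_def sum_distrib_left by (intro sum_mono 1)
    then have "ln (fibre_sum ?F ?v) \<le> ln (exp (?r - birkhoff_sum h n y) * fibre_sum f ?v)"
      using fibre_sum_pos'[OF F y, of n] by simp
    also have "\<dots> = ?r - birkhoff_sum h n y + ln (fibre_sum f ?v)"
      using fibre_sum_pos'[OF f y, of n] by (simp add: ln_mult)
    finally have a: "ln (fibre_sum ?F ?v) \<le> ?r - birkhoff_sum h n y + ln (fibre_sum f ?v)" .
    have "fibre_sum f ?v \<le> exp (?r + birkhoff_sum h n y) * fibre_sum ?F ?v"
      unfolding fibre_sum_def sum_distrib_left by (intro sum_mono 2)
    then have "ln (fibre_sum f ?v) \<le> ln (exp (?r + birkhoff_sum h n y) * fibre_sum ?F ?v)"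
      using fibre_sum_pos'[OF f y, of n] by simp
    also have "\<dots> = ?r + birkhoff_sum h n y + ln (fibre_sum ?F ?v)"
      using fibre_sum_pos'[OF F y, of n] by (simp add: ln_mult)
    finally show ?thesis using a by linarith
  qed
  then show "\<exists>C. \<forall>n. \<forall>y\<in>Y. \<bar>ln (fibre_sum ?F (initial_word n y)) - (ln (fibre_sum f (initial_word n y)) - birkhoff_sum h n y)\<bar> \<le> \<epsilon> * real n + C"
    by blast
qed

text \<open>A word is read off the fibre over \<open>y\<close> if and only if \<open>y\<close> lies in the image of its
  cylinder, a closed set.\<close>
lemma point_sum_measurable [measurable]: "(\<lambda>y. point_sum F n y) \<in> borel_measurable borel"
proof -
  have "point_sum F n y = (\<Sum>u\<in>words X n. if y \<in> \<pi> ` cyl X u then X.weight F u else 0)" for y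
  proof -
    have "u \<in> fibre_words n y \<longleftrightarrow> u \<in> words X n \<and> y \<in> \<pi> ` cyl X u" for u
    proof
      assume "u \<in> fibre_words n y"
      then obtain x where "x \<in> X" "\<pi> x = y" "u = initial_word n x" by (auto simp: fibre_words_def)
      then show "u \<in> words X n \<and> y \<in> \<pi> ` cyl X u" by (auto simp: X.words_eq cyl_def)
    next
      assume "u \<in> words X n \<and> y \<in> \<pi> ` cyl X u"
      then obtain x where x: "length u = n" "x \<in> cyl X u" "\<pi> x = y" by (auto simp: X.words_eq)
      then have "u = initial_word n x" "x \<in> X" by (auto simp: cyl_def)
      then show "u \<in> fibre_words n y" using x(3) by (auto simp: fibre_words_def)
    qed
    then have "fibre_words n y = {u \<in> words X n. y \<in> \<pi> ` cyl X u}" by blast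
    then show ?thesis unfolding point_sum_def by (simp add: sum.inter_filter)
  qed
  moreover have "(\<lambda>y. \<Sum>u\<in>words X n. if y \<in> \<pi> ` cyl X u then X.weight F u else 0) \<in> borel_measurable borel"
    by measurable
  ultimately show ?thesis by presburger
qed

lemma rel_pressure_real:
  assumes f: "continuous_on X f" and y: "y \<in> Y"
  shows "ereal (real_of_ereal (rel_pressure X \<pi> f y)) = limsup (\<lambda>n. ereal (ln (point_sum f n y) / real n))"
proof -
  obtain D where "\<And>n. \<bar>ln (point_sum f n y)\<bar> \<le> ln D * real n" using point_sum_bounds[OF f] y by metis
  from growth_abs_le(3)[OF this] show ?thesis
    unfolding rel_pressure_eq[OF f y] growth_def[symmetric] by (rule ereal_real')
qed

lemma rel_pressure_measurable:
  assumes f: "continuous_on X f" and m: "m \<in> inv_measures Y"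
  shows "(\<lambda>y. real_of_ereal (rel_pressure X \<pi> f y)) \<in> borel_measurable m"
proof -
  have [measurable]: "(\<lambda>y. point_sum f n y) \<in> borel_measurable m" for n
    by (rule Y.measurable_inv_measure[OF m point_sum_measurable])
  have "(\<lambda>y. real_of_ereal (limsup (\<lambda>n. ereal (ln (point_sum f n y) / real n)))) \<in> borel_measurable m"
    by measurable
  moreover have "real_of_ereal (limsup (\<lambda>n. ereal (ln (point_sum f n y) / real n))) = real_of_ereal (rel_pressure X \<pi> f y)"
    if "y \<in> space m" for y
    using rel_pressure_real[OF f, of y] that Y.inv_measures_space[OF m] by (metis real_of_ereal.simps(1))
  ultimately show ?thesis using measurable_cong[of m] by (metis (no_types, lifting))
qed

lemma unif_sublinearD:
  assumes "unif_sublinear S a" "\<epsilon> > 0"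
  obtains C where "\<And>n y. y \<in> S \<Longrightarrow> \<bar>a n y\<bar> \<le> \<epsilon> * real n + C"
  using assms unfolding unif_sublinear_def by blast

text \<open>The upper bound is the half of the ergodic theorem above. For the lower bound,
  Fatou's lemma requires the integrals of \<^const>\<open>point_sum\<close> at single times \<open>n\<close> only. By invariance,
  at each time the orbit is in \<open>settled T\<close> with probability close to \<open>1\<close>, and there \<^const>\<open>point_sum\<close>
  and \<^const>\<open>fibre_sum\<close> are comparable.\<close>
lemma integral_rel_pressure:
  assumes f: "continuous_on X f" and h: "continuous_on Y h" and m: "m \<in> inv_measures Y"
    and U: "unif_sublinear Y (\<lambda>n y. ln (fibre_sum f (initial_word n y)) - birkhoff_sum h n y)"
  shows "has_bochner_integral m (\<lambda>y. real_of_ereal (rel_pressure X \<pi> f y)) (integral\<^sup>L m h)"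
proof -
  interpret measure_preserving m shift_map by (rule Y.inv_measures_preserving[OF m])
  have sp: "space m = Y" by (rule Y.inv_measures_space[OF m])
  define L where "L y = real_of_ereal (rel_pressure X \<pi> f y)" for y
  have L_meas [measurable]: "L \<in> borel_measurable m" unfolding L_def[abs_def] by (rule rel_pressure_measurable[OF f m])
  have h_meas [measurable]: "h \<in> borel_measurable m" by (rule Y.continuous_measurable[OF m h])
  have ps_meas [measurable]: "(\<lambda>y. point_sum f n y) \<in> borel_measurable m" for n
    by (rule Y.measurable_inv_measure[OF m point_sum_measurable])
  obtain D where D: "D \<ge> 1" "\<And>n y. y \<in> Y \<Longrightarrow> \<bar>ln (point_sum f n y)\<bar> \<le> ln D * real n"
     "\<And>n y. y \<in> Y \<Longrightarrow> 0 < point_sum f n y" using point_sum_bounds[OF f] by metis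
  obtain K where K: "K \<ge> 0" "\<And>x. x \<in> Y \<Longrightarrow> \<bar>h x\<bar> \<le> K" using Y.continuous_bounded[OF h] by metis
  have Leq: "limsup (\<lambda>n. ereal (ln (point_sum f n y) / real n)) = ereal (L y)" if "y \<in> Y" for y
    using rel_pressure_real[OF f that] by (simp add: L_def)
  \<comment> \<open>As \<^const>\<open>point_sum\<close> is at most \<^const>\<open>fibre_sum\<close>, the relative pressure is at most the upper
    average \<open>u\<close> of \<open>h\<close> along the orbit.\<close>
  define u where "u y = real_of_ereal (growth (\<lambda>n. birkhoff_sum h n y))" for y
  have bm: "(\<lambda>y. birkhoff_sum h n y) \<in> borel_measurable m" for n
    using Y.continuous_measurable[OF m Y.continuous_birkhoff_sum[OF h]] .
  have [measurable]: "u \<in> borel_measurable m"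
    using bm unfolding u_def[abs_def] growth_def by measurable
  have ug: "growth (\<lambda>n. birkhoff_sum h n y) = ereal (u y)" if y: "y \<in> Y" for y
  proof -
    have "\<bar>birkhoff_sum h n y\<bar> \<le> K * real n" for n using Y.birkhoff_sum_bound[of h K y n] K y by blast
    then show ?thesis unfolding u_def by (intro ereal_real'[symmetric] growth_abs_le(3))
  qed
  have ug': "growth (\<lambda>n. \<Sum>i<n. h ((shift_map ^^ i) y)) = ereal (u y)" if "y \<in> space m" for y
    using ug[of y] that sp by (simp add: birkhoff_sum_def)
  have hK: "\<bar>h x\<bar> \<le> K" if "x \<in> space m" for x using K(2) that sp by simp
  note u_int = integral_upper_average_le[OF h_meas hK \<open>u \<in> borel_measurable m\<close> ug']
  have Lu: "L y \<le> u y" if y: "y \<in> Y" for y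
  proof -
    have "ereal (L y) \<le> ereal (u y)"
      unfolding Leq[OF y, symmetric] growth_def[symmetric] ug[OF y, symmetric]
    proof (rule growth_mono)
      fix \<epsilon> :: real assume e: "\<epsilon> > 0"
      obtain C where C: "\<And>n y. y \<in> Y \<Longrightarrow> \<bar>ln (fibre_sum f (initial_word n y)) - birkhoff_sum h n y\<bar> \<le> \<epsilon> * real n + C"
        using unif_sublinearD[OF U e] by metis
      have "ln (point_sum f n y) \<le> ln (fibre_sum f (initial_word n y))" for n
        using point_sum_le_fibre_sum[OF f, of n y] D(3)[OF y, of n] by (simp add: ln_mono)
      then have "ln (point_sum f n y) \<le> birkhoff_sum h n y + \<epsilon> * real n + C" for n
        using C[OF y, of n] by (smt (verit))
      then show "\<exists>C. \<forall>n. ln (point_sum f n y) \<le> birkhoff_sum h n y + \<epsilon> * real n + C" by blast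
    qed
    then show ?thesis by simp
  qed
  have Lb: "\<bar>L y\<bar> \<le> ln D" if y: "y \<in> Y" for y
  proof -
    have "ereal (L y) \<le> ereal (ln D)" "ereal (- ln D) \<le> ereal (L y)"
      unfolding Leq[OF y, symmetric] growth_def[symmetric] using growth_abs_le[OF D(2)[OF y]] by blast+
    then show ?thesis by (simp add: abs_le_iff)
  qed
  have L_int: "integrable m L" using Lb sp by (intro integrable_bounded[of _ "ln D"]) auto
  have le: "(\<integral>y. L y \<partial>m) \<le> (\<integral>y. h y \<partial>m)"
    using u_int(2) integral_mono[OF L_int u_int(1)] Lu sp by fastforce
  have h_int: "integrable m h" by (rule Y.continuous_integrable[OF m h])
  have set_sets: "settled T \<in> sets m" for T
  proof -
    have "settled T \<subseteq> Y" by (auto simp: settled_def)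
    then show ?thesis unfolding Y.inv_measures_sets[OF m] using settled_borel[of T] borel_closed[OF Y.Z_closed] by (subst sets_restrict_space_iff) auto
  qed
  have lim1: "(\<lambda>T. prob (settled T)) \<longlonglongrightarrow> 1"
  proof -
    have "(\<lambda>T. prob (settled T)) \<longlonglongrightarrow> prob (\<Union>T. settled T)"
      using set_sets settled_mono by (intro finite_Lim_measure_incseq) (auto simp: incseq_def)
    moreover have "(\<Union>T. settled T) = space m" using ex_settled sp by (auto simp: settled_def)
    ultimately show ?thesis by (simp add: prob_space)
  qed
  have ge: "(\<integral>y. h y \<partial>m) \<le> (\<integral>y. L y \<partial>m)"
  proof (rule integral_limsup_ge[where a = "\<lambda>n y. ln (point_sum f n y) / real n" and K = "ln D"])
    show "\<bar>ln (point_sum f n x) / real n\<bar> \<le> ln D" if "x \<in> space m" for n x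
      using D(2)[of x n] that sp D(1) by (cases "n = 0") (auto simp: field_simps)
    show "limsup (\<lambda>n. ereal (ln (point_sum f n x) / real n)) = ereal (L x)" if "x \<in> space m" for x
      using Leq that sp by simp
    fix \<epsilon> :: real assume e: "\<epsilon> > 0"
    define K' where "K' = ln D + K"
    have K': "K' \<ge> 0" using K(1) D(1) by (simp add: K'_def)
    \<comment> \<open>A bad set of measure \<open>\<delta>\<close> costs at most \<open>K' \<delta> \<le> \<epsilon> / 3\<close> per unit of time.\<close>
    define \<delta> where "\<delta> = \<epsilon> / (3 * (K' + 1))"
    have d: "\<delta> > 0" using e K' by (simp add: \<delta>_def)
    have "eventually (\<lambda>T. prob (settled T) > 1 - \<delta>) sequentially"
      using order_tendstoD(1)[OF lim1] d by simp
    then obtain T where T: "prob (settled T) > 1 - \<delta>" using eventually_happens by force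
    define bad where "bad = space m - settled T"
    have bad: "bad \<in> sets m" "prob bad < \<delta>"
      using T set_sets[of T] prob_compl[of "settled T"] by (auto simp: bad_def)
    obtain C where C: "\<And>n y. y \<in> Y \<Longrightarrow> \<bar>ln (fibre_sum f (initial_word n y)) - birkhoff_sum h n y\<bar> \<le> \<epsilon>/3 * real n + C"
      using unif_sublinearD[OF U, of "\<epsilon>/3"] e by auto
    obtain C' where C': "\<And>n y. y \<in> Y \<Longrightarrow> (shift_map ^^ n) y \<in> settled T \<Longrightarrow>
     ln (fibre_sum f (initial_word (n + Suc T) y)) \<le> ln (point_sum f n y) + C'"
      using fibre_sum_le_point_sum[OF f] by metis
    define C2 where "C2 = \<bar>C\<bar> + \<bar>C'\<bar> + (\<epsilon>/3 + K) * real (Suc T)"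
    have C2: "C2 \<ge> 0" using e K(1) by (simp add: C2_def)
    have pt: "birkhoff_sum h n y - \<epsilon>/3 * real n - C2 - K' * real n * indicator bad ((shift_map ^^ n) y) \<le> ln (point_sum f n y)"
      if y: "y \<in> Y" for n y
    proof (cases "(shift_map ^^ n) y \<in> bad")
      case True
      have "birkhoff_sum h n y \<le> K * real n" using Y.birkhoff_sum_bound[of h K y n] K y by (simp add: abs_le_iff)
      moreover have "- (ln D * real n) \<le> ln (point_sum f n y)" using D(2)[OF y, of n] by (simp add: abs_le_iff)
      moreover have "0 \<le> \<epsilon>/3 * real n" using e by simp
      ultimately show ?thesis using True C2 by (simp add: K'_def algebra_simps)
    next
      case False
      then have st: "(shift_map ^^ n) y \<in> settled T" using Y.Z_shift[OF y] sp by (simp add: bad_def)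
      define A B where "A = K * real (Suc T)" and "B = \<epsilon>/3 * real (Suc T)"
      have "birkhoff_sum h (n + Suc T) y = birkhoff_sum h n y + birkhoff_sum h (Suc T) ((shift_map ^^ n) y)"
        by (rule birkhoff_sum_add)
      moreover have "\<bar>birkhoff_sum h (Suc T) ((shift_map ^^ n) y)\<bar> \<le> A"
        unfolding A_def using Y.birkhoff_sum_bound[of h K] K Y.Z_shift[OF y] by blast
      moreover have "birkhoff_sum h (n + Suc T) y - (\<epsilon>/3 * real (n + Suc T) + C) \<le> ln (point_sum f n y) + C'"
        using C[OF y, of "n + Suc T"] C'[OF y st] by linarith
      moreover have "\<epsilon>/3 * real (n + Suc T) = \<epsilon>/3 * real n + B" by (simp only: B_def of_nat_add distrib_left)
      moreover have "C2 = \<bar>C\<bar> + \<bar>C'\<bar> + (B + A)" unfolding C2_def A_def B_def distrib_right ..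
      moreover have "K' * real n * indicator bad ((shift_map ^^ n) y) = 0" using False by simp
      ultimately show ?thesis by linarith
    qed
    have int: "real n * (\<integral>y. h y \<partial>m) - \<epsilon>/3 * real n - C2 - K' * real n * \<delta> \<le> (\<integral>y. ln (point_sum f n y) \<partial>m)" for n
    proof -
      have ib: "integrable m (\<lambda>y. indicator bad ((shift_map ^^ n) y) :: real)"
        using bad(1) by (intro integrable_bounded[of _ 1]) (auto simp: indicator_def)
      have ibs: "integrable m (\<lambda>y. birkhoff_sum h n y)"
        using Y.continuous_integrable[OF m Y.continuous_birkhoff_sum[OF h]] .
      have "(\<integral>y. indicator bad ((shift_map ^^ n) y) \<partial>m) = prob bad"
        using integral_T_power[of "indicator bad" n] bad(1) by (simp add: Int_absorb2 sets.sets_into_space)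
      then have "(\<integral>y. birkhoff_sum h n y - \<epsilon>/3 * real n - C2 - K' * real n * indicator bad ((shift_map ^^ n) y) \<partial>m)
          = real n * (\<integral>y. h y \<partial>m) - \<epsilon>/3 * real n - C2 - K' * real n * prob bad"
        using ib ibs by (simp add: prob_space Y.integral_birkhoff_sum[OF m h])
      moreover have "K' * real n * prob bad \<le> K' * real n * \<delta>"
        using bad(2) K' by (intro mult_left_mono) auto
      moreover have "(\<integral>y. birkhoff_sum h n y - \<epsilon>/3 * real n - C2 - K' * real n * indicator bad ((shift_map ^^ n) y) \<partial>m)
         \<le> (\<integral>y. ln (point_sum f n y) \<partial>m)"
      proof (rule integral_mono)
        show "integrable m (\<lambda>y. ln (point_sum f n y))" using D(2) sp by (intro integrable_bounded[of _ "ln D * real n"]) auto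
      qed (use ib ibs pt sp in auto)
      ultimately show ?thesis by linarith
    qed
    obtain N :: nat where N: "real N > 3 * C2 / \<epsilon>" using reals_Archimedean2 by blast
    have "eventually (\<lambda>n. n \<ge> Suc N) sequentially" by (rule eventually_ge_at_top)
    then show "eventually (\<lambda>n. (\<integral>y. h y \<partial>m) - \<epsilon> \<le> (\<integral>y. ln (point_sum f n y) / real n \<partial>m)) sequentially"
    proof eventually_elim
      case (elim n)
      then have n: "n \<ge> 1" "real n > 3 * C2 / \<epsilon>" using N by linarith+
      have "C2 \<le> \<epsilon>/3 * real n" using n(2) e by (simp add: field_simps)
      moreover have "K' * \<delta> \<le> \<epsilon>/3" unfolding \<delta>_def using K' e by (simp add: field_simps)
      then have "K' * real n * \<delta> \<le> \<epsilon>/3 * real n" using n(1) by (simp add: mult.commute mult.left_commute)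
      ultimately have "real n * (\<integral>y. h y \<partial>m) - \<epsilon> * real n \<le> (\<integral>y. ln (point_sum f n y) \<partial>m)"
        using int[of n] by linarith
      then have "((\<integral>y. h y \<partial>m) - \<epsilon>) * real n \<le> (\<integral>y. ln (point_sum f n y) \<partial>m)" by (simp add: algebra_simps)
      then show ?case using n(1) by (simp add: field_simps)
    qed
  qed measurable
  have "(\<integral>y. L y \<partial>m) = (\<integral>y. h y \<partial>m)" using le ge by simp
  then show ?thesis using L_int unfolding L_def[abs_def] has_bochner_integral_iff by simp
qed

text \<open>Dropping the first letter does not decrease the growth rate; along a periodic orbit
  it must therefore be constant.\<close>
lemma growth_fibre_sum_orbit:
  assumes f: "continuous_on X f" and z: "z \<in> Y" and l: "l \<ge> 1" "(shift_map ^^ l) z = z" and il: "i < l"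
  shows "growth (\<lambda>n. ln (fibre_sum f (initial_word n ((shift_map ^^ i) z)))) = growth (\<lambda>n. ln (fibre_sum f (initial_word n z)))"
proof -
  obtain D where D: "D \<ge> 1" "\<And>v. fibre_sum f v \<le> D ^ length v" using fibre_sum_bounds[OF f] by metis
  let ?g = "\<lambda>y. growth (\<lambda>n. ln (fibre_sum f (initial_word n y)))"
  have step: "?g y \<le> ?g (shift_map y)" if y: "y \<in> Y" for y
  proof -
    have "?g y \<le> growth (\<lambda>n. ln (fibre_sum f (initial_word (n + 1) y)))" by (rule growth_le_shift)
    also have "\<dots> \<le> ?g (shift_map y)"
    proof (rule growth_mono_const)
      fix n
      show "ln (fibre_sum f (initial_word (n + 1) y)) \<le> ln (fibre_sum f (initial_word n (shift_map y))) + ln D"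
      proof -
        have "fibre_sum f (initial_word (1 + n) y) \<le> fibre_sum f (initial_word 1 y) * fibre_sum f (initial_word n (shift_map y))"
          using fibre_sum_initial_word_add[OF f, of 1 n y] by simp
        also have "\<dots> \<le> D * fibre_sum f (initial_word n (shift_map y))"
          using D(2)[of "initial_word 1 y"] fibre_sum_nonneg[OF f] by (intro mult_right_mono) auto
        finally have "ln (fibre_sum f (initial_word (1 + n) y)) \<le> ln (D * fibre_sum f (initial_word n (shift_map y)))"
          using fibre_sum_pos'[OF f y, of "1 + n"] by (simp del: add_Suc add_Suc_right plus_1_eq_Suc)
        also have "\<dots> = ln D + ln (fibre_sum f (initial_word n (shift_map y)))"
          using D(1) fibre_sum_pos'[OF f Y.Z_shift1[OF y], of n] by (simp add: ln_mult)
        finally show ?thesis unfolding add.commute[of 1 n] by linarith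
      qed
    qed
    finally show ?thesis .
  qed
  have mono: "?g ((shift_map ^^ i) z) \<le> ?g ((shift_map ^^ (i + j)) z)" for i j
  proof (induction j)
    case (Suc j)
    then show ?case using step[OF Y.Z_shift[OF z, of "i + j"]] by simp
  qed simp
  show ?thesis using mono[of 0 i] mono[of i "l - i"] il l(2) by simp
qed

text \<open>Conversely, the equality of integrals for the measures carried by periodic orbits determines
  the growth along periodic points.\<close>
lemma growth_if_integral_rel_pressure:
  assumes f: "continuous_on X f" and h: "continuous_on Y h" and z: "z \<in> Y" "periodic_point z"
    and I: "\<And>m. m \<in> inv_measures Y \<Longrightarrow> (\<integral>y. real_of_ereal (rel_pressure X \<pi> f y) \<partial>m) = integral\<^sup>L m h"
  shows "growth (\<lambda>n. ln (fibre_sum f (initial_word n z)) - birkhoff_sum h n z) = 0"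
proof -
  obtain l where l: "l \<ge> 1" "(shift_map ^^ l) z = z" using z(2) by (auto simp: periodic_point_def)
  obtain D where D: "D \<ge> 1" "\<And>v. fibre_sum f v \<le> D ^ length v"
    "\<And>n y. y \<in> Y \<Longrightarrow> \<bar>ln (fibre_sum f (initial_word n y))\<bar> \<le> ln D * real n"
    using fibre_sum_bounds[OF f] by metis
  let ?g = "\<lambda>y. growth (\<lambda>n. ln (fibre_sum f (initial_word n y)))"
  have const: "?g ((shift_map ^^ i) z) = ?g z" if "i < l" for i
    by (rule growth_fibre_sum_orbit[OF f z(1) l that])
  define c where "c = real_of_ereal (?g z)"
  have gc: "?g z = ereal c" unfolding c_def using growth_abs_le(3)[OF D(3)[OF z(1)]] by (simp add: ereal_real')
  let ?m = "Y.orbit_measure l z"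
  have m: "?m \<in> inv_measures Y" by (rule Y.orbit_measure_inv[OF z(1) l(2,1)])
  have se: "borel_measurable ?m = borel_measurable (restrict_space borel Y)"
    by (rule measurable_cong_sets[OF Y.inv_measures_sets[OF m] refl])
  have per: "periodic_point ((shift_map ^^ i) z)" for i
  proof -
    have "(shift_map ^^ l) ((shift_map ^^ i) z) = (shift_map ^^ i) ((shift_map ^^ l) z)"
      by (simp add: shift_map_power add_ac)
    then show ?thesis using l unfolding periodic_point_def by auto
  qed
  have "real_of_ereal (rel_pressure X \<pi> f ((shift_map ^^ i) z)) = c" if "i < l" for i
    using rel_pressure_periodic[OF f Y.Z_shift[OF z(1)] per] const[OF that] by (simp add: gc)
  then have "(\<integral>y. real_of_ereal (rel_pressure X \<pi> f y) \<partial>?m) = c"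
    using Y.integral_orbit_measure[OF z(1), of "\<lambda>y. real_of_ereal (rel_pressure X \<pi> f y)" l]
      rel_pressure_measurable[OF f m] l(1) by (simp add: se)
  moreover have "integral\<^sup>L ?m h = birkhoff_sum h l z / real l"
    using Y.integral_orbit_measure[OF z(1), of h l] Y.continuous_measurable[OF m h] by (simp add: se birkhoff_sum_def)
  ultimately have c: "c = birkhoff_sum h l z / real l" using I[OF m] by simp
  obtain C where C: "\<And>n. \<bar>birkhoff_sum h n z - c * real n\<bar> \<le> C"
    using Y.birkhoff_sum_periodic[OF h z(1) l(2,1)] c by metis
  have "unif_sublinear {z} (\<lambda>n y. (ln (fibre_sum f (initial_word n y)) - birkhoff_sum h n y) - (ln (fibre_sum f (initial_word n y)) + (- c) * real n))"
    unfolding unif_sublinear_def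
  proof (intro allI impI exI ballI)
    fix \<epsilon> :: real and n y assume "\<epsilon> > 0" "y \<in> {z}"
    then show "\<bar>(ln (fibre_sum f (initial_word n y)) - birkhoff_sum h n y) - (ln (fibre_sum f (initial_word n y)) + (- c) * real n)\<bar> \<le> \<epsilon> * real n + C"
      using C[of n] mult_nonneg_nonneg[of \<epsilon> "real n"] by (simp add: abs_le_iff, intro conjI; linarith)
  qed
  from growth_cong[OF this, of z]
  have "growth (\<lambda>n. ln (fibre_sum f (initial_word n z)) - birkhoff_sum h n z) = ?g z + ereal (- c)"
    using growth_add_linear[of "\<lambda>n. ln (fibre_sum f (initial_word n z))" "- c"] by simp
  then show ?thesis by (simp add: gc)
qed

end

section \<open>Entropy\<close>

text \<open>Fekete's lemma. The existence of the limit is needed because entropies are defined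
  by \<^const>\<open>lim\<close>, which says nothing about divergent sequences.\<close>
lemma fekete_convergent:
  fixes a :: "nat \<Rightarrow> real"
  assumes sub: "\<And>n m. a (n + m) \<le> a n + a m" and pos: "\<And>n. 0 \<le> a n"
  shows "convergent (\<lambda>n. a n / real n)"
proof -
  define L where "L = Inf ((\<lambda>n. a n / real n) ` {1..})"
  have bdd: "bdd_below ((\<lambda>n. a n / real n) ` {1..})" using pos by (intro bdd_belowI[of _ 0]) auto
  have lo: "L \<le> a n / real n" if "n \<ge> 1" for n
    unfolding L_def using that by (intro cInf_lower bdd) auto
  have mult: "a (k * m + r) \<le> real k * a m + a r" for k m r
  proof (induction k)
    case (Suc k)
    have "a (Suc k * m + r) \<le> a m + a (k * m + r)" using sub[of m "k * m + r"] by (simp add: add.assoc)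
    then show ?case using Suc by (simp add: algebra_simps)
  qed simp
  have "growth a \<le> ereal L"
  proof (rule growth_leI)
    fix \<epsilon> :: real assume e: "\<epsilon> > 0"
    obtain m where m: "m \<ge> 1" "a m / real m < L + \<epsilon>"
      using cInf_lessD[of "(\<lambda>n. a n / real n) ` {1..}" "L + \<epsilon>"] e unfolding L_def by auto
    have "a n \<le> (L + \<epsilon>) * real n + (\<bar>L + \<epsilon>\<bar> * real m + (\<Sum>r<m. a r))" for n
    proof -
      define k r where "k = n div m" and "r = n mod m"
      have n: "n = k * m + r" and r: "r < m" using m(1) by (auto simp: k_def r_def)
      have "a n \<le> real k * a m + a r" unfolding n by (rule mult)
      also have "a m \<le> (L + \<epsilon>) * real m" using m by (simp add: field_simps)
      then have "real k * a m \<le> real k * ((L + \<epsilon>) * real m)" by (intro mult_left_mono) auto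
      also have "real k * ((L + \<epsilon>) * real m) = (L + \<epsilon>) * real n - (L + \<epsilon>) * real r" by (simp add: n algebra_simps)
      also have "a r \<le> (\<Sum>r<m. a r)" using r pos by (intro member_le_sum) auto
      finally have 1: "a n \<le> (L + \<epsilon>) * real n - (L + \<epsilon>) * real r + (\<Sum>r<m. a r)" by simp
      have "\<bar>(L + \<epsilon>) * real r\<bar> \<le> \<bar>L + \<epsilon>\<bar> * real m" unfolding abs_mult using r by (intro mult_left_mono) auto
      then show ?thesis using 1 by linarith
    qed
    then show "\<exists>C. \<forall>n. a n \<le> (L + \<epsilon>) * real n + C" by blast
  qed
  moreover have "ereal L \<le> liminf (\<lambda>n. ereal (a n / real n))"
  proof (rule Liminf_bounded)
    have "eventually (\<lambda>n. n \<ge> 1) sequentially" by (rule eventually_ge_at_top)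
    then show "eventually (\<lambda>n. ereal L \<le> ereal (a n / real n)) sequentially"
      by eventually_elim (use lo in auto)
  qed
  ultimately have "(\<lambda>n. ereal (a n / real n)) \<longlonglongrightarrow> ereal L"
    unfolding growth_def using Liminf_le_Limsup[of sequentially "\<lambda>n. ereal (a n / real n)"]
    by (subst tendsto_iff_Liminf_eq_Limsup) auto
  then show ?thesis unfolding convergent_def by auto
qed

lemma growth_eq_lim:
  assumes "convergent (\<lambda>n. a n / real n)" shows "growth a = ereal (lim (\<lambda>n. a n / real n))"
  unfolding growth_def using assms convergent_LIMSEQ_iff[of "\<lambda>n. a n / real n"]
  by (intro lim_imp_Limsup) auto

text \<open>Gibbs' inequality, from \<open>ln x \<le> x - 1\<close>. It bounds an entropy by the mean code length
  of any code, and all estimates of entropies by integrals are obtained by choosing a code.\<close>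
lemma gibbs_inequality:
  assumes "finite S" and p: "\<And>v. v \<in> S \<Longrightarrow> 0 \<le> p v" "(\<Sum>v\<in>S. p v) = 1"
    and q: "\<And>v. v \<in> S \<Longrightarrow> 0 \<le> q v" "(\<Sum>v\<in>S. q v) \<le> (1::real)" "\<And>v. v \<in> S \<Longrightarrow> p v > 0 \<Longrightarrow> q v > 0"
  shows "(\<Sum>v\<in>S. p v * - ln (p v)) \<le> (\<Sum>v\<in>S. p v * - ln (q v))"
proof -
  have "p v * - ln (p v) - p v * - ln (q v) \<le> q v - p v" if v: "v \<in> S" for v
  proof (cases "p v = 0")
    case False
    then have pos: "p v > 0" "q v > 0" using p(1)[OF v] q(3)[OF v] by auto
    have "ln (q v / p v) \<le> q v / p v - 1" using pos by (intro ln_le_minus_one) simp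
    then have "p v * ln (q v / p v) \<le> p v * (q v / p v - 1)" using pos by (intro mult_left_mono) auto
    then show ?thesis using pos by (simp add: ln_div algebra_simps)
  qed (use q(1)[OF v] in simp)
  then have "(\<Sum>v\<in>S. p v * - ln (p v) - p v * - ln (q v)) \<le> (\<Sum>v\<in>S. q v - p v)" by (rule sum_mono)
  then show ?thesis using p(2) q(2) unfolding sum_subtractf by linarith
qed

context prob_space
begin

text \<open>Finite partitions are handled through functions that give each point the label of
  its cell. Joins become tuples of labels, and a coarser partition becomes a composition.\<close>
definition label_prob :: "('a \<Rightarrow> 'b) \<Rightarrow> 'b \<Rightarrow> real" where
  "label_prob c v = prob (c -` {v} \<inter> space M)"

definition label_entropy :: "('a \<Rightarrow> 'b) \<Rightarrow> real" where
  "label_entropy c = (\<Sum>v\<in>c ` space M. label_prob c v * - ln (label_prob c v))"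

lemma simple_functionD_fibre: "simple_function M c \<Longrightarrow> c -` {v} \<inter> space M \<in> events"
  by (rule simple_functionD(2))

lemma label_prob_nonneg: "0 \<le> label_prob c v" by (simp add: label_prob_def)

lemma label_prob_le_1: "label_prob c v \<le> 1" by (simp add: label_prob_def)

lemma label_entropy_nonneg: "0 \<le> label_entropy c"
  unfolding label_entropy_def
proof (rule sum_nonneg)
  fix v show "0 \<le> label_prob c v * - ln (label_prob c v)"
    using label_prob_nonneg[of c v] label_prob_le_1[of c v]
    by (cases "label_prob c v = 0") (auto intro!: mult_nonneg_nonneg simp: mult_le_0_iff)
qed

lemma integral_label:
  assumes c: "simple_function M c"
  shows "integrable M (\<lambda>x. \<phi> (c x) :: real)" "(\<integral>x. \<phi> (c x) \<partial>M) = (\<Sum>v\<in>c ` space M. label_prob c v * \<phi> v)"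
proof -
  have fin: "finite (c ` space M)" using c by (rule simple_functionD(1))
  have eq: "\<phi> (c x) = (\<Sum>v\<in>c ` space M. \<phi> v * indicator (c -` {v} \<inter> space M) x)" if x: "x \<in> space M" for x
  proof -
    have "(\<Sum>v\<in>c ` space M. \<phi> v * indicator (c -` {v} \<inter> space M) x) = (\<Sum>v\<in>{c x}. \<phi> v * indicator (c -` {v} \<inter> space M) x)"
      using fin x by (intro sum.mono_neutral_right) (auto simp: indicator_def)
    then show ?thesis using x by simp
  qed
  have i: "integrable M (\<lambda>x. \<phi> v * indicator (c -` {v} \<inter> space M) x)" for v
    using simple_functionD_fibre[OF c, of v] by (intro integrable_mult_right integrable_real_indicator) (auto simp: emeasure_eq_measure)
  have "integrable M (\<lambda>x. \<Sum>v\<in>c ` space M. \<phi> v * indicator (c -` {v} \<inter> space M) x)" using i by (rule Bochner_Integration.integrable_sum)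
  then show "integrable M (\<lambda>x. \<phi> (c x))" using eq by (simp cong: Bochner_Integration.integrable_cong)
  have "(\<integral>x. \<phi> (c x) \<partial>M) = (\<integral>x. (\<Sum>v\<in>c ` space M. \<phi> v * indicator (c -` {v} \<inter> space M) x) \<partial>M)"
    using eq by (rule Bochner_Integration.integral_cong[OF refl])
  also have "\<dots> = (\<Sum>v\<in>c ` space M. \<phi> v * prob (c -` {v} \<inter> space M))"
    using i by (simp add: Bochner_Integration.integral_sum Int_assoc)
  finally show "(\<integral>x. \<phi> (c x) \<partial>M) = (\<Sum>v\<in>c ` space M. label_prob c v * \<phi> v)"
    by (simp add: label_prob_def mult.commute)
qed

lemma sum_label_prob: "simple_function M c \<Longrightarrow> (\<Sum>v\<in>c ` space M. label_prob c v) = 1"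
  using integral_label(2)[of c "\<lambda>_. 1"] by (simp add: prob_space)

lemma label_entropy_eq_integral:
  "simple_function M c \<Longrightarrow> label_entropy c = (\<integral>x. - ln (label_prob c (c x)) \<partial>M)"
  unfolding label_entropy_def by (rule integral_label(2)[symmetric])

lemma label_entropy_le:
  assumes c: "simple_function M c"
    and q: "\<And>v. v \<in> c ` space M \<Longrightarrow> 0 \<le> q v" "(\<Sum>v\<in>c ` space M. q v) \<le> 1"
     "\<And>v. v \<in> c ` space M \<Longrightarrow> label_prob c v > 0 \<Longrightarrow> q v > 0"
  shows "label_entropy c \<le> (\<integral>x. - ln (q (c x)) \<partial>M)"
  unfolding label_entropy_def integral_label(2)[OF c, of "\<lambda>v. - ln (q v)"]
  using q sum_label_prob[OF c] label_prob_nonneg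
  by (intro gibbs_inequality simple_functionD(1)[OF c]) auto

lemma AE_label_prob_pos:
  assumes c: "simple_function M c" shows "AE x in M. label_prob c (c x) > 0"
proof -
  define N where "N = (\<Union>v\<in>{v \<in> c ` space M. label_prob c v = 0}. c -` {v} \<inter> space M)"
  have "N \<in> null_sets M"
    unfolding N_def
  proof (rule null_sets_UN')
    show "countable {v \<in> c ` space M. label_prob c v = 0}" using simple_functionD(1)[OF c] by (simp add: countable_finite)
    fix v assume "v \<in> {v \<in> c ` space M. label_prob c v = 0}"
    then show "c -` {v} \<inter> space M \<in> null_sets M"
      using simple_functionD_fibre[OF c, of v] by (auto simp: null_sets_def label_prob_def emeasure_eq_measure)
  qed
  then show ?thesis
  proof (rule AE_I')
    show "{x \<in> space M. \<not> 0 < label_prob c (c x)} \<subseteq> N"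
    proof
      fix x assume "x \<in> {x \<in> space M. \<not> 0 < label_prob c (c x)}"
      then have x: "x \<in> space M" "label_prob c (c x) = 0" using label_prob_nonneg[of c "c x"] by auto
      then show "x \<in> N" unfolding N_def by (intro UN_I[of "c x"]) auto
    qed
  qed
qed

lemma label_prob_compose_ge:
  assumes "simple_function M c" shows "label_prob c v \<le> label_prob (\<lambda>x. g (c x)) (g v)"
  unfolding label_prob_def
  using simple_functionD_fibre[OF simple_function_compose[OF assms, of g], of "g v"]
  by (intro finite_measure_mono) (auto simp: o_def)

lemma label_entropy_compose_le:
  assumes c: "simple_function M c" shows "label_entropy (\<lambda>x. g (c x)) \<le> label_entropy c"
proof -
  have gc: "simple_function M (\<lambda>x. g (c x))" using simple_function_compose[OF c, of g] by (simp add: o_def)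
  show ?thesis unfolding label_entropy_eq_integral[OF gc] label_entropy_eq_integral[OF c]
  proof (rule integral_mono_AE)
    show "integrable M (\<lambda>x. - ln (label_prob (\<lambda>x. g (c x)) (g (c x))))"
      using integral_label(1)[OF gc, of "\<lambda>v. - ln (label_prob (\<lambda>x. g (c x)) v)"] .
    show "integrable M (\<lambda>x. - ln (label_prob c (c x)))"
      using integral_label(1)[OF c, of "\<lambda>v. - ln (label_prob c v)"] .
    show "AE x in M. - ln (label_prob (\<lambda>x. g (c x)) (g (c x))) \<le> - ln (label_prob c (c x))"
      using AE_label_prob_pos[OF c]
    proof eventually_elim
      case (elim x)
      then show ?case using label_prob_compose_ge[OF c, of "c x" g] by simp
    qed
  qed
qed

end

context measure_preserving
begin

definition itinerary :: "('a \<Rightarrow> 'b) \<Rightarrow> nat \<Rightarrow> 'a \<Rightarrow> 'b list" where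
  "itinerary c n x = map (\<lambda>i. c ((T ^^ i) x)) [0..<n]"

lemma itinerary_add: "itinerary c (n + m) x = itinerary c n x @ itinerary c m ((T ^^ n) x)"
  by (rule nth_equalityI) (auto simp: itinerary_def nth_append funpow_add[symmetric, THEN fun_cong, unfolded o_def] add.commute
     simp flip: funpow_add[THEN fun_cong, unfolded o_def])

lemma simple_itinerary:
  assumes c: "simple_function M c" shows "simple_function M (itinerary c n)"
proof (induction n)
  case 0
  have "itinerary c 0 = (\<lambda>_. [])" by (auto simp: itinerary_def)
  then show ?case by simp
next
  case (Suc n)
  have "simple_function M (\<lambda>x. c ((T ^^ n) x))" by (rule simple_function_comp[OF T_power_measurable c])
  from simple_function_Pair[OF Suc this]
  have "simple_function M ((\<lambda>(w, v). w @ [v]) \<circ> (\<lambda>x. (itinerary c n x, c ((T ^^ n) x))))" by (rule simple_function_compose)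
  moreover have "((\<lambda>(w, v). w @ [v]) \<circ> (\<lambda>x. (itinerary c n x, c ((T ^^ n) x)))) = itinerary c (Suc n)"
    by (auto simp: itinerary_def)
  ultimately show ?case by simp
qed

text \<open>Gibbs' inequality for the product of the distributions of the two parts, the second
  of which does not depend on the starting time.\<close>
lemma label_entropy_itinerary_subadd:
  assumes c: "simple_function M c"
  shows "label_entropy (itinerary c (n + m)) \<le> label_entropy (itinerary c n) + label_entropy (itinerary c m)"
proof -
  let ?a = "itinerary c n" and ?b = "itinerary c m" and ?c = "itinerary c (n + m)"
  note sa = simple_itinerary[OF c, of n] and sb = simple_itinerary[OF c, of m] and sc = simple_itinerary[OF c, of "n + m"]
  define q where "q w = label_prob ?a (take n w) * label_prob ?b (drop n w)" for w
  have td: "take n (?c x) = ?a x" "drop n (?c x) = ?b ((T ^^ n) x)" for x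
    unfolding itinerary_add by (auto simp: itinerary_def)
  have invb: "label_prob ?b v = label_prob (\<lambda>x. ?b ((T ^^ n) x)) v" for v
  proof -
    have "indicator (?b -` {v} \<inter> space M) \<in> borel_measurable M" using simple_functionD_fibre[OF sb] by simp
    from integral_T_power[OF this, of n]
    have "prob (?b -` {v} \<inter> space M) = (\<integral>x. indicator (?b -` {v} \<inter> space M) ((T ^^ n) x) \<partial>M)"
      using simple_functionD_fibre[OF sb, of v] by simp
    also have "\<dots> = (\<integral>x. indicator ((\<lambda>x. ?b ((T ^^ n) x)) -` {v} \<inter> space M) x \<partial>M)"
      using T_power_space by (intro Bochner_Integration.integral_cong) (auto simp: indicator_def)
    finally show ?thesis unfolding label_prob_def by simp
  qed
  have sbT: "simple_function M (\<lambda>x. ?b ((T ^^ n) x))" by (rule simple_function_comp[OF T_power_measurable sb])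
  have "label_entropy ?c \<le> (\<integral>x. - ln (q (?c x)) \<partial>M)"
  proof (rule label_entropy_le[OF sc])
    show "0 \<le> q v" for v unfolding q_def by (intro mult_nonneg_nonneg label_prob_nonneg)
    have "(\<Sum>v\<in>?c ` space M. q v) \<le> (\<Sum>a\<in>?a ` space M. label_prob ?a a) * (\<Sum>b\<in>?b ` space M. label_prob ?b b)"
      using simple_functionD(1)[OF sa] simple_functionD(1)[OF sb] label_prob_nonneg T_power_space td
      by (intro sum_split_words_le) (auto simp: q_def)
    also have "\<dots> = 1" by (simp only: sum_label_prob[OF sa] sum_label_prob[OF sb] mult_1)
    finally show "(\<Sum>v\<in>?c ` space M. q v) \<le> 1" .
    fix v assume "v \<in> ?c ` space M" "0 < label_prob ?c v"
    moreover have "label_prob ?c v \<le> label_prob ?a (take n v)"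
      using label_prob_compose_ge[OF sc, of v "take n"] by (simp add: td)
    moreover have "label_prob ?c v \<le> label_prob ?b (drop n v)"
      using label_prob_compose_ge[OF sc, of v "drop n"] unfolding td invb[symmetric] .
    ultimately show "q v > 0" unfolding q_def by (intro mult_pos_pos) auto
  qed
  also have "\<dots> = (\<integral>x. - ln (label_prob ?a (?a x)) + - ln (label_prob ?b (?b ((T ^^ n) x))) \<partial>M)"
  proof (rule integral_cong_AE)
    have m1: "(\<lambda>x. \<phi> (?a x) :: real) \<in> borel_measurable M" for \<phi> using integral_label(1)[OF sa, of \<phi>] by auto
    have m2: "(\<lambda>x. \<phi> (?b ((T ^^ n) x)) :: real) \<in> borel_measurable M" for \<phi> using integral_label(1)[OF sbT, of \<phi>] by auto
    have m3: "(\<lambda>x. \<phi> (?c x) :: real) \<in> borel_measurable M" for \<phi> using integral_label(1)[OF sc, of \<phi>] by auto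
    show "(\<lambda>x. - ln (q (?c x))) \<in> borel_measurable M" by (rule m3)
    show "(\<lambda>x. - ln (label_prob ?a (?a x)) + - ln (label_prob ?b (?b ((T ^^ n) x)))) \<in> borel_measurable M"
      by (intro borel_measurable_add m1 m2)
    show "AE x in M. - ln (q (?c x)) = - ln (label_prob ?a (?a x)) + - ln (label_prob ?b (?b ((T ^^ n) x)))"
      using AE_label_prob_pos[OF sa] AE_label_prob_pos[OF sbT]
    proof eventually_elim
      case (elim x)
      then show ?case unfolding q_def td invb[symmetric] by (simp add: ln_mult)
    qed
  qed
  also have "\<dots> = (\<integral>x. - ln (label_prob ?a (?a x)) \<partial>M) + (\<integral>x. - ln (label_prob ?b (?b ((T ^^ n) x))) \<partial>M)"
    using integral_label(1)[OF sa, of "\<lambda>v. - ln (label_prob ?a v)"] integral_label(1)[OF sbT, of "\<lambda>v. - ln (label_prob ?b v)"]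
    by (rule Bochner_Integration.integral_add)
  also have "(\<integral>x. - ln (label_prob ?b (?b ((T ^^ n) x))) \<partial>M) = (\<integral>x. - ln (label_prob ?b (?b x)) \<partial>M)"
    using integral_label(1)[OF sb, of "\<lambda>v. - ln (label_prob ?b v)"] by (intro integral_T_power[of "\<lambda>x. - ln (label_prob ?b (?b x))"]) auto
  finally show ?thesis unfolding label_entropy_eq_integral[OF sa] label_entropy_eq_integral[OF sb] .
qed

lemma convergent_label_entropy:
  "simple_function M c \<Longrightarrow> convergent (\<lambda>n. label_entropy (itinerary c n) / real n)"
  by (intro fekete_convergent label_entropy_itinerary_subadd label_entropy_nonneg)

definition cell :: "'a set set \<Rightarrow> 'a \<Rightarrow> 'a set" where
  "cell \<xi> x = (THE A. A \<in> \<xi> \<and> x \<in> A)"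

context
  fixes \<xi> assumes \<xi>: "finite_partition M \<xi>"
begin

lemma cell_eq: "x \<in> A \<Longrightarrow> A \<in> \<xi> \<Longrightarrow> cell \<xi> x = A"
  unfolding cell_def
proof (rule the_equality)
  fix B assume "x \<in> A" "A \<in> \<xi>" "B \<in> \<xi> \<and> x \<in> B"
  moreover have "disjoint \<xi>" using \<xi> by (auto simp: finite_partition_def partition_on_def)
  ultimately show "B = A" unfolding disjoint_def by blast
qed simp

lemma cell_in: "x \<in> space M \<Longrightarrow> cell \<xi> x \<in> \<xi> \<and> x \<in> cell \<xi> x"
proof -
  assume "x \<in> space M"
  then obtain A where "A \<in> \<xi>" "x \<in> A" using \<xi> by (auto simp: finite_partition_def partition_on_def)
  then show ?thesis using cell_eq by simp
qed

lemma simple_cell: "simple_function M (cell \<xi>)"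
  unfolding simple_function_def
proof
  have "cell \<xi> ` space M \<subseteq> \<xi>" using cell_in by auto
  then show "finite (cell \<xi> ` space M)" using \<xi> finite_subset unfolding finite_partition_def by blast
  have "cell \<xi> -` {A} \<inter> space M = A" if "A \<in> \<xi>" for A
  proof -
    have "A \<subseteq> space M" using \<xi> that sets.sets_into_space unfolding finite_partition_def by blast
    then show ?thesis using cell_in cell_eq that by blast
  qed
  then show "\<forall>A\<in>cell \<xi> ` space M. cell \<xi> -` {A} \<inter> space M \<in> sets M"
    using cell_in \<xi> unfolding finite_partition_def by auto
qed

text \<open>The cells of the join are the nonempty sets of points with a common itinerary.\<close>
lemma partition_entropy_join: "partition_entropy M (join_partition M T \<xi> n) = label_entropy (itinerary (cell \<xi>) n)"
proof -
  let ?c = "itinerary (cell \<xi>) n"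
  define fib where "fib w = ?c -` {w} \<inter> space M" for w
  have "join_partition M T \<xi> n = fib ` (?c ` space M)"
  proof (intro set_eqI iffI)
    fix B assume "B \<in> join_partition M T \<xi> n"
    then obtain A where A: "B = {x \<in> space M. \<forall>i<n. (T ^^ i) x \<in> A i}" "\<forall>i<n. A i \<in> \<xi>" "B \<noteq> {}"
      unfolding join_partition_def by blast
    have "B = fib (map A [0..<n])"
    proof (rule set_eqI)
      fix x
      have "(\<forall>i<n. (T ^^ i) x \<in> A i) \<longleftrightarrow> ?c x = map A [0..<n]" if "x \<in> space M"
      proof -
        have "(T ^^ i) x \<in> A i \<longleftrightarrow> cell \<xi> ((T ^^ i) x) = A i" if "i < n" for i
          using A(2) that cell_eq cell_in T_power_space[OF \<open>x \<in> space M\<close>] by metis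
        then show ?thesis by (auto simp: itinerary_def)
      qed
      then show "x \<in> B \<longleftrightarrow> x \<in> fib (map A [0..<n])" unfolding A(1) fib_def by auto
    qed
    moreover from this A(3) obtain x where "x \<in> space M" "?c x = map A [0..<n]" by (auto simp: fib_def)
    ultimately show "B \<in> fib ` (?c ` space M)" by (metis imageI)
  next
    fix B assume "B \<in> fib ` (?c ` space M)"
    then obtain x where x: "x \<in> space M" "B = fib (?c x)" by blast
    have "B = {y \<in> space M. \<forall>i<n. (T ^^ i) y \<in> cell \<xi> ((T ^^ i) x)}"
    proof (rule set_eqI)
      fix y
      have "?c y = ?c x \<longleftrightarrow> (\<forall>i<n. (T ^^ i) y \<in> cell \<xi> ((T ^^ i) x))" if "y \<in> space M"
      proof -
        have "(T ^^ i) y \<in> cell \<xi> ((T ^^ i) x) \<longleftrightarrow> cell \<xi> ((T ^^ i) y) = cell \<xi> ((T ^^ i) x)" for i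
          using cell_eq cell_in T_power_space[OF x(1)] T_power_space[OF that] by metis
        then show ?thesis by (auto simp: itinerary_def)
      qed
      then show "y \<in> B \<longleftrightarrow> y \<in> {y \<in> space M. \<forall>i<n. (T ^^ i) y \<in> cell \<xi> ((T ^^ i) x)}"
        unfolding x(2) fib_def by auto
    qed
    moreover have "x \<in> B" unfolding x(2) fib_def using x(1) by simp
    ultimately show "B \<in> join_partition M T \<xi> n"
      unfolding join_partition_def using cell_in T_power_space[OF x(1)] by (auto intro!: exI[of _ "\<lambda>i. cell \<xi> ((T ^^ i) x)"])
  qed
  moreover have "inj_on fib (?c ` space M)" by (rule inj_onI) (auto simp: fib_def)
  ultimately show ?thesis unfolding partition_entropy_def label_entropy_def
    by (simp add: sum.reindex label_prob_def fib_def[symmetric] sum_negf)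
qed

lemma entropy_rate_eq:
  "growth (\<lambda>n. label_entropy (itinerary (cell \<xi>) n)) = ereal (lim (\<lambda>n. partition_entropy M (join_partition M T \<xi> n) / real n))"
  unfolding partition_entropy_join by (intro growth_eq_lim convergent_label_entropy simple_cell)

end

lemma measure_entropy_eq:
  "measure_entropy M T = (SUP \<xi>\<in>{\<xi>. finite_partition M \<xi>}. growth (\<lambda>n. label_entropy (itinerary (cell \<xi>) n)))"
  unfolding measure_entropy_def by (intro SUP_cong) (auto simp: entropy_rate_eq)

lemma finite_partition_fibres:
  assumes c: "simple_function M c" shows "finite_partition M ((\<lambda>v. c -` {v} \<inter> space M) ` (c ` space M))"
  unfolding finite_partition_def
  using simple_functionD[OF c] by (auto simp: partition_on_def disjoint_def)

text \<open>A label is recovered from its cell in the partition into the sets of constant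
  label.\<close>
lemma measure_entropy_ge:
  assumes c: "simple_function M c" shows "growth (\<lambda>n. label_entropy (itinerary c n)) \<le> measure_entropy M T"
proof -
  let ?\<xi> = "(\<lambda>v. c -` {v} \<inter> space M) ` (c ` space M)"
  note part = finite_partition_fibres[OF c]
  have cell: "cell ?\<xi> x = c -` {c x} \<inter> space M" if "x \<in> space M" for x
    using that by (intro cell_eq[OF part]) auto
  define g where "g A = (THE v. \<exists>x\<in>A. v = c x)" for A
  have gc: "g (cell ?\<xi> x) = c x" if "x \<in> space M" for x
    unfolding cell[OF that] g_def using that by (intro the_equality) auto
  have "label_entropy (itinerary c n) \<le> label_entropy (itinerary (cell ?\<xi>) n)" for n
  proof -
    have "label_entropy (itinerary c n) = label_entropy (\<lambda>x. map g (itinerary (cell ?\<xi>) n x))"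
    proof -
      have e: "itinerary c n x = map g (itinerary (cell ?\<xi>) n x)" if "x \<in> space M" for x
        using gc[OF T_power_space[OF that]] by (auto simp: itinerary_def)
      then have "itinerary c n -` {v} \<inter> space M = (\<lambda>x. map g (itinerary (cell ?\<xi>) n x)) -` {v} \<inter> space M" for v by auto
      moreover have "itinerary c n ` space M = (\<lambda>x. map g (itinerary (cell ?\<xi>) n x)) ` space M" using e by auto
      ultimately show ?thesis unfolding label_entropy_def label_prob_def by simp
    qed
    also have "\<dots> \<le> label_entropy (itinerary (cell ?\<xi>) n)"
      by (rule label_entropy_compose_le[OF simple_itinerary[OF simple_cell[OF part]]])
    finally show ?thesis .
  qed
  then have "growth (\<lambda>n. label_entropy (itinerary c n)) \<le> growth (\<lambda>n. label_entropy (itinerary (cell ?\<xi>) n))"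
    by (intro growth_mono_const[where C = 0]) simp
  also have "\<dots> \<le> measure_entropy M T" unfolding measure_entropy_eq using part by (intro SUP_upper) simp
  finally show ?thesis .
qed

end

section \<open>Entropy and integral are bounded by the pressure\<close>

lemma sum_prod_list_lists:
  fixes \<rho> :: "'b \<Rightarrow> real"
  assumes "finite S"
  shows "(\<Sum>es\<in>{es. set es \<subseteq> S \<and> length es = n}. prod_list (map \<rho> es)) = (\<Sum>s\<in>S. \<rho> s) ^ n"
proof (induction n)
  case 0
  have "{es. set es \<subseteq> S \<and> length es = 0} = {[]}" by auto
  then show ?case by simp
next
  case (Suc n)
  let ?L = "{es. set es \<subseteq> S \<and> length es = n}"
  have "inj_on (\<lambda>(xs, s). s # xs) (?L \<times> S)" by (auto simp: inj_on_def)
  then have "(\<Sum>es\<in>{es. set es \<subseteq> S \<and> length es = Suc n}. prod_list (map \<rho> es))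
     = (\<Sum>(xs, s)\<in>?L \<times> S. \<rho> s * prod_list (map \<rho> xs))"
    unfolding lists_length_Suc_eq by (subst sum.reindex) (auto intro!: sum.cong)
  also have "\<dots> = (\<Sum>xs\<in>?L. prod_list (map \<rho> xs)) * (\<Sum>s\<in>S. \<rho> s)"
    unfolding sum_product sum.cartesian_product by (simp add: mult.commute)
  finally show ?case using Suc by simp
qed

context nonempty_subshift
begin

definition partition_sum :: "((nat \<Rightarrow> nat) \<Rightarrow> real) \<Rightarrow> nat \<Rightarrow> real" where
  "partition_sum \<psi> n = (\<Sum>u\<in>words Z n. weight \<psi> u)"

lemma pressure_eq: "pressure Z \<psi> = growth (\<lambda>n. ln (partition_sum \<psi> n))"
proof -
  have "(\<Sum>u\<in>words Z n. SUP x\<in>cyl Z u. exp (birkhoff_sum \<psi> n x)) = partition_sum \<psi> n" for n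
    unfolding partition_sum_def weight_def by (intro sum.cong refl) (auto simp: words_eq)
  then show ?thesis unfolding pressure_def growth_def by simp
qed

lemma partition_sum_pos: "continuous_on Z \<psi> \<Longrightarrow> 0 < partition_sum \<psi> n"
  unfolding partition_sum_def using words_nonempty weight_pos by (intro sum_pos) auto

lemma partition_sum_add:
  assumes F: "continuous_on Z \<psi>"
  shows "partition_sum \<psi> (n + m) \<le> partition_sum \<psi> n * partition_sum \<psi> m"
  unfolding partition_sum_def
proof (rule sum_split_words_le)
  fix u assume u: "u \<in> words Z (n + m)"
  have "take n u @ drop n u \<in> words Z (n + m)" "length (take n u) = n" using u by (auto simp: words_eq)
  from weight_append[OF F this]
  show "take n u \<in> words Z n \<and> drop n u \<in> words Z m \<and> weight \<psi> u \<le> weight \<psi> (take n u) * weight \<psi> (drop n u)" by auto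
qed (use weight_nonneg[OF F] in auto)

lemma simple_letter:
  assumes m: "m \<in> inv_measures Z" shows "simple_function m (\<lambda>x. x 0)"
  unfolding simple_function_def
proof
  have "(\<lambda>x. x 0) ` space m \<subseteq> {1..alphabet_bound}" using Z_letter inv_measures_space[OF m] by auto
  then show "finite ((\<lambda>x. x 0) ` space m)" using finite_subset by blast
  have "{x. P (initial_word 1 x)} \<in> sets borel" for P using open_word_set[of P 1] by simp
  from this[of "\<lambda>w. w ! 0 = a" for a] have "{x. x 0 = a} \<in> sets borel" for a :: nat by (simp add: initial_word_def)
  then have "Z \<inter> {x. x 0 = a} \<in> sets m" for a :: nat
    unfolding inv_measures_sets[OF m] by (auto simp: sets_restrict_space)
  moreover have "(\<lambda>x. x 0) -` {a} \<inter> space m = Z \<inter> {x. x 0 = a}" for a :: nat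
    using inv_measures_space[OF m] by auto
  ultimately show "\<forall>a\<in>(\<lambda>x. x 0) ` space m. (\<lambda>x. x 0) -` {a} \<inter> space m \<in> sets m" by simp
qed

lemma itinerary_letter: "measure_preserving.itinerary shift_map (\<lambda>x. x 0) n x = initial_word n x"
  if "measure_preserving m shift_map" for m
  by (simp add: measure_preserving.itinerary_def[OF that] shift_map_power initial_word_def)

lemma simple_initial_word:
  assumes m: "m \<in> inv_measures Z" shows "simple_function m (initial_word n)"
proof -
  interpret measure_preserving m shift_map by (rule inv_measures_preserving[OF m])
  have "itinerary (\<lambda>x. x 0) n = initial_word n"
    using itinerary_letter[OF measure_preserving_axioms] by blast
  then show ?thesis using simple_itinerary[OF simple_letter[OF m], of n] by simp
qed

lemma word_set_sets:
  assumes m: "m \<in> inv_measures Z" shows "{x\<in>Z. P (initial_word k x)} \<in> sets m"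
proof -
  have "{x\<in>Z. P (initial_word k x)} = Z \<inter> {x. P (initial_word k x)}" by auto
  moreover have "{x. P (initial_word k x)} \<in> sets borel" using open_word_set[of P k] by simp
  ultimately show ?thesis unfolding inv_measures_sets[OF m] by (auto simp: sets_restrict_space)
qed

definition approximable :: "(nat \<Rightarrow> nat) measure \<Rightarrow> (nat \<Rightarrow> nat) set \<Rightarrow> bool" where
  "approximable m A \<longleftrightarrow> A \<in> sets m \<and>
     (\<forall>\<delta>>0. \<exists>k P. measure m ((A - {x\<in>Z. P (initial_word k x)}) \<union> ({x\<in>Z. P (initial_word k x)} - A)) < \<delta>)"

lemma approximable_word_set:
  "m \<in> inv_measures Z \<Longrightarrow> approximable m {x\<in>Z. P (initial_word k x)}"
  unfolding approximable_def using word_set_sets[of m P k] by (auto intro!: exI[of _ k] exI[of _ P])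

lemma approximable_Un:
  assumes m: "m \<in> inv_measures Z" and A: "approximable m A" and B: "approximable m B"
  shows "approximable m (A \<union> B)"
  unfolding approximable_def
proof (intro conjI allI impI)
  interpret measure_preserving m shift_map by (rule inv_measures_preserving[OF m])
  show "A \<union> B \<in> sets m" using A B by (auto simp: approximable_def)
  fix \<delta> :: real assume "\<delta> > 0"
  then have d2: "\<delta> / 2 > 0" by simp
  obtain k P where P: "measure m ((A - {x\<in>Z. P (initial_word k x)}) \<union> ({x\<in>Z. P (initial_word k x)} - A)) < \<delta> / 2"
    using A d2 unfolding approximable_def by blast
  obtain l Q where Q: "measure m ((B - {x\<in>Z. Q (initial_word l x)}) \<union> ({x\<in>Z. Q (initial_word l x)} - B)) < \<delta> / 2"
    using B d2 unfolding approximable_def by blast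
  define R where "R w \<longleftrightarrow> P (take k w) \<or> Q (take l w)" for w
  have tk: "take k (initial_word (max k l) x) = initial_word k x" "take l (initial_word (max k l) x) = initial_word l x" for x :: "nat \<Rightarrow> nat"
    by (auto intro!: nth_equalityI)
  define SA where "SA = (A - {x\<in>Z. P (initial_word k x)}) \<union> ({x\<in>Z. P (initial_word k x)} - A)"
  define SB where "SB = (B - {x\<in>Z. Q (initial_word l x)}) \<union> ({x\<in>Z. Q (initial_word l x)} - B)"
  have sets: "SA \<in> sets m" "SB \<in> sets m"
    unfolding SA_def SB_def using A B word_set_sets[OF m] by (auto simp: approximable_def)
  have "measure m ((A \<union> B - {x\<in>Z. R (initial_word (max k l) x)}) \<union> ({x\<in>Z. R (initial_word (max k l) x)} - (A \<union> B)))
    \<le> measure m (SA \<union> SB)"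
    using sets by (intro finite_measure_mono) (auto simp: SA_def SB_def R_def tk)
  also have "\<dots> \<le> measure m SA + measure m SB" using sets by (rule measure_Un_le)
  also have "\<dots> < \<delta>" using P Q unfolding SA_def SB_def by linarith
  finally show "\<exists>k P. measure m ((A \<union> B - {x\<in>Z. P (initial_word k x)}) \<union> ({x\<in>Z. P (initial_word k x)} - (A \<union> B))) < \<delta>"
    by blast
qed

lemma approximable_UN:
  assumes m: "m \<in> inv_measures Z" and A: "\<And>i::nat. approximable m (A i)"
  shows "approximable m (\<Union>i. A i)"
  unfolding approximable_def
proof (intro conjI allI impI)
  interpret measure_preserving m shift_map by (rule inv_measures_preserving[OF m])
  have As: "A i \<in> sets m" for i using A by (auto simp: approximable_def)
  then show US: "(\<Union>i. A i) \<in> sets m" by blast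
  fix \<delta> :: real assume d: "\<delta> > 0"
  let ?B = "\<lambda>N. \<Union>i<N. A i"
  have ap: "approximable m (?B N)" for N
  proof (induction N)
    case 0
    have "{} = {x\<in>Z. False}" by simp
    then show ?case using approximable_word_set[OF m, of "\<lambda>_. False"] by simp
  next
    case (Suc N)
    then show ?case using approximable_Un[OF m A Suc, of N] by (simp add: lessThan_Suc)
  qed
  have "(\<lambda>N. measure m (?B N)) \<longlonglongrightarrow> measure m (\<Union>N. ?B N)"
    using As by (intro finite_Lim_measure_incseq) (auto intro!: incseq_SucI simp: lessThan_Suc)
  moreover have "(\<Union>N. ?B N) = (\<Union>i. A i)" by auto
  ultimately have "(\<lambda>N. measure m (?B N)) \<longlonglongrightarrow> measure m (\<Union>i. A i)" by simp
  then have "eventually (\<lambda>N. measure m (?B N) > measure m (\<Union>i. A i) - \<delta>/2) sequentially"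
    using d by (intro order_tendstoD(1)) auto
  then obtain N where N: "measure m (?B N) > measure m (\<Union>i. A i) - \<delta>/2" using eventually_happens by force
  obtain k P where P: "measure m ((?B N - {x\<in>Z. P (initial_word k x)}) \<union> ({x\<in>Z. P (initial_word k x)} - ?B N)) < \<delta> / 2"
    using ap[of N] half_gt_zero[OF d] unfolding approximable_def by blast
  have Bs: "?B N \<in> sets m" using As by auto
  define S where "S = (?B N - {x\<in>Z. P (initial_word k x)}) \<union> ({x\<in>Z. P (initial_word k x)} - ?B N)"
  define R where "R = (\<Union>i. A i) - ?B N"
  have sets: "S \<in> sets m" "R \<in> sets m" unfolding S_def R_def using word_set_sets[OF m] Bs US by auto
  have "measure m (((\<Union>i. A i) - {x\<in>Z. P (initial_word k x)}) \<union> ({x\<in>Z. P (initial_word k x)} - (\<Union>i. A i))) \<le> measure m (R \<union> S)"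
    using sets by (intro finite_measure_mono) (auto simp: R_def S_def)
  also have "\<dots> \<le> measure m R + measure m S" using sets(2,1) by (rule measure_Un_le)
  also have "measure m R = measure m (\<Union>i. A i) - measure m (?B N)"
    unfolding R_def by (rule finite_measure_Diff[OF US Bs]) auto
  also have "measure m (\<Union>i. A i) - measure m (?B N) + measure m S < \<delta>" using N P unfolding S_def by linarith
  finally show "\<exists>k P. measure m (((\<Union>i. A i) - {x\<in>Z. P (initial_word k x)}) \<union> ({x\<in>Z. P (initial_word k x)} - (\<Union>i. A i))) < \<delta>"
    by blast
qed

text \<open>The approximable sets form a \<open>\<sigma>\<close>-algebra, and an open set is a countable union of
  cylinders.\<close>
lemma approximable_sets:
  assumes m: "m \<in> inv_measures Z" and A: "A \<in> sets m"
  shows "approximable m A"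
proof -
  interpret measure_preserving m shift_map by (rule inv_measures_preserving[OF m])
  have sp: "space m = Z" by (rule inv_measures_space[OF m])
  have "approximable m (B \<inter> Z)" if "B \<in> sigma_sets UNIV {S. open S}" for B
    using that
  proof induction
    case (Basic U)
    define P where "P n w \<longleftrightarrow> (\<forall>z. initial_word n z = w \<longrightarrow> z \<in> U)" for n w
    have "U \<inter> Z = (\<Union>n. {x\<in>Z. P n (initial_word n x)})"
    proof (intro equalityI subsetI)
      fix x assume x: "x \<in> U \<inter> Z"
      then obtain n where "{z. initial_word n z = initial_word n x} \<subseteq> U"
        using open_contains_cylinder[of U x] Basic by auto
      then have "P n (initial_word n x)" unfolding P_def by blast
      then show "x \<in> (\<Union>n. {x\<in>Z. P n (initial_word n x)})" using x by blast
    qed (auto simp: P_def)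
    then show ?case using approximable_UN[OF m approximable_word_set[OF m]] by simp
  next
    case Empty
    show ?case using approximable_word_set[OF m, of "\<lambda>_. False" 0] by simp
  next
    case (Compl B)
    show ?case unfolding approximable_def
    proof (intro conjI allI impI)
      have e: "(UNIV - B) \<inter> Z = space m - (B \<inter> Z)" using sp by auto
      show "(UNIV - B) \<inter> Z \<in> sets m" unfolding e using Compl.IH by (auto simp: approximable_def)
      fix \<delta> :: real assume "\<delta> > 0"
      then obtain k P where P: "measure m ((B \<inter> Z - {x\<in>Z. P (initial_word k x)}) \<union> ({x\<in>Z. P (initial_word k x)} - (B \<inter> Z))) < \<delta>"
        using Compl.IH unfolding approximable_def by blast
      have "((UNIV - B) \<inter> Z - {x\<in>Z. \<not> P (initial_word k x)}) \<union> ({x\<in>Z. \<not> P (initial_word k x)} - (UNIV - B) \<inter> Z)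
        = (B \<inter> Z - {x\<in>Z. P (initial_word k x)}) \<union> ({x\<in>Z. P (initial_word k x)} - (B \<inter> Z))" by auto
      then show "\<exists>k P. measure m (((UNIV - B) \<inter> Z - {x\<in>Z. P (initial_word k x)}) \<union> ({x\<in>Z. P (initial_word k x)} - (UNIV - B) \<inter> Z)) < \<delta>"
        using P by (intro exI[of _ k] exI[of _ "\<lambda>w. \<not> P w"]) simp
    qed
  next
    case (Union B)
    have "(\<Union>i. B i) \<inter> Z = (\<Union>i. B i \<inter> Z)" by auto
    then show ?case using approximable_UN[OF m, of "\<lambda>i. B i \<inter> Z"] Union.IH by simp
  qed
  moreover obtain B where "B \<in> sets borel" "A = B \<inter> Z"
    using A unfolding inv_measures_sets[OF m] sets_restrict_space by auto
  moreover have "sets borel = sigma_sets UNIV {S :: (nat \<Rightarrow> nat) set. open S}" by (simp add: borel_def)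
  ultimately show ?thesis by auto
qed

text \<open>The left-hand side bounds the mean code length of a symbol that is exceptional with
  probability \<open>\<delta>\<close> and then takes one of \<open>exp L\<close> values.\<close>
lemma exists_error_level:
  fixes L \<eta> :: real
  assumes "\<eta> > 0"
  obtains \<delta> where "0 < \<delta>" "\<delta> < 1" "- ln (1 - \<delta>) + \<delta> * (L - ln \<delta>) < \<eta>"
proof -
  have "((\<lambda>\<delta>. - ln (1 - \<delta>) + \<delta> * (L - ln \<delta>)) \<longlongrightarrow> 0) (at_right (0::real))" by real_asymp
  then have "eventually (\<lambda>\<delta>. - ln (1 - \<delta>) + \<delta> * (L - ln \<delta>) < \<eta>) (at_right 0)"
    using assms by (rule order_tendstoD(2))
  moreover have "eventually (\<lambda>\<delta>. 0 < \<delta> \<and> \<delta> < (1::real)) (at_right 0)"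
    by (auto simp: eventually_at_right_field intro: exI[of _ 1])
  ultimately have "eventually (\<lambda>\<delta>. 0 < \<delta> \<and> \<delta> < 1 \<and> - ln (1 - \<delta>) + \<delta> * (L - ln \<delta>) < \<eta>) (at_right 0)"
    by eventually_elim auto
  then have "\<exists>\<delta>. 0 < \<delta> \<and> \<delta> < 1 \<and> - ln (1 - \<delta>) + \<delta> * (L - ln \<delta>) < \<eta>"
    using eventually_happens'[OF trivial_limit_at_right_real] by fast
  then show ?thesis using that by blast
qed

text \<open>The itinerary of \<open>x\<close> through a partition \<open>\<xi>\<close> is recovered from an initial word of \<open>x\<close> and from a
  list of corrections, most of which are \<^const>\<open>None\<close>. Gibbs' inequality is applied to the product of
  the weights of the words with independent weights of the corrections.\<close>
lemma itinerary_entropy_le: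
  assumes m: "m \<in> inv_measures Z" and \<psi>: "continuous_on Z \<psi>" and \<xi>: "finite_partition m \<xi>" and e: "\<eta> > 0"
  shows "\<exists>C. \<forall>n. prob_space.label_entropy m (measure_preserving.itinerary shift_map (measure_preserving.cell \<xi>) n)
     \<le> ln (partition_sum \<psi> n) - (\<integral>x. \<psi> x \<partial>m) * real n + \<eta> * real n + C"
proof -
  interpret measure_preserving m shift_map by (rule inv_measures_preserving[OF m])
  have sp: "space m = Z" by (rule inv_measures_space[OF m])
  define c where "c = cell \<xi>"
  have sc: "simple_function m c" unfolding c_def by (rule simple_cell[OF \<xi>])
  have fin: "finite \<xi>" using \<xi> by (simp add: finite_partition_def)
  have cin: "c x \<in> \<xi>" "x \<in> c x" if "x \<in> Z" for x using cell_in[OF \<xi>] that sp by (auto simp: c_def)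
  have ceq: "c x = A" if "x \<in> A" "A \<in> \<xi>" for x A unfolding c_def using cell_eq[OF \<xi> that] .
  have "\<xi> \<noteq> {}" using cin Z_nonempty by auto
  define r where "r = real (card \<xi>)"
  have r: "r \<ge> 1" using \<open>\<xi> \<noteq> {}\<close> fin by (simp add: r_def Suc_le_eq card_gt_0_iff)
  obtain \<delta> where d: "0 < \<delta>" "\<delta> < 1" "- ln (1 - \<delta>) + \<delta> * (ln r - ln \<delta>) < \<eta>"
    using exists_error_level[OF e] by metis
  have "\<forall>A\<in>\<xi>. \<exists>k P. measure m ((A - {x\<in>Z. P (initial_word k x)}) \<union> ({x\<in>Z. P (initial_word k x)} - A)) < \<delta> / r"
  proof
    fix A assume "A \<in> \<xi>"
    then have "approximable m A" using \<xi> by (intro approximable_sets[OF m]) (auto simp: finite_partition_def)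
    moreover have "\<delta> / r > 0" using d(1) r by simp
    ultimately show "\<exists>k P. measure m ((A - {x\<in>Z. P (initial_word k x)}) \<union> ({x\<in>Z. P (initial_word k x)} - A)) < \<delta> / r"
      unfolding approximable_def by blast
  qed
  from bchoice[OF this] obtain kk where "\<forall>A\<in>\<xi>. \<exists>P. measure m ((A - {x\<in>Z. P (initial_word (kk A) x)}) \<union> ({x\<in>Z. P (initial_word (kk A) x)} - A)) < \<delta> / r" ..
  from bchoice[OF this] obtain PP where PP0: "\<forall>A\<in>\<xi>. measure m ((A - {x\<in>Z. PP A (initial_word (kk A) x)}) \<union> ({x\<in>Z. PP A (initial_word (kk A) x)} - A)) < \<delta> / r" ..
  have PP: "\<And>A. A \<in> \<xi> \<Longrightarrow>
     measure m ((A - {x\<in>Z. PP A (initial_word (kk A) x)}) \<union> ({x\<in>Z. PP A (initial_word (kk A) x)} - A)) < \<delta> / r"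
    using PP0 by (rule bspec)
  define k where "k = Max (kk ` \<xi>)"
  \<comment> \<open>The cell guessed from the first \<open>k\<close> letters. The choice is arbitrary if no cell
    fits, but then \<open>x\<close> is one of the exceptional points in \<open>D (c x)\<close>.\<close>
  define b where "b w = (SOME A. A \<in> \<xi> \<and> PP A (take (kk A) w))" for w
  define D where "D A = (A - {x\<in>Z. PP A (initial_word (kk A) x)}) \<union> ({x\<in>Z. PP A (initial_word (kk A) x)} - A)" for A
  have Ds: "D A \<in> sets m" if "A \<in> \<xi>" for A
    using that \<xi> word_set_sets[OF m] unfolding D_def finite_partition_def by auto
  have tk: "take (kk A) (initial_word k x) = initial_word (kk A) x" if "A \<in> \<xi>" for A x
    using Max_ge[of "kk ` \<xi>" "kk A"] fin that unfolding k_def[symmetric] by (intro nth_equalityI) auto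
  define err where "err x = (if b (initial_word k x) = c x then None else Some (c x))" for x
  have serr: "simple_function m err"
  proof -
    have "simple_function m ((\<lambda>(w, A). if b w = A then None else Some A) \<circ> (\<lambda>x. (initial_word k x, c x)))"
      by (intro simple_function_compose simple_function_Pair simple_initial_word[OF m] sc)
    moreover have "((\<lambda>(w, A). if b w = A then None else Some A) \<circ> (\<lambda>x. (initial_word k x, c x))) = err"
      by (auto simp: err_def)
    ultimately show ?thesis by simp
  qed
  have err_sub: "{x\<in>Z. err x \<noteq> None} \<subseteq> (\<Union>A\<in>\<xi>. D A)"
  proof safe
    fix x y assume x: "x \<in> Z" "err x = Some y"
    then have ne: "b (initial_word k x) \<noteq> c x" by (auto simp: err_def split: if_splits)
    show "x \<in> (\<Union>A\<in>\<xi>. D A)"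
    proof (cases "\<exists>A. A \<in> \<xi> \<and> PP A (take (kk A) (initial_word k x))")
      case True
      define B where "B = b (initial_word k x)"
      have B: "B \<in> \<xi>" "PP B (take (kk B) (initial_word k x))"
        using someI_ex[OF True] unfolding B_def b_def by auto
      have "x \<notin> B" using ceq[OF _ B(1)] ne unfolding B_def by auto
      then have "x \<in> D B" using B x(1) tk[OF B(1), of x] by (simp add: D_def)
      then show ?thesis using B(1) by blast
    next
      case False
      then have "x \<in> D (c x)" using cin[OF x(1)] tk[of "c x" x] by (auto simp: D_def)
      then show ?thesis using cin[OF x(1)] by blast
    qed
  qed
  have err_sets: "{x\<in>Z. err x \<noteq> None} \<in> sets m"
  proof -
    have "{x\<in>Z. err x \<noteq> None} = space m - (err -` {None} \<inter> space m)" using sp by auto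
    then show ?thesis using simple_functionD(2)[OF serr, of "{None}"] by simp
  qed
  have perr: "prob {x\<in>Z. err x \<noteq> None} \<le> \<delta>"
  proof -
    have "prob {x\<in>Z. err x \<noteq> None} \<le> prob (\<Union>A\<in>\<xi>. D A)"
      using err_sub Ds fin by (intro finite_measure_mono) auto
    also have "\<dots> \<le> (\<Sum>A\<in>\<xi>. prob (D A))" using Ds fin by (intro finite_measure_subadditive_finite) auto
    also have "\<dots> \<le> (\<Sum>A\<in>\<xi>. \<delta> / r)" using PP by (intro sum_mono less_imp_le) (simp add: D_def)
    also have "\<dots> = \<delta>" using r by (simp add: r_def)
    finally show ?thesis .
  qed
  \<comment> \<open>The weights of the single corrections; there are \<open>r\<close> possible ones.\<close>
  define \<rho> where "\<rho> v = (case v of None \<Rightarrow> 1 - \<delta> | Some (_ :: (nat \<Rightarrow> nat) set) \<Rightarrow> \<delta> / r)" for v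
  have \<rho>pos: "\<rho> v > 0" for v using d r by (auto simp: \<rho>_def split: option.split)
  define S where "S = insert None (Some ` \<xi>)"
  have finS: "finite S" using fin by (simp add: S_def)
  have sumS: "(\<Sum>s\<in>S. \<rho> s) = 1"
    unfolding S_def using fin r by (subst sum.insert) (auto simp: sum.reindex \<rho>_def r_def)
  have errS: "err x \<in> S" if "x \<in> Z" for x using cin[OF that] by (auto simp: err_def S_def)
  define E where "E = (\<integral>x. - ln (\<rho> (err x)) \<partial>m)"
  have E: "E \<le> \<eta>"
  proof -
    have "E \<le> (\<integral>x. - ln (1 - \<delta>) + (ln r - ln \<delta>) * indicator {x\<in>Z. err x \<noteq> None} x \<partial>m)"
      unfolding E_def
    proof (rule integral_mono)
      show "integrable m (\<lambda>x. - ln (\<rho> (err x)))" using integral_label(1)[OF serr, of "\<lambda>v. - ln (\<rho> v)"] .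
      show "integrable m (\<lambda>x. - ln (1 - \<delta>) + (ln r - ln \<delta>) * indicator {x\<in>Z. err x \<noteq> None} x)"
        using err_sets by (intro Bochner_Integration.integrable_add integrable_mult_right integrable_const integrable_real_indicator)
           (auto simp: emeasure_eq_measure)
      fix x assume "x \<in> space m"
      then show "- ln (\<rho> (err x)) \<le> - ln (1 - \<delta>) + (ln r - ln \<delta>) * indicator {x\<in>Z. err x \<noteq> None} x"
        using d r sp by (auto simp: \<rho>_def ln_div split: option.split)
    qed
    also have "\<dots> = - ln (1 - \<delta>) + (ln r - ln \<delta>) * prob {x\<in>Z. err x \<noteq> None}"
      using err_sets sets.sets_into_space[OF err_sets]
      by (subst Bochner_Integration.integral_add) (auto simp: prob_space emeasure_eq_measure Int_absorb2)
    also have "(ln r - ln \<delta>) * prob {x\<in>Z. err x \<noteq> None} \<le> (ln r - ln \<delta>) * \<delta>"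
      using perr d r by (intro mult_left_mono) (auto simp: ln_le_zero_iff intro: order_trans[of _ 0])
    also have "- ln (1 - \<delta>) + (ln r - ln \<delta>) * \<delta> \<le> \<eta>" using d(3) by (simp add: mult.commute)
    finally show ?thesis by simp
  qed
  define I where "I = (\<integral>x. \<psi> x \<partial>m)"
  have main: "label_entropy (itinerary c n) \<le> ln (partition_sum \<psi> n) - I * real n + \<eta> * real n + (ln (partition_sum \<psi> k) + \<bar>I\<bar> * real k)" for n
  proof -
    \<comment> \<open>With \<open>k\<close> additional letters the guess can be made at each of the \<open>n\<close>
      positions.\<close>
    define J where "J x = (initial_word (n + k) x, itinerary err n x)" for x
    have sJ: "simple_function m J" unfolding J_def[abs_def]
      by (intro simple_function_Pair simple_initial_word[OF m] simple_itinerary[OF serr])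
    define g where "g = (\<lambda>(w, es). map (\<lambda>i. case es ! i of None \<Rightarrow> b (take k (drop i w)) | Some A \<Rightarrow> A) [0..<n])"
    have "itinerary c n x = g (J x)" for x
    proof -
      have "c ((shift_map ^^ i) x) = (case itinerary err n x ! i of None \<Rightarrow> b (take k (drop i (initial_word (n + k) x))) | Some A \<Rightarrow> A)"
        if i: "i < n" for i
      proof -
        have "take k (drop i (initial_word (n + k) x)) = initial_word k ((shift_map ^^ i) x)"
          using i by (intro nth_equalityI) (auto simp: shift_map_power)
        then show ?thesis using i by (auto simp: itinerary_def err_def split: option.split)
      qed
      then show ?thesis by (auto simp: g_def J_def itinerary_def)
    qed
    then have "itinerary c n = (\<lambda>x. g (J x))" by blast
    then have "label_entropy (itinerary c n) \<le> label_entropy J" using label_entropy_compose_le[OF sJ, of g] by simp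
    also have "\<dots> \<le> (\<integral>x. - ln ((\<lambda>(w, es). weight \<psi> w / partition_sum \<psi> (n + k) * prod_list (map \<rho> es)) (J x)) \<partial>m)"
    proof (rule label_entropy_le[OF sJ])
      let ?q = "\<lambda>(w, es). weight \<psi> w / partition_sum \<psi> (n + k) * prod_list (map \<rho> es)"
      let ?L = "{es. set es \<subseteq> S \<and> length es = n}"
      have plp: "prod_list (map \<rho> es) > 0" for es by (induction es) (use \<rho>pos in auto)
      have im: "J ` space m \<subseteq> words Z (n + k) \<times> ?L"
        using errS Z_shift sp by (auto simp: J_def words_eq itinerary_def)
      have qpos: "?q v > 0" if "v \<in> words Z (n + k) \<times> ?L" for v
        using that plp partition_sum_pos[OF \<psi>, of "n + k"] weight_pos[OF \<psi>] by (auto intro!: mult_pos_pos divide_pos_pos)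
      show "0 < ?q v" if "v \<in> J ` space m" for v by (rule qpos[OF subsetD[OF im that]])
      show "0 \<le> ?q v" if "v \<in> J ` space m" for v by (rule less_imp_le[OF qpos[OF subsetD[OF im that]]])
      have finL: "finite ?L" using finS finite_lists_length_eq by blast
      have "(\<Sum>v\<in>J ` space m. ?q v) \<le> (\<Sum>v\<in>words Z (n + k) \<times> ?L. ?q v)"
        using im finL less_imp_le[OF qpos] by (intro sum_mono2) auto
      also have "\<dots> = (\<Sum>w\<in>words Z (n + k). weight \<psi> w / partition_sum \<psi> (n + k)) * (\<Sum>es\<in>?L. prod_list (map \<rho> es))"
        unfolding sum_product sum.cartesian_product ..
      also have "(\<Sum>w\<in>words Z (n + k). weight \<psi> w / partition_sum \<psi> (n + k)) = 1"
        using partition_sum_pos[OF \<psi>, of "n + k"] by (simp add: partition_sum_def flip: sum_divide_distrib)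
      also have "(\<Sum>es\<in>?L. prod_list (map \<rho> es)) = 1" unfolding sum_prod_list_lists[OF finS] sumS by simp
      finally show "(\<Sum>v\<in>J ` space m. ?q v) \<le> 1" by simp
    qed
    also have "\<dots> \<le> (\<integral>x. (ln (partition_sum \<psi> n) + ln (partition_sum \<psi> k)) - birkhoff_sum \<psi> (n + k) x + (\<Sum>i<n. - ln (\<rho> (err ((shift_map ^^ i) x)))) \<partial>m)"
    proof (rule integral_mono)
      show "integrable m (\<lambda>x. - ln ((\<lambda>(w, es). weight \<psi> w / partition_sum \<psi> (n + k) * prod_list (map \<rho> es)) (J x)))"
        using integral_label(1)[OF sJ, of "\<lambda>v. - ln ((\<lambda>(w, es). weight \<psi> w / partition_sum \<psi> (n + k) * prod_list (map \<rho> es)) v)"] .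
      have "integrable m (\<lambda>x. - ln (\<rho> (err ((shift_map ^^ i) x))))" for i
        using integral_label(1)[OF simple_function_comp[OF T_power_measurable serr], of "\<lambda>v. - ln (\<rho> v)"] .
      then show "integrable m (\<lambda>x. (ln (partition_sum \<psi> n) + ln (partition_sum \<psi> k)) - birkhoff_sum \<psi> (n + k) x + (\<Sum>i<n. - ln (\<rho> (err ((shift_map ^^ i) x)))))"
        using continuous_integrable[OF m continuous_birkhoff_sum[OF \<psi>]]
        by (intro Bochner_Integration.integrable_add Bochner_Integration.integrable_diff Bochner_Integration.integrable_sum integrable_const) auto
      fix x assume x: "x \<in> space m"
      have pl: "ln (prod_list (map \<rho> (itinerary err n x))) = (\<Sum>i<n. ln (\<rho> (err ((shift_map ^^ i) x))))" for n
      proof (induction n)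
        case (Suc n)
        have "prod_list (map \<rho> (itinerary err n x)) > 0"
          unfolding itinerary_def by (induction n) (use \<rho>pos in auto)
        moreover have "itinerary err (Suc n) x = itinerary err n x @ [err ((shift_map ^^ n) x)]" by (simp add: itinerary_def)
        moreover have "\<rho> (err ((shift_map ^^ n) x)) \<noteq> 0" using \<rho>pos by (metis less_irrefl)
        ultimately show ?case using Suc \<rho>pos by (simp add: ln_mult)
      qed (simp add: itinerary_def)
      have plp: "prod_list (map \<rho> es) > 0" for es by (induction es) (use \<rho>pos in auto)
      have w: "exp (birkhoff_sum \<psi> (n + k) x) \<le> weight \<psi> (initial_word (n + k) x)"
        using weight_upper[OF \<psi>] x sp by simp
      then have wp: "weight \<psi> (initial_word (n + k) x) > 0" by (meson exp_gt_zero order_less_le_trans)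
      have "birkhoff_sum \<psi> (n + k) x \<le> ln (weight \<psi> (initial_word (n + k) x))" using w wp by (simp add: ln_ge_iff)
      moreover have "ln (partition_sum \<psi> (n + k)) \<le> ln (partition_sum \<psi> n * partition_sum \<psi> k)"
        using partition_sum_add[OF \<psi>] partition_sum_pos[OF \<psi>] by simp
      moreover have "ln (partition_sum \<psi> n * partition_sum \<psi> k) = ln (partition_sum \<psi> n) + ln (partition_sum \<psi> k)"
        using partition_sum_pos[OF \<psi>, of n] partition_sum_pos[OF \<psi>, of k] by (simp add: ln_mult)
      ultimately show "- ln ((\<lambda>(w, es). weight \<psi> w / partition_sum \<psi> (n + k) * prod_list (map \<rho> es)) (J x))
         \<le> (ln (partition_sum \<psi> n) + ln (partition_sum \<psi> k)) - birkhoff_sum \<psi> (n + k) x + (\<Sum>i<n. - ln (\<rho> (err ((shift_map ^^ i) x))))"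
        using wp plp[of "itinerary err n x"] partition_sum_pos[OF \<psi>, of "n + k"] pl[of n]
        by (simp add: J_def ln_mult ln_div sum_negf)
    qed
    also have "\<dots> = ln (partition_sum \<psi> n) + ln (partition_sum \<psi> k) - real (n + k) * I + real n * E"
    proof -
      have i1: "integrable m (\<lambda>x. - ln (\<rho> (err ((shift_map ^^ i) x))))" for i
        using integral_label(1)[OF simple_function_comp[OF T_power_measurable serr], of "\<lambda>v. - ln (\<rho> v)"] .
      have i2: "(\<integral>x. - ln (\<rho> (err ((shift_map ^^ i) x))) \<partial>m) = E" for i
        unfolding E_def using integral_label(1)[OF serr, of "\<lambda>v. - ln (\<rho> v)"]
        by (intro integral_T_power[of "\<lambda>x. - ln (\<rho> (err x))"]) auto
      have i3: "integrable m (birkhoff_sum \<psi> (n + k))" by (rule continuous_integrable[OF m continuous_birkhoff_sum[OF \<psi>]])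
      have i4: "(\<integral>x. (\<Sum>i<n. - ln (\<rho> (err ((shift_map ^^ i) x)))) \<partial>m) = real n * E"
        unfolding Bochner_Integration.integral_sum[OF i1] i2 by simp
      have i5: "integrable m (\<lambda>x. \<Sum>i<n. - ln (\<rho> (err ((shift_map ^^ i) x))))"
        by (intro Bochner_Integration.integrable_sum i1)
      show ?thesis using i3 i5 unfolding I_def
        by (simp add: Bochner_Integration.integral_add[OF _ i5] Bochner_Integration.integral_diff[OF _ i3] i4 integral_birkhoff_sum[OF m \<psi>] prob_space)
    qed
    also have "\<dots> \<le> ln (partition_sum \<psi> n) - I * real n + \<eta> * real n + (ln (partition_sum \<psi> k) + \<bar>I\<bar> * real k)"
    proof -
      have "real n * E \<le> \<eta> * real n" using mult_right_mono[OF E, of "real n"] by (simp add: mult.commute)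
      moreover have "- (real k * I) \<le> \<bar>I\<bar> * real k" by (metis abs_ge_minus_self mult.commute mult_minus_right mult_left_mono of_nat_0_le_iff)
      ultimately show ?thesis by (simp add: algebra_simps)
    qed
    finally show ?thesis .
  qed
  then show ?thesis unfolding c_def I_def by blast
qed

text \<open>One half of the variational principle.\<close>
theorem free_energy_le_pressure:
  assumes m: "m \<in> inv_measures Z" and \<psi>: "continuous_on Z \<psi>"
  shows "measure_entropy m shift_map + ereal (\<integral>x. \<psi> x \<partial>m) \<le> pressure Z \<psi>"
proof -
  interpret measure_preserving m shift_map by (rule inv_measures_preserving[OF m])
  define I where "I = (\<integral>x. \<psi> x \<partial>m)"
  have "measure_entropy m shift_map \<le> growth (\<lambda>n. ln (partition_sum \<psi> n)) + ereal (- I)"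
    unfolding measure_entropy_eq
  proof (rule SUP_least)
    fix \<xi> assume "\<xi> \<in> {\<xi>. finite_partition m \<xi>}"
    then have \<xi>: "finite_partition m \<xi>" by simp
    show "growth (\<lambda>n. label_entropy (itinerary (cell \<xi>) n)) \<le> growth (\<lambda>n. ln (partition_sum \<psi> n)) + ereal (- I)"
      unfolding growth_add_linear[symmetric]
    proof (rule growth_mono)
      fix \<epsilon> :: real assume "\<epsilon> > 0"
      from itinerary_entropy_le[OF m \<psi> \<xi> this]
      show "\<exists>C. \<forall>n. label_entropy (itinerary (cell \<xi>) n) \<le> ln (partition_sum \<psi> n) + - I * real n + \<epsilon> * real n + C"
        unfolding I_def by (simp add: algebra_simps)
    qed
  qed
  then have "measure_entropy m shift_map + ereal I \<le> growth (\<lambda>n. ln (partition_sum \<psi> n)) + ereal (- I) + ereal I"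
    by (rule add_right_mono)
  also have "\<dots> = growth (\<lambda>n. ln (partition_sum \<psi> n))" by (cases "growth (\<lambda>n. ln (partition_sum \<psi> n))") auto
  finally show ?thesis unfolding pressure_eq I_def .
qed

end

section \<open>Measures on free concatenations and the variational principle\<close>

lemma (in prob_space) label_entropy_superset:
  assumes "finite S" "c ` space M \<subseteq> S"
  shows "label_entropy c = (\<Sum>v\<in>S. label_prob c v * - ln (label_prob c v))"
  unfolding label_entropy_def
proof (rule sum.mono_neutral_left[OF assms])
  show "\<forall>v\<in>S - c ` space M. label_prob c v * - ln (label_prob c v) = 0"
  proof
    fix v assume "v \<in> S - c ` space M"
    then have "c -` {v} \<inter> space M = {}" by auto
    then show "label_prob c v * - ln (label_prob c v) = 0" by (simp add: label_prob_def)
  qed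
qed

text \<open>A finite set of blocks with positive weights \<open>P\<close> is the distribution of a sequence of
  independent blocks; the concatenated sequence, shifted by a uniform phase, is stationary.\<close>
locale free_concatenation = nonempty_subshift Z for Z +
  fixes W :: "nat list set" and p :: nat and P :: "nat list \<Rightarrow> real"
  assumes W_finite: "finite W" and p: "p \<ge> 1" and W_length: "\<And>w. w \<in> W \<Longrightarrow> length w = p"
    and concat_in: "\<And>B. (\<And>q. B q \<in> W) \<Longrightarrow> concat_point p B \<in> Z"
    and P_pos: "\<And>w. w \<in> W \<Longrightarrow> P w > 0" and P_sum: "(\<Sum>w\<in>W. P w) = 1"
begin

definition block_law :: "nat list measure" where
  "block_law = point_measure W (\<lambda>w. ennreal (P w))"

lemma block_law_space: "space block_law = W" and block_law_sets: "sets block_law = Pow W"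
  by (auto simp: block_law_def space_point_measure sets_point_measure)

lemma prob_block_law: "prob_space block_law"
proof
  have "emeasure block_law W = (\<Sum>w\<in>W. ennreal (P w))"
    unfolding block_law_def using W_finite by (simp add: emeasure_point_measure_finite)
  also have "\<dots> = ennreal (\<Sum>w\<in>W. P w)" using P_pos by (intro sum_ennreal) (auto intro: less_imp_le)
  finally show "emeasure block_law (space block_law) = 1" by (simp add: P_sum block_law_space)
qed

lemma measure_block_law: "w \<in> W \<Longrightarrow> measure block_law {w} = P w"
  unfolding block_law_def using W_finite P_pos
  by (simp add: Sigma_Algebra.measure_def emeasure_point_measure_finite less_imp_le)

lemma integral_block_law: "(\<integral>w. \<phi> w \<partial>block_law) = (\<Sum>w\<in>W. P w * \<phi> w :: real)"
  unfolding block_law_def using W_finite P_pos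
  by (subst lebesgue_integral_point_measure_finite) (auto intro: less_imp_le)

definition block_seq :: "(nat \<Rightarrow> nat list) measure" where
  "block_seq = PiM UNIV (\<lambda>_. block_law)"

sublocale blocks: product_prob_space "\<lambda>_::nat. block_law" UNIV
  using prob_block_law by (auto simp: product_prob_space_def product_prob_space_axioms_def product_sigma_finite_def
     intro: prob_space_imp_sigma_finite)

lemma prob_block_seq: "prob_space block_seq"
  unfolding block_seq_def by (rule prob_space_PiM) (rule prob_block_law)

lemma block_seq_space: "space block_seq = {B. \<forall>q. B q \<in> W}"
  by (auto simp: block_seq_def space_PiM block_law_space PiE_iff)

lemma block_component [measurable]: "(\<lambda>B. B q) \<in> measurable block_seq block_law"
  unfolding block_seq_def by (rule measurable_component_singleton) simp

lemma block_component_fun: "(\<lambda>B. \<phi> (B q)) \<in> measurable block_seq (borel :: 'b::topological_space measure)"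
proof -
  have "\<phi> \<in> measurable block_law borel" by (auto simp: measurable_def block_law_sets block_law_space)
  from measurable_compose[OF block_component this] show ?thesis .
qed

lemma integral_block_component: "(\<integral>B. \<phi> (B q) \<partial>block_seq) = (\<Sum>w\<in>W. P w * \<phi> w :: real)"
proof -
  have "\<phi> \<in> borel_measurable block_law" by (auto simp: measurable_def block_law_sets block_law_space)
  then have "(\<integral>B. \<phi> (B q) \<partial>block_seq) = (\<integral>w. \<phi> w \<partial>distr block_seq block_law (\<lambda>B. B q))"
    by (intro integral_distr[symmetric]) simp_all
  also have "distr block_seq block_law (\<lambda>B. B q) = block_law"
    unfolding block_seq_def by (rule blocks.PiM_component) simp
  finally show ?thesis by (simp add: integral_block_law)
qed

lemma block_seq_shift: "distr block_seq block_seq (\<lambda>B q. B (Suc q)) = block_seq"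
  using distr_PiM_reindex[of UNIV "\<lambda>_. block_law" Suc UNIV] prob_block_law
  by (simp add: block_seq_def restrict_def)

lemma coordinate_measurable: "(\<lambda>B. (shift_map ^^ j) (concat_point p B)) \<in> measurable block_seq (restrict_space borel Z)"
proof (rule measurable_restrict_space2)
  show "(\<lambda>B. (shift_map ^^ j) (concat_point p B)) \<in> space block_seq \<rightarrow> Z"
    using concat_in Z_shift by (auto simp: block_seq_space)
  show "(\<lambda>B. (shift_map ^^ j) (concat_point p B)) \<in> borel_measurable block_seq"
  proof (rule measurable_coordinatewise_then_product)
    fix i
    show "(\<lambda>B. (shift_map ^^ j) (concat_point p B) i) \<in> borel_measurable block_seq"
      unfolding shift_map_power concat_point_def by (rule block_component_fun)
  qed
qed

definition phase :: "nat measure" where "phase = uniform_count_measure {..<p}"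

lemma prob_phase: "prob_space phase"
  unfolding phase_def using p by (intro prob_space_uniform_count_measure) (auto simp: lessThan_empty_iff)

definition point_of :: "nat \<times> (nat \<Rightarrow> nat list) \<Rightarrow> nat \<Rightarrow> nat" where
  "point_of = (\<lambda>(j, B). (shift_map ^^ j) (concat_point p B))"

lemma point_of_measurable: "point_of \<in> measurable (phase \<Otimes>\<^sub>M block_seq) (restrict_space borel Z)"
proof -
  have "point_of \<in> measurable (count_space {..<p} \<Otimes>\<^sub>M block_seq) (restrict_space borel Z)"
    by (rule measurable_pair_measure_countable1) (auto simp: point_of_def coordinate_measurable)
  moreover have "sets (phase \<Otimes>\<^sub>M block_seq) = sets (count_space {..<p} \<Otimes>\<^sub>M block_seq)"
    by (intro sets_pair_measure_cong) (auto simp: phase_def sets_uniform_count_measure)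
  ultimately show ?thesis using measurable_cong_sets by blast
qed

definition stationary :: "(nat \<Rightarrow> nat) measure" where
  "stationary = distr (phase \<Otimes>\<^sub>M block_seq) (restrict_space borel Z) point_of"

lemma prob_stationary: "prob_space stationary"
proof -
  interpret A: prob_space phase by (rule prob_phase)
  interpret B: prob_space block_seq by (rule prob_block_seq)
  interpret pair_prob_space phase block_seq ..
  show ?thesis unfolding stationary_def by (rule prob_space_distr[OF point_of_measurable])
qed

lemma integral_stationary:
  assumes f: "f \<in> borel_measurable (restrict_space borel Z)" and K: "\<And>x. x \<in> Z \<Longrightarrow> \<bar>f x\<bar> \<le> (K::real)"
  shows "(\<integral>x. f x \<partial>stationary) = (\<Sum>j<p. \<integral>B. f ((shift_map ^^ j) (concat_point p B)) \<partial>block_seq) / real p"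
proof -
  interpret A: prob_space phase by (rule prob_phase)
  interpret B: prob_space block_seq by (rule prob_block_seq)
  interpret pair_prob_space phase block_seq ..
  have fm: "(\<lambda>x. f (point_of x)) \<in> borel_measurable (phase \<Otimes>\<^sub>M block_seq)"
    using measurable_compose[OF point_of_measurable f] .
  have "(\<integral>x. f x \<partial>stationary) = (\<integral>x. f (point_of x) \<partial>(phase \<Otimes>\<^sub>M block_seq))"
    unfolding stationary_def by (rule integral_distr[OF point_of_measurable f])
  also have "\<dots> = (\<integral>j. (\<integral>B. f (point_of (j, B)) \<partial>block_seq) \<partial>phase)"
  proof (rule integral_fst'[symmetric])
    have "\<bar>f (point_of x)\<bar> \<le> K" if "x \<in> space (phase \<Otimes>\<^sub>M block_seq)" for x
      using K measurable_space[OF point_of_measurable that] by (simp add: space_restrict_space)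
    then show "integrable (phase \<Otimes>\<^sub>M block_seq) (\<lambda>x. f (point_of x))"
      using fm by (intro integrable_const_bound[of _ K]) auto
  qed
  also have "\<dots> = (\<Sum>j<p. \<integral>B. f ((shift_map ^^ j) (concat_point p B)) \<partial>block_seq) / real p"
    unfolding phase_def by (subst integral_uniform_count_measure) (auto simp: point_of_def)
  finally show ?thesis .
qed

lemma stationary_sets: "sets stationary = sets (restrict_space borel Z)" by (simp add: stationary_def)

lemma stationary_space: "space stationary = Z"
  using sets_eq_imp_space_eq[OF stationary_sets] by (simp add: space_restrict_space)

lemma measure_stationary:
  assumes A: "A \<in> sets stationary"
  shows "measure stationary A = (\<Sum>j<p. measure block_seq {B \<in> space block_seq. (shift_map ^^ j) (concat_point p B) \<in> A}) / real p"
proof -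
  interpret S: prob_space stationary by (rule prob_stationary)
  have AZ: "A \<in> sets (restrict_space borel Z)" using A by (simp add: stationary_sets)
  have "indicator A \<in> borel_measurable (restrict_space borel Z)" using AZ by simp
  from integral_stationary[OF this, of 1]
  have "measure stationary A = (\<Sum>j<p. \<integral>B. indicator A ((shift_map ^^ j) (concat_point p B)) \<partial>block_seq) / real p"
    using A sets.sets_into_space[OF A] by (simp add: Int_absorb2)
  moreover have "(\<integral>B. indicator A ((shift_map ^^ j) (concat_point p B)) \<partial>block_seq)
     = measure block_seq {B \<in> space block_seq. (shift_map ^^ j) (concat_point p B) \<in> A}" for j
  proof -
    have "(\<integral>B. indicator A ((shift_map ^^ j) (concat_point p B)) \<partial>block_seq)
       = (\<integral>B. indicator {B \<in> space block_seq. (shift_map ^^ j) (concat_point p B) \<in> A} B \<partial>block_seq)"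
      by (intro Bochner_Integration.integral_cong) (auto simp: indicator_def)
    also have "\<dots> = measure block_seq {B \<in> space block_seq. (shift_map ^^ j) (concat_point p B) \<in> A}"
      by (simp add: Int_absorb2 subset_eq)
    finally show ?thesis .
  qed
  ultimately show ?thesis by simp
qed

text \<open>The shift raises the phase by one, and phase \<open>p\<close> is phase \<open>0\<close> after removal of the
  first block, which does not change the law of the sequence of blocks.\<close>
lemma stationary_inv: "stationary \<in> inv_measures Z"
proof -
  interpret S: prob_space stationary by (rule prob_stationary)
  interpret B: prob_space block_seq by (rule prob_block_seq)
  have T: "shift_map \<in> measurable stationary stationary"
    using shift_map_measurable measurable_cong_sets[OF stationary_sets stationary_sets] by simp
  have "distr stationary stationary shift_map = stationary"
  proof (rule measure_eqI)
    fix A assume "A \<in> sets (distr stationary stationary shift_map)"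
    then have A: "A \<in> sets stationary" by simp
    define a where "a j = measure block_seq {B \<in> space block_seq. (shift_map ^^ j) (concat_point p B) \<in> A}" for j
    have pre: "shift_map -` A \<inter> space stationary \<in> sets stationary" using measurable_sets[OF T A] .
    have "measure block_seq {B \<in> space block_seq. (shift_map ^^ j) (concat_point p B) \<in> shift_map -` A \<inter> space stationary} = a (Suc j)" for j
      unfolding a_def using concat_in Z_shift
      by (intro arg_cong[of _ _ "measure block_seq"]) (auto simp: stationary_space block_seq_space)
    then have pm: "measure stationary (shift_map -` A \<inter> space stationary) = (\<Sum>j<p. a (Suc j)) / real p"
      unfolding measure_stationary[OF pre] by simp
    have "a p = a 0"
    proof -
      have m0: "{B \<in> space block_seq. concat_point p B \<in> A} \<in> sets block_seq"
        using measurable_sets[OF coordinate_measurable[of 0], of A] A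
        by (simp add: stationary_sets vimage_def Int_def conj_commute)
      have ms: "(\<lambda>B q. B (Suc q)) \<in> measurable block_seq block_seq"
        unfolding block_seq_def by (rule measurable_PiM_single') (auto simp: space_PiM)
      have "a 0 = measure (distr block_seq block_seq (\<lambda>B q. B (Suc q))) {B \<in> space block_seq. concat_point p B \<in> A}"
        unfolding block_seq_shift by (simp add: a_def)
      also have "\<dots> = measure block_seq ((\<lambda>B q. B (Suc q)) -` {B \<in> space block_seq. concat_point p B \<in> A} \<inter> space block_seq)"
        by (rule measure_distr[OF ms m0])
      also have "\<dots> = a p"
        unfolding a_def shift_concat_point[OF p]
        by (intro arg_cong[of _ _ "measure block_seq"]) (auto simp: block_seq_space)
      finally show ?thesis by simp
    qed
    moreover have "(\<Sum>j<p. a (Suc j)) = (\<Sum>j<Suc p. a j) - a 0" by (subst sum.lessThan_Suc_shift) simp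
    ultimately have "(\<Sum>j<p. a (Suc j)) = (\<Sum>j<p. a j)" by simp
    then have "measure stationary (shift_map -` A \<inter> space stationary) = measure stationary A"
      using pm unfolding measure_stationary[OF A] a_def by simp
    then show "emeasure (distr stationary stationary shift_map) A = emeasure stationary A"
      using A by (simp add: emeasure_distr[OF T A] S.emeasure_eq_measure)
  qed simp
  then show ?thesis using stationary_sets prob_stationary by (simp add: inv_measures_def borel_of_shift_def)
qed

definition block_entropy :: real where "block_entropy = (\<Sum>w\<in>W. P w * - ln (P w))"

text \<open>Block \<open>0\<close> is left out because a phase may cut into it.\<close>
lemma entropy_of_blocks:
  "prob_space.label_entropy block_seq (\<lambda>B. map B [1..<Suc L]) = real L * block_entropy"
proof -
  interpret B: prob_space block_seq by (rule prob_block_seq)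
  let ?c = "\<lambda>B::nat \<Rightarrow> nat list. map B [1..<Suc L]"
  have sc: "simple_function block_seq ?c"
  proof (induction L)
    case (Suc L)
    have comp: "simple_function block_seq (\<lambda>B. B (Suc L))"
    proof -
      have "simple_function block_law (\<lambda>w. w)" using W_finite by (simp add: block_law_def)
      from simple_function_comp[OF block_component this, of "Suc L"] show ?thesis .
    qed
    from simple_function_compose[OF simple_function_Pair[OF Suc comp], of "\<lambda>(w, v). w @ [v]"]
    show ?case by (simp add: o_def)
  qed simp
  have lp: "B.label_prob ?c (?c b) = (\<Prod>q\<in>{1..<Suc L}. P (b q))" if b: "b \<in> space block_seq" for b
  proof -
    have "?c -` {?c b} \<inter> space block_seq = blocks.emb UNIV {1..<Suc L} (\<Pi>\<^sub>E q\<in>{1..<Suc L}. {b q})"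
      using b by (auto simp: prod_emb_def block_seq_space space_PiM block_law_space PiE_iff block_seq_def simp del: upt_Suc)
    moreover have "measure block_seq (blocks.emb UNIV {1..<Suc L} (\<Pi>\<^sub>E q\<in>{1..<Suc L}. {b q}))
       = (\<Prod>q\<in>{1..<Suc L}. measure block_law {b q})"
      unfolding block_seq_def by (rule blocks.measure_PiM_emb) (use b in \<open>auto simp: block_law_sets block_seq_space\<close>)
    ultimately show ?thesis using b by (simp add: B.label_prob_def measure_block_law block_seq_space)
  qed
  have int: "integrable block_seq (\<lambda>B. - ln (P (B q)))" for q
  proof -
    have sw: "simple_function block_seq (\<lambda>B. B q)"
    proof -
      have "simple_function block_law (\<lambda>w. w)" using W_finite by (simp add: block_law_def)
      from simple_function_comp[OF block_component this, of q] show ?thesis .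
    qed
    from B.integral_label(1)[OF sw, of "\<lambda>w. - ln (P w)"] show ?thesis .
  qed
  have "B.label_entropy ?c = (\<integral>B. - ln (B.label_prob ?c (?c B)) \<partial>block_seq)"
    by (rule B.label_entropy_eq_integral[OF sc])
  also have "\<dots> = (\<integral>B. (\<Sum>q\<in>{1..<Suc L}. - ln (P (B q))) \<partial>block_seq)"
  proof (rule Bochner_Integration.integral_cong[OF refl])
    fix b assume b: "b \<in> space block_seq"
    then show "- ln (B.label_prob ?c (?c b)) = (\<Sum>q\<in>{1..<Suc L}. - ln (P (b q)))"
    proof -
      have "P (b q) > 0" for q using b P_pos by (simp add: block_seq_space)
      moreover from this have "P (b q) \<noteq> 0" for q by (metis less_irrefl)
      ultimately show ?thesis unfolding lp[OF b] by (subst ln_prod) (auto simp: sum_negf)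
    qed
  qed
  also have "\<dots> = (\<Sum>q\<in>{1..<Suc L}. \<integral>B. - ln (P (B q)) \<partial>block_seq)"
    by (intro Bochner_Integration.integral_sum int)
  also have "\<dots> = real L * block_entropy"
    unfolding integral_block_component[of "\<lambda>w. - ln (P w)"] block_entropy_def by simp
  finally show ?thesis .
qed

text \<open>Entropy is concave, so it is enough to bound the entropy of the words of length \<open>k p\<close> for each
  phase; such a word contains \<open>k - 1\<close> complete blocks.\<close>
lemma entropy_stationary_ge:
  "ereal (block_entropy / real p) \<le> measure_entropy stationary shift_map"
proof -
  interpret measure_preserving stationary shift_map by (rule inv_measures_preserving[OF stationary_inv])
  interpret B: prob_space block_seq by (rule prob_block_seq)
  have it: "itinerary (\<lambda>x. x 0) n = initial_word n" for n
    using itinerary_letter[OF measure_preserving_axioms] by blast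
  define c where "c j n B = initial_word n ((shift_map ^^ j) (concat_point p B))" for j n B
  have sc: "simple_function block_seq (c j n)" for j n
  proof -
    have "simple_function (restrict_space borel Z) (initial_word n)"
      using simple_initial_word[OF stationary_inv, of n] stationary_sets stationary_space
      unfolding simple_function_def by (simp add: space_restrict_space)
    from simple_function_comp[OF coordinate_measurable this, of j] show ?thesis by (simp add: c_def[abs_def])
  qed
  have main: "real k * block_entropy - block_entropy \<le> label_entropy (itinerary (\<lambda>x. x 0) (k * p))" if k: "k \<ge> 1" for k
  proof -
    define n where "n = k * p"
    have cw: "c j n ` space block_seq \<subseteq> words Z n" for j
      using concat_in Z_shift by (auto simp: c_def words_eq block_seq_space)
    have lpj: "label_prob (initial_word n) u = (\<Sum>j<p. B.label_prob (c j n) u) / real p" for u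
    proof -
      have e: "initial_word n -` {u} \<inter> space stationary = {x\<in>Z. initial_word n x = u}"
        by (auto simp: stationary_space)
      have "{B \<in> space block_seq. (shift_map ^^ j) (concat_point p B) \<in> {x\<in>Z. initial_word n x = u}} = c j n -` {u} \<inter> space block_seq" for j
        using concat_in Z_shift by (auto simp: c_def block_seq_space)
      then show ?thesis unfolding label_prob_def B.label_prob_def e
        using measure_stationary[OF word_set_sets[OF stationary_inv, of "\<lambda>w. w = u"]] by simp
    qed
    have lw: "initial_word n ` space stationary \<subseteq> words Z n" by (auto simp: words_eq stationary_space)
    have one: "(\<Sum>u\<in>words Z n. B.label_prob (c j n) u) = 1" for j
    proof -
      have "(\<Sum>u\<in>words Z n. B.label_prob (c j n) u) = (\<Sum>u\<in>c j n ` space block_seq. B.label_prob (c j n) u)"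
      proof (rule sum.mono_neutral_right[OF finite_words cw])
        show "\<forall>u\<in>words Z n - c j n ` space block_seq. B.label_prob (c j n) u = 0"
        proof
          fix u assume "u \<in> words Z n - c j n ` space block_seq"
          then have "c j n -` {u} \<inter> space block_seq = {}" by auto
          then show "B.label_prob (c j n) u = 0" by (simp add: B.label_prob_def)
        qed
      qed
      then show ?thesis using B.sum_label_prob[OF sc] by simp
    qed
    have one': "(\<Sum>u\<in>words Z n. label_prob (initial_word n) u) = 1"
    proof -
      have "(\<Sum>u\<in>words Z n. label_prob (initial_word n) u) = (\<Sum>j<p. \<Sum>u\<in>words Z n. B.label_prob (c j n) u) / real p"
        unfolding lpj sum_divide_distrib[symmetric] by (subst sum.swap) simp
      then show ?thesis using p by (simp add: one)
    qed
    have ent: "real (k - 1) * block_entropy \<le> (\<Sum>u\<in>words Z n. B.label_prob (c j n) u * - ln (label_prob (initial_word n) u))"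
      if j: "j < p" for j
    proof -
      define L where "L = k - 1"
      \<comment> \<open>The complete blocks are read off a word that starts at phase \<open>j\<close>.\<close>
      define g where "g u = map (\<lambda>q. take p (drop (q * p - j) u)) [1..<Suc L]" for u :: "nat list"
      have gc: "g (c j n b) = map b [1..<Suc L]" if b: "b \<in> space block_seq" for b
      proof -
        have "take p (drop (q * p - j) (c j n b)) = b q" if q: "1 \<le> q" "q \<le> L" for q
        proof (rule nth_equalityI)
          have qn: "q * p + p \<le> n" using q k 
            using mult_le_mono1[of "Suc q" k p] unfolding n_def L_def by (simp add: Suc_le_eq add.commute)
          have qp: "p \<le> q * p" using q(1) by (cases q) auto
          have lb: "length (b q) = p" using b W_length by (auto simp: block_seq_space)
          show "length (take p (drop (q * p - j) (c j n b))) = length (b q)" using qn lb by (simp add: c_def)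
          fix i assume "i < length (take p (drop (q * p - j) (c j n b)))"
          then have i: "i < p" by simp
          have "take p (drop (q * p - j) (c j n b)) ! i = concat_point p b (j + (q * p - j + i))"
            using i qn by (simp add: c_def shift_map_power)
          also have "j + (q * p - j + i) = q * p + i"
            using le_trans[OF less_imp_le[OF j] qp] by (simp only: add.assoc[symmetric] le_add_diff_inverse)
          also have "concat_point p b (q * p + i) = b q ! i" using i by (simp add: concat_point_def)
          finally show "take p (drop (q * p - j) (c j n b)) ! i = b q ! i" .
        qed
        then show ?thesis by (auto simp: g_def)
      qed
      have "real L * block_entropy = B.label_entropy (\<lambda>B. map B [1..<Suc L])" by (rule entropy_of_blocks[symmetric])
      also have "\<dots> = B.label_entropy (\<lambda>b. g (c j n b))"
      proof -
        have "(\<lambda>B. map B [1..<Suc L]) -` {v} \<inter> space block_seq = (\<lambda>b. g (c j n b)) -` {v} \<inter> space block_seq" for v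
          using gc by auto
        moreover have "(\<lambda>B. map B [1..<Suc L]) ` space block_seq = (\<lambda>b. g (c j n b)) ` space block_seq"
          using gc by (intro image_cong) auto
        ultimately show ?thesis unfolding B.label_entropy_def B.label_prob_def by simp
      qed
      also have "\<dots> \<le> B.label_entropy (c j n)" by (rule B.label_entropy_compose_le[OF sc])
      also have "\<dots> = (\<Sum>u\<in>words Z n. B.label_prob (c j n) u * - ln (B.label_prob (c j n) u))"
        by (rule B.label_entropy_superset[OF finite_words cw])
      also have "\<dots> \<le> (\<Sum>u\<in>words Z n. B.label_prob (c j n) u * - ln (label_prob (initial_word n) u))"
      proof (rule gibbs_inequality[OF finite_words])
        fix u assume "0 < B.label_prob (c j n) u"
        also have "B.label_prob (c j n) u \<le> (\<Sum>j<p. B.label_prob (c j n) u)"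
          using j B.label_prob_nonneg by (intro member_le_sum) auto
        finally show "0 < label_prob (initial_word n) u" unfolding lpj using p by simp
      qed (use one one' label_prob_nonneg B.label_prob_nonneg in auto)
      finally show ?thesis by (simp add: L_def)
    qed
    have "real (k - 1) * block_entropy = (\<Sum>j<p. real (k - 1) * block_entropy) / real p" using p by simp
    also have "\<dots> \<le> (\<Sum>j<p. \<Sum>u\<in>words Z n. B.label_prob (c j n) u * - ln (label_prob (initial_word n) u)) / real p"
      using ent by (intro divide_right_mono sum_mono) auto
    also have "\<dots> = (\<Sum>u\<in>words Z n. label_prob (initial_word n) u * - ln (label_prob (initial_word n) u))"
    proof -
      have "(\<Sum>j<p. \<Sum>u\<in>words Z n. B.label_prob (c j n) u * d u) / real p = (\<Sum>u\<in>words Z n. (\<Sum>j<p. B.label_prob (c j n) u) / real p * d u)" for d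
        by (subst sum.swap) (simp add: sum_divide_distrib sum_distrib_right)
      then show ?thesis unfolding lpj[symmetric] .
    qed
    also have "\<dots> = label_entropy (itinerary (\<lambda>x. x 0) n)"
      unfolding it by (rule label_entropy_superset[OF finite_words lw, symmetric])
    finally show ?thesis using k by (simp add: n_def of_nat_diff algebra_simps)
  qed
  have "ereal (block_entropy / real p) \<le> growth (\<lambda>n. label_entropy (itinerary (\<lambda>x. x 0) n))"
    by (rule growth_ge_multiples[OF main p])
  also have "\<dots> \<le> measure_entropy stationary shift_map" by (rule measure_entropy_ge[OF simple_letter[OF stationary_inv]])
  finally show ?thesis .
qed

lemma integral_stationary_ge:
  assumes \<psi>: "continuous_on Z \<psi>" and l: "\<And>x. x \<in> Z \<Longrightarrow> initial_word p x \<in> W \<Longrightarrow> l (initial_word p x) \<le> birkhoff_sum \<psi> p x"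
  shows "(\<Sum>w\<in>W. P w * l w) / real p \<le> (\<integral>x. \<psi> x \<partial>stationary)"
proof -
  interpret B: prob_space block_seq by (rule prob_block_seq)
  obtain K where K: "K \<ge> 0" "\<And>x. x \<in> Z \<Longrightarrow> \<bar>\<psi> x\<bar> \<le> K" using continuous_bounded[OF \<psi>] by metis
  have m: "\<psi> \<in> borel_measurable (restrict_space borel Z)" by (rule borel_measurable_continuous_on_restrict[OF \<psi>])
  have int: "integrable block_seq (\<lambda>B. \<psi> ((shift_map ^^ j) (concat_point p B)))" for j
    using measurable_compose[OF coordinate_measurable m, of j] K(2) concat_in Z_shift
    by (intro B.integrable_const_bound[of _ K]) (auto simp: block_seq_space)
  have "(\<Sum>w\<in>W. P w * l w) = (\<integral>B. l (B 0) \<partial>block_seq)" by (rule integral_block_component[symmetric])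
  also have "\<dots> \<le> (\<integral>B. birkhoff_sum \<psi> p (concat_point p B) \<partial>block_seq)"
  proof (rule integral_mono)
    have "simple_function block_law (\<lambda>w. w)" using W_finite by (simp add: block_law_def)
    from B.integral_label(1)[OF simple_function_comp[OF block_component this, of 0], of l]
    show "integrable block_seq (\<lambda>B. l (B 0))" .
    show "integrable block_seq (\<lambda>B. birkhoff_sum \<psi> p (concat_point p B))"
      unfolding birkhoff_sum_def by (intro Bochner_Integration.integrable_sum int)
    fix B assume "B \<in> space block_seq"
    then have B: "B q \<in> W" for q by (simp add: block_seq_space)
    have "initial_word p (concat_point p B) = B 0" by (rule initial_word_concat_point[OF W_length[OF B]])
    then show "l (B 0) \<le> birkhoff_sum \<psi> p (concat_point p B)" 
      using l[of "concat_point p B"] concat_in[of B] B by simp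
  qed
  also have "\<dots> = (\<Sum>j<p. \<integral>B. \<psi> ((shift_map ^^ j) (concat_point p B)) \<partial>block_seq)"
    unfolding birkhoff_sum_def by (intro Bochner_Integration.integral_sum int)
  finally have "(\<Sum>w\<in>W. P w * l w) / real p \<le> (\<Sum>j<p. \<integral>B. \<psi> ((shift_map ^^ j) (concat_point p B)) \<partial>block_seq) / real p"
    by (rule divide_right_mono) simp
  then show ?thesis using integral_stationary[OF m K(2)] by simp
qed

end

text \<open>For weights proportional to \<open>exp (l w)\<close> there is equality in Gibbs' inequality.\<close>
lemma (in nonempty_subshift) free_concatenation_measure:
  assumes W: "finite W" "W \<noteq> {}" "p \<ge> 1" "\<And>w. w \<in> W \<Longrightarrow> length w = p"
    and conc: "\<And>B. (\<And>q. B q \<in> W) \<Longrightarrow> concat_point p B \<in> Z"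
    and \<psi>: "continuous_on Z \<psi>" and l: "\<And>x. x \<in> Z \<Longrightarrow> initial_word p x \<in> W \<Longrightarrow> l (initial_word p x) \<le> birkhoff_sum \<psi> p x"
  shows "\<exists>m\<in>inv_measures Z. ereal (ln (\<Sum>w\<in>W. exp (l w)) / real p) \<le> measure_entropy m shift_map + ereal (\<integral>x. \<psi> x \<partial>m)"
proof -
  define S where "S = (\<Sum>w\<in>W. exp (l w))"
  have S: "S > 0" unfolding S_def using W by (intro sum_pos) auto
  define P where "P w = exp (l w) / S" for w
  interpret free_concatenation Z W p P
  proof
    show "(\<Sum>w\<in>W. P w) = 1" unfolding P_def sum_divide_distrib[symmetric] S_def[symmetric] using S by simp
  qed (use W conc S in \<open>auto simp: P_def\<close>)
  have lnP: "l w = ln S + ln (P w)" for w using S by (simp add: P_def ln_div)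
  have "block_entropy + (\<Sum>w\<in>W. P w * l w) = (\<Sum>w\<in>W. P w * ln S)"
    unfolding block_entropy_def sum.distrib[symmetric] lnP by (intro sum.cong refl) (simp add: algebra_simps)
  also have "\<dots> = ln S" using P_sum by (simp add: sum_distrib_right[symmetric])
  finally have "ereal (ln S / real p) = ereal (block_entropy / real p) + ereal ((\<Sum>w\<in>W. P w * l w) / real p)"
    by (simp add: add_divide_distrib[symmetric])
  also have "\<dots> \<le> measure_entropy stationary shift_map + ereal (\<integral>x. \<psi> x \<partial>stationary)"
    using entropy_stationary_ge integral_stationary_ge[OF \<psi> l] by (intro add_mono) auto
  finally show ?thesis using stationary_inv unfolding S_def by blast
qed

context factor_code
begin

text \<open>The words of \<open>Y\<close> cannot be glued directly. One lift is chosen for each of them;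
  lifts that can be concatenated freely in \<open>X\<close> have images that can be concatenated freely in
  \<open>Y\<close>.\<close>
lemma pressure_le_free_energy:
  assumes \<phi>: "continuous_on Y \<phi>"
  shows "pressure Y \<phi> \<le> (SUP m\<in>inv_measures Y. measure_entropy m shift_map + ereal (\<integral>y. \<phi> y \<partial>m))"
proof (rule dense_ge)
  let ?s = "SUP m\<in>inv_measures Y. measure_entropy m shift_map + ereal (\<integral>y. \<phi> y \<partial>m)"
  fix t assume "?s < t"
  from ereal_dense2[OF this] obtain L where L: "?s < ereal L" "ereal L < t" by blast
  define M where "M = max_gap"
  obtain K where K: "K \<ge> 0" "\<And>x. x \<in> Y \<Longrightarrow> \<bar>\<phi> x\<bar> \<le> K" using Y.continuous_bounded[OF \<phi>] by metis
  define N where "N = real (X.alphabet_bound ^ 2)"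
  have N: "N \<ge> 1" using X.alphabet_bound(1) by (simp add: N_def)
  have "growth (\<lambda>n. ln (Y.partition_sum \<phi> n)) \<le> growth (\<lambda>n. L * real n)"
  proof (rule growth_mono_ge1)
    fix \<epsilon> :: real assume e: "\<epsilon> > 0"
    obtain C where C: "C \<ge> 0" "\<And>n x y. x \<in> Y \<Longrightarrow> y \<in> Y \<Longrightarrow> initial_word n x = initial_word n y \<Longrightarrow>
     \<bar>birkhoff_sum \<phi> n x - birkhoff_sum \<phi> n y\<bar> \<le> \<epsilon> * real n + C"
      using Y.bounded_distortion[OF \<phi> e] by metis
    have "ln (Y.partition_sum \<phi> n) \<le> L * real n + \<epsilon> * real n + (\<bar>L\<bar> * real M + C + K * real M + ln N)" if n: "n \<ge> 1" for n
    proof -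
      have "\<forall>v\<in>words Y n. \<exists>u. u \<in> lifts v" using lifts_nonempty by blast
      then obtain up where up: "\<And>v. v \<in> words Y n \<Longrightarrow> up v \<in> lifts v" by metis
      have len: "length v = n" if "v \<in> words Y n" for v using that by (auto simp: Y.words_eq)
      have upw: "up v \<in> words X n" "map \<theta> (up v) = v" if "v \<in> words Y n" for v
        using up[OF that] len[OF that] by (auto simp: lifts_def)
      define U where "U = up ` words Y n"
      have injup: "inj_on up (words Y n)" by (rule inj_onI) (metis upw(2))
      have tU: "map \<theta> u \<in> words Y n" if "u \<in> U" for u using that upw by (auto simp: U_def)
      have UX: "U \<subseteq> words X n" using upw by (auto simp: U_def)
      have wpos: "Y.weight \<phi> (map \<theta> u) \<ge> 0" if "u \<in> U" for u using Y.weight_nonneg[OF \<phi> tU[OF that]] .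
      obtain a t U' where t: "length t \<le> max_gap" "U' \<subseteq> U" "\<And>u. u \<in> U' \<Longrightarrow> u @ t \<in> returns a (n + length t)"
        "(\<Sum>u\<in>U. Y.weight \<phi> (map \<theta> u)) \<le> real (X.alphabet_bound ^ 2) * (\<Sum>u\<in>U'. Y.weight \<phi> (map \<theta> u))"
        by (rule return_extension[OF n UX wpos]) (assumption, blast)
      note t = t(1)[folded M_def] t(2,3) t(4)[folded N_def]
      have sumU: "(\<Sum>u\<in>U. Y.weight \<phi> (map \<theta> u)) = Y.partition_sum \<phi> n"
        unfolding U_def sum.reindex[OF injup] Y.partition_sum_def using upw(2) by (intro sum.cong) auto
      define p where "p = n + length t"
      have p: "p \<ge> 1" using n by (simp add: p_def)
      have lenU: "length u = n" if "u \<in> U" for u using UX that by (auto simp: X.words_eq)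
      define W where "W = (\<lambda>u. map \<theta> (u @ t)) ` U'"
      have injW: "inj_on (\<lambda>u. map \<theta> (u @ t)) U'"
      proof (rule inj_onI)
        fix u u' assume u: "u \<in> U'" "u' \<in> U'" "map \<theta> (u @ t) = map \<theta> (u' @ t)"
        then have "map \<theta> u = map \<theta> u'" by simp
        moreover obtain v v' where "v \<in> words Y n" "u = up v" "v' \<in> words Y n" "u' = up v'" using u t(2) unfolding U_def by blast
        ultimately show "u = u'" using upw(2) by simp
      qed
      have finU: "finite U'" by (rule finite_subset[OF t(2)]) (simp add: U_def)
      have pp: "0 < Y.partition_sum \<phi> n" by (rule Y.partition_sum_pos[OF \<phi>])
      then have "U' \<noteq> {}" using t(4) sumU by auto
      \<comment> \<open>Distortion, and the Birkhoff sum over the added word \<open>t\<close>.\<close>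
      define E where "E = \<epsilon> * real n + C + K * real M"
      define l where "l w = ln (Y.weight \<phi> (take n w)) - E" for w
      have "\<exists>m\<in>inv_measures Y. ereal (ln (\<Sum>w\<in>W. exp (l w)) / real p) \<le> measure_entropy m shift_map + ereal (\<integral>x. \<phi> x \<partial>m)"
      proof (rule Y.free_concatenation_measure)
        show "finite W" "W \<noteq> {}" using finU \<open>U' \<noteq> {}\<close> by (auto simp: W_def)
        show "length w = p" if "w \<in> W" for w using that lenU t(2) by (auto simp: W_def p_def)
        fix B :: "nat \<Rightarrow> nat list" assume B: "\<And>q. B q \<in> W"
        then have "\<forall>q. \<exists>u. u \<in> U' \<and> B q = map \<theta> (u @ t)" by (auto simp: W_def)
        then obtain b where b: "\<And>q. b q \<in> U'" "\<And>q. B q = map \<theta> (b q @ t)" by metis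
        have x: "concat_point p (\<lambda>q. b q @ t) \<in> X" using t(3) b(1) by (intro concat_point_in[OF p, of _ a]) (simp add: p_def)
        have "\<pi> (concat_point p (\<lambda>q. b q @ t)) = concat_point p B"
        proof
          fix i
          have "length (b (i div p) @ t) = p" using lenU b(1) t(2) by (auto simp: p_def subset_eq)
          moreover have "i mod p < p" using p by simp
          ultimately have "i mod p < length (b (i div p) @ t)" by simp
          from nth_map[OF this, of \<theta>] pi_nth[OF x, of i]
          show "\<pi> (concat_point p (\<lambda>q. b q @ t)) i = concat_point p B i"
            by (simp add: concat_point_def b(2))
        qed
        then show "concat_point p B \<in> Y" using pi_in[OF x] by simp
      next
        fix x assume x: "x \<in> Y" "initial_word p x \<in> W"
        have tn: "take n (initial_word p x) = initial_word n x" by (rule nth_equalityI) (auto simp: p_def)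
        have "initial_word n x \<in> words Y n" using x by (auto simp: Y.words_eq)
        then obtain x1 where x1: "x1 \<in> Y" "initial_word n x1 = initial_word n x" "Y.weight \<phi> (initial_word n x) = exp (birkhoff_sum \<phi> n x1)"
          using Y.weight_attained[OF \<phi>] by metis
        have "birkhoff_sum \<phi> n x1 \<le> birkhoff_sum \<phi> n x + \<epsilon> * real n + C" 
          using C(2)[OF x1(1) x(1) x1(2)] by linarith
        moreover have "\<bar>birkhoff_sum \<phi> (length t) ((shift_map ^^ n) x)\<bar> \<le> K * real (length t)"
          using Y.birkhoff_sum_bound[of \<phi> K] K Y.Z_shift[OF x(1)] by blast
        moreover have "K * real (length t) \<le> K * real M" using t(1) K(1) by (intro mult_left_mono) auto
        moreover have "ln (Y.weight \<phi> (take n (initial_word p x))) = birkhoff_sum \<phi> n x1" by (simp add: tn x1(3))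
        moreover have "birkhoff_sum \<phi> p x = birkhoff_sum \<phi> n x + birkhoff_sum \<phi> (length t) ((shift_map ^^ n) x)"
          by (simp add: p_def birkhoff_sum_add)
        ultimately show "l (initial_word p x) \<le> birkhoff_sum \<phi> p x"
          unfolding l_def E_def by linarith
      qed (use p \<phi> in auto)
      then obtain m where m: "m \<in> inv_measures Y" "ereal (ln (\<Sum>w\<in>W. exp (l w)) / real p) \<le> measure_entropy m shift_map + ereal (\<integral>x. \<phi> x \<partial>m)" by blast
      have "ereal (ln (\<Sum>w\<in>W. exp (l w)) / real p) \<le> ?s" 
        using SUP_upper[OF m(1), of "\<lambda>m. measure_entropy m shift_map + ereal (\<integral>y. \<phi> y \<partial>m)"] by (rule order_trans[OF m(2)])
      from order_trans[OF this less_imp_le[OF L(1)]] have "ln (\<Sum>w\<in>W. exp (l w)) / real p \<le> L" by simp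
      then have 1: "ln (\<Sum>w\<in>W. exp (l w)) \<le> L * real p" using p by (simp add: field_simps)
      have "(\<Sum>w\<in>W. exp (l w)) = (\<Sum>u\<in>U'. exp (- E) * Y.weight \<phi> (map \<theta> u))"
        unfolding W_def sum.reindex[OF injW]
      proof (rule sum.cong[OF refl])
        fix u assume u: "u \<in> U'"
        have "take n (map \<theta> (u @ t)) = map \<theta> u" using lenU u t(2) by auto
        then show "((\<lambda>w. exp (l w)) \<circ> (\<lambda>u. map \<theta> (u @ t))) u = exp (- E) * Y.weight \<phi> (map \<theta> u)"
          using Y.weight_pos[OF \<phi> tU, of u] u t(2) by (auto simp: l_def exp_diff exp_minus field_simps)
      qed
      also have "\<dots> = exp (- E) * (\<Sum>u\<in>U'. Y.weight \<phi> (map \<theta> u))" by (simp add: sum_distrib_left)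
      finally have 2: "(\<Sum>w\<in>W. exp (l w)) = exp (- E) * (\<Sum>u\<in>U'. Y.weight \<phi> (map \<theta> u))" .
      have "0 < (\<Sum>u\<in>U'. Y.weight \<phi> (map \<theta> u))" 
        using order_less_le_trans[OF pp, of "N * (\<Sum>u\<in>U'. Y.weight \<phi> (map \<theta> u))"] t(4) sumU N by (simp add: zero_less_mult_iff)
      then have "ln (\<Sum>w\<in>W. exp (l w)) = - E + ln (\<Sum>u\<in>U'. Y.weight \<phi> (map \<theta> u))" unfolding 2 by (simp add: ln_mult)
      moreover have "ln (Y.partition_sum \<phi> n) \<le> ln (N * (\<Sum>u\<in>U'. Y.weight \<phi> (map \<theta> u)))" using t(4) sumU pp by simp
      moreover have "ln (N * (\<Sum>u\<in>U'. Y.weight \<phi> (map \<theta> u))) = ln N + ln (\<Sum>u\<in>U'. Y.weight \<phi> (map \<theta> u))"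
        using N \<open>0 < (\<Sum>u\<in>U'. Y.weight \<phi> (map \<theta> u))\<close> by (simp add: ln_mult)
      ultimately have "ln (Y.partition_sum \<phi> n) \<le> ln N + E + L * real p" using 1 by linarith
      moreover have "L * real p = L * real n + L * real (length t)" by (simp add: p_def distrib_left)
      moreover have "L * real (length t) \<le> \<bar>L\<bar> * real M"
        using t(1) by (intro mult_mono) auto
      ultimately show ?thesis unfolding E_def by linarith
    qed
    then show "\<exists>C. \<forall>n\<ge>1. ln (Y.partition_sum \<phi> n) \<le> L * real n + \<epsilon> * real n + C" by blast
  qed
  also have "growth (\<lambda>n. L * real n) \<le> ereal L" by (rule growth_le_linear[where C = 0]) simp
  finally show "pressure Y \<phi> \<le> t" unfolding Y.pressure_eq using L(2) by (meson less_imp_le order_trans)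
qed

theorem variational_principle:
  assumes \<phi>: "continuous_on Y \<phi>"
  shows "(SUP m\<in>inv_measures Y. measure_entropy m shift_map + ereal (\<integral>y. \<phi> y \<partial>m)) = pressure Y \<phi>"
  using pressure_le_free_energy[OF \<phi>] Y.free_energy_le_pressure[OF _ \<phi>]
  by (intro antisym SUP_least) auto

end

lemma (in irreducible_sft) variational_principle_sft:
  assumes \<psi>: "continuous_on X \<psi>"
  shows "(SUP m\<in>inv_measures X. measure_entropy m shift_map + ereal (\<integral>x. \<psi> x \<partial>m)) = pressure X \<psi>"
proof -
  interpret I: factor_code X X "\<lambda>x. x" "\<lambda>a. a"
    by unfold_locales (auto simp: factor_map_def one_block_def X.Z_subshift)
  show ?thesis by (rule I.variational_principle[OF \<psi>])
qed

section \<open>Compensation functions\<close>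

context nonempty_subshift
begin

text \<open>A locally constant penalty \<open>t\<close> for each time at which a point is not near the orbit
  of \<open>z\<close>. For large \<open>t\<close> little but the orbit contributes to sums over words. Windows of length
  \<open>k + 1\<close> at consecutive times overlap in \<open>k\<close> letters.\<close>
definition orbit_well :: "(nat \<Rightarrow> nat) \<Rightarrow> nat \<Rightarrow> real \<Rightarrow> (nat \<Rightarrow> nat) \<Rightarrow> real" where
  "orbit_well z k t y = (if \<exists>i. initial_word (Suc k) y = initial_word (Suc k) ((shift_map ^^ i) z) then 0 else - t)"

lemma continuous_orbit_well: "continuous_on S (orbit_well z k t)"
  unfolding orbit_well_def[abs_def]
  by (rule continuous_on_word_fun[of _ "\<lambda>w. if \<exists>i. w = initial_word (Suc k) ((shift_map ^^ i) z) then 0 else - t"])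

lemma birkhoff_sum_orbit_well_le: "t \<ge> 0 \<Longrightarrow> birkhoff_sum (orbit_well z k t) n y \<le> 0"
  unfolding birkhoff_sum_def orbit_well_def by (intro sum_nonpos) auto

lemma birkhoff_sum_orbit_well_z: "birkhoff_sum (orbit_well z k t) n z = 0"
  unfolding birkhoff_sum_def orbit_well_def by (intro sum.neutral) auto

lemma orbit_reduce:
  assumes "(shift_map ^^ l) z = z" shows "(shift_map ^^ i) z = (shift_map ^^ (i mod l)) z"
proof -
  have "(shift_map ^^ i) z = (shift_map ^^ (i mod l + i div l * l)) z" by simp
  also have "\<dots> = (shift_map ^^ (i mod l)) z" unfolding funpow_add o_def using shift_periodic[OF assms] by simp
  finally show ?thesis .
qed

text \<open>The orbit is finite.\<close>
lemma orbit_separation: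
  assumes z: "(shift_map ^^ l) z = z" "l \<ge> 1"
  obtains k where "\<And>i j. initial_word k ((shift_map ^^ i) z) = initial_word k ((shift_map ^^ j) z) \<Longrightarrow> (shift_map ^^ i) z = (shift_map ^^ j) z"
proof -
  let ?o = "\<lambda>i. (shift_map ^^ i) z"
  have "\<exists>k. initial_word k (?o i) = initial_word k (?o j) \<longrightarrow> ?o i = ?o j" for i j
  proof (cases "?o i = ?o j")
    case False
    then obtain m where "?o i m \<noteq> ?o j m" by (auto simp: fun_eq_iff)
    then show ?thesis by (intro exI[of _ "Suc m"]) (auto simp: initial_word_eq_iff)
  qed simp
  then obtain kk where kk: "\<And>i j. initial_word (kk i j) (?o i) = initial_word (kk i j) (?o j) \<Longrightarrow> ?o i = ?o j" by metis
  define k where "k = Max ((\<lambda>(i, j). kk i j) ` ({..<l} \<times> {..<l}))"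
  show ?thesis
  proof (rule that[of k])
    fix i j assume e: "initial_word k (?o i) = initial_word k (?o j)"
    define i' j' where "i' = i mod l" and "j' = j mod l"
    have red: "?o i = ?o i'" "?o j = ?o j'" unfolding i'_def j'_def by (rule orbit_reduce[OF z(1)])+
    have "kk i' j' \<le> k" unfolding k_def using z(2) by (intro Max_ge) (auto simp: i'_def j'_def)
    then have "initial_word (kk i' j') (?o i') = initial_word (kk i' j') (?o j')"
      using e unfolding red by (rule initial_word_eq_mono[rotated])
    then show "?o i = ?o j" unfolding red by (rule kk)
  qed
qed

text \<open>Without a penalty, each window agrees with one on the orbit. The overlap of
  consecutive windows determines the point of the orbit, so all of them agree with the same
  stretch of the orbit.\<close>
lemma follow_orbit:
  assumes sep: "\<And>i j. initial_word k ((shift_map ^^ i) z) = initial_word k ((shift_map ^^ j) z) \<Longrightarrow> (shift_map ^^ i) z = (shift_map ^^ j) z"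
    and near: "\<And>m. m < n \<Longrightarrow> orbit_well z k t ((shift_map ^^ m) y) = 0" and t: "t > 0"
  shows "\<exists>i. initial_word n y = initial_word n ((shift_map ^^ i) z)"
proof -
  let ?o = "\<lambda>i. (shift_map ^^ i) z"
  have "\<exists>i. \<forall>m<n. initial_word (Suc k) ((shift_map ^^ m) y) = initial_word (Suc k) (?o (i + m))"
    using near
  proof (induction n)
    case (Suc n)
    obtain i where i: "\<forall>m<n. initial_word (Suc k) ((shift_map ^^ m) y) = initial_word (Suc k) (?o (i + m))"
      using Suc.IH Suc.prems by (metis less_Suc_eq)
    have "orbit_well z k t ((shift_map ^^ n) y) = 0" using Suc.prems by simp
    then obtain j where j: "initial_word (Suc k) ((shift_map ^^ n) y) = initial_word (Suc k) (?o j)"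
      using t by (auto simp: orbit_well_def split: if_splits)
    show ?case
    proof (cases n)
      case 0
      then show ?thesis using j by (intro exI[of _ j]) simp
    next
      case (Suc n')
      have "initial_word k ((shift_map ^^ n) y) = initial_word k (?o (i + n))"
      proof -
        have "(shift_map ^^ n') y (Suc m) = ?o (i + n') (Suc m)" if "m < k" for m
          using i Suc that by (auto simp: initial_word_eq_iff)
        then show ?thesis unfolding Suc by (auto simp: initial_word_eq_iff shift_map_power simp del: funpow.simps)
      qed
      moreover have "initial_word k ((shift_map ^^ n) y) = initial_word k (?o j)"
        using j by (rule initial_word_eq_mono) simp
      ultimately have "?o (i + n) = ?o j" using sep[of "i + n" j] by simp
      then have e: "initial_word (Suc k) ((shift_map ^^ n) y) = initial_word (Suc k) (?o (i + n))" using j by (simp only:)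
      have "initial_word (Suc k) ((shift_map ^^ m) y) = initial_word (Suc k) (?o (i + m))" if "m < Suc n" for m
      proof (cases "m = n")
        case False
        then have "m < n" using that by simp
        then show ?thesis using i by blast
      qed (use e in simp)
      then show ?thesis by blast
    qed
  qed simp
  then obtain i where i: "\<forall>m<n. initial_word (Suc k) ((shift_map ^^ m) y) = initial_word (Suc k) (?o (i + m))" by blast
  have "y m = ?o i m" if "m < n" for m
  proof -
    have "initial_word 1 ((shift_map ^^ m) y) = initial_word 1 (?o (i + m))"
      using initial_word_eq_mono[OF i[rule_format, OF that], of 1] by simp
    then show ?thesis by (simp add: initial_word_eq_iff shift_map_power)
  qed
  then show ?thesis by (auto simp: initial_word_eq_iff)
qed

text \<open>Words are decomposed at the first position where they leave the orbit, which costs a factor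
  \<open>exp (- t)\<close>. The resulting recursion \<open>Q n \<le> M \<kappa>\<^sup>n + \<tau> (\<Sum>i<n. \<kappa>\<^sup>i Q (n - 1 - i))\<close> is solved by \<open>M (\<kappa> + \<tau>)\<^sup>n\<close>.\<close>
lemma orbit_well_sum_le:
  fixes G :: "nat list \<Rightarrow> real"
  assumes z: "z \<in> Z" "(shift_map ^^ l) z = z" "l \<ge> 1" and t: "t > 0"
    and sep: "\<And>i j. initial_word k ((shift_map ^^ i) z) = initial_word k ((shift_map ^^ j) z) \<Longrightarrow> (shift_map ^^ i) z = (shift_map ^^ j) z"
    and G0: "\<And>v. 0 \<le> G v" and G_append: "\<And>u v. G (u @ v) \<le> G u * G v" and G1: "\<And>a. G [a] \<le> D"
    and G_orbit: "\<And>i n. i < l \<Longrightarrow> G (initial_word n ((shift_map ^^ i) z)) \<le> C * \<kappa> ^ n"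
    and pos: "\<kappa> > 0" "C \<ge> 0" "D \<ge> 0"
    and \<tau>: "\<tau> = real l * real alphabet_bound * C * D * exp (- t)"
  shows "(\<Sum>v\<in>words Z n. G v * weight (orbit_well z k t) v) \<le> real l * C * (\<kappa> + \<tau>) ^ n"
proof (induction n rule: less_induct)
  case (less n)
  let ?\<phi> = "orbit_well z k t" and ?o = "\<lambda>i. (shift_map ^^ i) z"
  let ?term = "\<lambda>v. G v * weight ?\<phi> v"
  define Q where "Q n = (\<Sum>v\<in>words Z n. ?term v)" for n
  have cont: "continuous_on Z ?\<phi>" by (rule continuous_orbit_well)
  have \<tau>0: "\<tau> \<ge> 0" using \<tau> pos by simp
  define A1 where "A1 = {v\<in>words Z n. \<exists>i<l. v = initial_word n (?o i)}"
  have w1: "weight ?\<phi> v \<le> 1" "0 < weight ?\<phi> v" if v: "v \<in> words Z m" for v m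
  proof -
    obtain x where "weight ?\<phi> v = exp (birkhoff_sum ?\<phi> m x)" using weight_attained[OF cont v] by metis
    then show "weight ?\<phi> v \<le> 1" using birkhoff_sum_orbit_well_le[of t z k m x] t by simp
    show "0 < weight ?\<phi> v" by (rule weight_pos[OF cont v])
  qed
  have 1: "sum ?term A1 \<le> (\<Sum>i<l. C * \<kappa> ^ n)"
  proof (rule sum_le_cover[where g = "\<lambda>i. initial_word n (?o i)"])
    fix v assume "v \<in> A1"
    then obtain i where i: "i < l" "v = initial_word n (?o i)" "v \<in> words Z n" by (auto simp: A1_def)
    have "?term v \<le> G v * 1" using w1(1)[OF i(3)] G0 by (intro mult_left_mono) auto
    also have "\<dots> \<le> C * \<kappa> ^ n" using G_orbit[OF i(1)] i(2) by simp
    finally show "\<exists>i\<in>{..<l}. initial_word n (?o i) = v \<and> ?term v \<le> C * \<kappa> ^ n" using i by auto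
  qed (use pos in auto)
  define J where "J = (SIGMA m:{..<n}. {..<l} \<times> {1..alphabet_bound} \<times> words Z (n - Suc m))"
  define b where "b = (\<lambda>(m, i :: nat, a :: nat, v'). C * D * exp (- t) * \<kappa> ^ m * ?term v')"
  have 2: "sum ?term (words Z n - A1) \<le> sum b J"
  proof (rule sum_le_cover[where g = "\<lambda>(m, i, a, v'). initial_word m (?o i) @ [a] @ v'"])
    show "finite J" unfolding J_def by auto
    show "0 \<le> b x" if "x \<in> J" for x
      using that G0 w1(2) pos unfolding J_def b_def by (auto intro!: mult_nonneg_nonneg intro: less_imp_le)
    fix v assume v: "v \<in> words Z n - A1"
    then obtain y where y: "y \<in> Z" "initial_word n y = v" "weight ?\<phi> v = exp (birkhoff_sum ?\<phi> n y)"
      using weight_attained[OF cont, of v n] by blast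
    have "\<exists>m<n. ?\<phi> ((shift_map ^^ m) y) \<noteq> 0"
    proof (rule ccontr)
      assume "\<not> ?thesis"
      then obtain i where "initial_word n y = initial_word n (?o i)" using follow_orbit[OF sep, where n = n and t = t and y = y] t by auto
      then have "v = initial_word n (?o (i mod l))" using y(2) orbit_reduce[OF z(2)] by simp
      then have "v \<in> A1" using v z(3) unfolding A1_def by (auto intro!: exI[of _ "i mod l"])
      then show False using v by blast
    qed
    define m where "m = (LEAST m. ?\<phi> ((shift_map ^^ m) y) \<noteq> 0)"
    have m: "?\<phi> ((shift_map ^^ m) y) \<noteq> 0" unfolding m_def using \<open>\<exists>m<n. _\<close> by (metis (mono_tags, lifting) LeastI)
    have mn: "m < n" unfolding m_def using \<open>\<exists>m<n. _\<close> by (meson Least_le le_less_trans)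
    have before: "?\<phi> ((shift_map ^^ m') y) = 0" if "m' < m" for m' using not_less_Least that unfolding m_def by blast
    obtain i0 where "initial_word m y = initial_word m (?o i0)" using follow_orbit[OF sep, where n = m and t = t and y = y] before t by auto
    then obtain i where i: "i < l" "initial_word m y = initial_word m (?o i)"
      using orbit_reduce[OF z(2), of i0] z(3) by (metis mod_less_divisor less_le_trans zero_less_one)
    define v' where "v' = initial_word (n - Suc m) ((shift_map ^^ Suc m) y)"
    have v'w: "v' \<in> words Z (n - Suc m)" using Z_shift[OF y(1), of "Suc m"] unfolding v'_def words_eq by blast
    have n: "n = m + (1 + (n - Suc m))" using mn by simp
    have split: "v = initial_word m (?o i) @ [y m] @ v'"
    proof -
      have "initial_word (m + (1 + (n - Suc m))) y = initial_word m y @ initial_word 1 ((shift_map ^^ m) y) @ initial_word (n - Suc m) ((shift_map ^^ 1) ((shift_map ^^ m) y))"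
        by (simp only: initial_word_add)
      moreover have "initial_word 1 ((shift_map ^^ m) y) = [y m]" by (simp add: initial_word_def shift_map_power)
      ultimately show ?thesis using n y(2) i(2) by (simp add: v'_def)
    qed
    have "birkhoff_sum ?\<phi> n y = birkhoff_sum ?\<phi> m y + (birkhoff_sum ?\<phi> 1 ((shift_map ^^ m) y) + birkhoff_sum ?\<phi> (n - Suc m) ((shift_map ^^ 1) ((shift_map ^^ m) y)))"
      by (subst n) (simp only: birkhoff_sum_add)
    moreover have "birkhoff_sum ?\<phi> 1 ((shift_map ^^ m) y) = - t"
      using m by (auto simp: birkhoff_sum_def orbit_well_def split: if_splits)
    moreover have "birkhoff_sum ?\<phi> m y \<le> 0" using birkhoff_sum_orbit_well_le t by simp
    ultimately have "birkhoff_sum ?\<phi> n y \<le> - t + birkhoff_sum ?\<phi> (n - Suc m) ((shift_map ^^ Suc m) y)" by simp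
    then have "weight ?\<phi> v \<le> exp (- t) * exp (birkhoff_sum ?\<phi> (n - Suc m) ((shift_map ^^ Suc m) y))"
      unfolding y(3) exp_add[symmetric] by simp
    also have "\<dots> \<le> exp (- t) * weight ?\<phi> v'"
      unfolding v'_def using weight_upper[OF cont Z_shift[OF y(1), of "Suc m"]] by (intro mult_left_mono) auto
    finally have wv: "weight ?\<phi> v \<le> exp (- t) * weight ?\<phi> v'" .
    have "G v \<le> G (initial_word m (?o i)) * (G [y m] * G v')"
      unfolding split by (rule order_trans[OF G_append mult_left_mono[OF G_append G0]])
    also have "\<dots> \<le> (C * \<kappa> ^ m) * (D * G v')"
      using G_orbit[OF i(1)] G1 G0 pos by (intro mult_mono mult_nonneg_nonneg) auto
    finally have "?term v \<le> ((C * \<kappa> ^ m) * (D * G v')) * (exp (- t) * weight ?\<phi> v')"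
      using wv w1(2)[of v n] v G0 pos by (intro mult_mono mult_nonneg_nonneg) auto
    then have "?term v \<le> b (m, i, y m, v')" by (simp add: b_def mult_ac)
    moreover have "(m, i, y m, v') \<in> J" using mn i v'w Z_letter[OF y(1)] by (auto simp: J_def)
    ultimately show "\<exists>x\<in>J. (case x of (m, i, a, v') \<Rightarrow> initial_word m (?o i) @ [a] @ v') = v \<and> ?term v \<le> b x"
      using split by (intro bexI[of _ "(m, i, y m, v')"]) auto
  qed
  have 3: "sum b J = (\<Sum>m<n. \<tau> * \<kappa> ^ m * Q (n - Suc m))"
  proof -
    have "sum b J = (\<Sum>m<n. \<Sum>(i, a, v')\<in>{..<l} \<times> {1..alphabet_bound} \<times> words Z (n - Suc m). C * D * exp (- t) * \<kappa> ^ m * ?term v')"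
    proof -
      have "sum b J = (\<Sum>(m, x)\<in>J. case x of (i, a, v') \<Rightarrow> C * D * exp (- t) * \<kappa> ^ m * ?term v')"
        by (intro sum.cong refl) (auto simp: b_def)
      also have "\<dots> = (\<Sum>m<n. \<Sum>x\<in>{..<l} \<times> {1..alphabet_bound} \<times> words Z (n - Suc m). case x of (i, a, v') \<Rightarrow> C * D * exp (- t) * \<kappa> ^ m * ?term v')"
        unfolding J_def by (rule sum.Sigma[symmetric]) auto
      finally show ?thesis .
    qed
    also have "\<dots> = (\<Sum>m<n. \<tau> * \<kappa> ^ m * Q (n - Suc m))"
    proof (rule sum.cong[OF refl])
      fix m
      have "(\<Sum>(i, a, v')\<in>{..<l} \<times> {1..alphabet_bound} \<times> words Z (n - Suc m). C * D * exp (- t) * \<kappa> ^ m * ?term v')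
        = (\<Sum>i<l. \<Sum>a\<in>{1..alphabet_bound}. \<Sum>v'\<in>words Z (n - Suc m). C * D * exp (- t) * \<kappa> ^ m * ?term v')"
        by (simp only: sum.cartesian_product)
      also have "\<dots> = \<tau> * \<kappa> ^ m * Q (n - Suc m)"
      proof -
        have "(\<Sum>v'\<in>words Z (n - Suc m). C * D * exp (- t) * \<kappa> ^ m * ?term v') = C * D * exp (- t) * \<kappa> ^ m * Q (n - Suc m)"
          unfolding Q_def by (rule sum_distrib_left[symmetric])
        then show ?thesis by (simp add: \<tau> mult_ac)
      qed
      finally show "(\<Sum>(i, a, v')\<in>{..<l} \<times> {1..alphabet_bound} \<times> words Z (n - Suc m). C * D * exp (- t) * \<kappa> ^ m * ?term v') = \<tau> * \<kappa> ^ m * Q (n - Suc m)" .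
    qed
    finally show ?thesis .
  qed
  have "Q n = sum ?term A1 + sum ?term (words Z n - A1)"
    unfolding Q_def by (subst sum.subset_diff[of A1]) (auto simp: A1_def)
  also have "\<dots> \<le> real l * C * \<kappa> ^ n + (\<Sum>m<n. \<tau> * \<kappa> ^ m * Q (n - Suc m))"
    using 1 2 unfolding 3 by simp
  also have "(\<Sum>m<n. \<tau> * \<kappa> ^ m * Q (n - Suc m)) \<le> (\<Sum>m<n. \<tau> * \<kappa> ^ m * (real l * C * (\<kappa> + \<tau>) ^ (n - Suc m)))"
    using less.IH \<tau>0 pos unfolding Q_def by (intro sum_mono mult_left_mono) auto
  also have "\<dots> = real l * C * (\<tau> * (\<Sum>m<n. (\<kappa> + \<tau>) ^ (n - Suc m) * \<kappa> ^ m))"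
    by (simp add: sum_distrib_left mult_ac)
  also have "\<tau> * (\<Sum>m<n. (\<kappa> + \<tau>) ^ (n - Suc m) * \<kappa> ^ m) = (\<kappa> + \<tau>) ^ n - \<kappa> ^ n"
    using power_diff_sumr2[of \<kappa> n "\<kappa> + \<tau>"] by simp
  also have "real l * C * \<kappa> ^ n + real l * C * ((\<kappa> + \<tau>) ^ n - \<kappa> ^ n) = real l * C * (\<kappa> + \<tau>) ^ n"
    by (simp add: algebra_simps)
  finally show ?case unfolding Q_def by simp
qed

lemma one_le_weight_orbit_well:
  assumes "z \<in> Z" "t \<ge> 0" shows "1 \<le> weight (orbit_well z k t) (initial_word n z)"
  using weight_upper[OF continuous_orbit_well assms(1), of z k t n] by (simp add: birkhoff_sum_orbit_well_z)

end

context factor_code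
begin

definition fibred_sum :: "((nat \<Rightarrow> nat) \<Rightarrow> real) \<Rightarrow> ((nat \<Rightarrow> nat) \<Rightarrow> real) \<Rightarrow> nat \<Rightarrow> real" where
  "fibred_sum F \<phi> n = (\<Sum>v\<in>words Y n. fibre_sum F v * Y.weight \<phi> v)"

lemma fibred_sum_pos:
  "continuous_on X F \<Longrightarrow> continuous_on Y \<phi> \<Longrightarrow> 0 < fibred_sum F \<phi> n"
  unfolding fibred_sum_def using Y.words_nonempty fibre_sum_pos Y.weight_pos by (intro sum_pos mult_pos_pos) auto

text \<open>Up to the distortion of \<open>\<phi>\<close>, the weight of a word for \<open>F + \<phi> \<circ> \<pi>\<close> is the product of
  its weight for \<open>F\<close> and of the weight of its image for \<open>\<phi>\<close>; the words are grouped by their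
  images.\<close>
lemma pressure_plus_pi:
  assumes F: "continuous_on X F" and \<phi>: "continuous_on Y \<phi>"
  shows "pressure X (\<lambda>x. F x + \<phi> (\<pi> x)) = growth (\<lambda>n. ln (fibred_sum F \<phi> n))"
proof -
  let ?\<Psi> = "\<lambda>x. F x + \<phi> (\<pi> x)"
  have \<Psi>: "continuous_on X ?\<Psi>" by (intro continuous_on_add F continuous_comp_pi \<phi>)
  have S: "birkhoff_sum ?\<Psi> n x = birkhoff_sum F n x + birkhoff_sum \<phi> n (\<pi> x)" if "x \<in> X" for n x
    using birkhoff_sum_plus[of F "\<lambda>x. \<phi> (\<pi> x)" n x] birkhoff_sum_pi[OF that, of \<phi> n] by simp
  have grp: "X.partition_sum ?\<Psi> n = (\<Sum>v\<in>words Y n. \<Sum>u\<in>lifts v. X.weight ?\<Psi> u)" for n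
  proof -
    have "map \<theta> ` words X n \<subseteq> words Y n" using map_initial_word pi_in by (auto simp: X.words_eq Y.words_eq)
    then have "X.partition_sum ?\<Psi> n = (\<Sum>v\<in>words Y n. \<Sum>u\<in>{u\<in>words X n. map \<theta> u = v}. X.weight ?\<Psi> u)"
      unfolding X.partition_sum_def by (intro sum.group[symmetric]) auto
    also have "\<dots> = (\<Sum>v\<in>words Y n. \<Sum>u\<in>lifts v. X.weight ?\<Psi> u)"
      by (intro sum.cong refl) (auto simp: lifts_def Y.words_eq)
    finally show ?thesis .
  qed
  have lw: "u \<in> words X n" "map \<theta> u = v" if "v \<in> words Y n" "u \<in> lifts v" for u v n
    using that by (auto simp: lifts_def Y.words_eq)
  have up: "X.partition_sum ?\<Psi> n \<le> fibred_sum F \<phi> n" for n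
    unfolding grp fibred_sum_def fibre_sum_def sum_distrib_right
  proof (intro sum_mono)
    fix v u assume vu: "v \<in> words Y n" "u \<in> lifts v"
    obtain x where x: "x \<in> X" "initial_word n x = u" "X.weight ?\<Psi> u = exp (birkhoff_sum ?\<Psi> n x)"
      using X.weight_attained[OF \<Psi> lw(1)[OF vu]] by metis
    have "initial_word n (\<pi> x) = v" using map_initial_word[OF x(1), of n] x(2) lw(2)[OF vu] by simp
    then show "X.weight ?\<Psi> u \<le> X.weight F u * Y.weight \<phi> v"
      unfolding x(3) S[OF x(1)] exp_add
      using X.weight_upper[OF F x(1), of n] Y.weight_upper[OF \<phi> pi_in[OF x(1)], of n] x(2) X.weight_pos[OF F lw(1)[OF vu]]
      by (intro mult_mono) auto
  qed
  have lo: "exp (- r) * fibred_sum F \<phi> n \<le> X.partition_sum ?\<Psi> n"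
    if r: "\<And>x y. x \<in> Y \<Longrightarrow> y \<in> Y \<Longrightarrow> initial_word n x = initial_word n y \<Longrightarrow> \<bar>birkhoff_sum \<phi> n x - birkhoff_sum \<phi> n y\<bar> \<le> r" for n r
    unfolding grp fibred_sum_def fibre_sum_def sum_distrib_right sum_distrib_left
  proof (intro sum_mono)
    fix v u assume vu: "v \<in> words Y n" "u \<in> lifts v"
    obtain x where x: "x \<in> X" "initial_word n x = u" "X.weight F u = exp (birkhoff_sum F n x)"
      using X.weight_attained[OF F lw(1)[OF vu]] by metis
    obtain y where y: "y \<in> Y" "initial_word n y = v" "Y.weight \<phi> v = exp (birkhoff_sum \<phi> n y)"
      using Y.weight_attained[OF \<phi> vu(1)] by metis
    have "initial_word n (\<pi> x) = v" using map_initial_word[OF x(1), of n] x(2) lw(2)[OF vu] by simp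
    then have "\<bar>birkhoff_sum \<phi> n (\<pi> x) - birkhoff_sum \<phi> n y\<bar> \<le> r" using r[OF pi_in[OF x(1)] y(1)] y(2) by simp
    then have "- r + (birkhoff_sum F n x + birkhoff_sum \<phi> n y) \<le> birkhoff_sum ?\<Psi> n x" unfolding S[OF x(1)] by linarith
    then have "exp (- r) * (exp (birkhoff_sum F n x) * exp (birkhoff_sum \<phi> n y)) \<le> exp (birkhoff_sum ?\<Psi> n x)"
      unfolding exp_add[symmetric] by simp
    also have "\<dots> \<le> X.weight ?\<Psi> u" using X.weight_upper[OF \<Psi> x(1), of n] x(2) by simp
    finally show "exp (- r) * (X.weight F u * Y.weight \<phi> v) \<le> X.weight ?\<Psi> u" unfolding x(3) y(3) .
  qed
  note p1 = X.partition_sum_pos[OF \<Psi>] and p2 = fibred_sum_pos[OF F \<phi>]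
  show ?thesis unfolding X.pressure_eq
  proof (rule antisym)
    show "growth (\<lambda>n. ln (X.partition_sum ?\<Psi> n)) \<le> growth (\<lambda>n. ln (fibred_sum F \<phi> n))"
      by (rule growth_mono_const[where C = 0]) (use up p1 p2 in simp)
    show "growth (\<lambda>n. ln (fibred_sum F \<phi> n)) \<le> growth (\<lambda>n. ln (X.partition_sum ?\<Psi> n))"
    proof (rule growth_mono)
      fix \<epsilon> :: real assume e: "\<epsilon> > 0"
      obtain C where C: "C \<ge> 0" "\<And>n x y. x \<in> Y \<Longrightarrow> y \<in> Y \<Longrightarrow> initial_word n x = initial_word n y \<Longrightarrow>
       \<bar>birkhoff_sum \<phi> n x - birkhoff_sum \<phi> n y\<bar> \<le> \<epsilon> * real n + C"
        using Y.bounded_distortion[OF \<phi> e] by metis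
      have "ln (fibred_sum F \<phi> n) \<le> ln (X.partition_sum ?\<Psi> n) + \<epsilon> * real n + C" for n
      proof -
        have a: "exp (- (\<epsilon> * real n + C)) * fibred_sum F \<phi> n \<le> X.partition_sum ?\<Psi> n" by (rule lo) (rule C(2))
        have "0 < exp (- (\<epsilon> * real n + C)) * fibred_sum F \<phi> n" using p2[of n] by (intro mult_pos_pos) auto
        from ln_mono[OF a this] have "ln (exp (- (\<epsilon> * real n + C)) * fibred_sum F \<phi> n) \<le> ln (X.partition_sum ?\<Psi> n)"
          .
        then show ?thesis using p2[of n] by (simp add: ln_mult)
    qed
    then show "\<exists>C. \<forall>n. ln (fibred_sum F \<phi> n) \<le> ln (X.partition_sum ?\<Psi> n) + \<epsilon> * real n + C" by blast
    qed
  qed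
qed

text \<open>The variational principle on both shifts.\<close>
lemma compensation_iff_pressure:
  assumes F: "continuous_on X F"
  shows "compensation_function X Y \<pi> F \<longleftrightarrow>
    (\<forall>\<phi>. continuous_on Y \<phi> \<longrightarrow> growth (\<lambda>n. ln (fibred_sum F \<phi> n)) = pressure Y \<phi>)"
proof -
  have "(SUP \<mu>\<in>inv_measures X. measure_entropy \<mu> shift_map + ereal (integral\<^sup>L \<mu> F) + ereal (integral\<^sup>L \<mu> (\<phi> \<circ> \<pi>)))
     = growth (\<lambda>n. ln (fibred_sum F \<phi> n))" if \<phi>: "continuous_on Y \<phi>" for \<phi>
  proof -
    let ?\<Psi> = "\<lambda>x. F x + \<phi> (\<pi> x)"
    have \<Psi>: "continuous_on X ?\<Psi>" by (intro continuous_on_add F continuous_comp_pi \<phi>)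
    have "measure_entropy \<mu> shift_map + ereal (integral\<^sup>L \<mu> F) + ereal (integral\<^sup>L \<mu> (\<phi> \<circ> \<pi>))
      = measure_entropy \<mu> shift_map + ereal (\<integral>x. ?\<Psi> x \<partial>\<mu>)" if m: "\<mu> \<in> inv_measures X" for \<mu>
    proof -
      have "(\<integral>x. ?\<Psi> x \<partial>\<mu>) = integral\<^sup>L \<mu> F + integral\<^sup>L \<mu> (\<phi> \<circ> \<pi>)"
        using Bochner_Integration.integral_add[OF X.continuous_integrable[OF m F] X.continuous_integrable[OF m continuous_comp_pi[OF \<phi>]]]
        by (simp add: o_def)
      then show ?thesis by (simp add: add.assoc)
    qed
    then have "(SUP \<mu>\<in>inv_measures X. measure_entropy \<mu> shift_map + ereal (integral\<^sup>L \<mu> F) + ereal (integral\<^sup>L \<mu> (\<phi> \<circ> \<pi>)))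
      = (SUP \<mu>\<in>inv_measures X. measure_entropy \<mu> shift_map + ereal (\<integral>x. ?\<Psi> x \<partial>\<mu>))" by (intro SUP_cong) auto
    then show ?thesis by (simp add: variational_principle_sft[OF \<Psi>] pressure_plus_pi[OF F \<phi>])
  qed
  then show ?thesis unfolding compensation_function_def using F variational_principle by auto
qed

lemma compensation_if_sublinear:
  assumes F: "continuous_on X F" and U: "unif_sublinear Y (\<lambda>n y. ln (fibre_sum F (initial_word n y)))"
  shows "compensation_function X Y \<pi> F"
  unfolding compensation_iff_pressure[OF F] Y.pressure_eq
proof (intro allI impI antisym growth_mono)
  fix \<phi> :: "(nat \<Rightarrow> nat) \<Rightarrow> real" and \<epsilon> :: real assume \<phi>: "continuous_on Y \<phi>" and e: "\<epsilon> > 0"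
  obtain C where C: "\<And>n y. y \<in> Y \<Longrightarrow> \<bar>ln (fibre_sum F (initial_word n y))\<bar> \<le> \<epsilon> * real n + C"
    using unif_sublinearD[OF U e] by metis
  have C': "fibre_sum F v \<le> exp (\<epsilon> * real n + C)" "exp (- (\<epsilon> * real n + C)) \<le> fibre_sum F v" if v: "v \<in> words Y n" for v n
  proof -
    obtain y where y: "y \<in> Y" "v = initial_word n y" using v by (auto simp: Y.words_eq)
    have p: "fibre_sum F v > 0" by (rule fibre_sum_pos[OF F v])
    have "ln (fibre_sum F v) \<le> \<epsilon> * real n + C" "- (\<epsilon> * real n + C) \<le> ln (fibre_sum F v)"
      using C[OF y(1), of n] unfolding y(2) by linarith+
    then have "exp (ln (fibre_sum F v)) \<le> exp (\<epsilon> * real n + C)" "exp (- (\<epsilon> * real n + C)) \<le> exp (ln (fibre_sum F v))"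
      by (simp_all only: exp_le_cancel_iff)
    then show "fibre_sum F v \<le> exp (\<epsilon> * real n + C)" "exp (- (\<epsilon> * real n + C)) \<le> fibre_sum F v"
      unfolding exp_ln[OF p] by simp_all
  qed
  note p1 = Y.partition_sum_pos[OF \<phi>] and p2 = fibred_sum_pos[OF F \<phi>]
  have "ln (fibred_sum F \<phi> n) \<le> ln (Y.partition_sum \<phi> n) + \<epsilon> * real n + C" for n
  proof -
    have "fibred_sum F \<phi> n \<le> exp (\<epsilon> * real n + C) * Y.partition_sum \<phi> n"
      unfolding fibred_sum_def Y.partition_sum_def sum_distrib_left
      using C'(1) Y.weight_pos[OF \<phi>] by (intro sum_mono mult_right_mono) (auto intro: less_imp_le)
    then have "ln (fibred_sum F \<phi> n) \<le> ln (exp (\<epsilon> * real n + C) * Y.partition_sum \<phi> n)" using p2[of n] by simp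
    then show ?thesis using p1[of n] by (simp add: ln_mult)
  qed
  then show "\<exists>C. \<forall>n. ln (fibred_sum F \<phi> n) \<le> ln (Y.partition_sum \<phi> n) + \<epsilon> * real n + C" by blast
  have "ln (Y.partition_sum \<phi> n) \<le> ln (fibred_sum F \<phi> n) + \<epsilon> * real n + C" for n
  proof -
    have "exp (- (\<epsilon> * real n + C)) * Y.partition_sum \<phi> n \<le> fibred_sum F \<phi> n"
      unfolding fibred_sum_def Y.partition_sum_def sum_distrib_left
      using C'(2) Y.weight_pos[OF \<phi>] by (intro sum_mono mult_right_mono) (auto intro: less_imp_le)
    then have "ln (exp (- (\<epsilon> * real n + C)) * Y.partition_sum \<phi> n) \<le> ln (fibred_sum F \<phi> n)" using p1[of n] p2[of n] by simp
    then show ?thesis using p1[of n] by (simp add: ln_mult)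
  qed
  then show "\<exists>C. \<forall>n. ln (Y.partition_sum \<phi> n) \<le> ln (fibred_sum F \<phi> n) + \<epsilon> * real n + C" by blast
qed

text \<open>A compensation function is tested on the potentials \<^const>\<open>nonempty_subshift.orbit_well\<close>.
  As \<open>t\<close> grows, little but the orbit contributes: the pressure on \<open>Y\<close> tends to \<open>0\<close>, and the
  pressure of the lifted potential is governed by the growth rate of the fibre sums along the
  orbit.\<close>
lemma growth_if_compensation:
  assumes F: "continuous_on X F" and comp: "compensation_function X Y \<pi> F"
    and z: "z \<in> Y" "periodic_point z"
  shows "growth (\<lambda>n. ln (fibre_sum F (initial_word n z))) = 0"
proof -
  obtain l where l: "l \<ge> 1" "(shift_map ^^ l) z = z" using z(2) by (auto simp: periodic_point_def)
  obtain k where sep: "\<And>i j. initial_word k ((shift_map ^^ i) z) = initial_word k ((shift_map ^^ j) z) \<Longrightarrow> (shift_map ^^ i) z = (shift_map ^^ j) z"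
    using Y.orbit_separation[OF l(2,1)] by metis
  let ?\<phi> = "Y.orbit_well z k"
  have cont: "continuous_on Y (?\<phi> t)" for t by (rule Y.continuous_orbit_well)
  have eq: "growth (\<lambda>n. ln (fibred_sum F (?\<phi> t) n)) = growth (\<lambda>n. ln (Y.partition_sum (?\<phi> t) n))" for t
    using comp cont unfolding compensation_iff_pressure[OF F] Y.pressure_eq by blast
  obtain D where D: "D \<ge> 1" "\<And>v. fibre_sum F v \<le> D ^ length v"
    "\<And>n y. y \<in> Y \<Longrightarrow> \<bar>ln (fibre_sum F (initial_word n y))\<bar> \<le> ln D * real n"
    using fibre_sum_bounds[OF F] by metis
  let ?g = "growth (\<lambda>n. ln (fibre_sum F (initial_word n z)))"
  define c where "c = real_of_ereal ?g"
  have gc: "?g = ereal c" unfolding c_def using growth_abs_le(3)[OF D(3)[OF z(1)]] by (simp add: ereal_real')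
  have zw: "initial_word n z \<in> words Y n" for n using z(1) by (auto simp: Y.words_eq)
  have bound: "growth (\<lambda>n. ln (a n)) \<le> ereal (ln s)" if "\<And>n. a n \<le> M * s ^ n" "\<And>n. 0 < a n" "s > 0" for a M s
  proof (rule growth_le_linear)
    fix n
    have "0 < M * s ^ 0" using that(1)[of 0] that(2)[of 0] by linarith
    then have M: "M > 0" by simp
    have "ln (a n) \<le> ln (M * s ^ n)" using that(1)[of n] that(2)[of n] by simp
    also have "\<dots> = ln s * real n + ln M" using M that(3) by (simp add: ln_mult ln_realpow)
    finally show "ln (a n) \<le> ln s * real n + ln M" .
  qed
  \<comment> \<open>The orbit alone gives the lifted potential a pressure of at least \<open>c\<close>, while the
    pressure on \<open>Y\<close> is small for large \<open>t\<close>.\<close>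
  have "c \<le> 0"
  proof (rule ccontr)
    assume "\<not> c \<le> 0"
    then have c: "c > 0" by simp
    define K where "K = real l * real Y.alphabet_bound * 1 * 1"
    have K: "K > 0" using l(1) Y.alphabet_bound(1) by (simp add: K_def)
    define t where "t = max 1 (ln (2 * K / c))"
    have t: "t > 0" by (simp add: t_def)
    have "K * exp (- t) \<le> K * exp (- ln (2 * K / c))" using K by (intro mult_left_mono) (auto simp: t_def)
    also have "\<dots> = c / 2" using K c by (simp add: exp_minus)
    finally have small: "K * exp (- t) \<le> c / 2" .
    have "growth (\<lambda>n. ln (fibre_sum F (initial_word n z))) \<le> growth (\<lambda>n. ln (fibred_sum F (?\<phi> t) n))"
    proof (rule growth_mono_const[where C = 0])
      fix n
      have "fibre_sum F (initial_word n z) * 1 \<le> fibre_sum F (initial_word n z) * Y.weight (?\<phi> t) (initial_word n z)"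
        using Y.one_le_weight_orbit_well[OF z(1), of t k n] t fibre_sum_nonneg[OF F] by (intro mult_left_mono) auto
      also have "\<dots> \<le> fibred_sum F (?\<phi> t) n" unfolding fibred_sum_def
        using Y.weight_nonneg[OF cont] fibre_sum_nonneg[OF F]
        by (intro member_le_sum[OF zw]) (auto intro!: mult_nonneg_nonneg)
      finally show "ln (fibre_sum F (initial_word n z)) \<le> ln (fibred_sum F (?\<phi> t) n) + 0"
        using fibre_sum_pos[OF F zw] fibred_sum_pos[OF F cont] by simp
    qed
    also have "\<dots> \<le> ereal (ln (1 + K * exp (- t)))" unfolding eq
    proof (rule bound)
      fix n
      have "(\<Sum>v\<in>words Y n. 1 * Y.weight (?\<phi> t) v) \<le> real l * 1 * (1 + K * exp (- t)) ^ n"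
        by (rule Y.orbit_well_sum_le[OF z(1) l(2,1) t sep, where G = "\<lambda>_. 1" and D = 1 and C = 1 and \<kappa> = 1]) (auto simp: K_def)
      then show "Y.partition_sum (?\<phi> t) n \<le> real l * (1 + K * exp (- t)) ^ n" by (simp add: Y.partition_sum_def)
    qed (use Y.partition_sum_pos[OF cont] K in \<open>auto intro: add_pos_pos\<close>)
    finally have "c \<le> ln (1 + K * exp (- t))" unfolding gc by simp
    also have "\<dots> \<le> K * exp (- t)" using K by (intro ln_add_one_self_le_self) simp
    finally show False using small c by simp
  qed
  \<comment> \<open>Otherwise the lifted potential has negative pressure for large \<open>t\<close>, while the orbit
    alone makes the pressure on \<open>Y\<close> nonnegative.\<close>
  moreover have "0 \<le> c + \<epsilon>" if e: "\<epsilon> > 0" for \<epsilon>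
  proof (rule ccontr)
    assume "\<not> 0 \<le> c + \<epsilon>"
    define \<kappa> where "\<kappa> = exp (c + \<epsilon>)"
    have \<kappa>: "\<kappa> > 0" "\<kappa> < 1" using \<open>\<not> 0 \<le> c + \<epsilon>\<close> by (auto simp: \<kappa>_def)
    have "\<exists>C. \<forall>n. ln (fibre_sum F (initial_word n ((shift_map ^^ i) z))) \<le> (c + \<epsilon>) * real n + C" if "i < l" for i
    proof -
      have "growth (\<lambda>n. ln (fibre_sum F (initial_word n ((shift_map ^^ i) z)))) \<le> ereal c"
        using growth_fibre_sum_orbit[OF F z(1) l that] gc by simp
      from growth_le_iff[THEN iffD1, rule_format, OF this e] show ?thesis .
    qed
    then obtain CC where CC: "\<And>i n. i < l \<Longrightarrow> ln (fibre_sum F (initial_word n ((shift_map ^^ i) z))) \<le> (c + \<epsilon>) * real n + CC i"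
      by metis
    define C where "C = (\<Sum>i<l. exp (CC i))"
    have C: "C \<ge> 0" unfolding C_def by (intro sum_nonneg) auto
    have orb: "fibre_sum F (initial_word n ((shift_map ^^ i) z)) \<le> C * \<kappa> ^ n" if i: "i < l" for i n
    proof -
      have "fibre_sum F (initial_word n ((shift_map ^^ i) z)) = exp (ln (fibre_sum F (initial_word n ((shift_map ^^ i) z))))"
        using fibre_sum_pos'[OF F Y.Z_shift[OF z(1)]] by simp
      also have "\<dots> \<le> exp ((c + \<epsilon>) * real n + CC i)" using CC[OF i] by simp
      also have "\<dots> = exp (CC i) * \<kappa> ^ n"
      proof -
        have "\<kappa> ^ n = exp ((c + \<epsilon>) * real n)" unfolding \<kappa>_def by (simp only: exp_of_nat_mult[symmetric] mult.commute)
        then show ?thesis by (simp only: exp_add mult.commute)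
      qed
      also have "\<dots> \<le> C * \<kappa> ^ n" unfolding C_def using i \<kappa> by (intro mult_right_mono member_le_sum) auto
      finally show ?thesis .
    qed
    define K where "K = real l * real Y.alphabet_bound * C * D"
    have K: "K \<ge> 0" using C D(1) by (simp add: K_def)
    define t where "t = max 1 (ln (2 * (K + 1) / (1 - \<kappa>)))"
    have t: "t > 0" by (simp add: t_def)
    have "K * exp (- t) \<le> (K + 1) * exp (- ln (2 * (K + 1) / (1 - \<kappa>)))" using K by (intro mult_mono) (auto simp: t_def)
    also have "\<dots> = (1 - \<kappa>) / 2" using K \<kappa> by (simp add: exp_minus field_simps)
    finally have small: "K * exp (- t) \<le> (1 - \<kappa>) / 2" .
    have "ereal 0 \<le> growth (\<lambda>n. ln (Y.partition_sum (?\<phi> t) n))"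
    proof (rule growth_ge[of _ 0])
      fix n :: nat
      have "1 \<le> Y.partition_sum (?\<phi> t) n" unfolding Y.partition_sum_def
        using Y.weight_pos[OF cont] order_trans[OF Y.one_le_weight_orbit_well[OF z(1), of t k n] member_le_sum[OF zw[of n], of "Y.weight (?\<phi> t)"]] t
        by (auto intro: less_imp_le)
      then show "0 * real n - 0 \<le> ln (Y.partition_sum (?\<phi> t) n)" by simp
    qed
    also have "\<dots> \<le> ereal (ln (\<kappa> + K * exp (- t)))" unfolding eq[symmetric]
    proof (rule bound)
      fix n
      show "fibred_sum F (?\<phi> t) n \<le> (real l * C) * (\<kappa> + K * exp (- t)) ^ n"
        unfolding fibred_sum_def
      proof (rule Y.orbit_well_sum_le[OF z(1) l(2,1) t sep fibre_sum_nonneg[OF F] fibre_sum_append[OF F] _ orb \<kappa>(1) C])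
        show "fibre_sum F [a] \<le> D" for a using D(2)[of "[a]"] by simp
      qed (use D(1) in \<open>auto simp: K_def\<close>)
    qed (use fibred_sum_pos[OF F cont] K \<kappa> in \<open>auto intro!: add_pos_nonneg\<close>)
    finally have "1 \<le> \<kappa> + K * exp (- t)" using \<kappa> K by (simp add: add_pos_nonneg ln_ge_zero_iff)
    then show False using small \<kappa> by simp
  qed
  then have "0 \<le> c" by (rule field_le_epsilon)
  ultimately show ?thesis unfolding gc by simp
qed

end

section \<open>Weak Gibbs measures and the equivalences\<close>

lemma unif_sublinear_add:
  assumes "unif_sublinear Y a" "unif_sublinear Y b" shows "unif_sublinear Y (\<lambda>n y. a n y + b n y)"
  unfolding unif_sublinear_def
proof (intro allI impI)
  fix \<epsilon> :: real assume e: "\<epsilon> > 0"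
  obtain C where C: "\<And>n y. y \<in> Y \<Longrightarrow> \<bar>a n y\<bar> \<le> \<epsilon>/2 * real n + C" using assms(1) half_gt_zero[OF e] unfolding unif_sublinear_def by blast
  obtain C' where C': "\<And>n y. y \<in> Y \<Longrightarrow> \<bar>b n y\<bar> \<le> \<epsilon>/2 * real n + C'" using assms(2) half_gt_zero[OF e] unfolding unif_sublinear_def by blast
  have "\<bar>a n y + b n y\<bar> \<le> \<epsilon> * real n + (C + C')" if "y \<in> Y" for n y
    using C[OF that, of n] C'[OF that, of n] by (simp add: field_simps) 
  then show "\<exists>C. \<forall>n. \<forall>y\<in>Y. \<bar>a n y + b n y\<bar> \<le> \<epsilon> * real n + C" by blast
qed

lemma unif_sublinear_uminus: "unif_sublinear Y a \<Longrightarrow> unif_sublinear Y (\<lambda>n y. - a n y)"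
  unfolding unif_sublinear_def by simp

lemma unif_sublinear_cong:
  assumes "\<And>n y. y \<in> Y \<Longrightarrow> a n y = b n y" shows "unif_sublinear Y a \<longleftrightarrow> unif_sublinear Y b"
  unfolding unif_sublinear_def using assms by simp

lemma unif_sublinear_tendsto:
  assumes U: "unif_sublinear Y a" and y: "y \<in> Y" shows "(\<lambda>n. a n y / real n) \<longlonglongrightarrow> 0"
proof (rule LIMSEQ_I)
  fix r :: real assume r: "r > 0"
  obtain C where C: "\<And>n y. y \<in> Y \<Longrightarrow> \<bar>a n y\<bar> \<le> r/2 * real n + C"
    using U half_gt_zero[OF r] unfolding unif_sublinear_def by blast
  obtain N :: nat where N: "real N > 2 * \<bar>C\<bar> / r" using reals_Archimedean2 by blast
  have "norm (a n y / real n - 0) < r" if n: "n \<ge> Suc N" for n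
  proof -
    have "real n > 2 * \<bar>C\<bar> / r" using N n by linarith
    then have "\<bar>C\<bar> < r/2 * real n" using r by (simp add: field_simps)
    then have "\<bar>a n y\<bar> < r * real n" using C[OF y, of n] by (simp add: field_simps)
    then show ?thesis using n by (simp add: field_simps)
  qed
  then show "\<exists>no. \<forall>n\<ge>no. norm (a n y / real n - 0) < r" by blast
qed

lemma unif_sublinear_sup_norm:
  assumes U: "unif_sublinear Y a" and ne: "Y \<noteq> {}"
  shows "(\<lambda>n. sup_norm Y (a n) / ereal (real n)) \<longlonglongrightarrow> 0"
proof (rule order_tendstoI)
  have nn: "0 \<le> sup_norm Y (a n)" for n
  proof -
    obtain y where "y \<in> Y" using ne by blast
    then have "ereal \<bar>a n y\<bar> \<le> sup_norm Y (a n)" unfolding sup_norm_def by (rule SUP_upper)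
    then show ?thesis by (meson abs_ge_zero ereal_less_eq(5) order_trans)
  qed
  fix t :: ereal assume "t < 0"
  have "0 \<le> sup_norm Y (a n) / ereal (real n)" for n
    using nn[of n] by (cases "n = 0") (auto simp: zero_ereal_def[symmetric] divide_ereal_def ereal_zero_le_0_iff)
  then show "eventually (\<lambda>n. t < sup_norm Y (a n) / ereal (real n)) sequentially"
    using \<open>t < 0\<close> by (intro always_eventually allI) (rule order_less_le_trans)
next
  fix t :: ereal assume "0 < t"
  from ereal_dense2[OF this] obtain r where r: "0 < ereal r" "ereal r < t" by blast
  then have r0: "r > 0" by simp
  obtain C where C: "\<And>n y. y \<in> Y \<Longrightarrow> \<bar>a n y\<bar> \<le> r/2 * real n + C"
    using U half_gt_zero[OF r0] unfolding unif_sublinear_def by blast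
  obtain N :: nat where N: "real N > 2 * \<bar>C\<bar> / r" using reals_Archimedean2 by blast
  have "eventually (\<lambda>n. n \<ge> Suc N) sequentially" by (rule eventually_ge_at_top)
  then show "eventually (\<lambda>n. sup_norm Y (a n) / ereal (real n) < t) sequentially"
  proof eventually_elim
    case (elim n)
    have "real n > 2 * \<bar>C\<bar> / r" using N elim by linarith
    then have "\<bar>C\<bar> < r/2 * real n" using r0 by (simp add: field_simps)
    then have "\<bar>a n y\<bar> \<le> r * real n" if "y \<in> Y" for y using C[OF that, of n] by (simp add: field_simps)
    then have "sup_norm Y (a n) \<le> ereal (r * real n)" unfolding sup_norm_def by (intro SUP_least) auto
    then have "sup_norm Y (a n) / ereal (real n) \<le> ereal (r * real n) / ereal (real n)"
      using elim by (intro ereal_divide_right_mono) auto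
    also have "\<dots> = ereal r" using elim by simp
    finally show ?case using r(2) by (rule order_le_less_trans)
  qed
qed

lemma sup_norm_tendsto_pointwise:
  assumes "(\<lambda>n. sup_norm Y (a n) / ereal (real n)) \<longlonglongrightarrow> 0" "y \<in> Y"
  shows "(\<lambda>n. a n y / real n) \<longlonglongrightarrow> 0"
proof -
  have "(\<lambda>n. ereal \<bar>a n y / real n\<bar>) \<longlonglongrightarrow> 0"
  proof (rule tendsto_sandwich[OF _ _ tendsto_const assms(1)])
    have "eventually (\<lambda>n. n > 0) sequentially" by (rule eventually_gt_at_top)
    then show "eventually (\<lambda>n. ereal \<bar>a n y / real n\<bar> \<le> sup_norm Y (a n) / ereal (real n)) sequentially"
    proof eventually_elim
      case (elim n)
      have "ereal \<bar>a n y\<bar> \<le> sup_norm Y (a n)" unfolding sup_norm_def using assms(2) by (rule SUP_upper)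
      then have "ereal \<bar>a n y\<bar> / ereal (real n) \<le> sup_norm Y (a n) / ereal (real n)"
        using elim by (intro ereal_divide_right_mono) auto
      then show ?case using elim by simp
    qed
  qed simp
  then have "(\<lambda>n. \<bar>a n y / real n\<bar>) \<longlonglongrightarrow> 0" unfolding zero_ereal_def by simp
  then show ?thesis by (rule tendsto_rabs_zero_cancel)
qed

lemma growth_zero: "growth (\<lambda>n. 0) = 0"
  by (simp add: growth_def zero_ereal_def[symmetric] Limsup_const)

lemma growth_linear: "growth (\<lambda>n. c * real n) = ereal c"
  using growth_add_linear[of "\<lambda>n. 0" c] growth_zero by simp

lemma growth_of_tendsto:
  assumes "(\<lambda>n. a n / real n) \<longlonglongrightarrow> 0" shows "growth a = 0"
  unfolding growth_def zero_ereal_def using assms by (intro lim_imp_Limsup) auto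

context nonempty_subshift
begin

text \<open>The suprema over \<open>Z\<close> of the deviations of the logarithms serve as logarithms of the
  constants.\<close>
lemma weak_gibbs_iff:
  assumes m: "m \<in> inv_measures Z"
  shows "weak_gibbs Z \<psi> m \<longleftrightarrow> (\<forall>x\<in>Z. \<forall>n. 0 < measure m (cyl Z (initial_word n x))) \<and>
    unif_sublinear Z (\<lambda>n x. ln (measure m (cyl Z (initial_word n x))) + real_of_ereal (pressure Z \<psi>) * real n - birkhoff_sum \<psi> n x)"
    (is "?l \<longleftrightarrow> ?p \<and> unif_sublinear Z ?a")
proof
  interpret measure_preserving m shift_map by (rule inv_measures_preserving[OF m])
  let ?P = "real_of_ereal (pressure Z \<psi>)"
  let ?m = "\<lambda>n x. measure m (cyl Z (initial_word n x))"
  let ?e = "\<lambda>n x. exp (- real n * ?P + birkhoff_sum \<psi> n x)"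
  have m0: "measure m (cyl Z []) = 1"
  proof -
    have "cyl Z [] = space m" by (simp add: cyl_def inv_measures_space[OF m])
    then show ?thesis by (simp add: prob_space)
  qed
  {
    assume ?l
    then obtain C :: "nat \<Rightarrow> real" where C: "\<And>n. n \<ge> 1 \<Longrightarrow> C n > 0" "(\<lambda>n. ln (C n) / real n) \<longlonglongrightarrow> 0"
      "\<And>x n. x \<in> Z \<Longrightarrow> n \<ge> 1 \<Longrightarrow> 1 / C n < ?m n x / ?e n x \<and> ?m n x / ?e n x < C n"
      unfolding weak_gibbs_def Let_def by blast
    have pos: "0 < ?m n x" if "x \<in> Z" for x n
    proof (cases "n = 0")
      case False
      then have n: "n \<ge> 1" by simp
      have "0 < 1 / C n" using C(1)[OF n] by simp
      then have "0 < ?m n x / ?e n x" using C(3)[OF that n] by linarith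
      then show ?thesis by (simp add: zero_less_divide_iff)
    qed (simp add: m0)
    have "unif_sublinear Z ?a"
      unfolding unif_sublinear_def
    proof (intro allI impI)
      fix \<epsilon> :: real assume e: "\<epsilon> > 0"
      have "growth (\<lambda>n. ln (C n)) \<le> ereal 0" using growth_of_tendsto[OF C(2)] by (simp add: zero_ereal_def)
      from growth_leD[OF this e] obtain K where K: "\<And>n. ln (C n) \<le> \<epsilon> * real n + K" by auto
      have "\<bar>?a n x\<bar> \<le> \<epsilon> * real n + \<bar>K\<bar>" if x: "x \<in> Z" for n x
      proof (cases "n = 0")
        case True
        then show ?thesis using m0 by simp
      next
        case False
        then have n: "n \<ge> 1" by simp
        have d: "?m n x / ?e n x > 0" using pos[OF x, of n] by simp
        have "ln (?m n x / ?e n x) = ?a n x" using pos[OF x, of n] by (simp add: ln_div mult.commute)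
        moreover have "ln (?m n x / ?e n x) < ln (C n)" using C(3)[OF x n] d by simp
        moreover have "ln (1 / C n) < ln (?m n x / ?e n x)"
          using C(3)[OF x n] d C(1)[OF n] by (subst ln_less_cancel_iff) auto
        moreover have "ln (1 / C n) = - ln (C n)" using C(1)[OF n] by (simp add: ln_div)
        ultimately have "\<bar>?a n x\<bar> \<le> ln (C n)" by linarith
        then show ?thesis using K[of n] by linarith
      qed
      then show "\<exists>C. \<forall>n. \<forall>x\<in>Z. \<bar>?a n x\<bar> \<le> \<epsilon> * real n + C" by blast
    qed
    then show "?p \<and> unif_sublinear Z ?a" using pos by blast
  next
    assume r: "?p \<and> unif_sublinear Z ?a"
    define s where "s n = (SUP x\<in>Z. \<bar>?a n x\<bar>)" for n
    have bdd: "bdd_above ((\<lambda>x. \<bar>?a n x\<bar>) ` Z)" for n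
    proof -
      obtain C where "\<forall>n. \<forall>x\<in>Z. \<bar>?a n x\<bar> \<le> 1 * real n + C"
        using conjunct2[OF r] unfolding unif_sublinear_def by (metis zero_less_one)
      then show ?thesis by (intro bdd_aboveI[of _ "1 * real n + C"]) auto
    qed
    have s: "\<bar>?a n x\<bar> \<le> s n" if "x \<in> Z" for n x unfolding s_def by (rule cSUP_upper[OF that bdd])
    have s0: "s n \<ge> 0" for n using s[of _ n] Z_nonempty by (meson abs_ge_zero ex_in_conv order_trans)
    \<comment> \<open>The summand \<open>1\<close> makes the inequalities of the definition strict.\<close>
    have "unif_sublinear {()} (\<lambda>n _. s n + 1)"
      unfolding unif_sublinear_def
    proof (intro allI impI)
      fix \<epsilon> :: real assume "\<epsilon> > 0"
      then obtain C where C: "\<forall>n. \<forall>x\<in>Z. \<bar>?a n x\<bar> \<le> \<epsilon> * real n + C" using conjunct2[OF r] unfolding unif_sublinear_def by blast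
      then have "s n \<le> \<epsilon> * real n + C" for n unfolding s_def using Z_nonempty by (intro cSUP_least) auto
      then have "\<bar>s n + 1\<bar> \<le> \<epsilon> * real n + (C + 1)" for n using s0[of n] by (simp add: algebra_simps)
      then show "\<exists>C. \<forall>n. \<forall>x\<in>{()}. \<bar>s n + 1\<bar> \<le> \<epsilon> * real n + C" by blast
    qed
    from unif_sublinear_tendsto[OF this, of "()"] have "(\<lambda>n. ln (exp (s n + 1)) / real n) \<longlonglongrightarrow> 0" by simp
    moreover have "1 / exp (s n + 1) < ?m n x / ?e n x \<and> ?m n x / ?e n x < exp (s n + 1)" if x: "x \<in> Z" for n x
    proof -
      have pos: "?m n x > 0" using r x by blast
      have q: "?m n x / ?e n x = exp (?a n x)"
        using pos by (simp add: exp_add exp_diff exp_minus field_simps)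
      show ?thesis unfolding q using s[OF x, of n] by (simp add: exp_minus[symmetric] inverse_eq_divide[symmetric] abs_le_iff)
    qed
    ultimately show ?l unfolding weak_gibbs_def Let_def using m
      by (intro conjI exI[of _ "\<lambda>n. exp (s n + 1)"]) auto
  }
qed

lemma sum_measure_cyl:
  assumes m: "m \<in> inv_measures Z" shows "(\<Sum>v\<in>words Z n. measure m (cyl Z v)) = 1"
proof -
  interpret measure_preserving m shift_map by (rule inv_measures_preserving[OF m])
  have sp: "space m = Z" by (rule inv_measures_space[OF m])
  have "label_prob (initial_word n) v = measure m (cyl Z v)" if "v \<in> words Z n" for v
    unfolding label_prob_def using that sp by (intro arg_cong[of _ _ "measure m"]) (auto simp: cyl_def words_eq)
  moreover have "initial_word n ` space m = words Z n" by (simp add: words_eq sp)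
  ultimately show ?thesis using sum_label_prob[OF simple_initial_word[OF m, of n]] by (simp cong: sum.cong)
qed

end

context factor_code
begin

definition pushforward :: "(nat \<Rightarrow> nat) measure \<Rightarrow> (nat \<Rightarrow> nat) measure" where
  "pushforward \<mu> = distr \<mu> (borel_of_shift Y) \<pi>"

lemma pi_measurable:
  assumes \<mu>: "\<mu> \<in> inv_measures X" shows "\<pi> \<in> measurable \<mu> (borel_of_shift Y)"
  unfolding borel_of_shift_def
proof (rule measurable_restrict_space2)
  show "\<pi> \<in> space \<mu> \<rightarrow> Y" using X.inv_measures_space[OF \<mu>] pi_in by auto
  show "\<pi> \<in> borel_measurable \<mu>"
    using borel_measurable_continuous_on_restrict[OF continuous_pi] measurable_cong_sets[OF X.inv_measures_sets[OF \<mu>] refl] by blast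
qed

lemma pushforward_inv:
  assumes \<mu>: "\<mu> \<in> inv_measures X" shows "pushforward \<mu> \<in> inv_measures Y"
proof -
  interpret measure_preserving \<mu> shift_map by (rule X.inv_measures_preserving[OF \<mu>])
  note pm = pi_measurable[OF \<mu>]
  have se: "sets (pushforward \<mu>) = sets (borel_of_shift Y)" by (simp add: pushforward_def)
  have sm: "shift_map \<in> measurable (borel_of_shift Y) (borel_of_shift Y)"
    unfolding borel_of_shift_def by (rule Y.shift_map_measurable)
  have "distr (pushforward \<mu>) (pushforward \<mu>) shift_map = distr (pushforward \<mu>) (borel_of_shift Y) shift_map"
    by (rule distr_cong) (simp_all add: se)
  also have "\<dots> = distr \<mu> (borel_of_shift Y) (shift_map \<circ> \<pi>)"
    unfolding pushforward_def by (rule distr_distr[OF sm pm])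
  also have "\<dots> = distr \<mu> (borel_of_shift Y) (\<pi> \<circ> shift_map)"
    using pi_shift[of _ 1] X.inv_measures_space[OF \<mu>] by (intro distr_cong) auto
  also have "\<dots> = distr (distr \<mu> \<mu> shift_map) (borel_of_shift Y) \<pi>"
    by (rule distr_distr[OF pm T_measurable, symmetric])
  also have "\<dots> = pushforward \<mu>" unfolding pushforward_def T_invariant ..
  finally have "distr (pushforward \<mu>) (pushforward \<mu>) shift_map = pushforward \<mu>" .
  moreover have "prob_space (pushforward \<mu>)" unfolding pushforward_def by (rule prob_space_distr[OF pm])
  ultimately show ?thesis using se by (simp add: inv_measures_def)
qed

lemma measure_pushforward_cyl:
  assumes \<mu>: "\<mu> \<in> inv_measures X"
  shows "measure (pushforward \<mu>) (cyl Y v) = (\<Sum>u\<in>lifts v. measure \<mu> (cyl X u))"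
proof -
  interpret measure_preserving \<mu> shift_map by (rule X.inv_measures_preserving[OF \<mu>])
  have sp: "space \<mu> = X" by (rule X.inv_measures_space[OF \<mu>])
  have "cyl Y v \<in> sets (pushforward \<mu>)"
    using Y.word_set_sets[OF pushforward_inv[OF \<mu>], of "\<lambda>w. w = v" "length v"] by (simp add: cyl_def)
  then have cs: "cyl Y v \<in> sets (borel_of_shift Y)" by (simp add: pushforward_def)
  have "measure (pushforward \<mu>) (cyl Y v) = measure \<mu> (\<pi> -` cyl Y v \<inter> space \<mu>)"
    unfolding pushforward_def by (rule measure_distr[OF pi_measurable[OF \<mu>] cs])
  also have "\<pi> -` cyl Y v \<inter> space \<mu> = (\<Union>u\<in>lifts v. cyl X u)"
  proof (intro set_eqI iffI)
    fix x assume "x \<in> \<pi> -` cyl Y v \<inter> space \<mu>"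
    then have x: "x \<in> X" "initial_word (length v) (\<pi> x) = v" using sp by (auto simp: cyl_def)
    then have "initial_word (length v) x \<in> lifts v" using map_initial_word[OF x(1)] by (auto simp: lifts_def X.words_eq)
    then show "x \<in> (\<Union>u\<in>lifts v. cyl X u)" using x(1) by (intro UN_I) (auto simp: cyl_def)
  next
    fix x assume "x \<in> (\<Union>u\<in>lifts v. cyl X u)"
    then obtain u where u: "u \<in> lifts v" "x \<in> X" "initial_word (length u) x = u" by (auto simp: cyl_def)
    then have "length u = length v" "map \<theta> u = v" by (auto simp: lifts_def X.words_eq)
    then have "initial_word (length v) (\<pi> x) = v" using map_initial_word[OF u(2), of "length v"] u(3) by simp
    then show "x \<in> \<pi> -` cyl Y v \<inter> space \<mu>" using u(2) pi_in sp by (auto simp: cyl_def)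
  qed
  also have "measure \<mu> (\<Union>u\<in>lifts v. cyl X u) = (\<Sum>u\<in>lifts v. measure \<mu> (cyl X u))"
  proof (rule finite_measure_finite_Union)
    show "disjoint_family_on (cyl X) (lifts v)"
      unfolding disjoint_family_on_def lifts_def cyl_def by (auto simp: X.words_eq)
    have "cyl X u \<in> sets \<mu>" for u using X.word_set_sets[OF \<mu>, of "\<lambda>w. w = u" "length u"] by (simp add: cyl_def)
    then show "cyl X ` lifts v \<subseteq> sets \<mu>" by auto
  qed simp
  finally show ?thesis .
qed

text \<open>The Gibbs property compares the weights of words with the measures of their
  cylinders, and the cylinders of the lifts of \<open>v\<close> partition the preimage of the cylinder of
  \<open>v\<close>.\<close>
lemma pushforward_fibre_sum:
  assumes f: "continuous_on X f" and g: "weak_gibbs X f \<mu>"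
  defines "P \<equiv> real_of_ereal (pressure X f)"
  shows "\<And>n y. y \<in> Y \<Longrightarrow> 0 < measure (pushforward \<mu>) (cyl Y (initial_word n y))"
    and "unif_sublinear Y (\<lambda>n y. ln (measure (pushforward \<mu>) (cyl Y (initial_word n y))) + P * real n - ln (fibre_sum f (initial_word n y)))"
proof -
  have \<mu>: "\<mu> \<in> inv_measures X" using g by (simp add: weak_gibbs_def)
  have pos: "0 < measure \<mu> (cyl X (initial_word n x))" if "x \<in> X" for n x
    using g X.weak_gibbs_iff[OF \<mu>] that by blast
  have sub: "unif_sublinear X (\<lambda>n x. ln (measure \<mu> (cyl X (initial_word n x))) + P * real n - birkhoff_sum f n x)"
    using g X.weak_gibbs_iff[OF \<mu>] unfolding P_def by blast
  have lpos: "0 < measure \<mu> (cyl X u)" if u: "u \<in> lifts v" for u v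
  proof -
    have "u \<in> words X (length v)" using u by (simp add: lifts_def)
    then obtain x where "x \<in> X" "u = initial_word (length v) x" by (auto simp: X.words_eq)
    then show ?thesis using pos by simp
  qed
  show nu_pos: "0 < measure (pushforward \<mu>) (cyl Y (initial_word n y))" if y: "y \<in> Y" for n y
  proof -
    have "initial_word n y \<in> words Y n" using y by (auto simp: Y.words_eq)
    then obtain u where "u \<in> lifts (initial_word n y)" using lifts_nonempty by blast
    then show ?thesis unfolding measure_pushforward_cyl[OF \<mu>] using lpos by (intro sum_pos) auto
  qed
  show "unif_sublinear Y (\<lambda>n y. ln (measure (pushforward \<mu>) (cyl Y (initial_word n y))) + P * real n - ln (fibre_sum f (initial_word n y)))"
    unfolding unif_sublinear_def
  proof (intro allI impI)
    fix \<epsilon> :: real assume "\<epsilon> > 0"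
    then obtain C where C: "\<And>n x. x \<in> X \<Longrightarrow> \<bar>ln (measure \<mu> (cyl X (initial_word n x))) + P * real n - birkhoff_sum f n x\<bar> \<le> \<epsilon> * real n + C"
      using unif_sublinearD[OF sub] by metis
    have "\<bar>ln (measure (pushforward \<mu>) (cyl Y (initial_word n y))) + P * real n - ln (fibre_sum f (initial_word n y))\<bar> \<le> \<epsilon> * real n + C"
      if y: "y \<in> Y" for n y
    proof -
      let ?v = "initial_word n y" and ?r = "\<epsilon> * real n + C"
      have w: "measure \<mu> (cyl X u) \<le> exp (?r - P * real n) * X.weight f u \<and> exp (- ?r - P * real n) * X.weight f u \<le> measure \<mu> (cyl X u)"
        if u: "u \<in> lifts ?v" for u
      proof -
        obtain x where x: "x \<in> X" "initial_word n x = u" "X.weight f u = exp (birkhoff_sum f n x)"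
          using X.weight_attained[OF f, of u n] u by (auto simp: lifts_def)
        have "ln (measure \<mu> (cyl X u)) \<le> ?r - P * real n + birkhoff_sum f n x" "- ?r - P * real n + birkhoff_sum f n x \<le> ln (measure \<mu> (cyl X u))"
          using C[OF x(1), of n] unfolding x(2) by linarith+
        then have "exp (ln (measure \<mu> (cyl X u))) \<le> exp (?r - P * real n + birkhoff_sum f n x)"
           "exp (- ?r - P * real n + birkhoff_sum f n x) \<le> exp (ln (measure \<mu> (cyl X u)))" by (simp_all only: exp_le_cancel_iff)
        then show ?thesis unfolding exp_ln[OF lpos[OF u]] x(3) exp_add[symmetric] by blast
      qed
      let ?nu = "measure (pushforward \<mu>) (cyl Y ?v)"
      note fp = fibre_sum_pos'[OF f y, of n]
      have "?nu \<le> exp (?r - P * real n) * fibre_sum f ?v"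
        unfolding measure_pushforward_cyl[OF \<mu>] fibre_sum_def sum_distrib_left using w by (intro sum_mono) blast
      then have "ln ?nu \<le> ln (exp (?r - P * real n) * fibre_sum f ?v)" using nu_pos[OF y, of n] by simp
      then have 1: "ln ?nu \<le> ?r - P * real n + ln (fibre_sum f ?v)" using fp by (simp add: ln_mult)
      have "exp (- ?r - P * real n) * fibre_sum f ?v \<le> ?nu"
        unfolding measure_pushforward_cyl[OF \<mu>] fibre_sum_def sum_distrib_left using w by (intro sum_mono) blast
      then have "ln (exp (- ?r - P * real n) * fibre_sum f ?v) \<le> ln ?nu" using fp by (intro ln_mono) auto
      then have 2: "- ?r - P * real n + ln (fibre_sum f ?v) \<le> ln ?nu" using fp by (simp add: ln_mult)
      show ?thesis using 1 2 by linarith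
    qed
    then show "\<exists>C. \<forall>n. \<forall>y\<in>Y. \<bar>ln (measure (pushforward \<mu>) (cyl Y (initial_word n y))) + P * real n - ln (fibre_sum f (initial_word n y))\<bar> \<le> \<epsilon> * real n + C"
      by blast
  qed
qed

text \<open>The measures of the cylinders of a given length add up to \<open>1\<close>.\<close>
lemma pressure_of_sublinear:
  assumes h: "continuous_on Y h" and m: "m \<in> inv_measures Y"
    and pos: "\<And>n y. y \<in> Y \<Longrightarrow> 0 < measure m (cyl Y (initial_word n y))"
    and sub: "unif_sublinear Y (\<lambda>n y. ln (measure m (cyl Y (initial_word n y))) + P * real n - birkhoff_sum h n y)"
  shows "pressure Y h = ereal P"
proof -
  note pp = Y.partition_sum_pos[OF h]
  have main: "\<exists>C. \<forall>n. \<bar>ln (Y.partition_sum h n) - P * real n\<bar> \<le> \<epsilon> * real n + C" if e: "\<epsilon> > 0" for \<epsilon>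
  proof -
    obtain C where C: "\<And>n y. y \<in> Y \<Longrightarrow> \<bar>ln (measure m (cyl Y (initial_word n y))) + P * real n - birkhoff_sum h n y\<bar> \<le> \<epsilon> * real n + C"
      using unif_sublinearD[OF sub e] by metis
    have "\<bar>ln (Y.partition_sum h n) - P * real n\<bar> \<le> \<epsilon> * real n + C" for n
    proof -
      let ?r = "\<epsilon> * real n + C"
      have w: "Y.weight h v \<le> exp (?r + P * real n) * measure m (cyl Y v) \<and> exp (- ?r + P * real n) * measure m (cyl Y v) \<le> Y.weight h v"
        if v: "v \<in> words Y n" for v
      proof -
        obtain y where y: "y \<in> Y" "initial_word n y = v" "Y.weight h v = exp (birkhoff_sum h n y)"
          using Y.weight_attained[OF h v] by metis
        have p: "0 < measure m (cyl Y v)" using pos[OF y(1), of n] y(2) by simp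
        have "birkhoff_sum h n y \<le> ?r + P * real n + ln (measure m (cyl Y v))" "- ?r + P * real n + ln (measure m (cyl Y v)) \<le> birkhoff_sum h n y"
          using C[OF y(1), of n] unfolding y(2) by linarith+
        then have "exp (birkhoff_sum h n y) \<le> exp (?r + P * real n + ln (measure m (cyl Y v)))"
          "exp (- ?r + P * real n + ln (measure m (cyl Y v))) \<le> exp (birkhoff_sum h n y)" by (simp_all only: exp_le_cancel_iff)
        then show ?thesis unfolding y(3) exp_add[of "?r + P * real n"] exp_add[of "- ?r + P * real n"] exp_ln[OF p] by blast
      qed
      have "Y.partition_sum h n \<le> exp (?r + P * real n) * (\<Sum>v\<in>words Y n. measure m (cyl Y v))"
        unfolding Y.partition_sum_def sum_distrib_left using w by (intro sum_mono) blast
      then have "Y.partition_sum h n \<le> exp (?r + P * real n)" unfolding Y.sum_measure_cyl[OF m] by simp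
      from ln_mono[OF this pp] have 1: "ln (Y.partition_sum h n) \<le> ?r + P * real n" by simp
      have "exp (- ?r + P * real n) * (\<Sum>v\<in>words Y n. measure m (cyl Y v)) \<le> Y.partition_sum h n"
        unfolding Y.partition_sum_def sum_distrib_left using w by (intro sum_mono) blast
      then have "exp (- ?r + P * real n) \<le> Y.partition_sum h n" unfolding Y.sum_measure_cyl[OF m] by simp
      from ln_mono[OF this] have 2: "- ?r + P * real n \<le> ln (Y.partition_sum h n)" by simp
      show ?thesis using 1 2 by linarith
    qed
    then show ?thesis by blast
  qed
  have "growth (\<lambda>n. ln (Y.partition_sum h n)) = growth (\<lambda>n. P * real n)"
    using growth_cong[of "{()}" "\<lambda>n _. ln (Y.partition_sum h n)" "\<lambda>n _. P * real n" "()"] main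
    unfolding unif_sublinear_def by auto
  then show ?thesis unfolding Y.pressure_eq growth_linear .
qed

text \<open>\<open>h\<close> is a potential on \<open>Y\<close> whose Birkhoff sums describe the fibre sums of \<open>f\<close>: the
  uniform statement to which all of the equivalent conditions reduce.\<close>
definition fibre_potential :: "((nat \<Rightarrow> nat) \<Rightarrow> real) \<Rightarrow> ((nat \<Rightarrow> nat) \<Rightarrow> real) \<Rightarrow> bool" where
  "fibre_potential f h \<longleftrightarrow> unif_sublinear Y (\<lambda>n y. ln (fibre_sum f (initial_word n y)) - birkhoff_sum h n y)"

definition fibre_potential_periodic :: "((nat \<Rightarrow> nat) \<Rightarrow> real) \<Rightarrow> ((nat \<Rightarrow> nat) \<Rightarrow> real) \<Rightarrow> bool" where
  "fibre_potential_periodic f h \<longleftrightarrow> (\<forall>z\<in>Y. periodic_point z \<longrightarrow> growth (\<lambda>n. ln (fibre_sum f (initial_word n z)) - birkhoff_sum h n z) = 0)"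

text \<open>Fibre sums and measures of cylinders under \<open>\<pi> \<mu>\<close> are comparable. A potential \<open>\<psi>\<close> of
  a weak Gibbs measure must be corrected by the difference of the pressures of \<open>f\<close> and \<open>\<psi>\<close>, as
  the comparison involves the pressure of \<open>f\<close>.\<close>
lemma ex_fibre_potential_iff_weak_gibbs:
  assumes f: "continuous_on X f" and g: "weak_gibbs X f \<mu>"
  shows "(\<exists>h. continuous_on Y h \<and> fibre_potential f h) \<longleftrightarrow> (\<exists>\<psi>. continuous_on Y \<psi> \<and> weak_gibbs Y \<psi> (pushforward \<mu>))"
proof -
  define P where "P = real_of_ereal (pressure X f)"
  have \<mu>: "\<mu> \<in> inv_measures X" using g by (simp add: weak_gibbs_def)
  let ?A = "\<lambda>n y. ln (measure (pushforward \<mu>) (cyl Y (initial_word n y)))"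
  note pos = pushforward_fibre_sum(1)[OF f g] and sub = pushforward_fibre_sum(2)[OF f g, folded P_def]
  note inv = pushforward_inv[OF \<mu>]
  show ?thesis
  proof
    assume "\<exists>h. continuous_on Y h \<and> fibre_potential f h"
    then obtain h where h: "continuous_on Y h" "fibre_potential f h" by blast
    have s: "unif_sublinear Y (\<lambda>n y. ?A n y + P * real n - birkhoff_sum h n y)"
      using unif_sublinear_add[OF sub h(2)[unfolded fibre_potential_def]]
      by (rule unif_sublinear_cong[THEN iffD1, rotated]) simp
    have "pressure Y h = ereal P" by (rule pressure_of_sublinear[OF h(1) inv pos s])
    then have "weak_gibbs Y h (pushforward \<mu>)" unfolding Y.weak_gibbs_iff[OF inv] using s pos by simp
    then show "\<exists>\<psi>. continuous_on Y \<psi> \<and> weak_gibbs Y \<psi> (pushforward \<mu>)" using h(1) by blast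
  next
    assume "\<exists>\<psi>. continuous_on Y \<psi> \<and> weak_gibbs Y \<psi> (pushforward \<mu>)"
    then obtain \<psi> where \<psi>: "continuous_on Y \<psi>" "weak_gibbs Y \<psi> (pushforward \<mu>)" by blast
    define Q where "Q = real_of_ereal (pressure Y \<psi>)"
    define h where "h y = \<psi> y + (P - Q)" for y
    have S: "birkhoff_sum h n y = birkhoff_sum \<psi> n y + (P - Q) * real n" for n y
      by (simp add: birkhoff_sum_def h_def sum.distrib mult.commute)
    have "unif_sublinear Y (\<lambda>n y. ?A n y + Q * real n - birkhoff_sum \<psi> n y)"
      using \<psi>(2) unfolding Y.weak_gibbs_iff[OF inv] Q_def by blast
    from unif_sublinear_uminus[OF unif_sublinear_add[OF unif_sublinear_uminus[OF this] sub]]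
    have "fibre_potential f h" unfolding fibre_potential_def S
      by (rule unif_sublinear_cong[THEN iffD1, rotated]) (simp add: algebra_simps)
    moreover have "continuous_on Y h" unfolding h_def[abs_def] by (intro continuous_intros \<psi>(1))
    ultimately show "\<exists>h. continuous_on Y h \<and> fibre_potential f h" by blast
  qed
qed

context
  fixes f h :: "(nat \<Rightarrow> nat) \<Rightarrow> real" and F
  assumes f: "continuous_on X f" and h: "continuous_on Y h"
  defines "F \<equiv> \<lambda>x. f x - h (\<pi> x)"
begin

lemma continuous_F: "continuous_on X F" unfolding F_def by (rule continuous_minus_pi[OF f h])

lemma growth_F:
  assumes "y \<in> Y"
  shows "growth (\<lambda>n. ln (fibre_sum F (initial_word n y))) = growth (\<lambda>n. ln (fibre_sum f (initial_word n y)) - birkhoff_sum h n y)"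
  unfolding F_def by (rule growth_cong[OF fibre_sum_minus_pi[OF f h] assms])

lemma fibre_potential_iff_F: "fibre_potential f h \<longleftrightarrow> unif_sublinear Y (\<lambda>n y. ln (fibre_sum F (initial_word n y)))"
proof
  assume c: "fibre_potential f h"
  show "unif_sublinear Y (\<lambda>n y. ln (fibre_sum F (initial_word n y)))"
    using unif_sublinear_add[OF fibre_sum_minus_pi[OF f h] c[unfolded fibre_potential_def]] unfolding F_def by simp
next
  assume "unif_sublinear Y (\<lambda>n y. ln (fibre_sum F (initial_word n y)))"
  from unif_sublinear_add[OF this unif_sublinear_uminus[OF fibre_sum_minus_pi[OF f h]]]
  show "fibre_potential f h" unfolding F_def fibre_potential_def by simp
qed

lemma fibre_potential_iff_periodic: "fibre_potential f h \<longleftrightarrow> fibre_potential_periodic f h"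
proof
  assume "fibre_potential f h"
  then show "fibre_potential_periodic f h"
    unfolding fibre_potential_def fibre_potential_periodic_def
    using growth_of_tendsto[OF unif_sublinear_tendsto[of Y "\<lambda>n y. ln (fibre_sum f (initial_word n y)) - birkhoff_sum h n y"]] by auto
next
  assume "fibre_potential_periodic f h"
  then show "fibre_potential f h" unfolding fibre_potential_iff_F fibre_potential_periodic_def
    by (intro unif_sublinear_if_periodic[OF continuous_F]) (simp add: growth_F)
qed

abbreviation q :: "nat \<Rightarrow> (nat \<Rightarrow> nat) \<Rightarrow> real" where
  "q \<equiv> \<lambda>n y. ln (g_fun X \<theta> f n y / exp (birkhoff_sum h n y))"

lemma q_eq: "y \<in> Y \<Longrightarrow> q n y = ln (fibre_sum f (initial_word n y)) - birkhoff_sum h n y"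
  using fibre_sum_pos'[OF f, of y n] by (simp add: g_fun_eq_fibre_sum[OF f] ln_div)

lemma fibre_potential_iff_q: "fibre_potential f h \<longleftrightarrow> unif_sublinear Y q"
  unfolding fibre_potential_def by (rule unif_sublinear_cong) (simp add: q_eq)

lemma fibre_potential_iff_rel_pressure:
  "fibre_potential f h \<longleftrightarrow> (\<forall>y\<in>Y. periodic_point y \<longrightarrow> rel_pressure X \<pi> F y = 0)"
  unfolding fibre_potential_iff_periodic fibre_potential_periodic_def
  using rel_pressure_periodic[OF continuous_F] growth_F by auto

lemma fibre_potential_if_periodic_limit:
  assumes "\<And>y. y \<in> Y \<Longrightarrow> periodic_point y \<Longrightarrow> (\<lambda>n. q n y / real n) \<longlonglongrightarrow> 0"
  shows "fibre_potential f h"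
  unfolding fibre_potential_iff_periodic fibre_potential_periodic_def
proof (intro ballI impI)
  fix z assume z: "z \<in> Y" "periodic_point z"
  show "growth (\<lambda>n. ln (fibre_sum f (initial_word n z)) - birkhoff_sum h n z) = 0"
    using growth_of_tendsto[OF assms[OF z]] q_eq[OF z(1)] by simp
qed

lemma fibre_potential_iff_periodic_limit:
  "fibre_potential f h \<longleftrightarrow> (\<forall>y\<in>Y. periodic_point y \<longrightarrow> (\<lambda>n. q n y / real n) \<longlonglongrightarrow> 0)"
  using fibre_potential_if_periodic_limit unif_sublinear_tendsto[of Y q] fibre_potential_iff_q by blast

lemma fibre_potential_iff_limit: "fibre_potential f h \<longleftrightarrow> (\<forall>y\<in>Y. (\<lambda>n. q n y / real n) \<longlonglongrightarrow> 0)"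
  using fibre_potential_if_periodic_limit unif_sublinear_tendsto[of Y q] fibre_potential_iff_q by blast

lemma fibre_potential_iff_asymptotically_additive:
  "fibre_potential f h \<longleftrightarrow> log_asymptotically_additive Y (g_fun X \<theta> f) \<and>
     (\<lambda>n. sup_norm Y (q n) / ereal (real n)) \<longlonglongrightarrow> 0"
proof
  assume c: "fibre_potential f h"
  have 1: "(\<lambda>n. sup_norm Y (q n) / ereal (real n)) \<longlonglongrightarrow> 0"
    using c unfolding fibre_potential_iff_q by (rule unif_sublinear_sup_norm[OF _ Y.Z_nonempty])
  have 2: "(\<lambda>n. sup_norm Y (\<lambda>y. ln (g_fun X \<theta> f n y) - birkhoff_sum h n y) / ereal (real n)) \<longlonglongrightarrow> 0"
    using c unfolding fibre_potential_def g_fun_eq_fibre_sum[OF f] by (rule unif_sublinear_sup_norm[OF _ Y.Z_nonempty])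
  have "log_asymptotically_additive Y (g_fun X \<theta> f)"
    unfolding log_asymptotically_additive_def
  proof (intro conjI allI impI)
    fix n :: nat
    show "continuous_on Y (g_fun X \<theta> f n)"
      using continuous_on_word_fun[of Y "fibre_sum f" n] by (simp add: g_fun_eq_fibre_sum[OF f] cong: continuous_on_cong)
    show "\<forall>y\<in>Y. 0 < g_fun X \<theta> f n y" using fibre_sum_pos'[OF f] by (simp add: g_fun_eq_fibre_sum[OF f])
    fix \<epsilon> :: real assume "\<epsilon> > 0"
    moreover have "limsup (\<lambda>n. sup_norm Y (\<lambda>y. ln (g_fun X \<theta> f n y) - birkhoff_sum h n y) / ereal (real n)) = 0"
      by (rule lim_imp_Limsup[OF _ 2]) simp
    ultimately show "\<exists>\<rho>. continuous_on Y \<rho> \<and>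
        limsup (\<lambda>n. sup_norm Y (\<lambda>y. ln (g_fun X \<theta> f n y) - birkhoff_sum \<rho> n y) / ereal (real n)) < ereal \<epsilon>"
      using h by (intro exI[of _ h]) simp
  qed
  then show "log_asymptotically_additive Y (g_fun X \<theta> f) \<and> (\<lambda>n. sup_norm Y (q n) / ereal (real n)) \<longlonglongrightarrow> 0"
    using 1 by blast
next
  assume "log_asymptotically_additive Y (g_fun X \<theta> f) \<and> (\<lambda>n. sup_norm Y (q n) / ereal (real n)) \<longlonglongrightarrow> 0"
  then show "fibre_potential f h" unfolding fibre_potential_iff_limit using sup_norm_tendsto_pointwise[of Y q] by blast
qed

lemma fibre_potential_iff_compensation: "fibre_potential f h \<longleftrightarrow> compensation_function X Y \<pi> F"
proof
  assume "fibre_potential f h"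
  then show "compensation_function X Y \<pi> F" unfolding fibre_potential_iff_F by (rule compensation_if_sublinear[OF continuous_F])
next
  assume c: "compensation_function X Y \<pi> F"
  then show "fibre_potential f h" unfolding fibre_potential_iff_periodic fibre_potential_periodic_def
    using growth_if_compensation[OF continuous_F c] growth_F by auto
qed

lemma fibre_potential_iff_integral:
  "fibre_potential f h \<longleftrightarrow> (\<forall>m\<in>inv_measures Y. has_bochner_integral m (\<lambda>y. real_of_ereal (rel_pressure X \<pi> f y)) (integral\<^sup>L m h))"
proof
  assume "fibre_potential f h"
  then show "\<forall>m\<in>inv_measures Y. has_bochner_integral m (\<lambda>y. real_of_ereal (rel_pressure X \<pi> f y)) (integral\<^sup>L m h)"
    unfolding fibre_potential_def using integral_rel_pressure[OF f h] by blast
next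
  assume "\<forall>m\<in>inv_measures Y. has_bochner_integral m (\<lambda>y. real_of_ereal (rel_pressure X \<pi> f y)) (integral\<^sup>L m h)"
  then have "(\<integral>y. real_of_ereal (rel_pressure X \<pi> f y) \<partial>m) = integral\<^sup>L m h" if "m \<in> inv_measures Y" for m
    using that by (simp add: has_bochner_integral_iff)
  then show "fibre_potential f h" unfolding fibre_potential_iff_periodic fibre_potential_periodic_def
    using growth_if_integral_rel_pressure[OF f h] by blast
qed

end

end

theorem theorem7p2:
  fixes X Y :: "(nat \<Rightarrow> nat) set"
    and \<pi> :: "(nat \<Rightarrow> nat) \<Rightarrow> (nat \<Rightarrow> nat)"
    and \<theta> :: "nat \<Rightarrow> nat"
    and f :: "(nat \<Rightarrow> nat) \<Rightarrow> real"
    and \<mu> :: "(nat \<Rightarrow> nat) measure"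
  assumes "one_step_sft X" and "irreducible_shift X"
    and "subshift Y"
    and "factor_map X Y \<pi>" and "one_block X \<theta> \<pi>"
    and "continuous_on X f"
    and "weak_gibbs X f \<mu>"
  shows
    "let g = g_fun X \<theta> f;
         q = (\<lambda>h n y. ln (g n y / exp (birkhoff_sum h n y)));
         s1 = (\<lambda>h. \<forall>y\<in>Y. periodic_point y \<longrightarrow> rel_pressure X \<pi> (\<lambda>x. f x - h (\<pi> x)) y = 0);
         s1' = (\<lambda>h. \<forall>y\<in>Y. periodic_point y \<longrightarrow> (\<lambda>n. q h n y / real n) \<longlonglongrightarrow> 0);
         s2 = (\<lambda>h. compensation_function X Y \<pi> (\<lambda>x. f x - h (\<pi> x)));
         s3 = (\<lambda>h. \<forall>y\<in>Y. (\<lambda>n. q h n y / real n) \<longlonglongrightarrow> 0);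
         s4 = (\<lambda>h. log_asymptotically_additive Y g \<and>
                   (\<lambda>n. sup_norm Y (q h n) / ereal (real n)) \<longlonglongrightarrow> 0);
         s5 = (\<lambda>h. \<forall>m\<in>inv_measures Y.
                   has_bochner_integral m (\<lambda>y. real_of_ereal (rel_pressure X \<pi> f y))
                     (integral\<^sup>L m h))
     in (\<forall>h. continuous_on Y h \<longrightarrow>
           (s1 h \<longleftrightarrow> s1' h) \<and> (s1 h \<longleftrightarrow> s2 h) \<and> (s1 h \<longleftrightarrow> s3 h) \<and> (s1 h \<longleftrightarrow> s4 h) \<and> (s1 h \<longleftrightarrow> s5 h)) \<and>
        ((\<exists>h. continuous_on Y h \<and> s1 h \<and> s1' h \<and> s2 h \<and> s3 h \<and> s4 h \<and> s5 h) \<longleftrightarrow>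
         (\<exists>\<psi> :: (nat \<Rightarrow> nat) \<Rightarrow> real. continuous_on Y \<psi> \<and>
            weak_gibbs Y \<psi> (distr \<mu> (borel_of_shift Y) \<pi>)))"
proof -
  have "\<mu> \<in> inv_measures X" using assms(7) by (simp add: weak_gibbs_def)
  then have "prob_space \<mu>" "sets \<mu> = sets (borel_of_shift X)" by (auto simp: inv_measures_def)
  then have "space \<mu> = X" using sets_eq_imp_space_eq[of \<mu> "borel_of_shift X"] by (simp add: borel_of_shift_def space_restrict_space)
  then have "X \<noteq> {}" using prob_space.not_empty[OF \<open>prob_space \<mu>\<close>] by simp
  then interpret factor_code X Y \<pi> \<theta>
    using assms(1-5) by unfold_locales
  note f = assms(6)
  note equivalences = fibre_potential_iff_rel_pressure[OF f] fibre_potential_iff_periodic_limit[OF f] fibre_potential_iff_compensation[OF f]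
    fibre_potential_iff_limit[OF f] fibre_potential_iff_asymptotically_additive[OF f] fibre_potential_iff_integral[OF f]
  show ?thesis
    unfolding Let_def ex_fibre_potential_iff_weak_gibbs[OF f assms(7), unfolded pushforward_def, symmetric]
  proof (rule conjI, intro allI impI, goal_cases)
    case (1 h)
    show ?case unfolding equivalences[OF 1, symmetric] by simp
  next
    case 2
    show ?case
    proof (rule ex_cong1, rule conj_cong[OF refl], goal_cases)
      case (1 h)
      show ?case unfolding equivalences[OF 1, symmetric] by simp
    qed
  qed
qed

end
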